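(* Let $n\ge2$ be an even integer and $k=n/2$. For $\beta\in[0,1)$ put $w_0(x)=\left(\ln\frac{1}{|x|}\right)^{\frac{\beta n}{2}}$ on the unit ball $B\subset\mathbb{R}^n$, $\gamma_{n,\beta}=\frac{n+2}{n(1-\beta)}$, $\alpha_{n,\beta}=n\left[c_n^{\frac{2}{n}}(1-\beta)\right]^{\frac{1}{1-\beta}}$, and $$\mathrm{MT}(n,\alpha_{n,\beta},\beta)=\sup\left\{\int_B \mathrm{e}^{\alpha_{n,\beta}|u|^{\gamma_{n,\beta}}}\,\mathrm{d}x \,:\, u\in\Phi^{k}_{0,\mathrm{rad}}(B,w_0),\ \|u\|_{\Phi,w_0}\le1\right\}.$$ Then there exists $\beta_0\in(0,1)$ such that for every $\beta\in[0,\beta_0)$ the supremum $\mathrm{MT}(n,\alpha_{n,\beta},\beta)$ is attained, i.e. there is $u\in\Phi^{k}_{0,\mathrm{rad}}(B,w_0)$ with $\|u\|_{\Phi,w_0}\le1$ and $\int_B \mathrm{e}^{\alpha_{n,\beta}|u|^{\gamma_{n,\beta}}}\,\mathrm{d}x=\mathrm{MT}(n,\alpha_{n,\beta},\beta)$.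
   Context: $B$ is the open unit ball of $\mathbb{R}^n$ centered at $0$, $\omega_{n-1}$ is the area of the unit sphere in $\mathbb{R}^n$, and $c_n=\frac{\omega_{n-1}}{k}\binom{n-1}{k-1}$. For $u\in C^2(B)$, $S_j(D^2u)$ is the sum of all $j\times j$ principal minors of the Hessian matrix $D^2u$. A function $u\in C^2(B)\cap C^0(\overline{B})$ is $k$-admissible if $S_j(D^2u)\ge0$ in $B$ for $j=1,\dots,k$. $\Phi^k_{0,\mathrm{rad}}(B)$ is the set of radially symmetric $k$-admissible functions on $B$ vanishing on $\partial B$. For a positive radial weight $w(x)=w(r)$ and a radial function $u(x)=v(r)$, $r=|x|$, set $$\|u\|_{\Phi,w}=\Big(c_n\int_0^1 r^{n-k}|v'(r)|^{k+1}w(r)\,\mathrm{d}r\Big)^{\frac{1}{k+1}}.$$ $\Phi^k_{0,\mathrm{rad}}(B,w)$ is the closure, with respect to $\|\cdot\|_{\Phi,w}$, of $\{u\in\Phi^k_{0,\mathrm{rad}}(B):\|u\|_{\Phi,w}<\infty\}$; its elements are identified with radial functions $u(x)=v(|x|)$, $v$ locally absolutely continuous on $(0,1)$ with $v(r)\to0$ as $r\to1$, that are limits of sequences in this set in the sense that $\|u_m-u\|_{\Phi,w}\to0$ (norm given by the same formula). *)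

theory Defs
  imports "HOL-Analysis.Analysis"
begin

section \<open>The Hessian and its elementary symmetric functions\<close>

definition partial_deriv :: "'n::finite \<Rightarrow> (real^'n \<Rightarrow> real) \<Rightarrow> real^'n \<Rightarrow> real" where
  "partial_deriv i u x = deriv (\<lambda>t. u (x + t *\<^sub>R axis i 1)) 0"

definition C1_on :: "(real^'n::finite) set \<Rightarrow> (real^'n \<Rightarrow> real) \<Rightarrow> bool" where
  "C1_on S u \<longleftrightarrow> u differentiable_on S \<and> (\<forall>i. continuous_on S (partial_deriv i u))"

definition C2_on :: "(real^'n::finite) set \<Rightarrow> (real^'n \<Rightarrow> real) \<Rightarrow> bool" where
  "C2_on S u \<longleftrightarrow> C1_on S u \<and> (\<forall>i. C1_on S (partial_deriv i u))"

definition hessian :: "(real^'n::finite \<Rightarrow> real) \<Rightarrow> real^'n \<Rightarrow> real^'n^'n" where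
  "hessian u x = (\<chi> i j. partial_deriv i (partial_deriv j u) x)"

(* Leibniz expansion of the determinant of the submatrix with rows and columns in I;
   for I = UNIV it is the definition of det. *)
definition principal_minor :: "'n::finite set \<Rightarrow> real^'n^'n \<Rightarrow> real" where
  "principal_minor I A = (\<Sum>p | p permutes I. of_int (sign p) * (\<Prod>i\<in>I. A $ i $ p i))"

lemma principal_minor_UNIV: "principal_minor UNIV A = det A"
  by (simp add: principal_minor_def det_def)

definition S_minors :: "nat \<Rightarrow> real^'n^'n::finite \<Rightarrow> real" where
  "S_minors j A = (\<Sum>I | card I = j. principal_minor I A)"


section \<open>Admissible functions\<close>

definition k_admissible :: "nat \<Rightarrow> (real^'n::finite \<Rightarrow> real) \<Rightarrow> bool" where
  "k_admissible k u \<longleftrightarrow>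
     C2_on (ball 0 1) u \<and> continuous_on (cball 0 1) u \<and>
     (\<forall>j\<in>{1..k}. \<forall>x\<in>ball 0 1. S_minors j (hessian u x) \<ge> 0)"

definition radial_on :: "(real^'n::finite) set \<Rightarrow> (real^'n \<Rightarrow> real) \<Rightarrow> bool" where
  "radial_on S u \<longleftrightarrow> (\<forall>x\<in>S. \<forall>y\<in>S. norm x = norm y \<longrightarrow> u x = u y)"

definition Phi_0_rad :: "nat \<Rightarrow> (real^'n::finite \<Rightarrow> real) set" where
  "Phi_0_rad k = {u. k_admissible k u \<and> radial_on (cball 0 1) u \<and> (\<forall>x\<in>sphere 0 1. u x = 0)}"


section \<open>The weighted norm\<close>

(* Area of the unit sphere of R^n, through the volume of the unit ball;
   the next two lemmas confirm the value. *)
definition sphere_area :: "nat \<Rightarrow> real" where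
  "sphere_area n = real n * unit_ball_vol (real n)"

lemma sphere_area_Gamma:
  assumes "n > 0"
  shows "sphere_area n = 2 * pi powr (real n / 2) / Gamma (real n / 2)"
proof -
  have "Gamma (real n / 2 + 1) = real n / 2 * Gamma (real n / 2)"
    using assms by (intro Gamma_plus1) auto
  moreover have "Gamma (real n / 2) > 0"
    using assms by (intro Gamma_real_pos) auto
  ultimately show ?thesis
    using assms unfolding sphere_area_def unit_ball_vol_def by (simp only:) (simp add: field_simps)
qed

lemma sphere_area_derivative_volume:
  "((\<lambda>r. measure lborel (ball (0 :: real^'n::finite) r)) has_real_derivative sphere_area CARD('n)) (at 1)"
proof (rule has_field_derivative_transform_within_open)
  show "((\<lambda>r. unit_ball_vol (real CARD('n)) * r ^ CARD('n)) has_real_derivative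
          sphere_area CARD('n)) (at 1)"
    unfolding sphere_area_def by (auto intro!: derivative_eq_intros)
  show "unit_ball_vol (real CARD('n)) * r ^ CARD('n) = measure lborel (ball (0 :: real^'n) r)"
    if "r \<in> {0<..}" for r
    using that by (simp add: content_ball)
qed auto

definition c_const :: "nat \<Rightarrow> nat \<Rightarrow> real" where
  "c_const n k = sphere_area n / real k * real ((n - 1) choose (k - 1))"

(* The v with u x = v (norm x), read off along one unit vector;
   for radial u the choice of the vector is immaterial. *)
definition radial_profile :: "(real^'n::finite \<Rightarrow> real) \<Rightarrow> real \<Rightarrow> real" where
  "radial_profile u r = u (r *\<^sub>R (SOME e. norm e = 1))"

lemma radial_profile_norm:
  fixes u :: "real^'n::finite \<Rightarrow> real"
  assumes "radial_on (ball 0 1) u" "x \<in> ball 0 1"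
  shows "u x = radial_profile u (norm x)"
proof -
  have "norm (axis undefined 1 :: real^'n) = 1"
    by simp
  then have "norm (SOME e :: real^'n. norm e = 1) = 1"
    by (rule someI)
  then have "norm (norm x *\<^sub>R (SOME e :: real^'n. norm e = 1)) = norm x"
    by simp
  then show ?thesis
    using assms unfolding radial_on_def radial_profile_def by (metis mem_ball_0)
qed

(* Values in [0, \<infinity>], so that finiteness of the norm is a genuine condition.
   deriv is unspecified where the profile is not differentiable, which for locally
   absolutely continuous profiles is a null set. *)
definition Phi_norm :: "nat \<Rightarrow> (real \<Rightarrow> real) \<Rightarrow> (real^'n::finite \<Rightarrow> real) \<Rightarrow> ennreal" where
  "Phi_norm k w u =
     (let E = ennreal (c_const CARD('n) k) *
              (\<integral>\<^sup>+r\<in>{0<..<1}. ennreal (r ^ (CARD('n) - k) *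
                  \<bar>deriv (radial_profile u) r\<bar> ^ (k + 1) * w r) \<partial>lebesgue)
      in if E = \<infinity> then \<infinity> else ennreal (enn2real E powr (1 / (real k + 1))))"


section \<open>The weighted space\<close>

definition abs_continuous_on_interval :: "real \<Rightarrow> real \<Rightarrow> (real \<Rightarrow> real) \<Rightarrow> bool" where
  "abs_continuous_on_interval a b v \<longleftrightarrow>
     (\<forall>\<epsilon>>0. \<exists>\<delta>>0. \<forall>D :: (real \<times> real) set.
        finite D \<and> (\<forall>(c, d)\<in>D. a \<le> c \<and> c \<le> d \<and> d \<le> b) \<and>
        disjoint_family_on (\<lambda>(c, d). {c<..<d}) D \<and> (\<Sum>(c, d)\<in>D. d - c) < \<delta>
        \<longrightarrow> (\<Sum>(c, d)\<in>D. \<bar>v d - v c\<bar>) < \<epsilon>)"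

definition locally_abs_continuous_01 :: "(real \<Rightarrow> real) \<Rightarrow> bool" where
  "locally_abs_continuous_01 v \<longleftrightarrow>
     (\<forall>a b. 0 < a \<and> a < b \<and> b < 1 \<longrightarrow> abs_continuous_on_interval a b v)"

(* The value of u at 0 and outside the ball is irrelevant throughout:
   elements may be unbounded near 0. *)
definition Phi_0_rad_weighted ::
    "nat \<Rightarrow> (real \<Rightarrow> real) \<Rightarrow> (real^'n::finite \<Rightarrow> real) set" where
  "Phi_0_rad_weighted k w =
     {u. radial_on (ball 0 1) u \<and>
         locally_abs_continuous_01 (radial_profile u) \<and>
         (radial_profile u \<longlongrightarrow> 0) (at_left 1) \<and>
         (\<exists>U :: nat \<Rightarrow> real^'n \<Rightarrow> real.
            (\<forall>m. U m \<in> Phi_0_rad k \<and> Phi_norm k w (U m) < \<infinity>) \<and>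
            (\<lambda>m. Phi_norm k w (\<lambda>x. U m x - u x)) \<longlonglongrightarrow> 0)}"


section \<open>The Moser-Trudinger supremum\<close>

definition w0 :: "nat \<Rightarrow> real \<Rightarrow> real \<Rightarrow> real" where
  "w0 n \<beta> r = ln (1 / r) powr (\<beta> * real n / 2)"

definition gamma_exp :: "nat \<Rightarrow> real \<Rightarrow> real" where
  "gamma_exp n \<beta> = (real n + 2) / (real n * (1 - \<beta>))"

definition alpha_crit :: "nat \<Rightarrow> real \<Rightarrow> real" where
  "alpha_crit n \<beta> =
     real n * (c_const n (n div 2) powr (2 / real n) * (1 - \<beta>)) powr (1 / (1 - \<beta>))"

definition MT_functional :: "real \<Rightarrow> real \<Rightarrow> (real^'n::finite \<Rightarrow> real) \<Rightarrow> ennreal" where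
  "MT_functional \<alpha> \<beta> u =
     (\<integral>\<^sup>+x\<in>ball 0 1. ennreal (exp (\<alpha> * \<bar>u x\<bar> powr gamma_exp CARD('n) \<beta>)) \<partial>lebesgue)"

definition MT_admissible :: "real \<Rightarrow> (real^'n::finite \<Rightarrow> real) set" where
  "MT_admissible \<beta> =
     {u \<in> Phi_0_rad_weighted (CARD('n) div 2) (w0 CARD('n) \<beta>).
        Phi_norm (CARD('n) div 2) (w0 CARD('n) \<beta>) u \<le> 1}"

definition MT :: "'n::finite itself \<Rightarrow> real \<Rightarrow> real \<Rightarrow> ennreal" where
  "MT _ \<alpha> \<beta> = (SUP u\<in>(MT_admissible \<beta> :: (real^'n \<Rightarrow> real) set). MT_functional \<alpha> \<beta> u)"

end

theory Submission
  imports Defs "HOL-Real_Asymp.Real_Asymp" "HOL-Library.Diagonal_Subsequence" "HOL-Combinatorics.Permutations"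
begin

text \<open>
  Write \<open>n = 2 k\<close>. A radial \<open>C\<^sup>2\<close> function with profile \<open>v\<close> is \<open>k\<close>-admissible only if \<open>v' \<ge> 0\<close> and \<open>r v'\<close> is
  nondecreasing, so with \<open>s = - n ln r\<close> and \<open>v = - scl * \<integral>\<^sub>0\<^sup>s g\<close> the problem becomes: maximise
  \<open>J g = \<integral> exp ((\<integral>\<^sub>0\<^sup>s g) powr gam - s) ds\<close> over nonnegative nonincreasing \<open>g\<close> on \<open>(0,\<infinity>)\<close> with
  \<open>\<integral> g^(k+1) s powr (b k) ds \<le> (1 - b)^k\<close>. Such \<open>g\<close> are compact under pointwise convergence of the primitives.
  If a maximising sequence tends to a nonzero limit, then \<open>J\<close> converges along it and the limit is a maximiser.
  Otherwise the sequence concentrates at \<open>s = \<infinity>\<close>, and Gibbs' variational principle bounds the limit of \<open>J\<close> by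
  \<open>1 + exp (harm k)\<close>. An explicit \<open>g\<close> gives a value above this bound for \<open>b = 0\<close>, hence also for all small \<open>b\<close>.
  Conversely, every such \<open>g\<close> comes from the weighted space: averaging \<open>g\<close> twice and cutting it off
  yields admissible functions of class \<open>C\<^sup>2\<close> that approximate it in energy.
\<close>

section \<open>Derivatives of absolutely continuous functions\<close>

text \<open>The scaling is critical: the energy budget yields only \<open>prim g s powr gam\<close>
  \<le> s, so the exponent in \<open>J\<close> is bounded by 0 and the majorant it supplies, 1, is
  not integrable. A bounded class alone therefore does not make \<open>J\<close> continuous. But
  once a fixed share of the energy is spent on a bounded interval, the rest grows with a factor
  below 1, the exponent becomes linear and negative, and domination returns; only the zero limit is
  dangerous. The level to be beaten does not depend on b: its 1 is the integral of exp (- s), and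
  \<open>harm k\<close> is minus the value at 1 of the primitive that the entropy argument leaves.
  So one strict inequality at b = 0, carried over by Fatou's lemma, covers all small b. The relation
  n = 2 k enters twice: the power of r in the norm then turns into ds under the logarithm, and the
  k-th minor sum controls the sign of (r v')'. Since the space speaks of interval families and
  \<open>deriv\<close>, the fundamental theorem for absolutely continuous functions is needed before
  a limit of profiles can be compared with an integral.\<close>

definition interval_families :: "real \<Rightarrow> real \<Rightarrow> (real \<times> real) set set" where
  "interval_families a b =
     {D. finite D \<and> (\<forall>(c, d)\<in>D. a \<le> c \<and> c < d \<and> d \<le> b) \<and> disjoint_family_on (\<lambda>(c, d). {c<..<d}) D}"

definition family_length :: "(real \<times> real) set \<Rightarrow> real" where
  "family_length D = (\<Sum>(c, d)\<in>D. d - c)"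

definition family_variation :: "(real \<Rightarrow> real) \<Rightarrow> (real \<times> real) set \<Rightarrow> real" where
  "family_variation w D = (\<Sum>(c, d)\<in>D. \<bar>w d - w c\<bar>)"

text \<open>Total variation, taken in \<open>ennreal\<close> so that it can be added and compared
  before it is known to be finite.\<close>

definition variation :: "(real \<Rightarrow> real) \<Rightarrow> real \<Rightarrow> real \<Rightarrow> ennreal" where
  "variation w a b = (SUP D\<in>interval_families a b. ennreal (family_variation w D))"

lemma family_variation_nonneg: "0 \<le> family_variation w D"
  unfolding family_variation_def by (auto intro: sum_nonneg)

lemma empty_interval_families [simp]: "{} \<in> interval_families a b"
  by (auto simp: interval_families_def disjoint_family_on_def)

lemma interval_familiesD:
  assumes "D \<in> interval_families a b"
  shows "finite D" "\<And>c d. (c, d) \<in> D \<Longrightarrow> a \<le> c" "\<And>c d. (c, d) \<in> D \<Longrightarrow> c < d" "\<And>c d. (c, d) \<in> D \<Longrightarrow> d \<le> b"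
    "disjoint_family_on (\<lambda>(c, d). {c<..<d}) D"
  using assms by (auto simp: interval_families_def)

lemma interval_families_eqI:
  assumes "D \<in> interval_families a b" "p \<in> D" "q \<in> D" "t \<in> {fst p<..<snd p}" "t \<in> {fst q<..<snd q}"
  shows "p = q"
proof (rule ccontr)
  assume "p \<noteq> q"
  then have "{fst p<..<snd p} \<inter> {fst q<..<snd q} = {}"
    using interval_familiesD(5)[OF assms(1)] assms(2,3) by (simp add: disjoint_family_on_def case_prod_beta)
  then show False using assms(4,5) by blast
qed

lemma interval_families_mono:
  "D \<in> interval_families a b \<Longrightarrow> a' \<le> a \<Longrightarrow> b \<le> b' \<Longrightarrow> D \<in> interval_families a' b'"
  unfolding interval_families_def by force

lemma family_length_le:
  assumes D: "D \<in> interval_families a b" and "a \<le> b"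
  shows "family_length D \<le> b - a"
proof -
  have "family_length D = (\<Sum>p\<in>D. measure lborel {fst p<..<snd p})"
    unfolding family_length_def using interval_familiesD[OF D]
    by (intro sum.cong) (auto simp: less_imp_le)
  also have "\<dots> = measure lborel (\<Union>p\<in>D. {fst p<..<snd p})"
    using interval_familiesD(1,5)[OF D] interval_familiesD(3)[OF D, THEN less_imp_le]
    by (intro measure_finite_Union[symmetric]) (auto simp: case_prod_unfold)
  also have "\<dots> \<le> measure lborel {a..b}"
  proof (rule measure_mono_fmeasurable)
    show "(\<Union>p\<in>D. {fst p<..<snd p}) \<subseteq> {a..b}"
    proof
      fix t assume "t \<in> (\<Union>p\<in>D. {fst p<..<snd p})"
      then obtain p where "p \<in> D" "t \<in> {fst p<..<snd p}" by blast
      then show "t \<in> {a..b}" using interval_familiesD(2,4)[OF D, of "fst p" "snd p"] by auto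
    qed
    show "(\<Union>p\<in>D. {fst p<..<snd p}) \<in> sets lborel"
      using interval_familiesD(1)[OF D] by auto
  qed (use \<open>a \<le> b\<close> in \<open>simp add: fmeasurable_def\<close>)
  also have "\<dots> = b - a" using \<open>a \<le> b\<close> by simp
  finally show ?thesis .
qed

text \<open>Clamping the endpoints by \<open>m\<close> cuts each interval at z and keeps one side.
  Intervals on the other side collapse to the pair (z, z); \<open>E\<close> discards them, and they
  contribute nothing to the variation.\<close>

lemma interval_families_split:
  assumes D: "D \<in> interval_families x y" and z: "x \<le> z" "z \<le> y"
    and m: "m = min z \<or> m = max z"
    and E: "E = {p \<in> (\<lambda>(c, d). (m c, m d)) ` D. fst p < snd p}"
  shows "E \<in> interval_families (m x) (m y)"
    and "family_variation w E = (\<Sum>(c, d)\<in>D. \<bar>w (m d) - w (m c)\<bar>)"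
proof -
  note d = interval_familiesD[OF D]
  have inj: "p = q" if "p \<in> D" "q \<in> D" "t \<in> {m (fst p)<..<m (snd p)}" "t \<in> {m (fst q)<..<m (snd q)}" for p q t
    using that m by (intro interval_families_eqI[OF D, of p q t]) (auto simp: max_def min_def split: if_splits)
  have mono: "mono m" using m by (auto simp: mono_def)
  show "E \<in> interval_families (m x) (m y)"
    unfolding interval_families_def
  proof (intro CollectI conjI)
    show "finite E" using d(1) E by auto
    show "\<forall>(c, d)\<in>E. m x \<le> c \<and> c < d \<and> d \<le> m y"
      using d E monoD[OF mono] by (auto intro: less_imp_le)
    show "disjoint_family_on (\<lambda>(c, d). {c<..<d}) E"
      unfolding disjoint_family_on_def
    proof (intro ballI impI)
      fix p q assume pq: "p \<in> E" "q \<in> E" "p \<noteq> q"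
      have "\<exists>p'\<in>D. p = (m (fst p'), m (snd p'))" "\<exists>q'\<in>D. q = (m (fst q'), m (snd q'))"
        using pq(1,2) E by force+
      then obtain p' q' where p': "p' \<in> D" "p = (m (fst p'), m (snd p'))"
        and q': "q' \<in> D" "q = (m (fst q'), m (snd q'))"
        by blast
      then have "p' \<noteq> q'" using pq by auto
      then show "(case p of (c, d) \<Rightarrow> {c<..<d}) \<inter> (case q of (c, d) \<Rightarrow> {c<..<d}) = {}"
        unfolding p'(2) q'(2) prod.case disjoint_iff using inj[of p' q'] p'(1) q'(1) by blast
    qed
  qed
  \<comment> \<open>Clamping is not injective on \<open>D\<close>, but two pairs with the same image
    have a degenerate image, whose summand is 0.\<close>
  have "(\<Sum>(c, d)\<in>D. \<bar>w (m d) - w (m c)\<bar>) = (\<Sum>p\<in>(\<lambda>(c, d). (m c, m d)) ` D. \<bar>w (snd p) - w (fst p)\<bar>)"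
  proof (subst sum.reindex_nontrivial)
    show "finite D" by (rule d)
    fix p q assume pq: "p \<in> D" "q \<in> D" "p \<noteq> q"
      "(case p of (c, d) \<Rightarrow> (m c, m d)) = (case q of (c, d) \<Rightarrow> (m c, m d))"
    then have eq: "m (fst p) = m (fst q)" "m (snd p) = m (snd q)" by (auto split: prod.splits)
    have "m (fst p) \<le> m (snd p)" using d(3)[of "fst p" "snd p"] pq mono by (auto simp: mono_def)
    moreover have "\<not> m (fst p) < m (snd p)"
    proof
      assume "m (fst p) < m (snd p)"
      then obtain t where "m (fst p) < t" "t < m (snd p)" using dense by blast
      then show False using inj[of p q t] eq pq by auto
    qed
    ultimately show "\<bar>w (snd (case p of (c, d) \<Rightarrow> (m c, m d))) - w (fst (case p of (c, d) \<Rightarrow> (m c, m d)))\<bar> = 0"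
      by (auto split: prod.splits)
  qed (auto intro!: sum.cong)
  also have "\<dots> = (\<Sum>p\<in>E. \<bar>w (snd p) - w (fst p)\<bar>)"
  proof (rule sum.mono_neutral_right)
    show "finite ((\<lambda>(c, d). (m c, m d)) ` D)" using d(1) by simp
    show "\<forall>p\<in>(\<lambda>(c, d). (m c, m d)) ` D - E. \<bar>w (snd p) - w (fst p)\<bar> = 0"
    proof
      fix p assume p: "p \<in> (\<lambda>(c, d). (m c, m d)) ` D - E"
      then obtain c e where ce: "(c, e) \<in> D" "p = (m c, m e)" by auto
      then have "m c \<le> m e" using d(3) mono by (auto simp: mono_def less_imp_le)
      then show "\<bar>w (snd p) - w (fst p)\<bar> = 0" using p ce E by auto
    qed
  qed (use E in auto)
  finally show "family_variation w E = (\<Sum>(c, d)\<in>D. \<bar>w (m d) - w (m c)\<bar>)"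
    by (simp add: family_variation_def case_prod_beta)
qed

lemma variation_subadd:
  assumes "x \<le> z" "z \<le> y"
  shows "variation w x y \<le> variation w x z + variation w z y"
  unfolding variation_def[of w x y]
proof (rule SUP_least)
  fix D assume D: "D \<in> interval_families x y"
  define E1 E2 where "E1 = {p \<in> (\<lambda>(c, d). (min z c, min z d)) ` D. fst p < snd p}"
    and "E2 = {p \<in> (\<lambda>(c, d). (max z c, max z d)) ` D. fst p < snd p}"
  have 1: "E1 \<in> interval_families (min z x) (min z y)"
    "family_variation w E1 = (\<Sum>(c, d)\<in>D. \<bar>w (min z d) - w (min z c)\<bar>)"
    by (rule interval_families_split[OF D assms _ E1_def]; simp)+
  have 2: "E2 \<in> interval_families (max z x) (max z y)"
    "family_variation w E2 = (\<Sum>(c, d)\<in>D. \<bar>w (max z d) - w (max z c)\<bar>)"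
    by (rule interval_families_split[OF D assms _ E2_def]; simp)+
  have "family_variation w D \<le> (\<Sum>(c, d)\<in>D. \<bar>w (min z d) - w (min z c)\<bar> + \<bar>w (max z d) - w (max z c)\<bar>)"
    unfolding family_variation_def by (intro sum_mono) (auto simp: min_def max_def)
  also have "\<dots> = family_variation w E1 + family_variation w E2"
    unfolding 1(2) 2(2) sum.distrib[symmetric] by (simp add: case_prod_beta)
  finally have "ennreal (family_variation w D) \<le> ennreal (family_variation w E1) + ennreal (family_variation w E2)"
    by (subst ennreal_plus[symmetric]) (simp_all add: family_variation_nonneg ennreal_leI del: ennreal_plus)
  also have "\<dots> \<le> variation w x z + variation w z y"
    unfolding variation_def using 1 2 assms
    by (intro add_mono SUP_upper) (auto simp: min_def max_def split: if_splits)
  finally show "ennreal (family_variation w D) \<le> variation w x z + variation w z y" .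
qed

text \<open>The induction takes the intervals of \<open>E\<close>, which carry their full variation,
  one at a time, and replaces each by an arbitrary subdivision \<open>F\<close> that joins
  \<open>D\<close>, where only increments are counted. With \<open>D\<close> empty it says that the
  variation function inherits absolute continuity from \<open>w\<close>.\<close>

lemma sum_variation_le:
  assumes small: "\<And>D. D \<in> interval_families a b \<Longrightarrow> family_length D < \<delta> \<Longrightarrow> family_variation w D \<le> \<epsilon>"
    and "E \<union> D \<in> interval_families a b" "E \<inter> D = {}" "family_length E + family_length D < \<delta>"
  shows "(\<Sum>(c, d)\<in>E. variation w c d) + ennreal (family_variation w D) \<le> ennreal \<epsilon>"
proof -
  have "finite E" using interval_familiesD(1)[OF assms(2)] by simp
  then show ?thesis
    using assms(2-4)
  proof (induction E arbitrary: D rule: finite_induct)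
    case empty
    then show ?case using small[of D] by (auto simp: family_length_def intro: ennreal_leI)
  next
    case (insert p E)
    obtain c d where p: "p = (c, d)" by (cases p)
    note fam = interval_familiesD[OF insert.prems(1)]
    have cd: "a \<le> c" "c < d" "d \<le> b" using fam(2-4)[of c d] p by auto
    have "variation w c d + ((\<Sum>(c, d)\<in>E. variation w c d) + ennreal (family_variation w D)) \<le> ennreal \<epsilon>"
      unfolding variation_def[of w c d]
    proof (subst ennreal_SUP_add_left[symmetric])
      show "(SUP F\<in>interval_families c d. ennreal (family_variation w F) + ((\<Sum>(c, d)\<in>E. variation w c d) + ennreal (family_variation w D))) \<le> ennreal \<epsilon>"
      proof (rule SUP_least)
        fix F assume F: "F \<in> interval_families c d"
        note famF = interval_familiesD[OF F]
        have sep: "{fst q<..<snd q} \<inter> {fst r<..<snd r} = {}" if "q \<in> F" "r \<in> E \<union> D" for q r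
        proof -
          have "r \<noteq> p" using that insert by auto
          then have "{fst r<..<snd r} \<inter> {c<..<d} = {}"
            using interval_families_eqI[OF insert.prems(1), of r p] that p
            unfolding disjoint_iff by fastforce
          moreover have "{fst q<..<snd q} \<subseteq> {c<..<d}"
            using famF(2,4)[of "fst q" "snd q"] that by auto
          ultimately show ?thesis by blast
        qed
        \<comment> \<open>A common pair would have a nonempty open interval, because pairs of an
          interval family satisfy c < d. This is the reason for excluding degenerate pairs from
          \<open>interval_families\<close>.\<close>
        have FD: "F \<inter> (E \<union> D) = {}"
        proof (rule ccontr)
          assume "F \<inter> (E \<union> D) \<noteq> {}"
          then obtain q where q: "q \<in> F" "q \<in> E \<union> D" by blast
          then have "fst q < snd q" using famF(3)[of "fst q" "snd q"] by simp
          then show False using sep[OF q] by simp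
        qed
        have U: "E \<union> (F \<union> D) \<in> interval_families a b"
          unfolding interval_families_def
        proof (intro CollectI conjI)
          show "finite (E \<union> (F \<union> D))" using fam famF by auto
          have "a \<le> x \<and> x < y \<and> y \<le> b" if "(x, y) \<in> E \<union> (F \<union> D)" for x y
          proof (cases "(x, y) \<in> F")
            case True then show ?thesis using famF(2-4)[OF True] cd by auto
          next
            case False then have "(x, y) \<in> insert p E \<union> D" using that by auto
            then show ?thesis using fam(2-4) by blast
          qed
          then show "\<forall>(c, d)\<in>E \<union> (F \<union> D). a \<le> c \<and> c < d \<and> d \<le> b" by blast
          show "disjoint_family_on (\<lambda>(c, d). {c<..<d}) (E \<union> (F \<union> D))"
            unfolding disjoint_family_on_def
          proof (intro ballI impI)
            fix q r assume qr: "q \<in> E \<union> (F \<union> D)" "r \<in> E \<union> (F \<union> D)" "q \<noteq> r"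
            consider "q \<in> F" "r \<in> F" | "q \<in> F" "r \<in> E \<union> D" | "r \<in> F" "q \<in> E \<union> D" | "q \<in> E \<union> D" "r \<in> E \<union> D"
              using qr by auto
            then have "{fst q<..<snd q} \<inter> {fst r<..<snd r} = {}"
            proof cases
              case 1 then show ?thesis using interval_families_eqI[OF F, of q r] qr by blast
            next
              case 2 then show ?thesis using sep by blast
            next
              case 3 then show ?thesis using sep by blast
            next
              case 4 then show ?thesis using interval_families_eqI[OF insert.prems(1), of q r] qr by blast
            qed
            then show "(case q of (c, d) \<Rightarrow> {c<..<d}) \<inter> (case r of (c, d) \<Rightarrow> {c<..<d}) = {}"
              by (simp add: case_prod_beta)
          qed
        qed
        have fin: "finite F" "finite D" "finite E" using fam famF by auto
        have len: "family_length (F \<union> D) = family_length F + family_length D"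
          "family_variation w (F \<union> D) = family_variation w F + family_variation w D"
          unfolding family_length_def family_variation_def using FD fin
          by (auto intro!: sum.union_disjoint)
        have "family_length (insert p E) = (d - c) + family_length E"
          unfolding family_length_def using insert p by simp
        then have "family_length E + family_length (F \<union> D) < \<delta>"
          using family_length_le[OF F] cd insert.prems(3) len by auto
        then have "(\<Sum>(c, d)\<in>E. variation w c d) + ennreal (family_variation w (F \<union> D)) \<le> ennreal \<epsilon>"
          using insert.IH[OF U] FD insert.prems(2) by auto
        then show "ennreal (family_variation w F) + ((\<Sum>(c, d)\<in>E. variation w c d) + ennreal (family_variation w D)) \<le> ennreal \<epsilon>"
          unfolding len by (simp add: ac_simps family_variation_nonneg)
      qed
    qed (use empty_interval_families in blast)
    then show ?case using insert.hyps p by (simp add: add.assoc)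
  qed
qed

text \<open>Averages over boxes with lower corner x converge to f x almost everywhere; in dimension
  one such an average is the right-hand difference quotient.\<close>

lemma AE_indefinite_integral_right_derivative:
  fixes f :: "real \<Rightarrow> real"
  assumes "integrable lborel f"
  shows "AE x in lborel. ((\<lambda>h. integral {x..x + h} f / h) \<longlongrightarrow> f x) (at_right 0)"
proof -
  have "f integrable_on cbox a b" for a b :: real
    using integrable_on_subcbox[OF integrable_on_lborel[OF assms], of a b] by simp
  then obtain N where N: "negligible N"
    "\<And>x e. x \<notin> N \<Longrightarrow> 0 < e \<Longrightarrow> \<exists>d>0. \<forall>h. 0 < h \<and> h < d \<longrightarrow>
        norm (integral (cbox x (x + h *\<^sub>R One)) f /\<^sub>R h ^ DIM(real) - f x) < e"
    using integrable_ccontinuous_explicit[of f] by metis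
  have "((\<lambda>h. integral {x..x + h} f / h) \<longlongrightarrow> f x) (at_right 0)" if x: "x \<notin> N" for x
  proof (rule tendstoI)
    fix e :: real assume "e > 0"
    then obtain d where d: "d > 0" "\<And>h. 0 < h \<and> h < d \<Longrightarrow>
        norm (integral (cbox x (x + h *\<^sub>R One)) f /\<^sub>R h ^ DIM(real) - f x) < e"
      using N(2)[OF x \<open>e > 0\<close>] by metis
    show "\<forall>\<^sub>F h in at_right 0. dist (integral {x..x + h} f / h) (f x) < e"
      using eventually_at_right_less[of "0::real"] eventually_at_right_real[OF d(1)]
    proof eventually_elim
      case (elim h)
      then show ?case using d(2)[of h] by (simp add: dist_norm divide_inverse mult.commute)
    qed
  qed
  moreover have "AE x in lebesgue. x \<notin> N"
    using N(1) by (simp add: negligible_iff_null_sets AE_not_in)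
  ultimately have "AE x in lebesgue. ((\<lambda>h. integral {x..x + h} f / h) \<longlongrightarrow> f x) (at_right 0)"
    by (auto elim!: eventually_mono)
  then show ?thesis
    by (simp add: AE_completion_iff)
qed

text \<open>The left derivative is the right derivative for the reflected function t -> f (- t).
  Reflection preserves \<open>lborel\<close>, so both one-sided limits exist off a common null
  set.\<close>

lemma AE_indefinite_integral_derivative:
  fixes f w :: "real \<Rightarrow> real"
  assumes f: "integrable lborel f"
    and w: "\<And>x y. a \<le> x \<Longrightarrow> x \<le> y \<Longrightarrow> y \<le> b \<Longrightarrow> w y - w x = integral {x..y} f"
  shows "AE x in lborel. x \<in> {a<..<b} \<longrightarrow> (w has_real_derivative f x) (at x)"
proof -
  have f': "integrable lborel (\<lambda>x. f (- x))"
    using lborel_integrable_real_affine[OF f, of "-1" 0] by simp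
  have R: "AE x in lborel. ((\<lambda>h. integral {x..x + h} f / h) \<longlongrightarrow> f x) (at_right 0)"
    by (rule AE_indefinite_integral_right_derivative[OF f])
  have "AE x in lborel. ((\<lambda>h. integral {x..x + h} (\<lambda>x. f (- x)) / h) \<longlongrightarrow> f (- x)) (at_right 0)"
    by (rule AE_indefinite_integral_right_derivative[OF f'])
  then have "AE x in distr lborel borel uminus. ((\<lambda>h. integral {x..x + h} (\<lambda>x. f (- x)) / h) \<longlongrightarrow> f (- x)) (at_right 0)"
    unfolding lborel_distr_uminus .
  then have "AE x in lborel. ((\<lambda>h. integral {- x..- x + h} (\<lambda>x. f (- x)) / h) \<longlongrightarrow> f x) (at_right 0)"
    using AE_distrD[of uminus lborel borel "\<lambda>x. ((\<lambda>h. integral {x..x + h} (\<lambda>x. f (- x)) / h) \<longlongrightarrow> f (- x)) (at_right 0)"]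
    by simp
  then show ?thesis
    using R
  proof eventually_elim
    case (elim x)
    show ?case
    proof
      assume x: "x \<in> {a<..<b}"
      have "\<forall>\<^sub>F h in at_right 0. (w (x + h) - w x) / h = integral {x..x + h} f / h"
        using eventually_at_right_real[of 0 "b - x"] x by (auto elim!: eventually_mono simp: w)
      then have r: "((\<lambda>h. (w (x + h) - w x) / h) \<longlongrightarrow> f x) (at_right 0)"
        using elim(2) tendsto_cong by fast
      have "\<forall>\<^sub>F h in at_right 0. (w (x + - h) - w x) / - h = integral {- x..- x + h} (\<lambda>x. f (- x)) / h"
      proof -
        have "\<forall>\<^sub>F h in at_right 0. h \<in> {0<..<x - a}"
          using x by (intro eventually_at_right_real) auto
        then show ?thesis
      proof eventually_elim
        case (elim h)
        have "integral {- x..- x + h} (\<lambda>x. f (- x)) = integral {x - h..x} f"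
          using Henstock_Kurzweil_Integration.integral_reflect_real[of x "x - h" f] by simp
        also have "\<dots> = w x - w (x - h)"
          using elim x by (subst w) auto
        finally have "integral {- x..- x + h} (\<lambda>x. f (- x)) = w x - w (x - h)" .
        moreover have "(w (x + - h) - w x) / - h = (w x - w (x - h)) / h"
          using elim by (simp add: divide_simps)
        ultimately show ?case by simp
      qed
      qed
      then have "((\<lambda>h. (w (x + - h) - w x) / - h) \<longlongrightarrow> f x) (at_right 0)"
        using elim(1) tendsto_cong by fast
      then have "((\<lambda>h. (w (x + h) - w x) / h) \<longlongrightarrow> f x) (at_left 0)"
        by (simp add: filterlim_at_left_to_right[of _ _ 0] del: minus_divide_right divide_minus_right)
      then have "((\<lambda>h. (w (x + h) - w x) / h) \<longlongrightarrow> f x) (at 0)"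
        using r filterlim_split_at by blast
      then show "(w has_real_derivative f x) (at x)"
        by (simp add: DERIV_def)
    qed
  qed
qed

text \<open>The Stieltjes measure of \<open>F\<close> on {a..b} is absolutely continuous: a null set
  has an open cover of length below \<delta>, and finitely many boxes of that cover form an interval
  family whose \<open>F\<close>-increments sum to at most e. Radon-Nikodym then gives the
  density.\<close>

lemma abs_continuous_mono_density:
  fixes F :: "real \<Rightarrow> real"
  assumes mono: "mono F" and cont: "continuous_on UNIV F" and "a < b"
    and ac: "\<And>e. e > 0 \<Longrightarrow> \<exists>\<delta>>0. \<forall>D\<in>interval_families a b. family_length D < \<delta> \<longrightarrow> (\<Sum>(c, d)\<in>D. F d - F c) \<le> e"
  obtains f where "integrable lborel f" "\<And>x y. a \<le> x \<Longrightarrow> x \<le> y \<Longrightarrow> y \<le> b \<Longrightarrow> F y - F x = integral {x..y} f"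
proof -
  define \<mu> where "\<mu> = interval_measure F"
  define \<nu> where "\<nu> = density \<mu> (indicator {a..b})"
  have Icc: "emeasure \<mu> {x..y} = ennreal (F y - F x)" if "x \<le> y" for x y
    unfolding \<mu>_def using mono cont that by (intro emeasure_interval_measure_Icc) (auto simp: mono_def)
  have [simp, measurable_cong]: "sets \<mu> = sets borel" by (simp add: \<mu>_def)
  have [simp, measurable_cong]: "sets \<nu> = sets borel" by (simp add: \<nu>_def)
  have \<nu>: "emeasure \<nu> A = emeasure \<mu> ({a..b} \<inter> A)" if "A \<in> sets borel" for A
    unfolding \<nu>_def using that by (subst emeasure_density) (auto simp: indicator_inter_arith[symmetric])
  have "absolutely_continuous lborel \<nu>"
    unfolding absolutely_continuous_def
  proof
    fix Z :: "real set" assume Z: "Z \<in> null_sets lborel"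
    then have Zb: "Z \<in> sets borel" by (simp add: null_sets_def)
    have "emeasure \<mu> ({a..b} \<inter> Z) \<le> 0 + ennreal e" if e: "e > 0" for e
    proof -
      obtain \<delta> where \<delta>: "\<delta> > 0" "\<And>D. D \<in> interval_families a b \<Longrightarrow> family_length D < \<delta> \<Longrightarrow> (\<Sum>(c, d)\<in>D. F d - F c) \<le> e"
        using ac[OF e] by blast
      obtain U where U: "open U" "Z \<subseteq> U" "emeasure lborel (U - Z) < ennreal \<delta>"
        using outer_regular_lborel[OF Zb \<delta>(1)] by metis
      have mU: "emeasure lborel U < ennreal \<delta>"
      proof -
        have "emeasure lborel U \<le> emeasure lborel (U - Z) + emeasure lborel Z"
        proof -
          have "U = (U - Z) \<union> Z" using U by blast
          then show ?thesis using U Zb emeasure_subadditive[of "U - Z" lborel Z] by auto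
        qed
        also have "\<dots> < ennreal \<delta>" using U(3) Z by (simp add: null_sets_def)
        finally show ?thesis .
      qed
      \<comment> \<open>Restricting the cover to the open interval keeps all boxes inside {a..b};
        only the endpoints are lost, and they have Stieltjes measure 0 because \<open>F\<close> is
        continuous.\<close>
      define V where "V = U \<inter> {a<..<b}"
      have "open V" using U by (auto simp: V_def)
      then obtain \<D> where \<D>: "countable \<D>" "\<D> \<subseteq> Pow V" "\<And>X. X \<in> \<D> \<Longrightarrow> \<exists>a b. X = cbox a b" "\<Union>\<D> = V"
        using open_countable_Union_open_cbox by metis
      have fin: "emeasure \<mu> (\<Union>\<F>) \<le> ennreal e" if \<F>: "finite \<F>" "\<F> \<subseteq> \<D>" for \<F>
      proof -
        obtain p where p: "p division_of \<Union>\<F>"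
          using elementary_unions_intervals[OF \<F>(1)] \<F>(2) \<D>(3) by blast
        note pD = division_ofD[OF p]
        \<comment> \<open>Degenerate members of the division carry neither length nor
          \<open>F\<close>-increment, and interval families do not admit them.\<close>
        define p' where "p' = {K \<in> p. Inf K < Sup K}"
        have box: "K = {Inf K..Sup K} \<and> Inf K \<le> Sup K" if "K \<in> p" for K
        proof -
          obtain c d where "K = cbox c d" using pD(4)[OF \<open>K \<in> p\<close>] by blast
          moreover then have "c \<le> d" using pD(3)[OF \<open>K \<in> p\<close>] by auto
          ultimately show ?thesis by simp
        qed
        define D where "D = (\<lambda>K. (Inf K, Sup K)) ` p'"
        have inj: "inj_on (\<lambda>K. (Inf K, Sup K)) p'"
        proof (rule inj_onI)
          fix K L assume "K \<in> p'" "L \<in> p'" "(Inf K, Sup K) = (Inf L, Sup L)"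
          then show "K = L" using box[of K] box[of L] by (simp add: p'_def)
        qed
        have sub: "\<Union>\<F> \<subseteq> V" using \<F> \<D> by blast
        have KV: "K \<subseteq> V" if "K \<in> p" for K using pD(2)[OF that] sub by blast
        have D: "D \<in> interval_families a b"
          unfolding interval_families_def
        proof (intro CollectI conjI)
          show "finite D" using pD(1) by (simp add: D_def p'_def)
          show "\<forall>(c, d)\<in>D. a \<le> c \<and> c < d \<and> d \<le> b"
          proof (clarsimp simp: D_def p'_def)
            fix K assume K: "K \<in> p" "Inf K < Sup K"
            then have "Inf K \<in> V" "Sup K \<in> V" using box[OF K(1)] KV[OF K(1)] by (metis atLeastAtMost_iff order_refl subsetD)+
            then show "a \<le> Inf K \<and> Sup K \<le> b" by (auto simp: V_def)
          qed
          have "{Inf K<..<Sup K} \<inter> {Inf L<..<Sup L} = {}" if "K \<in> p" "L \<in> p" "K \<noteq> L" for K L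
          proof -
            have "interior {Inf K..Sup K} \<inter> interior {Inf L..Sup L} = {}"
              using pD(5)[OF that] box that by metis
            then show ?thesis by simp
          qed
          then have "(case (Inf K, Sup K) of (c, d) \<Rightarrow> {c<..<d}) \<inter> (case (Inf L, Sup L) of (c, d) \<Rightarrow> {c<..<d}) = {}"
            if "K \<in> p" "L \<in> p" "(Inf K, Sup K) \<noteq> (Inf L, Sup L)" for K L
            unfolding prod.case using that by blast
          then show "disjoint_family_on (\<lambda>(c, d). {c<..<d}) D"
            unfolding disjoint_family_on_def D_def p'_def by blast
        qed
        have "ennreal (family_length D) = (\<Sum>K\<in>p'. emeasure lborel K)"
        proof -
          have "emeasure lborel K = ennreal (Sup K - Inf K)" if "K \<in> p'" for K
            using box[of K] that emeasure_lborel_Icc[of "Inf K" "Sup K"] unfolding p'_def by simp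
          then have "(\<Sum>K\<in>p'. emeasure lborel K) = (\<Sum>K\<in>p'. ennreal (Sup K - Inf K))" by simp
          also have "\<dots> = ennreal (\<Sum>K\<in>p'. Sup K - Inf K)"
            by (rule sum_ennreal) (auto simp: p'_def)
          finally show ?thesis unfolding family_length_def D_def by (simp add: sum.reindex[OF inj])
        qed
        also have "\<dots> \<le> emeasure lborel (\<Union>\<F>)"
        proof -
          have "(\<Sum>K\<in>p'. emeasure lborel K) = (\<Sum>K\<in>p'. emeasure lborel (interior K))"
          proof (rule sum.cong)
            fix K assume "K \<in> p'"
            then show "emeasure lborel K = emeasure lborel (interior K)"
              using box[of K] emeasure_lborel_Icc[of "Inf K" "Sup K"] emeasure_lborel_Ioo[of "Inf K" "Sup K"]
                interior_atLeastAtMost_real[of "Inf K" "Sup K"] unfolding p'_def by simp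
          qed simp
          also have "\<dots> = emeasure lborel (\<Union>K\<in>p'. interior K)"
            using pD(1,5) by (intro sum_emeasure) (auto simp: p'_def disjoint_family_on_def)
          also have "\<dots> \<le> emeasure lborel (\<Union>\<F>)"
          proof (rule emeasure_mono)
            show "(\<Union>K\<in>p'. interior K) \<subseteq> \<Union>\<F>" 
            proof (rule UN_least)
              fix K assume "K \<in> p'"
              then have "K \<subseteq> \<Union>\<F>" using pD(2) by (simp add: p'_def)
              then show "interior K \<subseteq> \<Union>\<F>" using interior_subset by blast
            qed
            have "X \<in> sets borel" if "X \<in> \<F>" for X using \<D>(3) that \<F>(2) by force
            then show "\<Union>\<F> \<in> sets lborel" using \<F>(1) by auto
          qed
          finally show ?thesis .
        qed
        also have "\<dots> \<le> emeasure lborel U"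
          using sub U(1) by (intro emeasure_mono) (auto simp: V_def)
        also note mU
        finally have len: "family_length D < \<delta>" by (meson ennreal_leI not_le)
        have "emeasure \<mu> (\<Union>\<F>) = emeasure \<mu> (\<Union>p)" using pD(6) by simp
        also have "\<dots> \<le> (\<Sum>K\<in>p. emeasure \<mu> K)"
        proof -
          have "K \<in> sets \<mu>" if "K \<in> p" for K using pD(4)[OF that] by auto
          then have "(\<lambda>K. K) ` p \<subseteq> sets \<mu>" by auto
          then show ?thesis using emeasure_subadditive_finite[OF pD(1), of "\<lambda>K. K" \<mu>] by simp
        qed
        also have "\<dots> = (\<Sum>K\<in>p'. emeasure \<mu> K)"
        proof (rule sum.mono_neutral_right)
          show "\<forall>K\<in>p - p'. emeasure \<mu> K = 0"
          proof
            fix K assume K: "K \<in> p - p'"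
            then have "K = {Inf K..Sup K}" "Inf K = Sup K" using box[of K] by (auto simp: p'_def)
            then show "emeasure \<mu> K = 0" using Icc[of "Inf K" "Sup K"] by simp
          qed
        qed (use pD(1) in \<open>auto simp: p'_def\<close>)
        also have "\<dots> = (\<Sum>K\<in>p'. ennreal (F (Sup K) - F (Inf K)))"
        proof (rule sum.cong)
          fix K assume "K \<in> p'"
          then show "emeasure \<mu> K = ennreal (F (Sup K) - F (Inf K))"
            using box[of K] Icc[of "Inf K" "Sup K"] by (simp add: p'_def)
        qed simp
        also have "\<dots> = ennreal (\<Sum>K\<in>p'. F (Sup K) - F (Inf K))"
          by (rule sum_ennreal) (use mono in \<open>auto simp: p'_def mono_def\<close>)
        also have "\<dots> = ennreal (\<Sum>(c, d)\<in>D. F d - F c)"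
          unfolding D_def by (simp add: sum.reindex[OF inj])
        also have "\<dots> \<le> ennreal e" using \<delta>(2)[OF D len] by (rule ennreal_leI)
        finally show ?thesis .
      qed
      have "emeasure \<mu> V \<le> ennreal e"
      proof (cases "\<D> = {}")
        case True then show ?thesis using \<D>(4) by simp
      next
        case False
        define B where "B n = (\<Union>i\<le>n. from_nat_into \<D> i)" for n
        have fni: "from_nat_into \<D> i \<in> \<D>" for i using False by (rule from_nat_into)
        have "V = (\<Union>n. B n)"
        proof -
          have "(\<Union>n. B n) = \<Union>(range (from_nat_into \<D>))" unfolding B_def by auto
          then show ?thesis using \<D>(4) range_from_nat_into[OF False \<D>(1)] by simp
        qed
        moreover have "(SUP n. emeasure \<mu> (B n)) = emeasure \<mu> (\<Union>n. B n)"
        proof (rule SUP_emeasure_incseq)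
          have "from_nat_into \<D> i \<in> sets \<mu>" for i using \<D>(3)[OF fni[of i]] by auto
          then show "range B \<subseteq> sets \<mu>" unfolding B_def by auto
          show "incseq B" unfolding B_def incseq_def by (auto intro: order_trans)
        qed
        moreover have "(SUP n. emeasure \<mu> (B n)) \<le> ennreal e"
        proof (rule SUP_least)
          fix n
          have "B n = \<Union>(from_nat_into \<D> ` {..n})" by (simp add: B_def)
          then show "emeasure \<mu> (B n) \<le> ennreal e" using fin[of "from_nat_into \<D> ` {..n}"] fni by auto
        qed
        ultimately show ?thesis by simp
      qed
      moreover have "emeasure \<mu> ({a..b} \<inter> Z) \<le> emeasure \<mu> (V \<union> ({a..a} \<union> {b..b}))"
        using U \<open>open V\<close> by (intro emeasure_mono) (auto simp: V_def)
      moreover have "emeasure \<mu> (V \<union> ({a..a} \<union> {b..b})) \<le> emeasure \<mu> V + (emeasure \<mu> {a..a} + emeasure \<mu> {b..b})"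
        using \<open>open V\<close> by (intro order_trans[OF emeasure_subadditive] add_left_mono emeasure_subadditive) auto
      ultimately show ?thesis using Icc[of a a] Icc[of b b] by (auto intro: order_trans)
    qed
    then have "emeasure \<mu> ({a..b} \<inter> Z) \<le> 0" by (rule ennreal_le_epsilon)
    then show "Z \<in> null_sets \<nu>" using \<nu>[OF Zb] Zb by (simp add: null_sets_def)
  qed
  then obtain g where g: "g \<in> borel_measurable lborel" "density lborel g = \<nu>"
    using sigma_finite_measure.Radon_Nikodym[OF sigma_finite_lborel, of \<nu>] by auto
  have gi: "(\<integral>\<^sup>+t. g t * indicator {x..y} t \<partial>lborel) = ennreal (F y - F x)" if "a \<le> x" "x \<le> y" "y \<le> b" for x y
  proof -
    have "emeasure \<nu> {x..y} = (\<integral>\<^sup>+t. g t * indicator {x..y} t \<partial>lborel)"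
      unfolding g(2)[symmetric] using g(1) by (intro emeasure_density) auto
    moreover have "emeasure \<nu> {x..y} = emeasure \<mu> {x..y}"
      using that by (subst \<nu>) (auto intro: arg_cong[where f = "emeasure \<mu>"])
    ultimately show ?thesis using Icc that by simp
  qed
  define f where "f t = enn2real (g t) * indicator {a..b} t" for t
  have gf: "AE t in lborel. t \<in> {a..b} \<longrightarrow> g t = ennreal (f t)"
  proof -
    have "AE t in lborel. g t * indicator {a..b} t \<noteq> \<infinity>"
      using gi[of a b] \<open>a < b\<close> g(1) by (intro nn_integral_PInf_AE) auto
    then show ?thesis by eventually_elim (auto simp: f_def indicator_def less_top)
  qed
  have fi: "(\<integral>\<^sup>+t. ennreal (f t * indicator {x..y} t) \<partial>lborel) = ennreal (F y - F x)" if "a \<le> x" "x \<le> y" "y \<le> b" for x y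
  proof -
    have "(\<integral>\<^sup>+t. ennreal (f t * indicator {x..y} t) \<partial>lborel) = (\<integral>\<^sup>+t. g t * indicator {x..y} t \<partial>lborel)"
    proof (rule nn_integral_cong_AE)
      show "AE t in lborel. ennreal (f t * indicator {x..y} t) = g t * indicator {x..y} t"
        using gf by eventually_elim (use that in \<open>auto simp: indicator_def\<close>)
    qed
    then show ?thesis using gi[OF that] by simp
  qed
  have fm: "f \<in> borel_measurable borel" using g(1) unfolding f_def by auto
  have f0: "f t \<ge> 0" for t by (simp add: f_def)
  have fab: "f t * indicator {a..b} t = f t" for t by (simp add: f_def indicator_def)
  have int: "integrable lborel f"
    using fi[of a b] \<open>a < b\<close> fm f0 unfolding fab by (intro integrableI_nonneg) auto
  have "F y - F x = integral {x..y} f" if xy: "a \<le> x" "x \<le> y" "y \<le> b" for x y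
  proof -
    have "set_integrable lborel {x..y} f"
      unfolding set_integrable_def using int by (intro integrable_mult_indicator) auto
    then have "integral {x..y} f = (LINT t:{x..y}|lborel. f t)"
      by (rule set_borel_integral_eq_integral(2)[symmetric])
    also have "\<dots> = enn2real (\<integral>\<^sup>+t. ennreal (f t * indicator {x..y} t) \<partial>lborel)"
      unfolding set_lebesgue_integral_def using fm f0
      by (subst integral_eq_nn_integral) (auto simp: mult.commute)
    also have "\<dots> = F y - F x" using fi[OF xy] mono xy by (simp add: mono_def)
    finally show ?thesis by simp
  qed
  with int show ?thesis by (rule that)
qed

lemma abs_continuous_on_intervalD:
  assumes "abs_continuous_on_interval a b w" "\<epsilon> > 0"
  obtains \<delta> where "\<delta> > 0" "\<And>D. D \<in> interval_families a b \<Longrightarrow> family_length D < \<delta> \<Longrightarrow> family_variation w D < \<epsilon>"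
proof -
  from assms(1)[unfolded abs_continuous_on_interval_def, rule_format, OF assms(2)]
  obtain \<delta> where d0: "\<delta> > 0" and \<delta>: "\<forall>D. finite D \<and> (\<forall>(c, d)\<in>D. a \<le> c \<and> c \<le> d \<and> d \<le> b) \<and>
        disjoint_family_on (\<lambda>(c, d). {c<..<d}) D \<and> (\<Sum>(c, d)\<in>D. d - c) < \<delta> \<longrightarrow> (\<Sum>(c, d)\<in>D. \<bar>w d - w c\<bar>) < \<epsilon>"
    by (elim exE conjE) (rule that)
  have "family_variation w D < \<epsilon>" if D: "D \<in> interval_families a b" "family_length D < \<delta>" for D
  proof -
    have "\<forall>(c, d)\<in>D. a \<le> c \<and> c \<le> d \<and> d \<le> b"
      using interval_familiesD(2-4)[OF D(1)] by (auto intro: less_imp_le)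
    then show ?thesis
      using \<delta>[rule_format, of D] interval_familiesD(1,5)[OF D(1)] D(2) unfolding family_length_def family_variation_def
      by simp
  qed
  then show ?thesis using that d0 by simp
qed

text \<open>Jordan decomposition: the variation function \<open>T\<close> and \<open>T\<close> - w
  are both monotone and absolutely continuous, so each is the integral of a density, and w is their
  difference.\<close>

lemma abs_continuous_on_interval_integral:
  assumes w: "abs_continuous_on_interval a b w" and ab: "a < b"
  obtains f where "integrable lborel f" "\<And>x y. a \<le> x \<Longrightarrow> x \<le> y \<Longrightarrow> y \<le> b \<Longrightarrow> w y - w x = integral {x..y} f"
    "AE x in lborel. x \<in> {a<..<b} \<longrightarrow> (w has_real_derivative f x) (at x)"
proof -
  have fin: "variation w x y < \<infinity>" if xy: "a \<le> x" "x \<le> y" "y \<le> b" for x y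
  proof -
    obtain \<delta> where \<delta>: "\<delta> > 0" "\<And>D. D \<in> interval_families a b \<Longrightarrow> family_length D < \<delta> \<Longrightarrow> family_variation w D < 1"
      using abs_continuous_on_intervalD[OF w, of 1] by auto
    have small: "variation w p q \<le> 1" if "x \<le> p" "p \<le> q" "q \<le> y" "q - p < \<delta>" for p q
      unfolding variation_def
    proof (rule SUP_least)
      fix D assume D: "D \<in> interval_families p q"
      then have "family_length D < \<delta>" using family_length_le[OF D] that by simp
      moreover have "D \<in> interval_families a b" using D that xy by (auto intro: interval_families_mono)
      ultimately show "ennreal (family_variation w D) \<le> 1" using \<delta>(2)[of D] by (simp add: ennreal_le_1)
    qed
    \<comment> \<open>Each step of length \<delta> / 2 adds at most 1 to the variation; the half
      keeps the step strictly shorter than \<delta>.\<close>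
    have step: "variation w x (min y (x + real n * (\<delta> / 2))) \<le> of_nat n" for n
    proof (induction n)
      case 0
      have "variation w x x = 0"
        unfolding variation_def
      proof (rule antisym, rule SUP_least)
        fix D assume "D \<in> interval_families x x"
        then have "D = {}" unfolding interval_families_def by fastforce
        then show "ennreal (family_variation w D) \<le> 0" by (simp add: family_variation_def)
      qed simp
      then show ?case using xy by (simp add: min_def)
    next
      case (Suc n)
      define p where "p = min y (x + real n * (\<delta> / 2))"
      define q where "q = min y (x + real (Suc n) * (\<delta> / 2))"
      have pq: "x \<le> p" "p \<le> q" "q \<le> y" "q - p < \<delta>"
        using xy \<delta>(1) by (auto simp: p_def q_def min_def field_simps)
      have "variation w x q \<le> variation w x p + variation w p q"
        using pq by (intro variation_subadd) auto
      also have "\<dots> \<le> of_nat n + 1" using Suc small[OF pq] by (intro add_mono) (auto simp: p_def)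
      finally show ?case by (simp add: q_def add.commute)
    qed
    obtain n where "real n * (\<delta> / 2) > y - x" using ex_less_of_nat_mult[of "\<delta> / 2" "y - x"] \<delta>(1) by auto
    then have "variation w x y \<le> of_nat n" using step[of n] by (simp add: min_def)
    then show ?thesis using of_nat_less_top[of n] by (simp add: order_le_less_trans)
  qed
  \<comment> \<open>Clamping to {a..b} extends the functions by constants, because the Stieltjes
    measure needs monotonicity and continuity on the whole line.\<close>
  define cl where "cl t = max a (min b t)" for t
  have cl: "a \<le> cl t" "cl t \<le> b" "t \<in> {a..b} \<Longrightarrow> cl t = t" "s \<le> t \<Longrightarrow> cl s \<le> cl t" "\<bar>cl s - cl t\<bar> \<le> \<bar>s - t\<bar>" for s t
    using ab by (auto simp: cl_def)
  define T where "T t = enn2real (variation w a (cl t))" for t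
  have Tsub: "T y - T x \<le> enn2real (variation w x y)" if "a \<le> x" "x \<le> y" "y \<le> b" for x y
  proof -
    have "enn2real (variation w a y) \<le> enn2real (variation w a x + variation w x y)"
      using variation_subadd[of a x y w] fin[of a x] fin[of x y] that by (intro enn2real_mono) (auto simp: less_top)
    also have "\<dots> = enn2real (variation w a x) + enn2real (variation w x y)"
      using fin[of a x] fin[of x y] that by (intro enn2real_plus) (auto simp: less_top)
    finally show ?thesis using that by (simp add: T_def cl)
  qed
  have Tsup: "\<bar>w y - w x\<bar> \<le> T y - T x" if xy: "a \<le> x" "x \<le> y" "y \<le> b" for x y
  proof (cases "x = y")
    case False
    then have "x < y" using xy by simp
    have "variation w a x + ennreal \<bar>w y - w x\<bar> \<le> variation w a y"
      unfolding variation_def[of w a x]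
    proof (subst ennreal_SUP_add_left[symmetric])
      show "(SUP D\<in>interval_families a x. ennreal (family_variation w D) + ennreal \<bar>w y - w x\<bar>) \<le> variation w a y"
      proof (rule SUP_least)
        fix D assume D: "D \<in> interval_families a x"
        note d = interval_familiesD[OF D]
        have nin: "(x, y) \<notin> D" using d(4) \<open>x < y\<close> by force
        have "insert (x, y) D \<in> interval_families a y"
          unfolding interval_families_def
        proof (intro CollectI conjI)
          show "finite (insert (x, y) D)" using d by simp
          show "\<forall>(c, d)\<in>insert (x, y) D. a \<le> c \<and> c < d \<and> d \<le> y" using d(2-4) xy \<open>x < y\<close> by force
          have "{x<..<y} \<inter> (\<Union>p\<in>D. case p of (c, d) \<Rightarrow> {c<..<d}) = {}" using d(4) by force
          then show "disjoint_family_on (\<lambda>(c, d). {c<..<d}) (insert (x, y) D)"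
            using d(5) nin by (simp add: disjoint_family_on_insert)
        qed
        then have "ennreal (family_variation w (insert (x, y) D)) \<le> variation w a y"
          unfolding variation_def by (rule SUP_upper)
        moreover have "family_variation w (insert (x, y) D) = family_variation w D + \<bar>w y - w x\<bar>"
          using d(1) nin by (simp add: family_variation_def)
        ultimately show "ennreal (family_variation w D) + ennreal \<bar>w y - w x\<bar> \<le> variation w a y"
          by (simp add: family_variation_nonneg)
      qed
    qed (use empty_interval_families in blast)
    then have "enn2real (variation w a x + ennreal \<bar>w y - w x\<bar>) \<le> enn2real (variation w a y)"
      using fin[of a y] xy by (intro enn2real_mono) auto
    moreover have "enn2real (variation w a x + ennreal \<bar>w y - w x\<bar>) = enn2real (variation w a x) + \<bar>w y - w x\<bar>"
      using fin[of a x] xy by (subst enn2real_plus) auto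
    ultimately show ?thesis using xy by (simp add: T_def cl)
  qed simp
  have Tcl: "T (cl t) = T t" for t using cl by (simp add: T_def)
  have varI: "\<exists>\<delta>>0. \<forall>D\<in>interval_families a b. family_length D < \<delta> \<longrightarrow> (\<Sum>(c, d)\<in>D. T d - T c) \<le> e" if e: "e > 0" for e
  proof -
    obtain \<delta> where \<delta>: "\<delta> > 0" "\<And>D. D \<in> interval_families a b \<Longrightarrow> family_length D < \<delta> \<Longrightarrow> family_variation w D < e"
      using abs_continuous_on_intervalD[OF w e] by auto
    have "(\<Sum>(c, d)\<in>D. T d - T c) \<le> e" if D: "D \<in> interval_families a b" "family_length D < \<delta>" for D
    proof -
      note d = interval_familiesD[OF D(1)]
      have "(\<Sum>(c, d)\<in>D. variation w c d) + ennreal (family_variation w {}) \<le> ennreal e"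
        by (rule sum_variation_le[of a b \<delta>]) (use \<delta>(2) D in \<open>auto simp: less_imp_le family_length_def\<close>)
      then have le: "(\<Sum>(c, d)\<in>D. variation w c d) \<le> ennreal e" by (simp add: family_variation_def)
      have "ennreal (\<Sum>(c, d)\<in>D. T d - T c) = (\<Sum>p\<in>D. ennreal (T (snd p) - T (fst p)))"
        unfolding case_prod_unfold
      proof (rule sum_ennreal[symmetric])
        fix p assume "p \<in> D"
        then show "0 \<le> T (snd p) - T (fst p)"
          using Tsup[of "fst p" "snd p"] d(2-4)[of "fst p" "snd p"] by auto
      qed
      also have "\<dots> \<le> (\<Sum>p\<in>D. variation w (fst p) (snd p))"
      proof (rule sum_mono)
        fix p assume "p \<in> D"
        then have p: "a \<le> fst p" "fst p \<le> snd p" "snd p \<le> b" using d(2-4)[of "fst p" "snd p"] by auto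
        then show "ennreal (T (snd p) - T (fst p)) \<le> variation w (fst p) (snd p)"
          using Tsub[OF p] fin[OF p] by (metis ennreal_enn2real ennreal_leI infinity_ennreal_def)
      qed
      also have "\<dots> \<le> ennreal e" using le by (simp add: case_prod_unfold)
      finally show ?thesis using e by (simp add: ennreal_le_iff)
    qed
    then show ?thesis using \<delta>(1) by blast
  qed
  have Tmono: "mono T"
  proof (rule monoI)
    fix s t :: real assume "s \<le> t"
    then show "T s \<le> T t" using Tsup[of "cl s" "cl t"] cl(1,2)[of s] cl(1,2)[of t] cl(4)[of s t] by (simp add: Tcl)
  qed
  have contI: "continuous_on UNIV F"
    if Fm: "mono F" and Fcl: "\<And>t. F (cl t) = F t"
      and ac: "\<And>e. e > 0 \<Longrightarrow> \<exists>\<delta>>0. \<forall>D\<in>interval_families a b. family_length D < \<delta> \<longrightarrow> (\<Sum>(c, d)\<in>D. F d - F c) \<le> e" for F :: "real \<Rightarrow> real"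
    unfolding continuous_on_iff
  proof (intro ballI allI impI)
    fix x e :: real assume e: "e > 0"
    obtain \<delta> where \<delta>: "\<delta> > 0" "\<And>D. D \<in> interval_families a b \<Longrightarrow> family_length D < \<delta> \<Longrightarrow> (\<Sum>(c, d)\<in>D. F d - F c) \<le> e / 2"
      using ac[of "e / 2"] e by auto
    have *: "F d - F c \<le> e / 2" if "a \<le> c" "c \<le> d" "d \<le> b" "d - c < \<delta>" for c d
    proof (cases "c = d")
      case False
      then have "{(c, d)} \<in> interval_families a b" using that by (auto simp: interval_families_def disjoint_family_on_def)
      then show ?thesis using \<delta>(2)[of "{(c, d)}"] that by (simp add: family_length_def)
    qed (use e in simp)
    have "dist (F y) (F x) < e" if y: "dist y x < \<delta>" for y
    proof (cases "y \<le> x")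
      case True
      have "F (cl x) - F (cl y) \<le> e / 2" using cl(5)[of x y] y True cl(1,2) cl(4) by (intro *) (auto simp: dist_real_def)
      then show ?thesis using monoD[OF Fm True] e by (simp add: Fcl dist_real_def)
    next
      case False
      have "F (cl y) - F (cl x) \<le> e / 2" using cl(5)[of x y] y False cl(1,2) cl(4) by (intro *) (auto simp: dist_real_def)
      then show ?thesis using monoD[OF Fm, of x y] False e by (simp add: Fcl dist_real_def)
    qed
    then show "\<exists>d>0. \<forall>y\<in>UNIV. dist y x < d \<longrightarrow> dist (F y) (F x) < e" using \<delta>(1) by blast
  qed
  define V where "V t = T t - w (cl t)" for t
  have Vcl: "V (cl t) = V t" for t using cl(3)[of "cl t"] cl(1,2) by (simp add: V_def Tcl)
  have Vmono: "mono V"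
  proof (rule monoI)
    fix s t :: real assume "s \<le> t"
    then show "V s \<le> V t"
      using Tsup[of "cl s" "cl t"] cl(1,2)[of s] cl(1,2)[of t] cl(4)[of s t] by (simp add: Tcl V_def)
  qed
  have Vac: "\<exists>\<delta>>0. \<forall>D\<in>interval_families a b. family_length D < \<delta> \<longrightarrow> (\<Sum>(c, d)\<in>D. V d - V c) \<le> e" if e: "e > 0" for e
  proof -
    obtain \<delta> where \<delta>: "\<delta> > 0" "\<And>D. D \<in> interval_families a b \<Longrightarrow> family_length D < \<delta> \<Longrightarrow> (\<Sum>(c, d)\<in>D. T d - T c) \<le> e / 2"
      using varI[of "e / 2"] e by auto
    have "(\<Sum>(c, d)\<in>D. V d - V c) \<le> e" if D: "D \<in> interval_families a b" "family_length D < \<delta>" for D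
    proof -
      note d = interval_familiesD[OF D(1)]
      have "(\<Sum>(c, d)\<in>D. V d - V c) \<le> (\<Sum>(c, d)\<in>D. 2 * (T d - T c))"
        unfolding case_prod_unfold
      proof (rule sum_mono)
        fix p assume "p \<in> D"
        then have p: "a \<le> fst p" "fst p \<le> snd p" "snd p \<le> b" using d(2-4)[of "fst p" "snd p"] by auto
        then show "V (snd p) - V (fst p) \<le> 2 * (T (snd p) - T (fst p))"
          using Tsup[OF p] by (simp add: V_def cl)
      qed
      also have "\<dots> = 2 * (\<Sum>(c, d)\<in>D. T d - T c)" by (simp add: sum_distrib_left case_prod_unfold)
      finally show ?thesis using \<delta>(2)[OF D] by simp
    qed
    then show ?thesis using \<delta>(1) by blast
  qed
  obtain f1 where f1: "integrable lborel f1" "\<And>x y. a \<le> x \<Longrightarrow> x \<le> y \<Longrightarrow> y \<le> b \<Longrightarrow> T y - T x = integral {x..y} f1"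
    using abs_continuous_mono_density[OF Tmono contI[OF Tmono Tcl varI] ab varI] by blast
  obtain f2 where f2: "integrable lborel f2" "\<And>x y. a \<le> x \<Longrightarrow> x \<le> y \<Longrightarrow> y \<le> b \<Longrightarrow> V y - V x = integral {x..y} f2"
    using abs_continuous_mono_density[OF Vmono contI[OF Vmono Vcl Vac] ab Vac] by blast
  define f where "f t = f1 t - f2 t" for t
  have int: "integrable lborel f" unfolding f_def using f1 f2 by auto
  have on: "h integrable_on {x..y}" if "integrable lborel h" for h :: "real \<Rightarrow> real" and x y
    using integrable_on_subcbox[OF integrable_on_lborel[OF that], of x y] by simp
  have eq: "w y - w x = integral {x..y} f" if "a \<le> x" "x \<le> y" "y \<le> b" for x y
  proof -
    have "integral {x..y} f = integral {x..y} f1 - integral {x..y} f2"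
      unfolding f_def using on f1(1) f2(1) by (intro Henstock_Kurzweil_Integration.integral_diff) auto
    also have "\<dots> = (T y - T x) - (V y - V x)" using f1(2) f2(2) that by simp
    finally show ?thesis using that by (simp add: V_def cl)
  qed
  show ?thesis
    using that[OF int eq AE_indefinite_integral_derivative[OF int eq]] by blast
qed

section \<open>Nonincreasing functions of finite energy\<close>

text \<open>Young's inequality for the conjugate exponents (k + 1) / k and k + 1, in a form without
  roots. The induction step multiplies by y and adds (k + 1) x^k (x - y)^2 \<ge> 0.\<close>

lemma weighted_amgm:
  fixes x y :: real
  assumes "x \<ge> 0" "y \<ge> 0"
  shows "(real k + 1) * x ^ k * y \<le> real k * x ^ Suc k + y ^ Suc k"
proof (induction k)
  case (Suc k)
  have "((real k + 1) * x ^ k * y) * y \<le> (real k * x ^ Suc k + y ^ Suc k) * y"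
    by (rule mult_right_mono[OF Suc \<open>y \<ge> 0\<close>])
  moreover have "0 \<le> (real k + 1) * x ^ k * (x - y)\<^sup>2"
    using assms by auto
  ultimately show ?case
    by (simp add: algebra_simps power2_eq_square)
qed simp

text \<open>Hoelder's inequality for f = (f / \<omega>) \<omega>: pointwise Young against a constant
  m, then the optimal choice m^(k+1) = E / X. For E = 0 this choice would be 0, and m is made
  arbitrarily small instead.\<close>

lemma nn_integral_power_mean:
  fixes f \<omega> :: "'a \<Rightarrow> real"
  assumes [measurable]: "f \<in> borel_measurable M" "\<omega> \<in> borel_measurable M" "A \<in> sets M"
    and f: "\<And>x. x \<in> A \<Longrightarrow> 0 \<le> f x" and \<omega>: "\<And>x. x \<in> A \<Longrightarrow> 0 < \<omega> x"
    and E: "(\<integral>\<^sup>+x\<in>A. ennreal (f x ^ Suc k / \<omega> x ^ k) \<partial>M) \<le> ennreal E" "0 \<le> E"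
    and X: "(\<integral>\<^sup>+x\<in>A. ennreal (\<omega> x) \<partial>M) \<le> ennreal X" "0 < X"
  shows "(\<integral>\<^sup>+x\<in>A. ennreal (f x) \<partial>M) \<le> ennreal (root (Suc k) (E * X ^ k))"
proof -
  have *: "(\<integral>\<^sup>+x\<in>A. ennreal (f x) \<partial>M) \<le> ennreal ((E + real k * m ^ Suc k * X) / ((real k + 1) * m ^ k))" if m: "m > 0" for m
  proof -
    let ?c = "(real k + 1) * m ^ k"
    have c: "?c > 0" using m by simp
    have "(\<integral>\<^sup>+x\<in>A. ennreal (f x) \<partial>M) \<le>
        (\<integral>\<^sup>+x. ennreal (1 / ?c) * (ennreal (f x ^ Suc k / \<omega> x ^ k) * indicator A x) +
              ennreal (real k * m ^ Suc k / ?c) * (ennreal (\<omega> x) * indicator A x) \<partial>M)"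
    proof (rule nn_integral_mono)
      fix x
      show "ennreal (f x) * indicator A x \<le> ennreal (1 / ?c) * (ennreal (f x ^ Suc k / \<omega> x ^ k) * indicator A x) +
              ennreal (real k * m ^ Suc k / ?c) * (ennreal (\<omega> x) * indicator A x)"
      proof (cases "x \<in> A")
        case True
        have w: "\<omega> x > 0" "f x \<ge> 0" using True f \<omega> by auto
        have "?c * (f x / \<omega> x) \<le> real k * m ^ Suc k + (f x / \<omega> x) ^ Suc k"
          using weighted_amgm[of m "f x / \<omega> x" k] m w by simp
        then have "?c * (f x / \<omega> x) * \<omega> x \<le> (real k * m ^ Suc k + (f x / \<omega> x) ^ Suc k) * \<omega> x"
          using w by (intro mult_right_mono) auto
        then have "?c * f x \<le> real k * m ^ Suc k * \<omega> x + f x ^ Suc k / \<omega> x ^ k"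
        proof -
          have "(f x / \<omega> x) ^ Suc k * \<omega> x = f x ^ Suc k / \<omega> x ^ k"
            using w by (simp add: power_divide)
          moreover assume "?c * (f x / \<omega> x) * \<omega> x \<le> (real k * m ^ Suc k + (f x / \<omega> x) ^ Suc k) * \<omega> x"
          ultimately show ?thesis using w by (simp only: distrib_right) simp
        qed
        then have "f x \<le> (real k * m ^ Suc k * \<omega> x + f x ^ Suc k / \<omega> x ^ k) / ?c"
          using c by (simp add: pos_le_divide_eq mult.commute)
        then have le: "f x \<le> 1 / ?c * (f x ^ Suc k / \<omega> x ^ k) + real k * m ^ Suc k / ?c * \<omega> x"
        proof -
          have "(a * w + p) / c = 1 / c * p + a / c * w" for a w p c :: real by (simp add: add_divide_distrib)
          moreover assume "f x \<le> (real k * m ^ Suc k * \<omega> x + f x ^ Suc k / \<omega> x ^ k) / ?c"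
          ultimately show ?thesis by (simp only:)
        qed
        have "ennreal (f x) \<le> ennreal (1 / ?c * (f x ^ Suc k / \<omega> x ^ k) + real k * m ^ Suc k / ?c * \<omega> x)"
          using le by (rule ennreal_leI)
        also have "\<dots> = ennreal (1 / ?c) * ennreal (f x ^ Suc k / \<omega> x ^ k) + ennreal (real k * m ^ Suc k / ?c) * ennreal (\<omega> x)"
          using w m by (subst ennreal_plus) (auto simp: ennreal_mult[symmetric] simp del: power_Suc)
        finally show ?thesis using True by simp
      qed simp
    qed
    also have "\<dots> = ennreal (1 / ?c) * (\<integral>\<^sup>+x\<in>A. ennreal (f x ^ Suc k / \<omega> x ^ k) \<partial>M) +
              ennreal (real k * m ^ Suc k / ?c) * (\<integral>\<^sup>+x\<in>A. ennreal (\<omega> x) \<partial>M)"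
      by (subst nn_integral_add) (auto simp: nn_integral_cmult)
    also have "\<dots> \<le> ennreal (1 / ?c) * ennreal E + ennreal (real k * m ^ Suc k / ?c) * ennreal X"
      using E X by (intro add_mono mult_left_mono) auto
    also have "\<dots> = ennreal ((E + real k * m ^ Suc k * X) / ?c)"
      using E X m by (simp add: ennreal_mult[symmetric] ennreal_plus[symmetric] add_divide_distrib del: ennreal_plus)
    finally show ?thesis .
  qed
  show ?thesis
  proof (cases "E = 0")
    case True
    have "(\<integral>\<^sup>+x\<in>A. ennreal (f x) \<partial>M) \<le> 0 + ennreal e" if e: "e > 0" for e
    proof -
      have "(\<integral>\<^sup>+x\<in>A. ennreal (f x) \<partial>M) \<le> ennreal (real k * (e / X) ^ Suc k * X / ((real k + 1) * (e / X) ^ k))"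
        using *[of "e / X"] e X True by simp
      also have "real k * (e / X) ^ Suc k * X / ((real k + 1) * (e / X) ^ k) = real k / (real k + 1) * e"
        using e X by simp
      also have "ennreal \<dots> \<le> ennreal e" using e by (intro ennreal_leI) (auto simp: field_simps)
      finally show ?thesis by simp
    qed
    then have "(\<integral>\<^sup>+x\<in>A. ennreal (f x) \<partial>M) \<le> 0" by (rule ennreal_le_epsilon)
    then show ?thesis by simp
  next
    case False
    then have E0: "E > 0" using E by simp
    define m where "m = root (Suc k) (E / X)"
    have m: "m > 0" "m ^ Suc k = E / X" using E0 X unfolding m_def by (auto intro!: real_root_pow_pos2 simp del: power_Suc)
    have "(E + real k * m ^ Suc k * X) / ((real k + 1) * m ^ k) = E / m ^ k"
    proof -
      have "E + real k * m ^ Suc k * X = (real k + 1) * E"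
        unfolding m(2) using X by (simp add: algebra_simps)
      moreover have "real k + 1 \<noteq> 0" by linarith
      ultimately show ?thesis by (metis nonzero_mult_divide_mult_cancel_left)
    qed
    also have "\<dots> = m * X" using m X by (simp add: divide_eq_eq) (simp add: field_simps)
    also have "\<dots> = root (Suc k) (E * X ^ k)"
    proof (rule real_root_pos_unique[symmetric])
      show "(m * X) ^ Suc k = E * X ^ k" unfolding power_mult_distrib m(2) using X by simp
    qed (use m X in auto)
    finally show ?thesis using *[OF m(1)] by simp
  qed
qed

text \<open>Monotonicity is asked only for s > 0, so g may blow up at 0. The value 0 for s \<le> 0
  is a normalisation that makes g Borel on the whole line.\<close>

definition decr :: "(real \<Rightarrow> real) \<Rightarrow> bool" where
  "decr g \<longleftrightarrow> (\<forall>s>0. \<forall>t\<ge>s. g t \<le> g s) \<and> (\<forall>s. 0 \<le> g s) \<and> (\<forall>s\<le>0. g s = 0)"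

definition prim :: "(real \<Rightarrow> real) \<Rightarrow> real \<Rightarrow> real" where
  "prim g s = integral {0..s} g"

lemma decrD:
  assumes "decr g"
  shows "\<And>s t. 0 < s \<Longrightarrow> s \<le> t \<Longrightarrow> g t \<le> g s" "\<And>s. 0 \<le> g s" "\<And>s. s \<le> 0 \<Longrightarrow> g s = 0"
  using assms by (auto simp: decr_def)

lemma decr_countable_discont:
  assumes "decr g"
  shows "countable {s. 0 < s \<and> \<not> isCont g s}"
proof -
  have "mono_on {0<..} (\<lambda>s. - g s)"
    using decrD(1)[OF assms] by (auto simp: mono_on_def)
  then have "countable {s\<in>{0<..}. \<not> isCont (\<lambda>s. - g s) s}"
    by (intro mono_on_ctble_discont_open) auto
  moreover have "isCont (\<lambda>s. - g s) s \<longleftrightarrow> isCont g s" for s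
    using continuous_minus[of "at s" g] continuous_minus[of "at s" "\<lambda>s. - g s"] by auto
  ultimately show ?thesis by simp
qed

lemma decr_AE_isCont:
  assumes "decr g"
  shows "AE s in lborel. 0 < s \<longrightarrow> isCont g s"
proof -
  have "{s. 0 < s \<and> \<not> isCont g s} \<in> null_sets lborel"
    using decr_countable_discont[OF assms] by (rule countable_imp_null_set_lborel)
  then show ?thesis by (rule AE_I'[of "{s. 0 < s \<and> \<not> isCont g s}"]) auto
qed

lemma decr_borel_measurable [measurable (raw)]:
  assumes "decr g"
  shows "g \<in> borel_measurable borel"
proof -
  have "mono_on {0<..} (\<lambda>s. - g s)"
    using decrD(1)[OF assms] by (auto simp: mono_on_def)
  then have "(\<lambda>s. - g s) \<in> borel_measurable (restrict_space borel {0<..})"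
    by (rule borel_measurable_mono_on_fnc)
  then have "(\<lambda>s. - (- g s)) \<in> borel_measurable (restrict_space borel {0<..})"
    by (rule borel_measurable_uminus)
  then have "(\<lambda>s. indicator {0<..} s *\<^sub>R g s) \<in> borel_measurable borel"
    by (subst (asm) borel_measurable_restrict_space_iff) auto
  moreover have "(\<lambda>s. indicator {0<..} s *\<^sub>R g s) = g"
    using decrD(3)[OF assms] by (auto simp: indicator_def fun_eq_iff)
  ultimately show ?thesis by simp
qed

definition decr_int :: "(real \<Rightarrow> real) \<Rightarrow> bool" where
  "decr_int g \<longleftrightarrow> decr g \<and> (\<forall>s. set_integrable lborel {0..s} g)"

lemma decr_intD:
  assumes "decr_int g"
  shows "decr g" "set_integrable lborel {0..s} g"
  using assms by (auto simp: decr_int_def)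

lemma decr_int_set_integrable:
  assumes "decr_int g" "0 \<le> a"
  shows "set_integrable lborel {a..b} g"
  using decr_intD(2)[OF assms(1), of b] by (rule set_integrable_subset) (use assms in auto)

lemma decr_int_integrable_on:
  assumes "decr_int g" "0 \<le> a"
  shows "g integrable_on {a..b}"
  using decr_int_set_integrable[OF assms] by (rule set_borel_integral_eq_integral(1))

lemma prim_diff:
  assumes "decr_int g" "0 \<le> a" "a \<le> b"
  shows "prim g b - prim g a = integral {a..b} g"
  unfolding prim_def
  using Henstock_Kurzweil_Integration.integral_combine[of 0 a b g] decr_int_integrable_on[of g 0 b] assms by simp

lemma prim_diff_nn:
  assumes "decr_int g" "0 \<le> a" "a \<le> b"
  shows "ennreal (prim g b - prim g a) = (\<integral>\<^sup>+s\<in>{a..b}. ennreal (g s) \<partial>lborel)"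
proof -
  have i: "set_integrable lborel {a..b} g" by (rule decr_int_set_integrable[OF assms(1,2)])
  have "(\<integral>\<^sup>+s\<in>{a..b}. ennreal (g s) \<partial>lborel) = (\<integral>\<^sup>+s. ennreal (indicator {a..b} s *\<^sub>R g s) \<partial>lborel)"
    by (intro nn_integral_cong) (auto simp: indicator_def)
  also have "\<dots> = ennreal (LINT s:{a..b}|lborel. g s)"
    unfolding set_lebesgue_integral_def using i decrD(2)[OF decr_intD(1)[OF assms(1)]]
    by (intro nn_integral_eq_integral) (auto simp: set_integrable_def)
  also have "(LINT s:{a..b}|lborel. g s) = integral {a..b} g"
    using i by (rule set_borel_integral_eq_integral(2))
  finally show ?thesis using prim_diff[OF assms] by simp
qed

lemma prim_0 [simp]: "prim g 0 = 0"
  by (simp add: prim_def)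

lemma prim_mono:
  assumes "decr_int g" "0 \<le> a" "a \<le> b" shows "prim g a \<le> prim g b"
proof -
  have "0 \<le> integral {a..b} g"
    using decrD(2)[OF decr_intD(1)[OF assms(1)]]
    by (intro Henstock_Kurzweil_Integration.integral_nonneg decr_int_integrable_on assms) auto
  then show ?thesis using prim_diff[OF assms] by simp
qed

lemma prim_nonneg:
  assumes "decr_int g" "0 \<le> a" shows "0 \<le> prim g a"
  using prim_mono[OF assms(1), of 0 a] assms by simp

lemma prim_continuous_on:
  assumes "decr_int g" shows "continuous_on {0..} (prim g)"
proof -
  have "continuous_on {0..c} (prim g)" for c
    unfolding prim_def by (rule indefinite_integral_continuous_1[OF decr_int_integrable_on[OF assms]]) simp
  then have "continuous (at x within {0..}) (prim g)" if "x \<ge> 0" for x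
  proof -
    have "continuous (at x within {0..x+1}) (prim g)"
      using \<open>\<And>c. continuous_on {0..c} (prim g)\<close>[of "x + 1"] that by (auto simp: continuous_on_eq_continuous_within)
    moreover have "at x within {0..x+1} = at x within {0..}"
      using that by (intro at_within_nhd[of x "{..<x+1}"]) auto
    ultimately show ?thesis by simp
  qed
  then show ?thesis by (auto simp: continuous_on_eq_continuous_within)
qed

lemma prim_has_derivative:
  assumes g: "decr_int g" and s: "0 < s" and c: "isCont g s"
  shows "(prim g has_real_derivative g s) (at s)"
proof -
  have "((\<lambda>u. integral {0..u} g) has_vector_derivative g s) (at s within ({0..s + 1} - {}))"
    using s c by (intro integral_has_vector_derivative_continuous_at decr_int_integrable_on g)
       (auto intro: continuous_within_subset)
  moreover have "at s within ({0..s + 1} - {}) = at s"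
    using s by (intro at_within_interior) auto
  ultimately show ?thesis
    unfolding prim_def has_real_derivative_iff_has_vector_derivative by simp
qed

lemma prim_ge:
  assumes "decr_int g" "0 < s" shows "s * g s \<le> prim g s"
proof -
  \<comment> \<open>By convention g vanishes at 0, so the constant g s must be lowered at that one
    point to stay below g.\<close>
  have "integral {0..s} (\<lambda>t. if t = 0 then 0 else g s) \<le> integral {0..s} g"
  proof (rule integral_le)
    have "((\<lambda>t. g s) has_integral s * g s) {0..s}"
      using has_integral_const_real[of "g s" 0 s] assms(2) by simp
    then have *: "((\<lambda>t. if t = 0 then 0 else g s) has_integral s * g s) {0..s}"
      by (rule has_integral_spike[of "{0}", rotated 2]) auto
    then show "(\<lambda>t. if t = 0 then 0 else g s) integrable_on {0..s}" by blast
  qed (use decr_int_integrable_on[OF assms(1)] decrD[OF decr_intD(1)[OF assms(1)]] in auto)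
  moreover have "integral {0..s} (\<lambda>t. if t = 0 then 0 else g s) = integral {0..s} (\<lambda>t. g s)"
    by (rule integral_spike[of "{0}"]) auto
  ultimately show ?thesis using assms unfolding prim_def by simp
qed

lemma prim_diff_nn_Ioc:
  assumes "decr_int g" "0 \<le> a" "a \<le> b"
  shows "ennreal (prim g b - prim g a) = (\<integral>\<^sup>+s\<in>{a<..b}. ennreal (g s) \<partial>lborel)"
proof -
  have "AE s in lborel. s \<noteq> a" by (rule AE_lborel_singleton)
  then have "(\<integral>\<^sup>+s\<in>{a..b}. ennreal (g s) \<partial>lborel) = (\<integral>\<^sup>+s\<in>{a<..b}. ennreal (g s) \<partial>lborel)"
    by (intro nn_integral_cong_AE) (auto simp: indicator_def elim!: eventually_mono)
  then show ?thesis using prim_diff_nn[OF assms] by simp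
qed

lemma decr_intI:
  assumes g: "decr g" and fin: "\<And>s. s > 0 \<Longrightarrow> (\<integral>\<^sup>+t\<in>{0<..s}. ennreal (g t) \<partial>lborel) < \<infinity>"
  shows "decr_int g"
  unfolding decr_int_def
proof (intro conjI allI g)
  fix s
  have [measurable]: "g \<in> borel_measurable borel" by (rule decr_borel_measurable[OF g])
  show "set_integrable lborel {0..s} g"
    unfolding set_integrable_def
  proof (rule integrableI_nonneg)
    have "(\<integral>\<^sup>+t. ennreal (indicator {0..s} t *\<^sub>R g t) \<partial>lborel) \<le> (\<integral>\<^sup>+t\<in>{0<..\<bar>s\<bar> + 1}. ennreal (g t) \<partial>lborel)"
    proof (rule nn_integral_mono)
      fix t show "ennreal (indicator {0..s} t *\<^sub>R g t) \<le> ennreal (g t) * indicator {0<..\<bar>s\<bar> + 1} t"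
        using decrD(3)[OF g, of t] by (auto simp: indicator_def)
    qed
    also have "\<dots> < \<infinity>" by (rule fin) simp
    finally show "(\<integral>\<^sup>+t. ennreal (indicator {0..s} t *\<^sub>R g t) \<partial>lborel) < \<infinity>" .
  qed (use decrD(2)[OF g] in auto)
qed

lemma nn_integral_powr_Ioc:
  fixes a c b :: real
  assumes "0 \<le> a" "a \<le> c" "0 \<le> b" "b < 1"
  shows "(\<integral>\<^sup>+s\<in>{a<..c}. ennreal (s powr - b) \<partial>lborel) = ennreal ((c powr (1 - b) - a powr (1 - b)) / (1 - b))"
proof -
  have "((\<lambda>s. s powr - b) has_integral (c powr (1 - b) / (1 - b) - a powr (1 - b) / (1 - b))) {a..c}"
  proof (rule fundamental_theorem_of_calculus_interior)
    show "continuous_on {a..c} (\<lambda>s. s powr (1 - b) / (1 - b))"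
      using assms by (intro continuous_intros continuous_on_powr') auto
    fix s assume "s \<in> {a<..<c}"
    then show "((\<lambda>s. s powr (1 - b) / (1 - b)) has_vector_derivative s powr - b) (at s)"
      unfolding has_real_derivative_iff_has_vector_derivative[symmetric] using assms
      by (auto intro!: derivative_eq_intros)
  qed (use assms in auto)
  then have "(\<integral>\<^sup>+s. ennreal (s powr - b) * indicator {a..c} s \<partial>lborel) = ennreal ((c powr (1 - b) - a powr (1 - b)) / (1 - b))"
    by (subst nn_integral_has_integral_lebesgue') (auto simp: diff_divide_distrib)
  moreover have "(\<integral>\<^sup>+s\<in>{a..c}. ennreal (s powr - b) \<partial>lborel) = (\<integral>\<^sup>+s\<in>{a<..c}. ennreal (s powr - b) \<partial>lborel)"
    using AE_lborel_singleton[of a]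
    by (intro nn_integral_cong_AE) (auto simp: indicator_def elim!: eventually_mono)
  ultimately show ?thesis by simp
qed

lemma nn_integral_exp_atLeast:
  fixes a d :: real
  assumes "d > 0"
  shows "(\<integral>\<^sup>+s\<in>{a..}. ennreal (exp (- d * s)) \<partial>lborel) = ennreal (exp (- d * a) / d)"
proof -
  have "(\<integral>\<^sup>+s. ennreal (exp (- d * s)) * indicator {a..} s \<partial>lborel) = ennreal (0 - (- exp (- d * a) / d))"
  proof (rule nn_integral_FTC_atLeast)
    show "((\<lambda>s. - exp (- d * s) / d) \<longlongrightarrow> 0) at_top"
      using assms by real_asymp
  qed (use assms in \<open>auto intro!: derivative_eq_intros\<close>)
  then show ?thesis by simp
qed

section \<open>The reduced variational problem: growth bound, compactness, convergence of
  \<open>J\<close>\<close>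

locale mt_class =
  fixes k :: nat and b :: real
  assumes k: "1 \<le> k" and b0: "0 \<le> b" and b1: "b < 1"
begin

definition kap :: real where "kap = real k * (1 - b)"

definition gam :: real where "gam = (real k + 1) / kap"

text \<open>Up to a constant, the radial energy in the variable s = - 2 k ln r. The factor r^(n-k)
  of the norm disappears in the substitution exactly because n = 2 k.\<close>

definition energy :: "real set \<Rightarrow> (real \<Rightarrow> real) \<Rightarrow> ennreal" where
  "energy A g = (\<integral>\<^sup>+s\<in>A. ennreal (g s ^ Suc k * s powr (b * real k)) \<partial>lborel)"

text \<open>The budget (1 - b)^k is what the condition norm \<le> 1 becomes; with it the growth
  bound for \<open>prim g\<close> has constant 1.\<close>

definition cls :: "(real \<Rightarrow> real) \<Rightarrow> bool" where
  "cls g \<longleftrightarrow> decr g \<and> energy {0<..} g \<le> ennreal ((1 - b) ^ k)"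

definition J :: "(real \<Rightarrow> real) \<Rightarrow> ennreal" where
  "J g = (\<integral>\<^sup>+s\<in>{0<..}. ennreal (exp (prim g s powr gam - s)) \<partial>lborel)"

lemma kap_pos: "0 < kap" and gam_pos: "0 < gam" and gam_gt1: "1 < gam"
proof -
  show 1: "0 < kap" using k b1 by (simp add: kap_def)
  then show "0 < gam" by (simp add: gam_def add_pos_nonneg)
  have "kap \<le> real k" using b0 k by (simp add: kap_def mult_left_le)
  then show "1 < gam" using 1 by (simp add: gam_def)
qed

lemma energy_mono: "A \<subseteq> B \<Longrightarrow> energy A g \<le> energy B g"
  unfolding energy_def by (intro nn_integral_mono) (auto simp: indicator_def)

lemma energy_Ioc_add:
  assumes "decr g" "0 \<le> a" "a \<le> c"
  shows "energy {0<..a} g + energy {a<..c} g \<le> energy {0<..} g"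
proof -
  have [measurable]: "g \<in> borel_measurable borel" by (rule decr_borel_measurable[OF assms(1)])
  have "energy {0<..a} g + energy {a<..c} g = energy {0<..c} g"
    unfolding energy_def using assms
    by (subst nn_integral_add[symmetric]) (auto intro!: nn_integral_cong simp: indicator_def)
  also have "\<dots> \<le> energy {0<..} g" by (rule energy_mono) auto
  finally show ?thesis .
qed

text \<open>Hoelder with \<omega> = s powr (- b), the weight for which g^(k+1) / \<omega>^k is the
  energy density.\<close>

lemma nn_integral_growth:
  assumes g: "decr g" and a: "0 \<le> a" "a < c" and e: "e \<ge> 0" and E: "energy {a<..c} g \<le> ennreal ((1 - b) ^ k * e)"
  shows "(\<integral>\<^sup>+s\<in>{a<..c}. ennreal (g s) \<partial>lborel) \<le> ennreal (root (Suc k) (e * (c powr (1 - b) - a powr (1 - b)) ^ k))"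
proof -
  have [measurable]: "g \<in> borel_measurable borel" by (rule decr_borel_measurable[OF g])
  let ?X = "(c powr (1 - b) - a powr (1 - b)) / (1 - b)"
  have X: "?X > 0" using a b1 by (simp add: powr_less_mono2)
  have "(\<integral>\<^sup>+s\<in>{a<..c}. ennreal (g s) \<partial>lborel) \<le> ennreal (root (Suc k) (((1 - b) ^ k * e) * ?X ^ k))"
  proof (rule nn_integral_power_mean)
    show "(\<integral>\<^sup>+s\<in>{a<..c}. ennreal (s powr - b) \<partial>lborel) \<le> ennreal ?X"
      using a b0 b1 by (subst nn_integral_powr_Ioc) auto
    have "(\<integral>\<^sup>+s\<in>{a<..c}. ennreal (g s ^ Suc k / (s powr - b) ^ k) \<partial>lborel) = energy {a<..c} g"
      unfolding energy_def
    proof (intro nn_integral_cong)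
      fix s
      show "ennreal (g s ^ Suc k / (s powr - b) ^ k) * indicator {a<..c} s = ennreal (g s ^ Suc k * s powr (b * real k)) * indicator {a<..c} s"
      proof (cases "s > 0")
        case True
        then have "(s powr - b) ^ k = s powr - (b * real k)" by (simp add: powr_power mult.commute)
        then show ?thesis by (simp add: powr_minus field_simps)
      qed (use a in \<open>auto simp: indicator_def\<close>)
    qed
    then show "(\<integral>\<^sup>+s\<in>{a<..c}. ennreal (g s ^ Suc k / (s powr - b) ^ k) \<partial>lborel) \<le> ennreal ((1 - b) ^ k * e)"
      using E by simp
  qed (use a X b1 e decrD(2)[OF g] in auto)
  also have "((1 - b) ^ k * e) * ?X ^ k = e * (c powr (1 - b) - a powr (1 - b)) ^ k"
    using b1 by (simp add: power_divide)
  finally show ?thesis .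
qed

lemma decr_int_energy:
  assumes g: "decr g" and E: "energy {0<..} g < \<infinity>"
  shows "decr_int g"
proof (rule decr_intI[OF g])
  fix s :: real assume s: "s > 0"
  define e where "e = enn2real (energy {0<..s} g) / (1 - b) ^ k"
  have fin: "energy {0<..s} g < \<infinity>" by (rule le_less_trans[OF energy_mono E]) auto
  have "(\<integral>\<^sup>+t\<in>{0<..s}. ennreal (g t) \<partial>lborel) \<le> ennreal (root (Suc k) (e * (s powr (1 - b) - 0 powr (1 - b)) ^ k))"
    using g s fin b1 unfolding e_def by (intro nn_integral_growth) (auto simp: less_top)
  then show "(\<integral>\<^sup>+t\<in>{0<..s}. ennreal (g t) \<partial>lborel) < \<infinity>"
    using ennreal_less_top le_less_trans unfolding infinity_ennreal_def by blast
qed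

lemma prim_growth:
  assumes g: "decr_int g" and a: "0 \<le> a" "a \<le> c" and e: "e \<ge> 0" and E: "energy {a<..c} g \<le> ennreal ((1 - b) ^ k * e)"
  shows "(prim g c - prim g a) ^ Suc k \<le> e * (c powr (1 - b) - a powr (1 - b)) ^ k"
proof (cases "a = c")
  case False
  let ?D = "c powr (1 - b) - a powr (1 - b)"
  have D: "?D \<ge> 0" using a b1 by (simp add: powr_mono2)
  have "ennreal (prim g c - prim g a) \<le> ennreal (root (Suc k) (e * ?D ^ k))"
    unfolding prim_diff_nn_Ioc[OF g a] using False a e E decr_intD(1)[OF g] by (intro nn_integral_growth) auto
  then have "prim g c - prim g a \<le> root (Suc k) (e * ?D ^ k)"
    using e D by (subst (asm) ennreal_le_iff) auto
  then have "(prim g c - prim g a) ^ Suc k \<le> root (Suc k) (e * ?D ^ k) ^ Suc k"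
    using prim_mono[OF g a] by (intro power_mono) auto
  also have "\<dots> = e * ?D ^ k" using e D by (intro real_root_pow_pos2) auto
  finally show ?thesis .
qed (use e in simp)

lemma clsD:
  assumes "cls g"
  shows "decr g" "energy {0<..} g \<le> ennreal ((1 - b) ^ k)" "decr_int g"
proof -
  show 1: "decr g" and 2: "energy {0<..} g \<le> ennreal ((1 - b) ^ k)"
    using assms by (auto simp: cls_def)
  show "decr_int g" by (rule decr_int_energy[OF 1 le_less_trans[OF 2]]) simp
qed

lemma powr_one_minus_power: "s \<ge> 0 \<Longrightarrow> (s powr (1 - b)) ^ k = s powr kap"
  using k by (cases "s = 0") (simp_all add: powr_power kap_def mult.commute)

lemma power_le_powr:
  assumes "0 \<le> y" "0 \<le> s" "0 \<le> e" "y ^ Suc k \<le> e * s powr kap"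
  shows "y \<le> e powr (1 / (real k + 1)) * s powr (1 / gam)" "y powr gam \<le> e powr (1 / kap) * s"
proof -
  have y: "y = (y ^ Suc k) powr (1 / (real k + 1))"
  proof (cases "y = 0")
    case False
    have "y ^ Suc k = y powr (real k + 1)"
      using powr_realpow[of y "Suc k"] assms(1) False by (simp add: add.commute)
    then show ?thesis using assms(1) False by (simp add: powr_powr add_nonneg_eq_0_iff del: power_Suc)
  qed simp
  also have "\<dots> \<le> (e * s powr kap) powr (1 / (real k + 1))"
    using assms by (intro powr_mono2) auto
  also have "\<dots> = e powr (1 / (real k + 1)) * s powr (1 / gam)"
    using assms kap_pos by (simp add: powr_mult powr_powr gam_def)
  finally show le: "y \<le> e powr (1 / (real k + 1)) * s powr (1 / gam)" .
  have "y powr gam \<le> (e powr (1 / (real k + 1)) * s powr (1 / gam)) powr gam"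
    using le assms gam_pos by (intro powr_mono2) auto
  also have "\<dots> = e powr (1 / kap) * s"
    using assms gam_pos kap_pos by (simp add: powr_mult powr_powr) (simp add: gam_def)
  finally show "y powr gam \<le> e powr (1 / kap) * s" .
qed

text \<open>Growth from 0 with the whole budget. The third form says that the exponent in
  \<open>J\<close> is never positive.\<close>

lemma prim_le:
  assumes g: "cls g" and s: "0 \<le> s"
  shows "prim g s ^ Suc k \<le> s powr kap" "prim g s \<le> s powr (1 / gam)" "prim g s powr gam \<le> s"
proof -
  have "energy {0<..s} g \<le> ennreal ((1 - b) ^ k * 1)"
    by (simp, intro order_trans[OF energy_mono clsD(2)[OF g]]) auto
  from prim_growth[OF clsD(3)[OF g] _ s _ this] 
  show 1: "prim g s ^ Suc k \<le> s powr kap" using s powr_one_minus_power by simp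
  show "prim g s \<le> s powr (1 / gam)" "prim g s powr gam \<le> s"
    using power_le_powr[of "prim g s" s 1] 1 s prim_nonneg[OF clsD(3)[OF g] s] by auto
qed

lemma energy_Fatou:
  assumes g: "\<And>m. decr (g m)" "decr g'" and conv: "AE s in lborel. 0 < s \<longrightarrow> (\<lambda>m. g m s) \<longlonglongrightarrow> g' s"
    and M: "\<And>m. energy {0<..} (g m) \<le> M"
  shows "energy {0<..} g' \<le> M"
proof -
  have [measurable]: "g m \<in> borel_measurable borel" "g' \<in> borel_measurable borel" for m
    using g by (auto intro: decr_borel_measurable)
  have "energy {0<..} g' = (\<integral>\<^sup>+s. liminf (\<lambda>m. ennreal (g m s ^ Suc k * s powr (b * real k)) * indicator {0<..} s) \<partial>lborel)"
    unfolding energy_def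
  proof (rule nn_integral_cong_AE)
    show "AE s in lborel. ennreal (g' s ^ Suc k * s powr (b * real k)) * indicator {0<..} s =
        liminf (\<lambda>m. ennreal (g m s ^ Suc k * s powr (b * real k)) * indicator {0<..} s)"
      using conv
    proof eventually_elim
      case (elim s)
      show ?case
      proof (cases "s > 0")
        case True
        then have "(\<lambda>m. ennreal (g m s ^ Suc k * s powr (b * real k)) * indicator {0<..} s) \<longlonglongrightarrow> ennreal (g' s ^ Suc k * s powr (b * real k)) * indicator {0<..} s"
          using elim by (auto intro!: tendsto_intros)
        then show ?thesis by (simp add: lim_imp_Liminf)
      qed (simp add: Liminf_const)
    qed
  qed
  also have "\<dots> \<le> liminf (\<lambda>m. energy {0<..} (g m))"
    unfolding energy_def by (intro nn_integral_liminf) auto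
  also have "\<dots> \<le> M" using M by (intro Liminf_le) (auto intro: always_eventually)
  finally show ?thesis .
qed

text \<open>Helly's selection principle along the positive rationals. The energy bound alone
  supplies the pointwise majorant \<open>B\<close>, which is integrable at 0 because gam > 1; hence
  no mass is lost at 0 and the primitives converge as well.\<close>

lemma helly:
  fixes g :: "nat \<Rightarrow> real \<Rightarrow> real"
  assumes g: "\<And>m. decr (g m)" and M: "\<And>m. energy {0<..} (g m) \<le> ennreal M" and M0: "M \<ge> 0"
  obtains r g' where "strict_mono r" "decr_int g'" "energy {0<..} g' \<le> ennreal M"
    "\<And>s. 0 \<le> s \<Longrightarrow> (\<lambda>m. prim (g (r m)) s) \<longlonglongrightarrow> prim g' s"
proof -
  have gi: "decr_int (g m)" for m
    using g[of m] by (rule decr_int_energy) (rule le_less_trans[OF M], simp)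
  have [measurable]: "g m \<in> borel_measurable borel" for m using g by (rule decr_borel_measurable)
  define e where "e = M / (1 - b) ^ k"
  have e: "e \<ge> 0" "(1 - b) ^ k * e = M" using M0 b1 by (auto simp: e_def)
  \<comment> \<open>Monotonicity gives s * g s \<le> prim g s, and the primitive is at most a
    constant times s powr (1 / gam); \<open>B\<close> is the quotient by s.\<close>
  define B where "B s = e powr (1 / (real k + 1)) * s powr (- (1 - 1 / gam))" for s
  have gB: "g m s \<le> B s" if s: "s > 0" for m s
  proof -
    have "energy {0<..s} (g m) \<le> ennreal ((1 - b) ^ k * e)"
      unfolding e(2) by (rule order_trans[OF energy_mono M]) auto
    then have "prim (g m) s ^ Suc k \<le> e * s powr kap"
      using prim_growth[OF gi, of 0 s e m] s e powr_one_minus_power by simp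
    then have "prim (g m) s \<le> e powr (1 / (real k + 1)) * s powr (1 / gam)"
      using s e prim_nonneg[OF gi, of s m] by (intro power_le_powr) auto
    moreover have "s * B s = e powr (1 / (real k + 1)) * s powr (1 / gam)"
      using s by (simp add: B_def mult.left_commute powr_mult_base)
    ultimately have "s * g m s \<le> s * B s"
      using prim_ge[OF gi s, of m] by linarith
    then show ?thesis using s by simp
  qed
  define q where "q = from_nat_into {x \<in> \<rat>. 0 < (x :: real)}"
  have count: "countable {x \<in> \<rat>. 0 < (x :: real)}" by (rule countable_subset[OF _ countable_rat]) auto
  have "(1 :: real) \<in> {x \<in> \<rat>. 0 < x}" by simp
  then have range_q: "range q = {x \<in> \<rat>. 0 < x}"
    unfolding q_def using count by (intro range_from_nat_into) blast+
  have q0: "q n > 0" for n using range_q by auto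
  interpret subseqs "\<lambda>n s. convergent (\<lambda>m. g (s m) (q n))"
  proof
    fix n :: nat and s :: "nat \<Rightarrow> nat" assume "strict_mono s"
    have "compact {0..B (q n)}" by simp
    then have "seq_compact {0..B (q n)}" by (simp add: compact_eq_seq_compact_metric)
    moreover have "\<forall>m. g (s m) (q n) \<in> {0..B (q n)}" using gB[OF q0] decrD(2)[OF g] by auto
    ultimately obtain l r where "strict_mono r" "((\<lambda>m. g (s m) (q n)) \<circ> r) \<longlonglongrightarrow> l"
      using seq_compactE by metis
    then show "\<exists>r'. strict_mono r' \<and> convergent (\<lambda>m. g ((s \<circ> r') m) (q n))"
      by (auto simp: convergent_def o_def)
  qed
  define r where "r = diagseq"
  have r: "strict_mono r" unfolding r_def by (rule subseq_diagseq)
  have conv: "convergent (\<lambda>m. g (r m) (q n))" for n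
  proof -
    have "convergent (\<lambda>m. g ((diagseq \<circ> (+) (Suc n)) m) (q n))"
    proof (rule diagseq_holds)
      fix r s :: "nat \<Rightarrow> nat" and n
      assume "strict_mono r" "convergent (\<lambda>m. g (s m) (q n))"
      then show "convergent (\<lambda>m. g ((s \<circ> r) m) (q n))"
        using convergent_subseq_convergent[of "\<lambda>m. g (s m) (q n)" r] by (simp add: o_def)
    qed
    then have "convergent (\<lambda>m. g (r (m + Suc n)) (q n))" by (simp add: r_def add.commute)
    then show ?thesis
      by (subst (asm) convergent_ignore_initial_segment[of "\<lambda>m. g (r m) (q n)"])
  qed
  define G where "G x = lim (\<lambda>m. g (r m) x)" for x
  have G: "(\<lambda>m. g (r m) x) \<longlonglongrightarrow> G x" if "x \<in> \<rat>" "x > 0" for x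
  proof -
    have "x \<in> range q" unfolding range_q using that by simp
    then obtain n where "x = q n" by (rule rangeE)
    then show ?thesis using conv[of n] unfolding G_def convergent_LIMSEQ_iff by simp
  qed
  have Gmono: "G y \<le> G x" if "x \<in> \<rat>" "y \<in> \<rat>" "0 < x" "x \<le> y" for x y
    using LIMSEQ_le[OF G[of y] G[of x]] decrD(1)[OF g] that by auto
  have G0: "0 \<le> G x" if "x \<in> \<rat>" "0 < x" for x
    using LIMSEQ_le_const[OF G[OF that]] decrD(2)[OF g] by auto
  define Q where "Q s = {x \<in> \<rat>. 0 < x \<and> x < (s :: real)}" for s
  have Qne: "Q s \<noteq> {}" if "s > 0" for s
    using Rats_dense_in_real[OF that] by (auto simp: Q_def)
  \<comment> \<open>Taking the infimum of the rational limits to the left of s gives a nonincreasing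
    function; it is the limit of the sequence wherever it is continuous, hence off a countable
    set.\<close>
  define g' where "g' s = (if s \<le> 0 then 0 else Inf (G ` Q s))" for s
  have bdd: "bdd_below (G ` Q s)" for s
    using G0 by (intro bdd_belowI[of _ 0]) (auto simp: Q_def)
  have g': "decr g'"
    unfolding decr_def
  proof (intro conjI allI impI)
    fix s t :: real assume "0 < s" "s \<le> t"
    then show "g' t \<le> g' s"
      unfolding g'_def using Qne[of s] bdd by (auto intro!: cInf_superset_mono simp: Q_def)
  next
    fix s :: real show "0 \<le> g' s"
      unfolding g'_def using Qne[of s] G0 by (auto intro!: cInf_greatest simp: Q_def)
  qed (simp add: g'_def)
  have lower: "g' t \<le> G x" if "x \<in> \<rat>" "0 < x" "x < t" for x t
    unfolding g'_def using that bdd by (auto intro!: cInf_lower simp: Q_def)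
  have pt: "(\<lambda>m. g (r m) s) \<longlonglongrightarrow> g' s" if s: "s > 0" "isCont g' s" for s
  proof (rule LIMSEQ_I)
    fix \<epsilon> :: real assume \<epsilon>: "\<epsilon> > 0"
    have "Inf (G ` Q s) < g' s + \<epsilon>" using s \<epsilon> by (simp add: g'_def)
    then obtain x where x: "x \<in> Q s" "G x < g' s + \<epsilon>"
      using cInf_lessD[of "G ` Q s"] Qne[OF s(1)] by auto
    obtain d where d: "d > 0" "\<And>t. \<bar>t - s\<bar> < d \<Longrightarrow> \<bar>g' t - g' s\<bar> < \<epsilon>"
      using s(2) \<epsilon> unfolding continuous_at_eps_delta real_norm_def dist_real_def by metis
    obtain y where y: "y \<in> \<rat>" "s < y" "y < s + d / 2" using Rats_dense_in_real[of s "s + d / 2"] d by auto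
    have "g' (s + d / 2) \<le> G y" using y s by (intro lower) auto
    moreover have "\<bar>g' (s + d / 2) - g' s\<bar> < \<epsilon>" using d by auto
    ultimately have Gy: "G y > g' s - \<epsilon>" by linarith
    have "\<forall>\<^sub>F m in sequentially. g (r m) x < g' s + \<epsilon>"
      using G[of x] x by (intro order_tendstoD) (auto simp: Q_def)
    moreover have "\<forall>\<^sub>F m in sequentially. g (r m) y > g' s - \<epsilon>"
      using G[of y] y s Gy by (intro order_tendstoD) auto
    ultimately have "\<forall>\<^sub>F m in sequentially. norm (g (r m) s - g' s) < \<epsilon>"
    proof eventually_elim
      case (elim m)
      have "g (r m) s \<le> g (r m) x" "g (r m) y \<le> g (r m) s"
        using decrD(1)[OF g, of x s "r m"] decrD(1)[OF g, of s y "r m"] x y s by (auto simp: Q_def)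
      then show ?case using elim by auto
    qed
    then show "\<exists>no. \<forall>n\<ge>no. norm (g (r n) s - g' s) < \<epsilon>" by (simp add: eventually_sequentially)
  qed
  have AEconv: "AE s in lborel. 0 < s \<longrightarrow> (\<lambda>m. g (r m) s) \<longlonglongrightarrow> g' s"
    using decr_AE_isCont[OF g'] by eventually_elim (use pt in auto)
  have E': "energy {0<..} g' \<le> ennreal M"
    by (rule energy_Fatou[of "\<lambda>m. g (r m)"]) (use g g' AEconv M in auto)
  have gi': "decr_int g'"
    using g' by (rule decr_int_energy) (rule le_less_trans[OF E'], simp)
  have [measurable]: "g' \<in> borel_measurable borel" using g' by (rule decr_borel_measurable)
  have "(\<lambda>m. prim (g (r m)) s) \<longlonglongrightarrow> prim g' s" if s: "0 \<le> s" for s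
  proof -
    have "(\<lambda>m. \<integral>\<^sup>+t\<in>{0<..s}. ennreal (g (r m) t) \<partial>lborel) \<longlonglongrightarrow> (\<integral>\<^sup>+t\<in>{0<..s}. ennreal (g' t) \<partial>lborel)"
    proof (rule nn_integral_dominated_convergence)
      show "(\<integral>\<^sup>+t. ennreal (B t) * indicator {0<..s} t \<partial>lborel) < \<infinity>"
      proof -
        have "(\<integral>\<^sup>+t. ennreal (B t) * indicator {0<..s} t \<partial>lborel) =
            (\<integral>\<^sup>+t. ennreal (e powr (1 / (real k + 1))) * (ennreal (t powr (- (1 - 1 / gam))) * indicator {0<..s} t) \<partial>lborel)"
          unfolding B_def by (intro nn_integral_cong) (simp add: ennreal_mult' mult.assoc)
        also have "\<dots> = ennreal (e powr (1 / (real k + 1))) * (\<integral>\<^sup>+t\<in>{0<..s}. ennreal (t powr (- (1 - 1 / gam))) \<partial>lborel)"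
          by (rule nn_integral_cmult) auto
        also have "\<dots> < \<infinity>"
          using gam_gt1 s by (subst nn_integral_powr_Ioc) (auto simp: ennreal_mult_less_top)
        finally show ?thesis .
      qed
      show "AE t in lborel. ennreal (g (r m) t) * indicator {0<..s} t \<le> ennreal (B t) * indicator {0<..s} t" for m
        using gB by (auto simp: indicator_def intro!: ennreal_leI)
      show "AE t in lborel. (\<lambda>m. ennreal (g (r m) t) * indicator {0<..s} t) \<longlonglongrightarrow> ennreal (g' t) * indicator {0<..s} t"
        using AEconv by eventually_elim (auto simp: indicator_def)
    qed (auto simp: B_def)
    then have "(\<lambda>m. ennreal (prim (g (r m)) s)) \<longlonglongrightarrow> ennreal (prim g' s)"
      using prim_diff_nn_Ioc[OF gi order_refl s] prim_diff_nn_Ioc[OF gi' order_refl s] by simp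
    then show ?thesis
      using prim_nonneg[OF gi s] prim_nonneg[OF gi' s] by (subst (asm) tendsto_ennreal_iff) auto
  qed
  then show ?thesis using that[OF r gi' E'] by blast
qed

text \<open>A positive value of the limit at \<open>s1\<close> forces a fixed share of the budget to
  be spent on {0<..s1}. What remains allows growth only with a factor \<theta> < 1, so from some
  point on the exponent is at most - d * s for all late members of the sequence, and dominated
  convergence applies.\<close>

lemma J_convergent:
  assumes g: "\<And>m. cls (g m)" and g': "cls g'"
    and conv: "\<And>s. 0 \<le> s \<Longrightarrow> (\<lambda>m. prim (g m) s) \<longlonglongrightarrow> prim g' s"
    and pos: "0 < s1" "0 < prim g' s1"
  shows "(\<lambda>m. J (g m)) \<longlonglongrightarrow> J g'"
proof -
  define \<eta> where "\<eta> = prim g' s1 / 2"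
  have \<eta>: "\<eta> > 0" "\<eta> < prim g' s1" using pos by (auto simp: \<eta>_def)
  obtain M where M: "\<And>m. m \<ge> M \<Longrightarrow> \<eta> < prim (g m) s1"
    using order_tendstoD(1)[OF conv \<eta>(2)] pos by (auto simp: eventually_sequentially)
  \<comment> \<open>The least share of the budget with which the growth bound permits height \<eta>
    at \<open>s1\<close>.\<close>
  define e0 where "e0 = \<eta> ^ Suc k / s1 powr kap"
  have e0: "e0 > 0" using \<eta> pos by (simp add: e0_def)
  have "\<eta> ^ Suc k \<le> s1 powr kap"
    using power_mono[of \<eta> "prim g' s1" "Suc k"] prim_le(1)[OF g', of s1] \<eta> pos by linarith
  then have e01: "e0 \<le> 1" using pos by (simp add: e0_def)
  define \<theta> where "\<theta> = (1 - e0) powr (1 / (real k + 1))"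
  have \<theta>: "0 \<le> \<theta>" "\<theta> < 1"
    using e0 e01 powr_less_mono2[of "1 / (real k + 1)" "1 - e0" 1] by (auto simp: \<theta>_def)
  have tail: "prim (g m) s \<le> s1 powr (1 / gam) + \<theta> * s powr (1 / gam)" if m: "m \<ge> M" and s: "s \<ge> s1" for m s
  proof -
    note gm = clsD[OF g[of m]]
    define em where "em = enn2real (energy {0<..s1} (g m)) / (1 - b) ^ k"
    have fin: "energy {0<..s1} (g m) < top"
      by (rule le_less_trans[OF order_trans[OF energy_mono gm(2)]]) auto
    have em: "em \<ge> 0" "energy {0<..s1} (g m) = ennreal ((1 - b) ^ k * em)"
      using fin b1 by (auto simp: em_def less_top)
    have "prim (g m) s1 ^ Suc k \<le> em * s1 powr kap"
      using prim_growth[OF gm(3), of 0 s1 em] em pos powr_one_minus_power[of s1] by simp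
    moreover have "\<eta> ^ Suc k \<le> prim (g m) s1 ^ Suc k"
      using M[OF m] \<eta> by (intro power_mono) auto
    ultimately have "e0 \<le> em" using pos by (simp add: e0_def pos_divide_le_eq)
    have "ennreal ((1 - b) ^ k * e0) + energy {s1<..s} (g m) \<le> ennreal ((1 - b) ^ k)"
    proof -
      have "ennreal ((1 - b) ^ k * e0) + energy {s1<..s} (g m) \<le> energy {0<..s1} (g m) + energy {s1<..s} (g m)"
        unfolding em(2) using \<open>e0 \<le> em\<close> b1 by (intro add_right_mono ennreal_leI mult_left_mono) auto
      also have "\<dots> \<le> energy {0<..} (g m)" using gm(1) pos s by (intro energy_Ioc_add) auto
      finally show ?thesis using gm(2) by simp
    qed
    then have "energy {s1<..s} (g m) \<le> ennreal ((1 - b) ^ k) - ennreal ((1 - b) ^ k * e0)"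
      by (simp add: ennreal_le_minus_iff add.commute)
    also have "\<dots> = ennreal ((1 - b) ^ k * (1 - e0))"
      using e0 b1 by (subst ennreal_minus) (auto simp: algebra_simps)
    finally have "(prim (g m) s - prim (g m) s1) ^ Suc k \<le> (1 - e0) * (s powr (1 - b) - s1 powr (1 - b)) ^ k"
      using gm(3) pos s e01 by (intro prim_growth) auto
    also have "\<dots> \<le> (1 - e0) * (s powr (1 - b)) ^ k"
      using e01 pos s b1 by (intro mult_left_mono power_mono) (auto intro: powr_mono2)
    also have "(s powr (1 - b)) ^ k = s powr kap" using pos s by (intro powr_one_minus_power) auto
    finally have "prim (g m) s - prim (g m) s1 \<le> \<theta> * s powr (1 / gam)"
      unfolding \<theta>_def using prim_mono[OF gm(3), of s1 s] pos s e01 by (intro power_le_powr) auto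
    moreover have "prim (g m) s1 \<le> s1 powr (1 / gam)" using prim_le(2)[OF g] pos by simp
    ultimately show ?thesis by simp
  qed
  \<comment> \<open>The midpoint between \<theta> and 1 leaves room to absorb the additive constant
    s1 powr (1 / gam) once s \<ge> \<open>S\<close>.\<close>
  define \<theta>' where "\<theta>' = (1 + \<theta>) / 2"
  have \<theta>': "0 < \<theta>'" "\<theta>' < 1" "\<theta> < \<theta>'" using \<theta> by (auto simp: \<theta>'_def)
  define S where "S = max s1 ((s1 powr (1 / gam) / (\<theta>' - \<theta>)) powr gam)"
  define d where "d = 1 - \<theta>' powr gam"
  have d: "d > 0" using \<theta>' gam_pos powr_less_mono2[of gam \<theta>' 1] by (simp add: d_def)
  have far: "prim (g m) s powr gam - s \<le> - d * s" if m: "m \<ge> M" and s: "s \<ge> S" for m s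
  proof -
    have s1: "s \<ge> s1" "s > 0" using s pos by (auto simp: S_def)
    have "s1 powr (1 / gam) / (\<theta>' - \<theta>) = ((s1 powr (1 / gam) / (\<theta>' - \<theta>)) powr gam) powr (1 / gam)"
      using gam_pos \<theta>' by (simp add: powr_powr)
    also have "\<dots> \<le> s powr (1 / gam)" using s gam_pos by (intro powr_mono2) (auto simp: S_def)
    finally have "s1 powr (1 / gam) \<le> (\<theta>' - \<theta>) * s powr (1 / gam)"
      using \<theta>' by (simp add: pos_divide_le_eq mult.commute)
    then have "prim (g m) s \<le> \<theta>' * s powr (1 / gam)"
      using tail[OF m s1(1)] by (simp add: algebra_simps)
    then have "prim (g m) s powr gam \<le> (\<theta>' * s powr (1 / gam)) powr gam"
      using gam_pos prim_nonneg[OF clsD(3)[OF g], of s m] s1 by (intro powr_mono2) auto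
    also have "\<dots> = \<theta>' powr gam * s" using \<theta>' s1 gam_pos by (simp add: powr_mult powr_powr)
    finally show ?thesis by (simp add: d_def algebra_simps)
  qed
  have [measurable]: "(\<lambda>s. prim h s * indicator {0<..} s) \<in> borel_measurable borel" if "cls h" for h
  proof -
    have "continuous_on {0<..} (prim h)" by (rule continuous_on_subset[OF prim_continuous_on[OF clsD(3)[OF that]]]) auto
    then have "(\<lambda>s. indicator {0<..} s *\<^sub>R prim h s) \<in> borel_measurable borel"
      by (intro borel_measurable_continuous_on_indicator) auto
    then show ?thesis by (simp add: mult.commute)
  qed
  \<comment> \<open>Measurability of \<open>prim h\<close> is obtained from continuity on {0<..}
    only; the indicator inside the exponent changes nothing there.\<close>
  have ind: "ennreal (exp (prim h s powr gam - s)) * indicator {0<..} s =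
      ennreal (exp ((prim h s * indicator {0<..} s) powr gam - s)) * indicator {0<..} s" for h s
    by (auto simp: indicator_def)
  have "(\<lambda>m. J (g (m + M))) \<longlonglongrightarrow> J g'"
    unfolding J_def
  proof (rule nn_integral_dominated_convergence)
    show "(\<integral>\<^sup>+s. ennreal (exp (d * S)) * (ennreal (exp (- d * s)) * indicator {0..} s) \<partial>lborel) < \<infinity>"
      using nn_integral_exp_atLeast[OF d, of 0] by (subst nn_integral_cmult) (auto simp: ennreal_mult_less_top)
    show "AE s in lborel. ennreal (exp (prim (g (m + M)) s powr gam - s)) * indicator {0<..} s
        \<le> ennreal (exp (d * S)) * (ennreal (exp (- d * s)) * indicator {0..} s)" for m
    proof (rule AE_I2)
      fix s
      show "ennreal (exp (prim (g (m + M)) s powr gam - s)) * indicator {0<..} s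
        \<le> ennreal (exp (d * S)) * (ennreal (exp (- d * s)) * indicator {0..} s)"
      proof (cases "s > 0")
        case True
        have "prim (g (m + M)) s powr gam - s \<le> d * S + - d * s"
        proof (cases "s \<ge> S")
          case True
          have "0 \<le> d * S" using d pos by (simp add: S_def)
          then show ?thesis using far[OF _ True, of "m + M"] by simp
        next
          case False
          then have "d * s \<le> d * S" using d by (intro mult_left_mono) auto
          then show ?thesis using prim_le(3)[OF g, of s "m + M"] \<open>s > 0\<close> by simp
        qed
        then have "ennreal (exp (prim (g (m + M)) s powr gam - s)) \<le> ennreal (exp (d * S) * exp (- d * s))"
          unfolding exp_add[symmetric] by (intro ennreal_leI) simp
        then show ?thesis using True by (simp add: ennreal_mult)
      qed simp
    qed
    show "AE s in lborel. (\<lambda>m. ennreal (exp (prim (g (m + M)) s powr gam - s)) * indicator {0<..} s)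
        \<longlonglongrightarrow> ennreal (exp (prim g' s powr gam - s)) * indicator {0<..} s"
    proof (rule AE_I2)
      fix s
      show "(\<lambda>m. ennreal (exp (prim (g (m + M)) s powr gam - s)) * indicator {0<..} s)
        \<longlonglongrightarrow> ennreal (exp (prim g' s powr gam - s)) * indicator {0<..} s"
      proof (cases "s > 0")
        case True
        have "(\<lambda>m. prim (g (m + M)) s) \<longlonglongrightarrow> prim g' s"
          using conv[of s] True by (intro LIMSEQ_ignore_initial_segment) auto
        then have "(\<lambda>m. prim (g (m + M)) s powr gam) \<longlonglongrightarrow> prim g' s powr gam"
          using gam_pos prim_nonneg[OF clsD(3)[OF g]] True
          by (intro tendsto_powr2) (auto intro!: always_eventually)
        then show ?thesis using True by (auto intro!: tendsto_intros)
      qed simp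
    qed
    show "(\<lambda>s. ennreal (exp (prim (g (m + M)) s powr gam - s)) * indicator {0<..} s) \<in> borel_measurable lborel" for m
      unfolding ind using g by measurable
    show "(\<lambda>s. ennreal (exp (prim g' s powr gam - s)) * indicator {0<..} s) \<in> borel_measurable lborel"
      unfolding ind using g' by measurable
  qed auto
  then show ?thesis by (rule LIMSEQ_offset)
qed

end

section \<open>The concentration bound\<close>

text \<open>If F rose, it would still rise after subtracting a small linear term. Among the
  uncountably many intermediate values one is not taken on the countable set; at the last point
  where the value is not exceeded the derivative exists and is negative, so the point is not the
  last.\<close>

lemma nonincreasing_countable_exceptions:
  fixes F :: "real \<Rightarrow> real"
  assumes "a \<le> c" and F: "continuous_on {a..c} F" and S: "countable S"
    and D: "\<And>x. a < x \<Longrightarrow> x < c \<Longrightarrow> x \<notin> S \<Longrightarrow> \<exists>D\<le>0. (F has_real_derivative D) (at x)"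
  shows "F c \<le> F a"
proof (rule ccontr)
  assume "\<not> F c \<le> F a"
  then have lt: "F a < F c" and ac: "a < c" using \<open>a \<le> c\<close> by (auto simp: less_le)
  define \<epsilon> where "\<epsilon> = (F c - F a) / 2 / (c - a)"
  have \<epsilon>: "\<epsilon> > 0" "\<epsilon> * (c - a) < F c - F a" 
  proof -
    show "\<epsilon> > 0" using lt ac by (simp add: \<epsilon>_def)
    have "\<epsilon> * (c - a) = (F c - F a) / 2" using nonzero_eq_divide_eq[of "c - a" \<epsilon> "(F c - F a) / 2"] ac unfolding \<epsilon>_def by simp
    then show "\<epsilon> * (c - a) < F c - F a" using lt by simp
  qed
  define G where "G x = F x - \<epsilon> * (x - a)" for x
  have G: "continuous_on {a..c} G" unfolding G_def by (intro continuous_intros F)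
  have "G a < G c" using \<epsilon> by (simp add: G_def)
  then have "uncountable {G a<..<G c}" by (simp add: uncountable_open_interval)
  moreover have "countable (G ` S)" using S by simp
  ultimately have "{G a<..<G c} - G ` S \<noteq> {}" by (metis countable_empty uncountable_minus_countable)
  then obtain y where "y \<in> {G a<..<G c}" "y \<notin> G ` S" by blast
  then have y: "G a < y" "y < G c" "y \<notin> G ` S" by simp_all
  define X where "X = {a..c} \<inter> G -` {..y}"
  have "closed X" unfolding X_def using G by (intro continuous_closed_preimage) auto
  moreover have "bounded X" unfolding X_def by (rule bounded_subset[of "{a..c}"]) auto
  ultimately have "compact X" by (simp add: compact_eq_bounded_closed)
  moreover have "a \<in> X" using y ac by (simp add: X_def)
  ultimately obtain x0 where x0: "x0 \<in> X" "\<And>x. x \<in> X \<Longrightarrow> x \<le> x0"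
    using compact_attains_sup[of X] by blast
  have x0c: "a \<le> x0" "x0 \<le> c" "G x0 \<le> y" using x0(1) by (auto simp: X_def)
  have "\<exists>x\<ge>x0. x \<le> c \<and> G x = y"
    using x0c y(2) by (intro IVT') (auto intro: continuous_on_subset[OF G])
  then obtain x where "x0 \<le> x" "x \<le> c" "G x = y" by blast
  moreover then have "x = x0" using x0(2)[of x] x0c by (auto simp: X_def)
  ultimately have Gx0: "G x0 = y" by simp
  then have in_ac: "a < x0" "x0 < c" "x0 \<notin> S" using x0c y by (auto simp: less_le)
  then obtain D where "D \<le> 0" "(F has_real_derivative D) (at x0)" using D by blast
  then have "(G has_real_derivative D - \<epsilon>) (at x0)" "D - \<epsilon> < 0"
    unfolding G_def using \<epsilon> by (auto intro!: derivative_eq_intros)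
  then obtain d where d: "d > 0" "\<And>h. 0 < h \<Longrightarrow> h < d \<Longrightarrow> G (x0 + h) < G x0"
    using DERIV_neg_dec_right by metis
  define h where "h = min (d / 2) (c - x0)"
  have "0 < h" "h < d" "x0 + h \<le> c" using d in_ac by (auto simp: h_def)
  then have "x0 + h \<in> X" using d(2)[of h] Gx0 in_ac by (auto simp: X_def)
  then show False using x0(2)[of "x0 + h"] \<open>0 < h\<close> by simp
qed

lemma continuous_on_x_ln_x: "continuous_on {0..} (\<lambda>x::real. x * ln x)"
proof -
  have "((\<lambda>x::real. x * ln x) \<longlongrightarrow> 0) (at_right 0)" by real_asymp
  then have "continuous (at 0 within {0..}) (\<lambda>x::real. x * ln x)"
    unfolding continuous_within by (simp add: at_within_Ici_at_right)
  moreover have "continuous (at x within {0..}) (\<lambda>x::real. x * ln x)" if "x > 0" for x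
    using that by (intro continuous_intros) auto
  ultimately show ?thesis
    unfolding continuous_on_eq_continuous_within by (metis atLeast_iff less_eq_real_def)
qed

text \<open>In the variable R = z^k this is an antiderivative of 1 + ln (R (1 - R powr (1 / k))).
  The factor of (1 - z) ln (1 - z) is the geometric sum (1 - z^k) / (1 - z); written this way, both
  logarithms occur as x ln x and the function is continuous up to 0 and 1.\<close>

definition cc_primitive :: "nat \<Rightarrow> real \<Rightarrow> real" where
  "cc_primitive k z = z ^ k * ln (z ^ k) - (\<Sum>i<k. z ^ i) * ((1 - z) * ln (1 - z)) - (\<Sum>i=1..k. z ^ i / real i)"

lemma cc_primitive_0: "1 \<le> k \<Longrightarrow> cc_primitive k 0 = 0"
proof -
  assume "1 \<le> k"
  then have "(0::real) ^ k = 0" by simp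
  moreover have "(\<Sum>i=1..k. (0::real) ^ i / real i) = 0" by (intro sum.neutral) auto
  ultimately show ?thesis unfolding cc_primitive_def by simp
qed

text \<open>The origin of \<open>harm k\<close> in the concentration level: at 1 both x ln x terms
  vanish and the harmonic sum remains.\<close>

lemma cc_primitive_1: "cc_primitive k 1 = - harm k"
  by (simp add: cc_primitive_def harm_def divide_inverse)

lemma continuous_on_cc_primitive: "continuous_on {0..1} (cc_primitive k)"
proof -
  have "continuous_on {0..1} (\<lambda>z::real. z ^ k * ln (z ^ k))"
    by (rule continuous_on_compose2[OF continuous_on_x_ln_x, of _ "\<lambda>z. z ^ k"]) (auto intro!: continuous_intros)
  moreover have "continuous_on {0..1} (\<lambda>z::real. (1 - z) * ln (1 - z))"
    by (rule continuous_on_compose2[OF continuous_on_x_ln_x, of _ "\<lambda>z. 1 - z"]) (auto intro!: continuous_intros)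
  moreover have "continuous_on {0..1} (\<lambda>z::real. \<Sum>i<k. z ^ i)" by (intro continuous_intros)
  moreover have "continuous_on {0..1} (\<lambda>z::real. \<Sum>i=1..k. z ^ i / real i)" by (intro continuous_intros) auto
  ultimately show ?thesis
    unfolding cc_primitive_def by (intro continuous_on_diff continuous_on_mult[of _ "\<lambda>z. \<Sum>i<k. z ^ i"])
qed

lemma cc_primitive_derivative:
  assumes "1 \<le> k" "0 < z" "z < 1"
  shows "(cc_primitive k has_real_derivative real k * z ^ (k - 1) * (1 + ln (z ^ k * (1 - z)))) (at z)"
proof -
  have eq: "cc_primitive k t = t ^ k * (real k * ln t) - (1 - t ^ k) * ln (1 - t) - (\<Sum>i=1..k. t ^ i / real i)"
    if "t \<in> {0<..<1}" for t
  proof -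
    have "(\<Sum>i<k. t ^ i) * (1 - t) = 1 - t ^ k"
      using one_diff_power_eq[of t k] by (simp add: mult.commute)
    then show ?thesis using that by (simp add: cc_primitive_def ln_realpow mult.assoc[symmetric])
  qed
  have "(\<Sum>i=1..k. real i * z ^ (i - 1) / real i) = (\<Sum>i=1..k. z ^ (i - 1))"
    by (intro sum.cong) auto
  also have "\<dots> = (\<Sum>i<k. z ^ i)"
    by (rule sum.reindex_bij_witness[of _ Suc "\<lambda>i. i - 1"]) auto
  also have "\<dots> = (1 - z ^ k) / (1 - z)"
    using assms sum_gp_strict[of z k] by simp
  finally have sum: "(\<Sum>i=1..k. real i * z ^ (i - 1) / real i) = (1 - z ^ k) / (1 - z)" .
  have zk: "z ^ k = z * z ^ (k - 1)" using assms by (cases k) auto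
  have "((\<lambda>t. t ^ k * (real k * ln t) - (1 - t ^ k) * ln (1 - t) - (\<Sum>i=1..k. t ^ i / real i)) has_real_derivative
      real k * z ^ (k - 1) * (real k * ln z) + z ^ k * (real k * (1 / z)) -
       (- (real k * z ^ (k - 1)) * ln (1 - z) + (1 - z ^ k) * (- 1 / (1 - z))) - (\<Sum>i=1..k. real i * z ^ (i - 1) / real i)) (at z)"
    using assms by (auto intro!: derivative_eq_intros sum.cong)
  also have "real k * z ^ (k - 1) * (real k * ln z) + z ^ k * (real k * (1 / z)) -
       (- (real k * z ^ (k - 1)) * ln (1 - z) + (1 - z ^ k) * (- 1 / (1 - z))) - (\<Sum>i=1..k. real i * z ^ (i - 1) / real i)
     = real k * z ^ (k - 1) * (1 + (real k * ln z + ln (1 - z)))"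
  proof -
    define c where "c = (1 - z ^ k) / (1 - z)"
    have "(1 - z ^ k) * (- 1 / (1 - z)) = - c" by (simp add: c_def)
    moreover have "z ^ k * (real k * (1 / z)) = real k * z ^ (k - 1)" using zk assms by simp
    ultimately show ?thesis unfolding sum c_def[symmetric] by (simp only:) (simp add: algebra_simps)
  qed
  also have "real k * ln z + ln (1 - z) = ln (z ^ k * (1 - z))"
    using assms by (simp add: ln_mult ln_realpow)
  finally show ?thesis
    by (rule has_field_derivative_transform_within_open[of _ _ _ "{0<..<1}"]) (use assms eq in auto)
qed

text \<open>
  Gibbs' variational principle: with \<open>\<rho> = exp f / I\<close> and \<open>R s\<close> the \<open>\<rho>\<close>-mass of \<open>{s..c}\<close>, one has
  \<open>ln I - f a = \<integral> (f' R - \<rho> ln \<rho>)\<close>. Young's inequality absorbs \<open>w R\<close> into \<open>R powr (1 + 1/k)\<close> and the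
  energy \<open>Q\<close>, and \<open>1 + ln x \<le> x\<close> leaves an exact derivative of \<open>cc_primitive k (R powr (1/k))\<close>.
\<close>

lemma exponential_integral_bound:
  fixes f w Q q :: "real \<Rightarrow> real"
  assumes k: "1 \<le> k" and ac: "a < c"
    and f: "continuous_on {a..c} f" and Q: "continuous_on {a..c} Q" and S: "countable S"
    and df: "\<And>s. a < s \<Longrightarrow> s < c \<Longrightarrow> s \<notin> S \<Longrightarrow> (f has_real_derivative w s - 1) (at s)"
    and dQ: "\<And>s. a < s \<Longrightarrow> s < c \<Longrightarrow> s \<notin> S \<Longrightarrow> (Q has_real_derivative q s) (at s)"
    and w: "\<And>s. a < s \<Longrightarrow> s < c \<Longrightarrow> 0 \<le> w s"
    and q: "\<And>s. a < s \<Longrightarrow> s < c \<Longrightarrow> s \<notin> S \<Longrightarrow> (real k / (real k + 1)) ^ Suc k / real k * w s ^ Suc k \<le> q s"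
  shows "integral {a..c} (\<lambda>s. exp (f s)) \<le> exp (f a + harm k + (Q c - Q a))"
proof -
  define e where "e s = exp (f s)" for s
  have e: "continuous_on {a..c} e" unfolding e_def by (intro continuous_intros f)
  have ei: "e integrable_on {x..y}" if "a \<le> x" "y \<le> c" for x y
    by (intro integrable_continuous_real continuous_on_subset[OF e]) (use that in auto)
  have e0: "0 \<le> e s" for s by (simp add: e_def)
  have pos: "0 < integral {x..y} e" if xy: "a \<le> x" "x < y" "y \<le> c" for x y
  proof -
    have "0 \<le> integral {x..y} e" by (intro Henstock_Kurzweil_Integration.integral_nonneg ei xy) (simp add: e_def)
    moreover have "integral {x..y} e \<noteq> 0"
    proof
      assume 0: "integral {x..y} e = 0"
      have "\<forall>t\<in>{x..y}. e t = 0"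
      proof (rule integral_eq_0_iff[THEN iffD1])
        show "continuous_on {x..y} e" by (rule continuous_on_subset[OF e]) (use xy in auto)
      qed (use 0 xy e0 in auto)
      then show False using xy by (auto simp: e_def)
    qed
    ultimately show ?thesis by simp
  qed
  define I where "I = integral {a..c} e"
  have I: "I > 0" unfolding I_def using ac by (intro pos) auto
  define R where "R s = 1 - integral {a..s} e / I" for s
  have R_eq: "R s = integral {s..c} e / I" if "a \<le> s" "s \<le> c" for s
    using Henstock_Kurzweil_Integration.integral_combine[of a s c e] ei[of a c] that I
    by (simp add: R_def I_def[symmetric] field_simps)
  have Ra: "R a = 1" by (simp add: R_def)
  have Rc: "R c = 0" using R_eq[of c] ac by simp
  have R01: "0 < R s" "R s < 1" if "a < s" "s < c" for s
  proof -
    show "0 < R s" using pos[of s c] that I R_eq[of s] by simp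
    show "R s < 1" unfolding R_def using pos[of a s] that I by simp
  qed
  have Rcont: "continuous_on {a..c} R"
    unfolding R_def by (intro continuous_intros indefinite_integral_continuous_1 ei) (use I in auto)
  have R_range: "R s \<in> {0..1}" if "s \<in> {a..c}" for s
    using R01[of s] Ra Rc that by (cases "s = a"; cases "s = c") auto
  have dR: "(R has_real_derivative - (e s / I)) (at s)" if s: "a < s" "s < c" for s
  proof -
    have "((\<lambda>x. integral {a..x} e) has_real_derivative e s) (at s within {a..c})"
      using s by (intro integral_has_real_derivative e) auto
    moreover have "at s within {a..c} = at s" using s by (intro at_within_interior) auto
    ultimately show ?thesis unfolding R_def using I by (auto intro!: derivative_eq_intros)
  qed
  define z where "z s = R s powr (1 / real k)" for s
  have zcont: "continuous_on {a..c} z"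
    unfolding z_def using R_range k by (intro continuous_on_powr' Rcont continuous_on_const) auto
  have z_range: "z s \<in> {0..1}" if "s \<in> {a..c}" for s
    using R_range[OF that] powr_mono2[of "1 / real k" "R s" 1] by (auto simp: z_def)
  \<comment> \<open>Since R falls from 1 at a to 0 at c, F c is - Q c and F a is f a - ln I + harm k
    - Q a. Hence F c \<le> F a is the claim in logarithmic form.\<close>
  define F where "F s = (f s - ln I) * R s - cc_primitive k (z s) - Q s" for s
  have "F c \<le> F a"
  proof (rule nonincreasing_countable_exceptions[where S = S and F = F and a = a and c = c])
    show "countable S" by (rule S)
    show "continuous_on {a..c} F"
      unfolding F_def using z_range
      by (intro continuous_intros f Q Rcont continuous_on_compose2[OF continuous_on_cc_primitive zcont]) auto
    fix s assume s: "a < s" "s < c" "s \<notin> S"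
    note R = R01[OF s(1,2)]
    have z01: "0 < z s" "z s < 1" using R k powr_less_mono2[of "1 / real k" "R s" 1] by (auto simp: z_def)
    have zk: "z s ^ k = R s" using R k by (simp add: z_def powr_power)
    define \<rho> where "\<rho> = e s / I"
    have \<rho>: "\<rho> > 0" "ln \<rho> = f s - ln I" using I by (auto simp: \<rho>_def e_def ln_div)
    have "(z has_real_derivative 1 / real k * R s powr (1 / real k - 1) * (- \<rho>)) (at s)"
      unfolding z_def using dR[OF s(1,2)] R k
      by (auto intro!: derivative_eq_intros simp: \<rho>_def powr_diff field_simps)
    then have "((\<lambda>s. cc_primitive k (z s)) has_real_derivative
        (real k * z s ^ (k - 1) * (1 + ln (z s ^ k * (1 - z s)))) * (1 / real k * R s powr (1 / real k - 1) * (- \<rho>))) (at s)"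
      using cc_primitive_derivative[OF k z01] by (rule DERIV_chain2[rotated])
    also have "(real k * z s ^ (k - 1) * (1 + ln (z s ^ k * (1 - z s)))) * (1 / real k * R s powr (1 / real k - 1) * (- \<rho>))
      = (z s ^ (k - 1) * R s powr (1 / real k - 1)) * (- \<rho> * (1 + ln (R s * (1 - z s))))"
      unfolding zk using k by simp
    also have "z s ^ (k - 1) * R s powr (1 / real k - 1) = 1"
    proof -
      have "z s ^ (k - 1) = R s powr (real (k - 1) / real k)" using R by (simp add: z_def powr_power)
      moreover have "real (k - 1) / real k + (1 / real k - 1) = 0" using k by (simp add: field_simps of_nat_diff)
      ultimately show ?thesis using R by (simp add: powr_add[symmetric])
    qed
    finally have dL: "((\<lambda>s. cc_primitive k (z s)) has_real_derivative - \<rho> * (1 + ln (R s * (1 - z s)))) (at s)"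
      by simp
    define D where "D = (w s - 1) * R s + (f s - ln I) * (- \<rho>) - (- \<rho> * (1 + ln (R s * (1 - z s)))) - q s"
    have "(F has_real_derivative D) (at s)"
      unfolding F_def D_def \<rho>_def
      by (rule derivative_eq_intros df[OF s] dQ[OF s] dR[OF s(1,2)] dL[unfolded \<rho>_def] refl | simp add: algebra_simps)+
    moreover have "D \<le> 0"
    proof -
      \<comment> \<open>\<open>A\<close> is exactly what Young's inequality leaves over: w R - q
        \<le> R z = R - A, while the entropy term is at most \<open>A\<close>, so the two estimates
        add up to D \<le> 0.\<close>
      define A where "A = R s * (1 - z s)"
      have A: "A > 0" using R z01 by (simp add: A_def)
      define m where "m = w s * real k / (real k + 1)"
      have m: "m \<ge> 0" using w[OF s(1,2)] by (simp add: m_def)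
      have "(real k + 1) * z s ^ k * m \<le> real k * z s ^ Suc k + m ^ Suc k"
        using z01 m by (intro weighted_amgm) auto
      then have "real k * (w s * R s) \<le> real k * (R s * z s) + m ^ Suc k"
      proof -
        have "(real k + 1) * m = real k * w s" by (simp add: m_def add_nonneg_eq_0_iff)
        then have "(real k + 1) * z s ^ k * m = real k * (w s * R s)" by (simp add: zk mult_ac)
        moreover have "real k * z s ^ Suc k = real k * (R s * z s)" by (simp add: zk mult_ac)
        moreover assume "(real k + 1) * z s ^ k * m \<le> real k * z s ^ Suc k + m ^ Suc k"
        ultimately show ?thesis by (simp only:)
      qed
      then have "w s * R s \<le> R s * z s + m ^ Suc k / real k"
        using k by (simp add: field_simps)
      also have "m ^ Suc k / real k = (real k / (real k + 1)) ^ Suc k / real k * w s ^ Suc k"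
        unfolding m_def by (simp add: power_mult_distrib power_divide)
      also have "\<dots> \<le> q s" by (rule q[OF s])
      finally have 1: "w s * R s - q s \<le> R s * z s" by simp
      have "\<rho> * (1 + ln (A / \<rho>)) \<le> \<rho> * (A / \<rho>)"
        using ln_le_minus_one[of "A / \<rho>"] A \<rho> by (intro mult_left_mono) auto
      then have 2: "\<rho> * (1 + (ln A - ln \<rho>)) \<le> A" using A \<rho> by (simp add: ln_div)
      have "D = (w s * R s - q s) - R s + \<rho> * (1 + (ln A - ln \<rho>))"
        unfolding D_def \<rho>(2) A_def by (simp add: algebra_simps)
      also have "\<dots> \<le> R s * z s - R s + A" using 1 2 by simp
      finally show ?thesis by (simp add: A_def algebra_simps)
    qed
    ultimately show "\<exists>D\<le>0. (F has_real_derivative D) (at s)" by blast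
  qed (use ac in auto)
  then have "ln I \<le> f a + harm k + (Q c - Q a)"
    using k by (simp add: F_def Ra Rc z_def cc_primitive_0 cc_primitive_1)
  then have "exp (ln I) \<le> exp (f a + harm k + (Q c - Q a))" by simp
  then show ?thesis unfolding exp_ln[OF I] by (simp add: I_def e_def[abs_def])
qed

text \<open>Joint convexity of A^(k+1) / X^k, a Hoelder inequality with two terms: each term is
  compared by Young with the common slope m = (A + B) / (X + Y).\<close>

lemma convex_combination_power_mean:
  fixes A B X Y :: real
  assumes "0 \<le> A" "0 \<le> B" "0 < X" "0 < Y"
  shows "(A + B) ^ Suc k \<le> (A ^ Suc k / X ^ k + B ^ Suc k / Y ^ k) * (X + Y) ^ k"
proof -
  define m where "m = (A + B) / (X + Y)"
  have m: "m \<ge> 0" using assms by (simp add: m_def)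
  have *: "(real k + 1) * m ^ k * A \<le> real k * m ^ Suc k * X + A ^ Suc k / X ^ k" if "0 \<le> A" "0 < X" for A X
  proof -
    have "(real k + 1) * m ^ k * (A / X) * X \<le> (real k * m ^ Suc k + (A / X) ^ Suc k) * X"
      using weighted_amgm[of m "A / X" k] m that by (intro mult_right_mono) auto
    moreover have "(A / X) ^ Suc k * X = A ^ Suc k / X ^ k" using that by (simp add: power_divide)
    moreover have "(real k + 1) * m ^ k * (A / X) * X = (real k + 1) * m ^ k * A" using that by simp
    ultimately show ?thesis by (simp only: distrib_right)
  qed
  have AB: "A + B = m * (X + Y)" using assms by (simp add: m_def)
  have "(real k + 1) * m ^ k * (A + B) \<le> real k * m ^ Suc k * (X + Y) + (A ^ Suc k / X ^ k + B ^ Suc k / Y ^ k)"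
    using *[OF assms(1,3)] *[OF assms(2,4)] unfolding distrib_left by linarith
  then have "m ^ Suc k * (X + Y) \<le> A ^ Suc k / X ^ k + B ^ Suc k / Y ^ k"
    unfolding AB by (simp add: algebra_simps)
  then have "m ^ Suc k * (X + Y) * (X + Y) ^ k \<le> (A ^ Suc k / X ^ k + B ^ Suc k / Y ^ k) * (X + Y) ^ k"
    using assms by (intro mult_right_mono) auto
  moreover have "(A + B) ^ Suc k = m ^ Suc k * (X + Y) * (X + Y) ^ k"
    unfolding AB by (simp add: power_mult_distrib)
  ultimately show ?thesis by simp
qed

text \<open>Concavity through the tangent at the intermediate point p; the tangent inequality is
  Young's inequality for u / p against 1.\<close>

lemma powr_concave_combination:
  fixes a s \<theta> t :: real
  assumes "0 < a" "0 < s" "0 < \<theta>" "\<theta> \<le> 1" "0 \<le> t" "t \<le> 1"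
  shows "(1 - t) * a powr \<theta> + t * s powr \<theta> \<le> ((1 - t) * a + t * s) powr \<theta>"
proof -
  define p where "p = (1 - t) * a + t * s"
  have p: "p > 0" unfolding p_def using assms by (cases "t = 0") (auto intro: add_nonneg_pos)
  have tangent: "u powr \<theta> \<le> p powr \<theta> * (1 + \<theta> * (u / p - 1))" if "u > 0" for u
  proof -
    have "(u / p) powr \<theta> * 1 powr (1 - \<theta>) \<le> \<theta> * (u / p) + (1 - \<theta>) * 1"
      using assms that p by (intro Youngs_inequality_0) auto
    then have "(u / p) powr \<theta> \<le> 1 + \<theta> * (u / p - 1)" by (simp add: algebra_simps)
    then have "p powr \<theta> * (u / p) powr \<theta> \<le> p powr \<theta> * (1 + \<theta> * (u / p - 1))"
      by (rule mult_left_mono) simp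
    moreover have "p powr \<theta> * (u / p) powr \<theta> = u powr \<theta>" using that p by (simp add: powr_divide)
    ultimately show ?thesis by simp
  qed
  have "(1 - t) * a powr \<theta> + t * s powr \<theta> \<le>
      (1 - t) * (p powr \<theta> * (1 + \<theta> * (a / p - 1))) + t * (p powr \<theta> * (1 + \<theta> * (s / p - 1)))"
    using assms by (intro add_mono mult_left_mono tangent) auto
  also have "\<dots> = p powr \<theta> * (1 + \<theta> * (((1 - t) * a + t * s) / p - 1))"
    using p by (simp add: field_simps)
  also have "\<dots> = p powr \<theta>" using p unfolding p_def[symmetric] by simp
  finally show ?thesis by (simp add: p_def)
qed

lemma powr_one_minus_ge:
  fixes z \<kappa> :: real
  assumes "0 \<le> z" "z < 1" "0 < \<kappa>"
  shows "1 - \<kappa> * (z / (1 - z)) \<le> (1 - z) powr \<kappa>"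
proof -
  have "ln (1 / (1 - z)) \<le> 1 / (1 - z) - 1" using assms by (intro ln_le_minus_one) auto
  also have "\<dots> = z / (1 - z)" using assms by (simp add: field_simps)
  finally have "- (z / (1 - z)) \<le> ln (1 - z)" using assms by (simp add: ln_div)
  then have "\<kappa> * - (z / (1 - z)) \<le> \<kappa> * ln (1 - z)" using assms by (intro mult_left_mono) auto
  then have "1 - \<kappa> * (z / (1 - z)) \<le> 1 + \<kappa> * ln (1 - z)" by simp
  also have "\<dots> \<le> exp (\<kappa> * ln (1 - z))" by (rule exp_ge_add_one_self)
  finally show ?thesis using assms by (simp add: powr_def)
qed

section \<open>Tail estimates for a concentrating sequence\<close>

context mt_class
begin

lemma prim_gam_continuous_on:
  assumes "cls g" "0 \<le> a"
  shows "continuous_on {a..} (\<lambda>s. prim g s powr gam)"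
proof (rule continuous_on_powr')
  show "continuous_on {a..} (prim g)"
    by (rule continuous_on_subset[OF prim_continuous_on[OF clsD(3)[OF assms(1)]]]) (use assms in auto)
qed (use prim_nonneg[OF clsD(3)[OF assms(1)]] assms gam_pos in auto)

text \<open>\<open>exponential_integral_bound\<close> for f s = prim g s powr gam - s, with Q a
  multiple of the energy spent so far. As prim g s powr gam \<le> s, the (k+1)-st power of the slope
  of prim g powr gam is at most gam^(k+1) * s times the energy density, and s \<le> c on the window
  turns this into the fixed multiple \<open>K\<close>.\<close>

lemma window_bound:
  assumes g: "cls g" and a: "0 < a" "a < c" and ya: "0 < prim g a"
    and e: "0 \<le> e" and E: "energy {a<..c} g \<le> ennreal ((1 - b) ^ k * e)"
  shows "(\<integral>\<^sup>+s\<in>{a<..c}. ennreal (exp (prim g s powr gam - s)) \<partial>lborel)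
    \<le> ennreal (exp (prim g a powr gam - a + harm k + c * e / kap))"
proof -
  note gd = clsD[OF g]
  have [measurable]: "g \<in> borel_measurable borel" by (rule decr_borel_measurable[OF gd(1)])
  define C where "C = (real k / (real k + 1)) ^ Suc k / real k"
  define h where "h t = g t ^ Suc k * t powr (b * real k)" for t
  have h0: "0 \<le> h t" for t using decrD(2)[OF gd(1)] by (simp add: h_def)
  have "h integrable_on {a..c}"
  proof -
    have "set_integrable lborel {a..c} h"
      unfolding set_integrable_def
    proof (rule integrableI_nonneg)
      have "(\<integral>\<^sup>+t. ennreal (indicator {a..c} t *\<^sub>R h t) \<partial>lborel) \<le> energy {0<..} g"
        unfolding energy_def using a by (intro nn_integral_mono) (auto simp: indicator_def h_def)
      also have "\<dots> < \<infinity>" by (rule le_less_trans[OF gd(2)]) simp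
      finally show "(\<integral>\<^sup>+t. ennreal (indicator {a..c} t *\<^sub>R h t) \<partial>lborel) < \<infinity>" .
    qed (use h0 in \<open>auto simp: h_def\<close>)
    then show ?thesis by (rule set_borel_integral_eq_integral(1))
  qed
  then have hi: "h integrable_on {x..y}" if "a \<le> x" "y \<le> c" for x y
    by (rule integrable_on_subinterval) (use that in auto)
  define K where "K = C * gam ^ Suc k * c"
  have C0: "0 \<le> C" by (simp add: C_def)
  define Q where "Q s = K * integral {a..s} h" for s
  define S where "S = {s. 0 < s \<and> \<not> isCont g s}"
  have "integral {a..c} (\<lambda>s. exp (prim g s powr gam - s)) \<le> exp ((prim g a powr gam - a) + harm k + (Q c - Q a))"
  proof (rule exponential_integral_bound[OF k a(2), where S = S and w = "\<lambda>s. gam * prim g s powr (gam - 1) * g s" and q = "\<lambda>s. K * h s"])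
    show "continuous_on {a..c} (\<lambda>s. prim g s powr gam - s)"
      by (intro continuous_intros continuous_on_subset[OF prim_gam_continuous_on[OF g, of 0]]) (use a in auto)
    show "continuous_on {a..c} Q"
      unfolding Q_def by (intro continuous_intros indefinite_integral_continuous_1 hi) auto
    show "countable S" unfolding S_def by (rule decr_countable_discont[OF gd(1)])
    fix s assume s: "a < s" "s < c"
    have ys: "prim g s > 0" using prim_mono[OF gd(3), of a s] ya a s by simp
    show "0 \<le> gam * prim g s powr (gam - 1) * g s" using gam_pos decrD(2)[OF gd(1)] by simp
    assume "s \<notin> S"
    then have cont: "isCont g s" using s a by (simp add: S_def)
    have dp: "(prim g has_real_derivative g s) (at s)" using prim_has_derivative[OF gd(3) _ cont] s a by simp
    show "((\<lambda>s. prim g s powr gam - s) has_real_derivative gam * prim g s powr (gam - 1) * g s - 1) (at s)"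
      using ys by (auto intro!: derivative_eq_intros dp)
    have "((\<lambda>u. integral {a..u} h) has_vector_derivative h s) (at s within ({a..c} - {}))"
    proof (rule integral_has_vector_derivative_continuous_at)
      have "isCont h s" unfolding h_def using s a by (intro continuous_intros cont) auto
      then show "continuous (at s within ({a..c} - {})) h" by (rule continuous_at_imp_continuous_at_within)
    qed (use s hi in auto)
    moreover have "at s within ({a..c} - {}) = at s" using s by (intro at_within_interior) auto
    ultimately have "((\<lambda>u. integral {a..u} h) has_real_derivative h s) (at s)"
      by (simp add: has_real_derivative_iff_has_vector_derivative)
    then show "(Q has_real_derivative K * h s) (at s)"
      unfolding Q_def by (rule DERIV_cmult)
    have "(gam * prim g s powr (gam - 1) * g s) ^ Suc k = gam ^ Suc k * (prim g s powr (gam - 1)) ^ Suc k * g s ^ Suc k"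
      by (simp only: power_mult_distrib)
    also have "(prim g s powr (gam - 1)) ^ Suc k \<le> c * s powr (b * real k)"
    proof -
      have "(prim g s powr (gam - 1)) ^ Suc k = (prim g s powr gam) powr ((gam - 1) * real (Suc k) / gam)"
        using ys gam_pos by (simp add: powr_powr powr_power mult.commute del: power_Suc of_nat_Suc)
      also have "\<dots> \<le> s powr ((gam - 1) * real (Suc k) / gam)"
        using prim_le(3)[OF g, of s] s a gam_gt1 by (intro powr_mono2) auto
      \<comment> \<open>The exponent is k + 1 - kap, so one power of s is left over beyond the
        weight s powr (b k).\<close>
      also have "(gam - 1) * real (Suc k) / gam = 1 + b * real k"
      proof -
        have "(gam - 1) * real (Suc k) / gam = real k + 1 - (real k + 1) / gam"
          using gam_pos by (simp add: field_simps)
        also have "(real k + 1) / gam = kap" using kap_pos by (simp add: gam_def)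
        finally show ?thesis by (simp add: kap_def algebra_simps)
      qed
      also have "s powr (1 + b * real k) = s * s powr (b * real k)" using s a by (simp add: powr_add)
      also have "\<dots> \<le> c * s powr (b * real k)" using s by (intro mult_right_mono) auto
      finally show ?thesis .
    qed
    finally have "(gam * prim g s powr (gam - 1) * g s) ^ Suc k \<le> gam ^ Suc k * (c * s powr (b * real k)) * g s ^ Suc k"
      using gam_pos decrD(2)[OF gd(1), of s] by (simp add: mult_left_mono mult_right_mono del: power_Suc)
    then have "C * (gam * prim g s powr (gam - 1) * g s) ^ Suc k \<le> C * (gam ^ Suc k * (c * s powr (b * real k)) * g s ^ Suc k)"
      using C0 by (rule mult_left_mono)
    then show "(real k / (real k + 1)) ^ Suc k / real k * (gam * prim g s powr (gam - 1) * g s) ^ Suc k \<le> K * h s"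
      unfolding C_def[symmetric] by (simp add: K_def h_def algebra_simps del: power_Suc)
  qed
  also have "Q c - Q a \<le> c * e / kap"
  proof -
    have "ennreal (integral {a..c} h) = (\<integral>\<^sup>+t. ennreal (h t) * indicator {a..c} t \<partial>lborel)"
      using h0 hi[of a c] by (subst nn_integral_has_integral_lebesgue'[of "{a..c}" h]) (auto intro: integrable_integral)
    also have "\<dots> = energy {a<..c} g"
      unfolding energy_def h_def using AE_lborel_singleton[of a]
      by (intro nn_integral_cong_AE) (auto simp: indicator_def elim!: eventually_mono)
    also note E
    finally have le: "integral {a..c} h \<le> (1 - b) ^ k * e" using e b1 by (subst (asm) ennreal_le_iff) auto
    have K: "K * (1 - b) ^ k = c / kap"
    proof -
      have "C * gam ^ Suc k = (real k) ^ k / kap ^ Suc k"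
        unfolding C_def gam_def using k by (simp add: power_divide)
      then have "K * (1 - b) ^ k = c * ((real k * (1 - b)) ^ k / kap ^ Suc k)"
        by (simp add: K_def power_mult_distrib)
      also have "\<dots> = c / kap" unfolding kap_def[symmetric] using kap_pos by simp
      finally show ?thesis .
    qed
    have "K \<ge> 0" using C0 gam_pos a by (simp add: K_def)
    then have "K * integral {a..c} h \<le> K * ((1 - b) ^ k * e)" using le by (intro mult_left_mono)
    also have "\<dots> = c * e / kap" using K by (simp add: mult.assoc[symmetric])
    finally show ?thesis by (simp add: Q_def)
  qed
  finally have le: "integral {a..c} (\<lambda>s. exp (prim g s powr gam - s)) \<le> exp (prim g a powr gam - a + harm k + c * e / kap)"
    by simp
  have "(\<integral>\<^sup>+s\<in>{a<..c}. ennreal (exp (prim g s powr gam - s)) \<partial>lborel) \<le> (\<integral>\<^sup>+s. ennreal (exp (prim g s powr gam - s)) * indicator {a..c} s \<partial>lborel)"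
    by (intro nn_integral_mono) (auto simp: indicator_def)
  also have "\<dots> = ennreal (integral {a..c} (\<lambda>s. exp (prim g s powr gam - s)))"
  proof (rule nn_integral_has_integral_lebesgue')
    show "((\<lambda>s. exp (prim g s powr gam - s)) has_integral integral {a..c} (\<lambda>s. exp (prim g s powr gam - s))) {a..c}"
      by (intro integrable_integral integrable_continuous_real continuous_intros
          continuous_on_subset[OF prim_gam_continuous_on[OF g, of 0]]) (use a in auto)
  qed simp
  also have "\<dots> \<le> ennreal (exp (prim g a powr gam - a + harm k + c * e / kap))" using le by (rule ennreal_leI)
  finally show ?thesis .
qed

text \<open>In \<open>far_bound\<close> the logarithm of the growth factor (1 + 4^k e) powr (1 /
  kap) is at most 2 * 4^k * z; the further factor 2 pays for exp x \<le> 1 + 2 x on [0, 1].\<close>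

definition far_const :: real where "far_const = 4 * 4 ^ k"

text \<open>By the growth bound, reaching prim g a powr gam = a (1 - z) costs at least the share (1
  - z) powr kap of the budget. What is left beyond a is of first order in z.\<close>

lemma tail_energy:
  assumes g: "cls g" and a: "0 < a" "a \<le> c" and z: "0 \<le> z" "z < 1" and ya: "prim g a powr gam = a * (1 - z)"
  shows "energy {a<..c} g \<le> ennreal ((1 - b) ^ k * (kap * (z / (1 - z))))"
proof -
  note gd = clsD[OF g]
  define ea where "ea = enn2real (energy {0<..a} g) / (1 - b) ^ k"
  have fin: "energy {0<..a} g < top"
    by (rule le_less_trans[OF order_trans[OF energy_mono gd(2)]]) auto
  have ea: "ea \<ge> 0" "energy {0<..a} g = ennreal ((1 - b) ^ k * ea)"
    using fin b1 by (auto simp: ea_def less_top)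
  have y0: "prim g a \<ge> 0" using prim_nonneg[OF gd(3)] a by simp
  have yz: "prim g a \<noteq> 0" using ya a z by auto
  have "prim g a ^ Suc k \<le> ea * a powr kap"
    using prim_growth[OF gd(3), of 0 a ea] ea a powr_one_minus_power[of a] by simp
  moreover have "prim g a ^ Suc k = (prim g a powr gam) powr kap"
  proof -
    have "gam * kap = real (Suc k)" using kap_pos by (simp add: gam_def)
    then show ?thesis using powr_realpow[of "prim g a" "Suc k"] y0 yz by (simp add: powr_powr)
  qed
  ultimately have "a powr kap * (1 - z) powr kap \<le> a powr kap * ea"
    unfolding ya using a z by (simp add: powr_mult mult.commute)
  then have "(1 - z) powr kap \<le> ea" using a by simp
  then have ea_ge: "1 - kap * (z / (1 - z)) \<le> ea"
    using powr_one_minus_ge[OF z kap_pos] by simp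
  have "energy {a<..c} g \<le> ennreal ((1 - b) ^ k) - energy {0<..a} g"
    using order_trans[OF energy_Ioc_add[OF gd(1), of a c] gd(2)] a fin
    by (simp add: ennreal_le_minus_iff add.commute)
  also have "\<dots> = ennreal ((1 - b) ^ k * (1 - ea))"
    unfolding ea(2) using ea b1 by (subst ennreal_minus) (auto simp: algebra_simps)
  also have "\<dots> \<le> ennreal ((1 - b) ^ k * (kap * (z / (1 - z))))"
    using ea_ge b1 by (intro ennreal_leI mult_left_mono) auto
  finally show ?thesis .
qed

text \<open>The increment beyond a has energy of order z only. It may therefore be weighed against a
  quarter of the remaining length, at the price of a factor 4^k on that small energy. So prim g s
  powr gam is at most (1 + far_const z) (a + (s - a) / 4), and subtracting s leaves a decay of slope
  1 / 2.\<close>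

lemma far_bound:
  assumes g: "cls g" and a: "0 < a" "a < s" and z: "0 \<le> z" "z \<le> 1 / 2" "far_const * z \<le> 1"
    and ya: "prim g a powr gam = a * (1 - z)"
  shows "prim g s powr gam - s \<le> far_const * (a * z) - (s - a) / 2"
proof -
  note gd = clsD[OF g]
  define e where "e = kap * (z / (1 - z))"
  have e0: "e \<ge> 0" using z kap_pos by (simp add: e_def)
  have E: "energy {a<..s} g \<le> ennreal ((1 - b) ^ k * e)"
    unfolding e_def using a z by (intro tail_energy[OF g _ _ _ _ ya]) auto
  define xa where "xa = a powr (1 - b)"
  define xs where "xs = s powr (1 - b)"
  have x: "0 < xa" "xa < xs" using a b1 by (auto simp: xa_def xs_def intro: powr_less_mono2)
  have 1: "(prim g s - prim g a) ^ Suc k \<le> e * (xs - xa) ^ k"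
    unfolding xs_def xa_def using a e0 by (intro prim_growth gd(3) E) auto
  have 2: "prim g a ^ Suc k \<le> xa ^ k"
    using prim_le(1)[OF g, of a] powr_one_minus_power[of a] a by (simp add: xa_def)
  have "prim g s ^ Suc k = (prim g a + (prim g s - prim g a)) ^ Suc k" by simp
  also have "\<dots> \<le> (prim g a ^ Suc k / xa ^ k + (prim g s - prim g a) ^ Suc k / ((xs - xa) / 4) ^ k) * (xa + (xs - xa) / 4) ^ k"
    using prim_nonneg[OF gd(3), of a] prim_mono[OF gd(3), of a s] a x
    by (intro convex_combination_power_mean) auto
  also have "\<dots> \<le> (1 + 4 ^ k * e) * (xa + (xs - xa) / 4) ^ k"
  proof (rule mult_right_mono)
    have "prim g a ^ Suc k / xa ^ k \<le> 1" using 2 x by (simp add: pos_divide_le_eq)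
    moreover have "(prim g s - prim g a) ^ Suc k / ((xs - xa) / 4) ^ k \<le> e * (xs - xa) ^ k / ((xs - xa) / 4) ^ k"
      using 1 x by (intro divide_right_mono) auto
    moreover have "e * (xs - xa) ^ k / ((xs - xa) / 4) ^ k = 4 ^ k * e" using x by (simp add: power_divide)
    ultimately show "prim g a ^ Suc k / xa ^ k + (prim g s - prim g a) ^ Suc k / ((xs - xa) / 4) ^ k \<le> 1 + 4 ^ k * e"
      by linarith
  qed (use x in auto)
  also have "(xa + (xs - xa) / 4) ^ k \<le> ((a + (s - a) / 4) powr (1 - b)) ^ k"
  proof (rule power_mono)
    have "(1 - 1 / 4) * a powr (1 - b) + 1 / 4 * s powr (1 - b) \<le> ((1 - 1 / 4) * a + 1 / 4 * s) powr (1 - b)"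
      using a b0 b1 by (intro powr_concave_combination) auto
    moreover have "(1 - 1 / 4) * a + 1 / 4 * s = a + (s - a) / 4" by (simp add: field_simps)
    ultimately show "xa + (xs - xa) / 4 \<le> (a + (s - a) / 4) powr (1 - b)"
      by (simp add: xa_def xs_def field_simps)
  qed (use x in auto)
  also have "((a + (s - a) / 4) powr (1 - b)) ^ k = (a + (s - a) / 4) powr kap"
    using a by (intro powr_one_minus_power) auto
  finally have "prim g s ^ Suc k \<le> (1 + 4 ^ k * e) * (a + (s - a) / 4) powr kap"
    using e0 by (simp add: mult_left_mono del: power_Suc)
  then have "prim g s powr gam \<le> (1 + 4 ^ k * e) powr (1 / kap) * (a + (s - a) / 4)"
    using prim_nonneg[OF gd(3), of s] a e0 by (intro power_le_powr(2)) auto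
  also have "(1 + 4 ^ k * e) powr (1 / kap) \<le> 1 + far_const * z"
  proof -
    have "ln (1 + 4 ^ k * e) \<le> 4 ^ k * e" using ln_le_minus_one[of "1 + 4 ^ k * e"] e0 by (simp add: add_pos_nonneg)
    then have "1 / kap * ln (1 + 4 ^ k * e) \<le> 1 / kap * (4 ^ k * e)" using kap_pos by (intro mult_left_mono) auto
    also have "\<dots> = 4 ^ k * (z / (1 - z))" using kap_pos by (simp add: e_def)
    also have "\<dots> \<le> 4 ^ k * (2 * z)"
    proof (rule mult_left_mono)
      have "z \<le> 2 * z * (1 - z)" using z mult_left_mono[of z "1 / 2" z] by (simp add: algebra_simps)
      then show "z / (1 - z) \<le> 2 * z" using z by (simp add: pos_divide_le_eq)
    qed simp
    finally have "(1 + 4 ^ k * e) powr (1 / kap) \<le> exp (far_const * z / 2)"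
      using e0 by (simp add: powr_def add_nonneg_eq_0_iff far_const_def mult_ac)
    also have "\<dots> \<le> 1 + far_const * z / 2 + (far_const * z / 2)\<^sup>2"
    proof (rule exp_bound)
      show "0 \<le> far_const * z / 2" using z by (simp add: far_const_def)
      show "far_const * z / 2 \<le> 1" using z by linarith
    qed
    also have "\<dots> \<le> 1 + far_const * z"
    proof -
      have u: "0 \<le> far_const * z / 2" "far_const * z / 2 \<le> 1" 
      proof -
        show "0 \<le> far_const * z / 2" using z by (simp add: far_const_def)
        show "far_const * z / 2 \<le> 1" using z by linarith
      qed
      have "(far_const * z / 2)\<^sup>2 \<le> far_const * z / 2 * 1"
        unfolding power2_eq_square using u by (intro mult_left_mono) auto
      then show ?thesis by simp
    qed
    finally show ?thesis .
  qed
  finally have le: "prim g s powr gam \<le> (1 + far_const * z) * (a + (s - a) / 4)"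
    using a by (simp add: mult_right_mono)
  define d where "d = (s - a) / 4"
  have "prim g s powr gam \<le> (1 + far_const * z) * (a + d)" using le by (simp add: d_def)
  moreover have "far_const * z * d \<le> 1 * d" using z a by (intro mult_right_mono) (auto simp: d_def)
  moreover have "(1 + far_const * z) * (a + d) = a + far_const * (a * z) + d + far_const * z * d"
    by (simp add: algebra_simps)
  moreover have "s = a + 4 * d" by (simp add: d_def field_simps)
  ultimately show ?thesis by simp
qed

text \<open>Let prim g a powr gam = a (1 - z), so that a z \<le> 2 ln a. The window from a to a +
  sqrt a is short compared with a: the energy term of \<open>window_bound\<close> is a z up to a
  vanishing error and cancels the deficit - a z of the exponent at a, leaving exp (harm k). It is
  also long enough: beyond it the decay exp (- sqrt a / 2) beats every power of a lost in
  \<open>far_bound\<close>.\<close>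

lemma concentration_tail:
  assumes "\<epsilon> > 0"
  obtains A where "A \<ge> 1" "\<And>g a. cls g \<Longrightarrow> A \<le> a \<Longrightarrow> a - 2 * ln a \<le> prim g a powr gam \<Longrightarrow>
    (\<integral>\<^sup>+s\<in>{a<..}. ennreal (exp (prim g s powr gam - s)) \<partial>lborel) \<le> ennreal (exp (harm k) + \<epsilon>)"
proof -
  define B where "B a = exp (harm k + 4 * ln a * (1 / sqrt a + 2 * ln a / a)) +
      2 * exp (far_const * (2 * ln a) - sqrt a / 2)" for a
  have "(B \<longlongrightarrow> exp (harm k)) at_top"
  proof -
    have "((\<lambda>a::real. exp (harm k + 4 * ln a * (1 / sqrt a + 2 * ln a / a))) \<longlongrightarrow> exp (harm k + 0)) at_top"
      by (intro tendsto_intros) real_asymp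
    moreover have "((\<lambda>a::real. 2 * exp (far_const * (2 * ln a) - sqrt a / 2)) \<longlongrightarrow> 0) at_top"
      by real_asymp
    ultimately show ?thesis unfolding B_def using tendsto_add by fastforce
  qed
  then have "\<forall>\<^sub>F a in at_top. B a < exp (harm k) + \<epsilon>" using assms by (intro order_tendstoD) auto
  moreover have "\<forall>\<^sub>F a::real in at_top. 2 * ln a / a \<le> 1 / 2"
  proof -
    have "((\<lambda>a::real. 2 * ln a / a) \<longlongrightarrow> 0) at_top" by real_asymp
    then show ?thesis by (rule eventually_mono[OF order_tendstoD(2)[of _ 0 _ "1 / 2"]]) auto
  qed
  moreover have "\<forall>\<^sub>F a::real in at_top. far_const * (2 * ln a / a) \<le> 1"
  proof -
    have "((\<lambda>a::real. far_const * (2 * ln a / a)) \<longlongrightarrow> 0) at_top" by real_asymp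
    then show ?thesis by (rule eventually_mono[OF order_tendstoD(2)[of _ 0 _ 1]]) auto
  qed
  ultimately have "\<forall>\<^sub>F a::real in at_top. B a < exp (harm k) + \<epsilon> \<and> 2 * ln a / a \<le> 1 / 2 \<and> far_const * (2 * ln a / a) \<le> 1"
    by eventually_elim auto
  then obtain A0 where A0: "\<And>a. a \<ge> A0 \<Longrightarrow> B a < exp (harm k) + \<epsilon> \<and> 2 * ln a / a \<le> 1 / 2 \<and> far_const * (2 * ln a / a) \<le> 1"
    by (auto simp: eventually_at_top_linorder)
  show ?thesis
  proof (rule that[of "max 1 A0"])
    fix g a assume g: "cls g" and a: "max 1 A0 \<le> a" and ya: "a - 2 * ln a \<le> prim g a powr gam"
    note gd = clsD[OF g]
    have a1: "a \<ge> 1" "a \<ge> A0" using a by auto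
    have l0: "ln a \<ge> 0" using a1 by simp
    define z where "z = 1 - prim g a powr gam / a"
    have yz: "prim g a powr gam = a * (1 - z)" using a1 by (simp add: z_def)
    have z0: "z \<ge> 0" using prim_le(3)[OF g, of a] a1 by (simp add: z_def)
    have az: "a * z \<le> 2 * ln a" using ya a1 yz by (simp add: algebra_simps)
    then have zle: "z \<le> 2 * ln a / a" using a1 by (simp add: pos_le_divide_eq mult.commute)
    have fc: "far_const > 0" by (simp add: far_const_def)
    have z: "z \<le> 1 / 2" "far_const * z \<le> 1"
      using zle A0[OF a1(2)] mult_left_mono[OF zle, of far_const] fc by auto
    define c where "c = a + sqrt a"
    have c: "a < c" using a1 by (simp add: c_def)
    have ypos: "prim g a > 0"
    proof -
      have "prim g a powr gam > 0" unfolding yz using a1 z by simp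
      then show ?thesis using prim_nonneg[OF gd(3), of a] a1 by (cases "prim g a = 0") auto
    qed
    have E: "energy {a<..c} g \<le> ennreal ((1 - b) ^ k * (kap * (z / (1 - z))))"
      using a1 c z z0 by (intro tail_energy[OF g _ _ _ _ yz]) auto
    have "(\<integral>\<^sup>+s\<in>{a<..c}. ennreal (exp (prim g s powr gam - s)) \<partial>lborel)
        \<le> ennreal (exp (prim g a powr gam - a + harm k + c * (kap * (z / (1 - z))) / kap))"
      using a1 c z z0 kap_pos by (intro window_bound[OF g _ _ ypos _ E]) auto
    also have "\<dots> \<le> ennreal (exp (harm k + 4 * ln a * (1 / sqrt a + 2 * ln a / a)))"
    proof (intro ennreal_leI, subst exp_le_cancel_iff)
      have "c * (kap * (z / (1 - z))) / kap = c * z / (1 - z)" using kap_pos by simp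
      also have "\<dots> \<le> a * z + 4 * ln a * (1 / sqrt a + 2 * ln a / a)"
      proof -
        have sq: "sqrt a = a * (1 / sqrt a)" using a1 by (simp add: real_div_sqrt)
        have "c * z = (a * z) * (1 + 1 / sqrt a)"
          unfolding c_def by (subst sq) (simp add: algebra_simps)
        then have "c * z - a * z * (1 - z) = (a * z) * (1 / sqrt a + z)" by (simp add: algebra_simps)
        also have "\<dots> \<le> (2 * ln a) * (1 / sqrt a + 2 * ln a / a)"
          using z0 a1 l0 by (intro mult_mono[OF az add_left_mono[OF zle]]) auto
        finally have le: "c * z - a * z * (1 - z) \<le> (2 * ln a) * (1 / sqrt a + 2 * ln a / a)" .
        have "0 \<le> 4 * ln a * (1 / sqrt a + 2 * ln a / a)" using a1 l0 by simp
        then have "4 * ln a * (1 / sqrt a + 2 * ln a / a) * (1 / 2) \<le> 4 * ln a * (1 / sqrt a + 2 * ln a / a) * (1 - z)"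
          using z by (intro mult_left_mono) auto
        then have "c * z \<le> (a * z + 4 * ln a * (1 / sqrt a + 2 * ln a / a)) * (1 - z)"
          using le by (simp add: algebra_simps)
        then show ?thesis using z by (simp add: pos_divide_le_eq)
      qed
      finally show "prim g a powr gam - a + harm k + c * (kap * (z / (1 - z))) / kap
          \<le> harm k + 4 * ln a * (1 / sqrt a + 2 * ln a / a)"
        unfolding yz by (simp add: algebra_simps)
    qed
    finally have near: "(\<integral>\<^sup>+s\<in>{a<..c}. ennreal (exp (prim g s powr gam - s)) \<partial>lborel)
      \<le> ennreal (exp (harm k + 4 * ln a * (1 / sqrt a + 2 * ln a / a)))" .
    have "(\<integral>\<^sup>+s\<in>{c<..}. ennreal (exp (prim g s powr gam - s)) \<partial>lborel)
        \<le> (\<integral>\<^sup>+s. ennreal (exp (far_const * (2 * ln a) + a / 2)) * (ennreal (exp (- (1 / 2) * s)) * indicator {c..} s) \<partial>lborel)"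
    proof (rule nn_integral_mono)
      fix s
      show "ennreal (exp (prim g s powr gam - s)) * indicator {c<..} s
        \<le> ennreal (exp (far_const * (2 * ln a) + a / 2)) * (ennreal (exp (- (1 / 2) * s)) * indicator {c..} s)"
      proof (cases "s > c")
        case True
        have "prim g s powr gam - s \<le> far_const * (a * z) - (s - a) / 2"
          using True c a1 z z0 by (intro far_bound[OF g _ _ _ _ _ yz]) auto
        also have "\<dots> \<le> (far_const * (2 * ln a) + a / 2) + - (1 / 2) * s"
        proof -
          have "far_const * (a * z) \<le> far_const * (2 * ln a)" using az fc by (intro mult_left_mono) auto
          then show ?thesis by (simp add: diff_divide_distrib)
        qed
        finally show ?thesis using True
          by (simp add: ennreal_mult[symmetric] exp_add[symmetric] ennreal_leI)
      qed simp
    qed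
    also have "\<dots> = ennreal (exp (far_const * (2 * ln a) + a / 2)) * ennreal (exp (- (1 / 2) * c) / (1 / 2))"
      using nn_integral_exp_atLeast[of "1 / 2" c] by (subst nn_integral_cmult) auto
    also have "\<dots> = ennreal (2 * exp (far_const * (2 * ln a) - sqrt a / 2))"
    proof -
      have "exp (far_const * (2 * ln a) + a / 2) * exp (- (1 / 2) * c) = exp (far_const * (2 * ln a) - sqrt a / 2)"
        unfolding exp_add[symmetric] c_def by (simp add: algebra_simps add_divide_distrib)
      then have "exp (far_const * (2 * ln a) + a / 2) * (exp (- (1 / 2) * c) / (1 / 2)) = 2 * exp (far_const * (2 * ln a) - sqrt a / 2)"
        by simp
      then show ?thesis by (subst ennreal_mult[symmetric]) (auto simp del: exp_gt_zero)
    qed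
    finally have far: "(\<integral>\<^sup>+s\<in>{c<..}. ennreal (exp (prim g s powr gam - s)) \<partial>lborel)
        \<le> ennreal (2 * exp (far_const * (2 * ln a) - sqrt a / 2))" .
    have meas: "(\<lambda>s. ennreal (exp (prim g s powr gam - s)) * indicator {a<..c} s) \<in> borel_measurable lborel"
    proof -
      have "continuous_on {a<..c} (\<lambda>s. exp (prim g s powr gam - s))"
        by (intro continuous_intros continuous_on_subset[OF prim_gam_continuous_on[OF g, of 0]]) (use a1 in auto)
      then have "(\<lambda>s. indicator {a<..c} s *\<^sub>R exp (prim g s powr gam - s)) \<in> borel_measurable borel"
        by (intro borel_measurable_continuous_on_indicator) auto
      then have "(\<lambda>s. ennreal (indicator {a<..c} s *\<^sub>R exp (prim g s powr gam - s))) \<in> borel_measurable lborel" by simp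
      also have "(\<lambda>s. ennreal (indicator {a<..c} s *\<^sub>R exp (prim g s powr gam - s))) =
          (\<lambda>s. ennreal (exp (prim g s powr gam - s)) * indicator {a<..c} s)"
        by (auto simp: indicator_def fun_eq_iff)
      finally show ?thesis .
    qed
    have meas2: "(\<lambda>s. ennreal (exp (prim g s powr gam - s)) * indicator {c<..} s) \<in> borel_measurable lborel"
    proof -
      have "continuous_on {c<..} (\<lambda>s. exp (prim g s powr gam - s))"
        by (intro continuous_intros continuous_on_subset[OF prim_gam_continuous_on[OF g, of 0]]) (use a1 c in auto)
      then have "(\<lambda>s. indicator {c<..} s *\<^sub>R exp (prim g s powr gam - s)) \<in> borel_measurable borel"
        by (intro borel_measurable_continuous_on_indicator) auto
      then have "(\<lambda>s. ennreal (indicator {c<..} s *\<^sub>R exp (prim g s powr gam - s))) \<in> borel_measurable lborel" by simp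
      also have "(\<lambda>s. ennreal (indicator {c<..} s *\<^sub>R exp (prim g s powr gam - s))) =
          (\<lambda>s. ennreal (exp (prim g s powr gam - s)) * indicator {c<..} s)"
        by (auto simp: indicator_def fun_eq_iff)
      finally show ?thesis .
    qed
    have "(\<integral>\<^sup>+s\<in>{a<..}. ennreal (exp (prim g s powr gam - s)) \<partial>lborel) =
      (\<integral>\<^sup>+s\<in>{a<..c}. ennreal (exp (prim g s powr gam - s)) \<partial>lborel) + (\<integral>\<^sup>+s\<in>{c<..}. ennreal (exp (prim g s powr gam - s)) \<partial>lborel)"
      by (subst nn_integral_add[symmetric]) (use c meas meas2 in \<open>auto intro!: nn_integral_cong simp: indicator_def\<close>)
    also have "\<dots> \<le> ennreal (exp (harm k + 4 * ln a * (1 / sqrt a + 2 * ln a / a))) + ennreal (2 * exp (far_const * (2 * ln a) - sqrt a / 2))"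
      by (rule add_mono[OF near far])
    also have "\<dots> = ennreal (B a)" unfolding B_def by (subst ennreal_plus) auto
    also have "\<dots> \<le> ennreal (exp (harm k) + \<epsilon>)" using A0[OF a1(2)] by (intro ennreal_leI) auto
    finally show "(\<integral>\<^sup>+s\<in>{a<..}. ennreal (exp (prim g s powr gam - s)) \<partial>lborel) \<le> ennreal (exp (harm k) + \<epsilon>)" .
  qed simp
qed

text \<open>Three ranges. Up to \<open>A\<close> the primitives are uniformly small, and the
  integral is close to that of exp (- s). While prim g s powr gam < s - 2 ln s the integrand is
  below 1 / s^2, which is small beyond \<open>A\<close>. From the first point where this fails on,
  \<open>concentration_tail\<close> applies; the threshold 2 ln s is large enough for integrability
  and small enough for that lemma.\<close>

lemma J_concentration:
  assumes g: "\<And>m. cls (g m)" and conv: "\<And>s. 0 \<le> s \<Longrightarrow> (\<lambda>m. prim (g m) s) \<longlonglongrightarrow> 0" and e: "\<epsilon> > 0"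
  shows "\<forall>\<^sub>F m in sequentially. J (g m) \<le> ennreal (1 + exp (harm k) + \<epsilon>)"
proof -
  obtain A0 where A0: "A0 \<ge> 1" "\<And>g a. cls g \<Longrightarrow> A0 \<le> a \<Longrightarrow> a - 2 * ln a \<le> prim g a powr gam \<Longrightarrow>
    (\<integral>\<^sup>+s\<in>{a<..}. ennreal (exp (prim g s powr gam - s)) \<partial>lborel) \<le> ennreal (exp (harm k) + \<epsilon> / 3)"
    using concentration_tail[of "\<epsilon> / 3"] e by auto
  define A where "A = max A0 (3 / \<epsilon>)"
  have A: "A \<ge> 1" "A \<ge> A0" "1 / A \<le> \<epsilon> / 3"
  proof -
    show "A \<ge> 1" "A \<ge> A0" using A0 by (auto simp: A_def)
    have "1 / A \<le> 1 / (3 / \<epsilon>)" using e by (intro frac_le) (auto simp: A_def)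
    then show "1 / A \<le> \<epsilon> / 3" by simp
  qed
  have "(\<lambda>m. exp (prim (g m) A powr gam)) \<longlonglongrightarrow> exp (0 powr gam)"
    using A gam_pos prim_nonneg[OF clsD(3)[OF g], of A]
    by (intro tendsto_intros tendsto_powr2 conv) (auto intro!: always_eventually)
  then have "\<forall>\<^sub>F m in sequentially. exp (prim (g m) A powr gam) < 1 + \<epsilon> / 3"
    using e by (intro order_tendstoD(2)) auto
  then show ?thesis
  proof eventually_elim
    case (elim m)
    note gd = clsD[OF g[of m]]
    define w where "w s = exp (prim (g m) s powr gam - s)" for s
    have wm: "(\<lambda>s. ennreal (w s) * indicator T s) \<in> borel_measurable lborel" if "T \<in> sets borel" "T \<subseteq> {0..}" for T
    proof -
      have "continuous_on {0..} w"
        unfolding w_def by (intro continuous_intros prim_gam_continuous_on g) auto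
      then have "continuous_on T w" by (rule continuous_on_subset) fact
      then have "(\<lambda>s. indicator T s *\<^sub>R w s) \<in> borel_measurable borel"
        using that by (intro borel_measurable_continuous_on_indicator) auto
      then have "(\<lambda>s. ennreal (indicator T s *\<^sub>R w s)) \<in> borel_measurable lborel" by simp
      also have "(\<lambda>s. ennreal (indicator T s *\<^sub>R w s)) = (\<lambda>s. ennreal (w s) * indicator T s)"
        by (auto simp: indicator_def fun_eq_iff)
      finally show ?thesis .
    qed
    have near: "(\<integral>\<^sup>+s\<in>{0<..A}. ennreal (w s) \<partial>lborel) \<le> ennreal (1 + \<epsilon> / 3)"
    proof -
      have "(\<integral>\<^sup>+s\<in>{0<..A}. ennreal (w s) \<partial>lborel) \<le> (\<integral>\<^sup>+s. ennreal (1 + \<epsilon> / 3) * (ennreal (exp (- 1 * s)) * indicator {0..} s) \<partial>lborel)"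
      proof (rule nn_integral_mono)
        fix s
        show "ennreal (w s) * indicator {0<..A} s \<le> ennreal (1 + \<epsilon> / 3) * (ennreal (exp (- 1 * s)) * indicator {0..} s)"
        proof (cases "0 < s \<and> s \<le> A")
          case True
          have "prim (g m) s powr gam \<le> prim (g m) A powr gam"
            using True gam_pos prim_mono[OF gd(3), of s A] prim_nonneg[OF gd(3), of s] by (intro powr_mono2) auto
          then have "w s \<le> exp (prim (g m) A powr gam) * exp (- s)"
            unfolding w_def exp_add[symmetric] by simp
          also have "\<dots> \<le> (1 + \<epsilon> / 3) * exp (- s)" using elim by (intro mult_right_mono) auto
          finally have "ennreal (w s) \<le> ennreal (1 + \<epsilon> / 3) * ennreal (exp (- s))"
            using e by (subst ennreal_mult[symmetric]) (auto intro: ennreal_leI)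
          then show ?thesis using True by simp
        qed (auto simp: indicator_def)
      qed
      also have "\<dots> = ennreal (1 + \<epsilon> / 3)"
        using nn_integral_exp_atLeast[of 1 0] by (subst nn_integral_cmult) auto
      finally show ?thesis .
    qed
    have mid: "(\<integral>\<^sup>+s\<in>T. ennreal (w s) \<partial>lborel) \<le> ennreal (\<epsilon> / 3)"
      if T: "T \<subseteq> {A<..}" "\<And>s. s \<in> T \<Longrightarrow> prim (g m) s powr gam < s - 2 * ln s" for T
    proof -
      have "(\<integral>\<^sup>+s\<in>T. ennreal (w s) \<partial>lborel) \<le> (\<integral>\<^sup>+s. ennreal (1 / s\<^sup>2) * indicator {A..} s \<partial>lborel)"
      proof (rule nn_integral_mono)
        fix s
        show "ennreal (w s) * indicator T s \<le> ennreal (1 / s\<^sup>2) * indicator {A..} s"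
        proof (cases "s \<in> T")
          case True
          then have s: "s > 0" "s \<ge> A" using T(1) A by auto
          have "w s \<le> exp (- (2 * ln s))" unfolding w_def using T(2)[OF True] by simp
          also have "\<dots> = 1 / s\<^sup>2"
            using s by (simp add: exp_minus exp_double inverse_eq_divide)
          finally show ?thesis using True s by (simp add: ennreal_leI)
        qed simp
      qed
      also have "\<dots> = ennreal (0 - (- (1 / A)))"
      proof (rule nn_integral_FTC_atLeast)
        show "((\<lambda>s::real. - (1 / s)) \<longlongrightarrow> 0) at_top" by real_asymp
        fix s :: real assume "A \<le> s"
        then have "s \<noteq> 0" using A by auto
        then show "((\<lambda>s. - (1 / s)) has_real_derivative 1 / s\<^sup>2) (at s)"
          by (auto intro!: derivative_eq_intros simp: power2_eq_square)
      qed auto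
      also have "\<dots> \<le> ennreal (\<epsilon> / 3)" using A by (intro ennreal_leI) auto
      finally show ?thesis .
    qed
    have tail: "(\<integral>\<^sup>+s\<in>{A<..}. ennreal (w s) \<partial>lborel) \<le> ennreal (\<epsilon> / 3) + ennreal (exp (harm k) + \<epsilon> / 3)"
    proof (cases "\<exists>s\<ge>A. s - 2 * ln s \<le> prim (g m) s powr gam")
      case False
      have "(\<integral>\<^sup>+s\<in>{A<..}. ennreal (w s) \<partial>lborel) \<le> ennreal (\<epsilon> / 3)"
      proof (rule mid)
        fix s assume "s \<in> {A<..}"
        then show "prim (g m) s powr gam < s - 2 * ln s"
          using False by (meson greaterThan_iff less_imp_le not_le)
      qed simp
      then show ?thesis by (rule order_trans) simp
    next
      case True
      \<comment> \<open>The set is closed, so the failure is attained at its infimum a; the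
        pointwise bound holds on all of {A<..<a}.\<close>
      define T where "T = {A..} \<inter> (\<lambda>s. prim (g m) s powr gam - (s - 2 * ln s)) -` {0..}"
      have "closed T"
        unfolding T_def using A
        by (intro continuous_closed_preimage continuous_intros prim_gam_continuous_on g) auto
      moreover have ne: "T \<noteq> {}" using True by (auto simp: T_def)
      moreover have bb: "bdd_below T" by (intro bdd_belowI[of _ A]) (auto simp: T_def)
      ultimately have aT: "Inf T \<in> T" by (intro closed_contains_Inf) auto
      define a where "a = Inf T"
      have a: "A \<le> a" "a - 2 * ln a \<le> prim (g m) a powr gam" using aT by (auto simp: T_def a_def)
      have before: "prim (g m) s powr gam < s - 2 * ln s" if "s \<in> {A<..<a}" for s
      proof (rule ccontr)
        assume "\<not> ?thesis"
        then have "s \<in> T" using that by (auto simp: T_def)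
        then have "a \<le> s" unfolding a_def using bb by (intro cInf_lower)
        then show False using that by simp
      qed
      have "(\<integral>\<^sup>+s\<in>{A<..}. ennreal (w s) \<partial>lborel) = (\<integral>\<^sup>+s. ennreal (w s) * indicator {A<..<a} s + ennreal (w s) * indicator {a<..} s \<partial>lborel)"
        using AE_lborel_singleton[of a] a(1)
        by (intro nn_integral_cong_AE) (auto simp: indicator_def elim!: eventually_mono)
      also have "\<dots> = (\<integral>\<^sup>+s\<in>{A<..<a}. ennreal (w s) \<partial>lborel) + (\<integral>\<^sup>+s\<in>{a<..}. ennreal (w s) \<partial>lborel)"
        using A a by (intro nn_integral_add wm) auto
      also have "\<dots> \<le> ennreal (\<epsilon> / 3) + ennreal (exp (harm k) + \<epsilon> / 3)"
      proof (rule add_mono)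
        show "(\<integral>\<^sup>+s\<in>{A<..<a}. ennreal (w s) \<partial>lborel) \<le> ennreal (\<epsilon> / 3)"
          using before by (intro mid) auto
        show "(\<integral>\<^sup>+s\<in>{a<..}. ennreal (w s) \<partial>lborel) \<le> ennreal (exp (harm k) + \<epsilon> / 3)"
          unfolding w_def using a A by (intro A0(2) g) auto
      qed
      finally show ?thesis .
    qed
    have "J (g m) = (\<integral>\<^sup>+s. ennreal (w s) * indicator {0<..A} s + ennreal (w s) * indicator {A<..} s \<partial>lborel)"
      unfolding J_def w_def using A by (intro nn_integral_cong) (auto simp: indicator_def)
    also have "\<dots> = (\<integral>\<^sup>+s\<in>{0<..A}. ennreal (w s) \<partial>lborel) + (\<integral>\<^sup>+s\<in>{A<..}. ennreal (w s) \<partial>lborel)"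
      using A by (intro nn_integral_add wm) auto
    also have "\<dots> \<le> ennreal (1 + \<epsilon> / 3) + (ennreal (\<epsilon> / 3) + ennreal (exp (harm k) + \<epsilon> / 3))"
      by (rule add_mono[OF near tail])
    also have "\<dots> = ennreal (1 + exp (harm k) + \<epsilon>)"
      using e by (simp add: ennreal_plus[symmetric] del: ennreal_plus)
    finally show ?case .
  qed
qed

end

section \<open>A test function above the concentration level\<close>

lemma power_ge_cubic:
  fixes x :: real
  assumes "x \<ge> 0"
  shows "1 + real n * x + real n * (real n - 1) / 2 * x\<^sup>2 + real n * (real n - 1) * (real n - 2) / 6 * x ^ 3 \<le> (1 + x) ^ n"
proof (induction n)
  case (Suc n)
  let ?P = "\<lambda>n. 1 + n * x + n * (n - 1) / 2 * x\<^sup>2 + n * (n - 1) * (n - 2) / 6 * x ^ 3"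
  \<comment> \<open>For n = 0 and n = 1 a factor vanishes, although n - 2 is negative over the
    reals.\<close>
  have nn: "0 \<le> real n * (real n - 1) * (real n - 2)"
  proof (cases "n < 2")
    case True
    then have "n = 0 \<or> n = 1" by auto
    then show ?thesis by auto
  qed auto
  have "?P (real n) * (1 + x) \<le> (1 + x) ^ n * (1 + x)"
    using Suc assms by (intro mult_right_mono) auto
  moreover have "?P (real n) * (1 + x) = ?P (real n + 1) + real n * (real n - 1) * (real n - 2) / 6 * x ^ 4"
    by (simp add: field_simps power2_eq_square power3_eq_cube power4_eq_xxxx)
  moreover have "0 \<le> real n * (real n - 1) * (real n - 2) / 6 * x ^ 4" using nn assms by simp
  ultimately have "?P (real n + 1) \<le> (1 + x) ^ n * (1 + x)" by linarith
  then show ?case by (simp add: add.commute mult.commute)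
qed simp

lemma exp_le_pade:
  fixes z :: real
  assumes "0 \<le> z" "z < 2"
  shows "exp z \<le> (1 + z / 2) / (1 - z / 2)"
proof -
  define F where "F t = 1 + t / 2 - exp t * (1 - t / 2)" for t :: real
  have "F 0 \<le> F z"
  proof (rule DERIV_nonneg_imp_nondecreasing[OF assms(1)])
    fix t :: real
    have "1 - t \<le> exp (- t)" using exp_ge_add_one_self[of "- t"] by simp
    then have "exp t * (1 - t) \<le> exp t * exp (- t)" by (intro mult_left_mono) auto
    then have le: "exp t * (1 - t) \<le> 1" by (simp add: exp_minus)
    have "(F has_real_derivative 1 / 2 - (exp t * (1 - t / 2) + exp t * (- (1 / 2)))) (at t)"
      unfolding F_def by (auto intro!: derivative_eq_intros)
    moreover have "0 \<le> 1 / 2 - (exp t * (1 - t / 2) + exp t * (- (1 / 2)))"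
      using le by (simp add: algebra_simps)
    ultimately show "\<exists>y. (F has_real_derivative y) (at t) \<and> 0 \<le> y" by blast
  qed
  then have "exp z * (1 - z / 2) \<le> 1 + z / 2" by (simp add: F_def)
  then show ?thesis using assms by (simp add: pos_le_divide_eq)
qed

text \<open>The Pade bound for exp at 1 / (n + 1) equals (n + 3/2) / (n + 1/2), so the product
  telescopes. The constant makes k = 1 an equality.\<close>

lemma exp_harm_le:
  assumes "1 \<le> k"
  shows "exp (harm k) \<le> 2 * exp 1 / 3 * (real k + 1 / 2)"
  using assms
proof (induction k rule: dec_induct)
  case base
  then show ?case by (simp add: harm_def)
next
  case (step n)
  define z where "z = inverse (real (Suc n))"
  have z: "0 \<le> z" "z < 2" using step by (auto simp: z_def inverse_eq_divide divide_less_eq)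
  have "exp (harm (Suc n)) = exp (harm n) * exp z"
    by (simp add: harm_Suc exp_add z_def)
  also have "\<dots> \<le> (2 * exp 1 / 3 * (real n + 1 / 2)) * ((1 + z / 2) / (1 - z / 2))"
    using step.IH exp_le_pade[OF z] z by (intro mult_mono) auto
  also have "(1 + z / 2) / (1 - z / 2) = (real (Suc n) + 1 / 2) / (real n + 1 / 2)"
    by (simp add: z_def divide_simps) (simp add: algebra_simps)
  also have "(2 * exp 1 / 3 * (real n + 1 / 2)) * ((real (Suc n) + 1 / 2) / (real n + 1 / 2)) = 2 * exp 1 / 3 * (real (Suc n) + 1 / 2)"
  proof -
    define a where "a = real n + 1 / 2"
    have "a > 0" by (simp add: a_def)
    then show ?thesis unfolding a_def[symmetric] by simp
  qed
  finally show ?case .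
qed

lemma exp_one_bounds: "2.7182 \<le> exp (1::real)" "exp (1::real) \<le> 2.7183"
  using e_approx_32 by (simp_all add: abs_if field_simps split: if_splits)

lemma exp_five_thirds: "5.29 \<le> exp (5 / 3 :: real)"
proof (rule power_le_imp_le_base[of _ 2])
  have "(5.29::real) ^ Suc 2 \<le> 2.7182 ^ 5" by (simp add: power_numeral_reduce eval_nat_numeral)
  also have "\<dots> \<le> exp 1 ^ 5" by (rule power_mono[OF exp_one_bounds(1)]) simp
  also have "\<dots> = exp (5 / 3 :: real) ^ Suc 2" by (simp flip: exp_of_nat_mult)
  finally show "(5.29::real) ^ Suc 2 \<le> exp (5 / 3) ^ Suc 2" .
qed simp

text \<open>The point at which the energy of the test function at b = 0 reaches 1. With q = k / (k +
  1) the linear part costs q^k and the power part q^(k+1) ln ((test_end - 1) / k); this is the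
  solution of the resulting equation.\<close>

definition test_end :: "nat \<Rightarrow> real" where
  "test_end k = 1 + real k * exp ((1 + 1 / real k) ^ Suc k - (1 + 1 / real k))"

text \<open>After multiplication by exp 1 both sides are compared with affine functions of k: about
  4.93 k + 5.18 for the left one and 5.54 k + 4.01 for the right one. They cross just below k = 2,
  so this estimate does not reach k = 1.\<close>

lemma test_constant_ge2:
  assumes "2 \<le> k"
  shows "1 + exp (harm k) < exp (-1) * ((real k + 1) * (2 - (3 * real k + 1) / (2 * (2 * real k + 1)))) +
    exp (-1) * (test_end k - (real k + 1)) + exp (-1)"
proof -
  define x where "x = 1 / real k"
  have x: "0 < x" "x \<le> 1 / 2" "real k * x = 1" using assms by (auto simp: x_def)
  define L where "L = (1 + x) ^ Suc k - (1 + x)"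
  have "1 + real k * x + real k * (real k - 1) / 2 * x\<^sup>2 + real k * (real k - 1) * (real k - 2) / 6 * x ^ 3 \<le> (1 + x) ^ k"
    using x by (intro power_ge_cubic) auto
  moreover have "real k * (real k - 1) / 2 * x\<^sup>2 = (1 - x) / 2"
    using assms by (simp add: x_def power2_eq_square field_simps)
  moreover have "real k * (real k - 1) * (real k - 2) / 6 * x ^ 3 = (1 - x) * (1 - 2 * x) / 6"
    using assms by (simp add: x_def power3_eq_cube field_simps)
  ultimately have p: "1 + (1 - x) / 2 + (1 - x) * (1 - 2 * x) / 6 \<le> (1 + x) ^ k - 1" using x by simp
  have "5 / 3 + x / 3 \<le> (1 + x) * (1 + (1 - x) / 2 + (1 - x) * (1 - 2 * x) / 6)"
  proof -
    have "(1 + x) * (1 + (1 - x) / 2 + (1 - x) * (1 - 2 * x) / 6) = 5 / 3 + x / 3 + (x / 3) * (1 - 2 * x) + x ^ 3 / 3"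
      by (simp add: field_simps power3_eq_cube)
    moreover have "0 \<le> (x / 3) * (1 - 2 * x)" using x by (intro mult_nonneg_nonneg) auto
    moreover have "0 \<le> x ^ 3 / 3" using x by simp
    ultimately show ?thesis by linarith
  qed
  also have "\<dots> \<le> (1 + x) * ((1 + x) ^ k - 1)" using p x by (intro mult_left_mono) auto
  also have "\<dots> = L" by (simp add: L_def algebra_simps)
  finally have L: "5 / 3 + x / 3 \<le> L" .
  \<comment> \<open>The number 5.29 lies just below exp (5 / 3); since k x = 1, the correction x / 3
    turns into a constant after multiplication by k.\<close>
  have "5.29 * (1 + x / 3) \<le> exp (5 / 3) * exp (x / 3)"
    using exp_five_thirds exp_ge_add_one_self[of "x / 3"] x by (intro mult_mono) auto
  also have "\<dots> \<le> exp L" using L by (simp flip: exp_add)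
  finally have "real k * (5.29 * (1 + x / 3)) \<le> real k * exp L" by (intro mult_left_mono) auto
  moreover have "real k * (5.29 * (1 + x / 3)) = 5.29 * real k + 5.29 / 3" using x(3) by (simp add: algebra_simps)
  ultimately have kL: "5.29 * real k + 5.29 / 3 \<le> real k * exp L" by simp
  have te: "test_end k = 1 + real k * exp L" by (simp add: test_end_def L_def x_def)
  have frac: "(3 * real k + 1) / (2 * (2 * real k + 1)) \<le> 3 / 4" by (simp add: divide_le_eq)
  have c1: "(real k + 1) * (5 / 4) \<le> (real k + 1) * (2 - (3 * real k + 1) / (2 * (2 * real k + 1)))"
    using frac by (intro mult_left_mono) auto
  have "exp 1 * (1 + exp (harm k)) \<le> exp 1 + exp 1 * (2 * exp 1 / 3 * (real k + 1 / 2))"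
  proof -
    have "exp 1 * exp (harm k) \<le> exp 1 * (2 * exp 1 / 3 * (real k + 1 / 2))"
      using exp_harm_le[of k] assms by (intro mult_left_mono) auto
    then show ?thesis unfolding distrib_left[of "exp 1" 1] mult_1_right by (rule add_left_mono)
  qed
  also have "\<dots> \<le> 2.7183 + 2.7183 * (2 * 2.7183 / 3 * (real k + 1 / 2))"
    using exp_one_bounds(2) by (intro add_mono mult_mono divide_right_mono) auto
  also have "\<dots> < (real k + 1) * (5 / 4) + (5.29 * real k + 5.29 / 3 - real k) + 1"
    using assms by (simp add: field_simps)
  also have "\<dots> \<le> (real k + 1) * (2 - (3 * real k + 1) / (2 * (2 * real k + 1))) + (test_end k - (real k + 1)) + 1"
    using c1 kL unfolding te by linarith
  finally have "exp (-1) * (exp 1 * (1 + exp (harm k))) < exp (-1) * ((real k + 1) * (2 - (3 * real k + 1) / (2 * (2 * real k + 1))) + (test_end k - (real k + 1)) + 1)"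
    by simp
  moreover have "exp (-1) * (exp 1 * (1 + exp (harm k))) = 1 + exp (harm k :: real)"
    by (simp add: exp_minus)
  moreover have "e * (X + Y + 1) = e * X + e * Y + e" for e X Y :: real by (simp add: distrib_left)
  ultimately show ?thesis by (simp only:)
qed

section \<open>The test function at b = 0 and its functional\<close>

definition test_slope :: "nat \<Rightarrow> real" where
  "test_slope k = real k / (real k + 1) * real k powr (- 1 / (real k + 1))"

definition test_deriv :: "nat \<Rightarrow> real \<Rightarrow> real" where
  "test_deriv k t = (if t \<le> 0 then 0 else if t \<le> real k + 1 then test_slope k
     else if t \<le> test_end k then real k / (real k + 1) * (t - 1) powr (- 1 / (real k + 1)) else 0)"

text \<open>In the middle range the power (k + 1) / k of the function is t - 1, so the exponent of
  the functional is constantly -1 there. The first piece is the line through the origin tangent to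
  that curve, touching it at t = k + 1; the function is stopped where the energy is used up.\<close>

definition test_fun :: "nat \<Rightarrow> real \<Rightarrow> real" where
  "test_fun k t = (if t \<le> real k + 1 then test_slope k * t
     else if t \<le> test_end k then (t - 1) powr (real k / (real k + 1)) else (test_end k - 1) powr (real k / (real k + 1)))"

lemma test_end_ge:
  assumes "1 \<le> k" shows "real k + 1 \<le> test_end k"
proof -
  have "(1 + 1 / real k) ^ 1 \<le> (1 + 1 / real k) ^ Suc k" by (rule power_increasing) auto
  then have "1 \<le> exp ((1 + 1 / real k) ^ Suc k - (1 + 1 / real k))" by simp
  then show ?thesis unfolding test_end_def using mult_left_mono[of 1 _ "real k"] by simp
qed

lemma test_slope_pos: "1 \<le> k \<Longrightarrow> 0 < test_slope k"
  by (simp add: test_slope_def)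

lemma test_slope_mult: 
  assumes "1 \<le> k" shows "test_slope k * (real k + 1) = real k powr (real k / (real k + 1))"
proof -
  have "test_slope k * (real k + 1) = real k powr 1 * real k powr (- 1 / (real k + 1))"
    using assms by (simp add: test_slope_def add_nonneg_eq_0_iff)
  also have "\<dots> = real k powr (real k / (real k + 1))"
    unfolding powr_add[symmetric] by (rule arg_cong[of _ _ "\<lambda>x. real k powr x"]) (simp add: field_simps)
  finally show ?thesis .
qed

lemma decr_test_deriv:
  assumes k: "1 \<le> k" shows "decr (test_deriv k)"
proof -
  have le: "(t - 1) powr (- 1 / (real k + 1)) \<le> (s - 1) powr (- 1 / (real k + 1))" if "1 < s" "s \<le> t" for s t :: real
    using that by (intro powr_mono2') auto
  have "test_deriv k t \<le> test_deriv k s" if "0 < s" "s \<le> t" for s t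
    using le[of s t] le[of "real k + 1" t] that k test_slope_pos[OF k]
    by (auto simp: test_deriv_def test_slope_def intro!: divide_right_mono mult_left_mono)
  then show ?thesis
    unfolding decr_def using test_slope_pos[OF k] by (auto simp: test_deriv_def)
qed

lemma prim_test_deriv:
  assumes k: "1 \<le> k" and t: "0 \<le> t"
  shows "prim (test_deriv k) t = test_fun k t"
proof -
  note A = test_end_ge[OF k]
  have kk: "real k > 0" using k by simp
  have "continuous_on ({..real k + 1} \<union> ({real k + 1..test_end k} \<union> {test_end k..})) (test_fun k)"
  proof (intro continuous_on_closed_Un)
    have "continuous_on {..real k + 1} (\<lambda>t. test_slope k * t)" by (intro continuous_intros)
    then show "continuous_on {..real k + 1} (test_fun k)"
      by (rule continuous_on_eq) (auto simp: test_fun_def)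
    have "continuous_on {real k + 1..test_end k} (\<lambda>t. (t - 1) powr (real k / (real k + 1)))"
      using kk by (intro continuous_intros) auto
    then show "continuous_on {real k + 1..test_end k} (test_fun k)"
      by (rule continuous_on_eq) (use test_slope_mult[OF k] in \<open>auto simp: test_fun_def\<close>)
    have "continuous_on {test_end k..} (\<lambda>t. (test_end k - 1) powr (real k / (real k + 1)))" by (intro continuous_intros)
    then show "continuous_on {test_end k..} (test_fun k)"
      by (rule continuous_on_eq) (use A test_slope_mult[OF k] in \<open>auto simp: test_fun_def\<close>)
  qed auto
  moreover have "{..real k + 1} \<union> ({real k + 1..test_end k} \<union> {test_end k..}) = UNIV" using A by auto
  ultimately have cont: "continuous_on {0..t} (test_fun k)" by (auto intro: continuous_on_subset)
  have "(test_deriv k has_integral (test_fun k t - test_fun k 0)) {0..t}"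
  proof (rule fundamental_theorem_of_calculus_interior_strong[of "{real k + 1, test_end k}"])
    fix s assume s: "s \<in> {0<..<t} - {real k + 1, test_end k}"
    consider "s < real k + 1" | "real k + 1 < s" "s < test_end k" | "test_end k < s" using s by force
    then have "(test_fun k has_real_derivative test_deriv k s) (at s)"
    proof cases
      case 1
      have "((\<lambda>t. test_slope k * t) has_real_derivative test_slope k) (at s)" by (auto intro!: derivative_eq_intros)
      then have "(test_fun k has_real_derivative test_slope k) (at s)"
        by (rule has_field_derivative_transform_within_open[of _ _ _ "{..<real k + 1}"]) (use 1 in \<open>auto simp: test_fun_def\<close>)
      then show ?thesis using 1 s by (simp add: test_deriv_def)
    next
      case 2
      have e: "real k / (real k + 1) - 1 = - 1 / (real k + 1)" by (simp add: field_simps)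
      have "((\<lambda>t. (t - 1) powr (real k / (real k + 1))) has_real_derivative
          real k / (real k + 1) * (s - 1) powr (- 1 / (real k + 1))) (at s)"
        using 2 kk unfolding e[symmetric] by (auto intro!: derivative_eq_intros)
      then have "(test_fun k has_real_derivative real k / (real k + 1) * (s - 1) powr (- 1 / (real k + 1))) (at s)"
        by (rule has_field_derivative_transform_within_open[of _ _ _ "{real k + 1<..<test_end k}"]) (use 2 in \<open>auto simp: test_fun_def\<close>)
      then show ?thesis using 2 s by (simp add: test_deriv_def)
    next
      case 3
      have "((\<lambda>t. (test_end k - 1) powr (real k / (real k + 1))) has_real_derivative 0) (at s)" by simp
      then have "(test_fun k has_real_derivative 0) (at s)"
        by (rule has_field_derivative_transform_within_open[of _ _ _ "{test_end k<..}"]) (use 3 A in \<open>auto simp: test_fun_def\<close>)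
      then show ?thesis using 3 s A by (simp add: test_deriv_def)
    qed
    then show "(test_fun k has_vector_derivative test_deriv k s) (at s)"
      by (simp add: has_real_derivative_iff_has_vector_derivative)
  qed (use t cont in auto)
  then show ?thesis by (simp add: prim_def integral_unique test_fun_def)
qed

lemma test_energy:
  assumes k: "1 \<le> k"
  shows "(\<integral>\<^sup>+s\<in>{0<..}. ennreal (test_deriv k s ^ Suc k) \<partial>lborel) \<le> 1"
proof -
  note A = test_end_ge[OF k]
  have kk: "real k > 0" using k by simp
  define q where "q = real k / (real k + 1)"
  have q: "q > 0" using kk by (simp add: q_def)
  have pw: "(q * u powr (- 1 / (real k + 1))) ^ Suc k = q ^ Suc k / u" if "u > 0" for u
  proof -
    have "(u powr (- 1 / (real k + 1))) ^ Suc k = u powr (- 1)"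
      using that by (subst powr_power) (auto simp: add_nonneg_eq_0_iff add.commute)
    then show ?thesis using that unfolding power_mult_distrib by (simp add: powr_minus field_simps)
  qed
  have s1: "test_slope k ^ Suc k = q ^ Suc k / real k"
    unfolding test_slope_def q_def[symmetric] by (rule pw[OF kk])
  have "(\<integral>\<^sup>+s\<in>{0<..}. ennreal (test_deriv k s ^ Suc k) \<partial>lborel) \<le>
    (\<integral>\<^sup>+s. ennreal (q ^ Suc k / real k) * indicator {0..real k + 1} s + ennreal (q ^ Suc k / (s - 1)) * indicator {real k + 1..test_end k} s \<partial>lborel)"
  proof (rule nn_integral_mono)
    fix s
    show "ennreal (test_deriv k s ^ Suc k) * indicator {0<..} s \<le> ennreal (q ^ Suc k / real k) * indicator {0..real k + 1} s + ennreal (q ^ Suc k / (s - 1)) * indicator {real k + 1..test_end k} s"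
      using s1 pw[of "s - 1"] kk unfolding test_deriv_def q_def[symmetric]
      by (auto simp: indicator_def simp del: power_Suc)
  qed
  also have "\<dots> = (\<integral>\<^sup>+s. ennreal (q ^ Suc k / real k) * indicator {0..real k + 1} s \<partial>lborel) +
      (\<integral>\<^sup>+s. ennreal (q ^ Suc k / (s - 1)) * indicator {real k + 1..test_end k} s \<partial>lborel)"
    by (rule nn_integral_add) auto
  also have "(\<integral>\<^sup>+s. ennreal (q ^ Suc k / real k) * indicator {0..real k + 1} s \<partial>lborel) = ennreal (q ^ k)"
  proof -
    have "(\<integral>\<^sup>+s. ennreal (q ^ Suc k / real k) * indicator {0..real k + 1} s \<partial>lborel) = ennreal (q ^ Suc k / real k) * ennreal (real k + 1)"
      by (subst nn_integral_cmult_indicator) auto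
    also have "\<dots> = ennreal (q ^ Suc k / real k * (real k + 1))" using q by (intro ennreal_mult[symmetric]) auto
    also have "q ^ Suc k / real k * (real k + 1) = q ^ k * (q * (real k + 1) / real k)" by simp
    also have "q * (real k + 1) / real k = 1" using kk by (simp add: q_def add_nonneg_eq_0_iff)
    finally show ?thesis by simp
  qed
  also have "(\<integral>\<^sup>+s. ennreal (q ^ Suc k / (s - 1)) * indicator {real k + 1..test_end k} s \<partial>lborel) = ennreal (1 - q ^ k)"
  proof -
    have "((\<lambda>s. q ^ Suc k / (s - 1)) has_integral (q ^ Suc k * ln (test_end k - 1) - q ^ Suc k * ln (real k + 1 - 1))) {real k + 1..test_end k}"
    proof (rule fundamental_theorem_of_calculus[OF A])
      fix s assume s: "s \<in> {real k + 1..test_end k}"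
      have "((\<lambda>s. q ^ Suc k * ln (s - 1)) has_real_derivative q ^ Suc k / (s - 1)) (at s within {real k + 1..test_end k})"
        using s kk by (auto intro!: derivative_eq_intros)
      then show "((\<lambda>s. q ^ Suc k * ln (s - 1)) has_vector_derivative q ^ Suc k / (s - 1)) (at s within {real k + 1..test_end k})"
        by (simp add: has_real_derivative_iff_has_vector_derivative)
    qed
    moreover have "q ^ Suc k * ln (test_end k - 1) - q ^ Suc k * ln (real k + 1 - 1) = 1 - q ^ k"
    proof -
      have iq: "1 + 1 / real k = 1 / q" using kk by (simp add: q_def field_simps)
      have "ln (test_end k - 1) = ln (real k) + ((1 / q) ^ Suc k - 1 / q)"
        using kk by (simp add: test_end_def ln_mult iq)
      then have "q ^ Suc k * ln (test_end k - 1) - q ^ Suc k * ln (real k + 1 - 1) = q ^ Suc k * ((1 / q) ^ Suc k - 1 / q)"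
        unfolding right_diff_distrib[symmetric] by simp
      also have "\<dots> = (q * (1 / q)) ^ Suc k - q ^ k * (q * (1 / q))"
        unfolding power_mult_distrib by (simp add: algebra_simps)
      also have "\<dots> = 1 - q ^ k" using q by simp
      finally show ?thesis .
    qed
    ultimately show ?thesis using q kk
      by (subst nn_integral_has_integral_lebesgue'[where I = "1 - q ^ k"]) auto
  qed
  also have "ennreal (q ^ k) + ennreal (1 - q ^ k) = 1"
  proof -
    have "q ^ k \<le> 1" using q by (intro power_le_one) (auto simp: q_def)
    then show ?thesis using q by (simp add: ennreal_plus[symmetric] del: ennreal_plus)
  qed
  finally show ?thesis .
qed

text \<open>In the middle range the integrand is exp (-1), and beyond \<open>test_end\<close> it is
  exp (test_end k - 1 - s) with integral exp (-1). Only the first range has to be estimated, by any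
  nonnegative minorant p with known integral.\<close>

lemma test_functional_ge:
  assumes k: "1 \<le> k" and p: "(p has_integral c) {0..real k + 1}" "\<And>t. t \<in> {0..real k + 1} \<Longrightarrow> 0 \<le> p t"
    and le: "\<And>t. t \<in> {0<..real k + 1} \<Longrightarrow> p t \<le> exp (real k * (t / (real k + 1)) powr ((real k + 1) / real k) - t)"
  shows "ennreal (c + exp (-1) * (test_end k - (real k + 1)) + exp (-1)) \<le>
    (\<integral>\<^sup>+s\<in>{0<..}. ennreal (exp (prim (test_deriv k) s powr ((real k + 1) / real k) - s)) \<partial>lborel)"
proof -
  note A = test_end_ge[OF k]
  have kk: "real k > 0" using k by simp
  have c0: "0 \<le> c" using p has_integral_nonneg by blast
  have mp: "(\<lambda>s. ennreal (p s) * indicator {0..real k + 1} s) \<in> borel_measurable lebesgue"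
  proof -
    have "(\<lambda>s. indicator {0..real k + 1} s *\<^sub>R p s) \<in> borel_measurable lebesgue"
      using p(1) by (rule has_integral_implies_lebesgue_measurable)
    then have "(\<lambda>s. ennreal (indicator {0..real k + 1} s *\<^sub>R p s)) \<in> borel_measurable lebesgue" by simp
    also have "(\<lambda>s. ennreal (indicator {0..real k + 1} s *\<^sub>R p s)) = (\<lambda>s. ennreal (p s) * indicator {0..real k + 1} s)"
      by (auto simp: indicator_def fun_eq_iff)
    finally show ?thesis .
  qed
  have "ennreal (c + exp (-1) * (test_end k - (real k + 1)) + exp (-1)) =
      ennreal c + (ennreal (exp (-1)) * ennreal (test_end k - (real k + 1)) + ennreal (exp (-1)))"
    using c0 A by (subst ennreal_mult[symmetric]) (auto simp: ennreal_plus[symmetric] simp del: ennreal_plus)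
  also have "\<dots> = (\<integral>\<^sup>+s. ennreal (p s) * indicator {0..real k + 1} s \<partial>lebesgue) +
      ((\<integral>\<^sup>+s. ennreal (exp (-1)) * indicator {real k + 1<..test_end k} s \<partial>lebesgue) +
      (\<integral>\<^sup>+s. ennreal (exp (test_end k - 1)) * (ennreal (exp (- 1 * s)) * indicator {test_end k..} s) \<partial>lebesgue))"
  proof -
    have "(\<integral>\<^sup>+s. ennreal (p s) * indicator {0..real k + 1} s \<partial>lebesgue) = ennreal c"
      unfolding nn_integral_completion by (rule nn_integral_has_integral_lebesgue'[OF p(2,1)])
    moreover have "(\<integral>\<^sup>+s. ennreal (exp (-1)) * indicator {real k + 1<..test_end k} s \<partial>lebesgue) = ennreal (exp (-1)) * ennreal (test_end k - (real k + 1))"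
      unfolding nn_integral_completion using A by (subst nn_integral_cmult_indicator) auto
    moreover have "(\<integral>\<^sup>+s. ennreal (exp (test_end k - 1)) * (ennreal (exp (- 1 * s)) * indicator {test_end k..} s) \<partial>lebesgue) = ennreal (exp (-1))"
      unfolding nn_integral_completion using nn_integral_exp_atLeast[of 1 "test_end k"]
      by (subst nn_integral_cmult) (auto simp: ennreal_mult[symmetric] exp_add[symmetric])
    ultimately show ?thesis by simp
  qed
  also have "\<dots> = (\<integral>\<^sup>+s. ennreal (p s) * indicator {0..real k + 1} s + (ennreal (exp (-1)) * indicator {real k + 1<..test_end k} s +
      ennreal (exp (test_end k - 1)) * (ennreal (exp (- 1 * s)) * indicator {test_end k..} s)) \<partial>lebesgue)"
  proof -
    have "(\<lambda>s. ennreal (exp (-1)) * indicator {real k + 1<..test_end k} s) \<in> borel_measurable lebesgue"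
      "(\<lambda>s. ennreal (exp (test_end k - 1)) * (ennreal (exp (- 1 * s)) * indicator {test_end k..} s)) \<in> borel_measurable lebesgue"
      by (intro measurable_completion; measurable)+
    then show ?thesis using mp by (subst nn_integral_add[symmetric]; (subst nn_integral_add[symmetric])?) auto
  qed
  also have "\<dots> = (\<integral>\<^sup>+s. ennreal (p s) * indicator {0..real k + 1} s + (ennreal (exp (-1)) * indicator {real k + 1<..test_end k} s +
      ennreal (exp (test_end k - 1)) * (ennreal (exp (- 1 * s)) * indicator {test_end k..} s)) \<partial>lborel)"
    by (rule nn_integral_completion)
  also have "\<dots> \<le> (\<integral>\<^sup>+s\<in>{0<..}. ennreal (exp (prim (test_deriv k) s powr ((real k + 1) / real k) - s)) \<partial>lborel)"
  proof (rule nn_integral_mono_AE)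
    have q: "real k / (real k + 1) * ((real k + 1) / real k) = 1" using kk by (simp add: add_nonneg_eq_0_iff)
    have low: "p s \<le> exp (test_fun k s powr ((real k + 1) / real k) - s)" if s: "s \<in> {0<..real k + 1}" for s
    proof -
      have tf: "test_fun k s = test_slope k * (real k + 1) * (s / (real k + 1))"
        using s by (simp add: test_fun_def add_nonneg_eq_0_iff)
      have "test_fun k s powr ((real k + 1) / real k) = real k * (s / (real k + 1)) powr ((real k + 1) / real k)"
        unfolding tf test_slope_mult[OF k] using s kk by (subst powr_mult) (auto simp: powr_powr q)
      then show ?thesis using le[OF s] by simp
    qed
    show "AE s in lborel. ennreal (p s) * indicator {0..real k + 1} s + (ennreal (exp (-1)) * indicator {real k + 1<..test_end k} s +
      ennreal (exp (test_end k - 1)) * (ennreal (exp (- 1 * s)) * indicator {test_end k..} s))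
      \<le> ennreal (exp (prim (test_deriv k) s powr ((real k + 1) / real k) - s)) * indicator {0<..} s"
      using AE_lborel_singleton[of 0] AE_lborel_singleton[of "test_end k"]
    proof eventually_elim
      case (elim s)
      consider "s < 0" | "s \<in> {0<..real k + 1}" "s < test_end k" | "real k + 1 < s" "s < test_end k" | "test_end k < s"
        using elim A by force
      then show ?case
      proof cases
        case 1
        then show ?thesis using A kk by (simp add: indicator_def)
      next
        case 2
        then show ?thesis using low[OF 2(1)] by (simp add: indicator_def prim_test_deriv[OF k] ennreal_leI)
      next
        case 3
        then have "prim (test_deriv k) s powr ((real k + 1) / real k) - s = -1"
          using kk by (simp add: prim_test_deriv[OF k] test_fun_def powr_powr q)
        then show ?thesis using 3 kk by (simp add: indicator_def)
      next
        case 4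
        then have "prim (test_deriv k) s powr ((real k + 1) / real k) - s = (test_end k - 1) + - 1 * s"
          using kk A by (simp add: prim_test_deriv[OF k] test_fun_def powr_powr q)
        then show ?thesis using 4 kk A by (simp add: indicator_def ennreal_mult[symmetric] exp_add[symmetric])
      qed
    qed
  qed
  finally show ?thesis .
qed

lemma test_functional_gt:
  assumes k: "1 \<le> k"
  shows "ennreal (1 + exp (harm k)) <
    (\<integral>\<^sup>+s\<in>{0<..}. ennreal (exp (prim (test_deriv k) s powr ((real k + 1) / real k) - s)) \<partial>lborel)"
proof (cases "k = 1")
  case True
  \<comment> \<open>For k = 1 the claim reduces to a first-range constant above exp 1. The linear
    minorant of the other case would give 8 / 3 < exp 1; the quadratic Taylor bound in v = (1 - t /
    2)^2 gives 43 / 15 > exp 1.\<close>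
  define F where "F t = exp (-1) * (t - 2 / 3 * (1 - t / 2) ^ 3 - (1 - t / 2) ^ 5 / 5)" for t :: real
  define p where "p t = exp (-1) * (1 + (1 - t / 2)\<^sup>2 + (1 - t / 2) ^ 4 / 2)" for t :: real
  have "(p has_integral (F 2 - F 0)) {0..2}"
  proof (rule fundamental_theorem_of_calculus)
    fix t :: real
    have "(F has_real_derivative p t) (at t within {0..2})"
      unfolding F_def p_def by (auto intro!: derivative_eq_intros simp: field_simps power2_eq_square)
    then show "(F has_vector_derivative p t) (at t within {0..2})"
      by (simp add: has_real_derivative_iff_has_vector_derivative)
  qed simp
  moreover have "F 2 - F 0 = exp (-1) * (43 / 15)" by (simp add: F_def field_simps)
  ultimately have int: "(p has_integral exp (-1) * (43 / 15)) {0..real k + 1}" using True by simp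
  have "ennreal (exp (-1) * (43 / 15) + exp (-1) * (test_end k - (real k + 1)) + exp (-1)) \<le>
    (\<integral>\<^sup>+s\<in>{0<..}. ennreal (exp (prim (test_deriv k) s powr ((real k + 1) / real k) - s)) \<partial>lborel)"
  proof (rule test_functional_ge[OF k int])
    fix t :: real
    show "0 \<le> p t" by (simp add: p_def)
    assume t: "t \<in> {0<..real k + 1}"
    define v where "v = (1 - t / 2)\<^sup>2"
    have "1 + v + v\<^sup>2 / 2 \<le> exp v" by (rule exp_lower_Taylor_quadratic) (simp add: v_def)
    moreover have "v\<^sup>2 = (1 - t / 2) ^ 4" by (simp add: v_def flip: power_mult)
    ultimately have "p t \<le> exp (-1) * exp v" by (simp add: p_def v_def)
    also have "\<dots> = exp (real k * (t / (real k + 1)) powr ((real k + 1) / real k) - t)"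
    proof -
      have "(t / 2) powr 2 = (t / 2)\<^sup>2" using t by (simp add: powr_numeral)
      then show ?thesis using True unfolding exp_add[symmetric] v_def by (simp add: power2_eq_square algebra_simps)
    qed
    finally show "p t \<le> exp (real k * (t / (real k + 1)) powr ((real k + 1) / real k) - t)" .
  qed
  moreover have "1 + exp (harm k) < exp (-1) * (43 / 15) + exp (-1) * (test_end k - (real k + 1)) + exp (-1)"
  proof -
    have "test_end k = 1 + exp 1 * exp 1" using True by (simp add: test_end_def power2_eq_square flip: exp_add)
    then have "exp (-1) * (43 / 15) + exp (-1) * (test_end k - (real k + 1)) + exp (-1) = exp (-1) * (43 / 15) + (exp 1 :: real)"
      using True by (simp add: exp_minus field_simps)
    moreover have "1 < exp (-1) * (43 / 15 :: real)"
      using exp_one_bounds(2) by (simp add: exp_minus field_simps)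
    ultimately show ?thesis using True by (simp add: harm_def)
  qed
  moreover have "0 < 1 + exp (harm k :: real)" by (simp add: add_pos_pos)
  ultimately show ?thesis by (meson ennreal_lessI less_trans order.strict_trans2)
next
  case False
  then have k2: "2 \<le> k" using k by simp
  have kk: "real k > 0" using k by simp
  define q where "q = (real k + 1) / real k"
  have q1: "q + 1 = (2 * real k + 1) / real k" using kk by (simp add: q_def field_simps)
  have qp: "q > 0" using kk by (simp add: q_def)
  define F where "F t = exp (-1) * (2 * t + real k * ((real k + 1) / (q + 1)) * (t / (real k + 1)) powr (q + 1) - t\<^sup>2 / 2)" for t
  define p where "p t = exp (-1) * (2 + real k * (t / (real k + 1)) powr q - t)" for t
  define c where "c = exp (-1) * ((real k + 1) * (2 - (3 * real k + 1) / (2 * (2 * real k + 1))))"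
  have "(p has_integral (F (real k + 1) - F 0)) {0..real k + 1}"
  proof (rule fundamental_theorem_of_calculus_interior)
    show "continuous_on {0..real k + 1} F"
      unfolding F_def using qp by (intro continuous_intros continuous_on_powr') auto
    fix t assume t: "t \<in> {0<..<real k + 1}"
    have "(F has_real_derivative p t) (at t)"
      unfolding F_def p_def using t qp kk
      by (auto intro!: derivative_eq_intros simp: add_nonneg_eq_0_iff field_simps)
    then show "(F has_vector_derivative p t) (at t)"
      by (simp add: has_real_derivative_iff_has_vector_derivative)
  qed simp
  moreover have "F (real k + 1) - F 0 = c"
  proof -
    have "real k * ((real k + 1) / (q + 1)) = (real k + 1) * (real k * real k / (2 * real k + 1))"
      unfolding q1 using kk by (simp add: field_simps)
    moreover have "2 * (real k + 1) + (real k + 1) * (real k * real k / (2 * real k + 1)) - (real k + 1)\<^sup>2 / 2 =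
      (real k + 1) * (2 - (3 * real k + 1) / (2 * (2 * real k + 1)))"
      using kk by (simp add: power2_eq_square divide_simps) (simp add: algebra_simps)
    ultimately show ?thesis using qp by (simp add: F_def c_def)
  qed
  ultimately have int: "(p has_integral c) {0..real k + 1}" by simp
  \<comment> \<open>With \<tau> = t / (k + 1) this is Young's inequality for \<tau> powr (1 / k)
    against 1; the exponent is thus at least -1 on the first range too, and 1 + x \<le> exp x is
    applied to a nonnegative x.\<close>
  have u: "0 \<le> 1 + real k * (t / (real k + 1)) powr q - t" if t: "t \<in> {0..real k + 1}" for t
  proof -
    define \<tau> where "\<tau> = t / (real k + 1)"
    have \<tau>: "\<tau> \<ge> 0" using t by (simp add: \<tau>_def)
    define z where "z = \<tau> powr (1 / real k)"
    have zk: "z ^ k = \<tau>" using kk \<tau> k by (cases "\<tau> = 0") (simp_all add: z_def powr_power)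
    have zq: "z ^ Suc k = \<tau> powr q"
      using kk \<tau> by (cases "\<tau> = 0") (simp_all add: z_def powr_power q_def add.commute del: power_Suc)
    have "(real k + 1) * z ^ k * 1 \<le> real k * z ^ Suc k + 1 ^ Suc k"
      by (rule weighted_amgm) (simp_all add: z_def)
    then have "(real k + 1) * \<tau> \<le> real k * \<tau> powr q + 1" unfolding zk zq by simp
    then show ?thesis by (simp add: \<tau>_def add_nonneg_eq_0_iff)
  qed
  have "ennreal (c + exp (-1) * (test_end k - (real k + 1)) + exp (-1)) \<le>
    (\<integral>\<^sup>+s\<in>{0<..}. ennreal (exp (prim (test_deriv k) s powr ((real k + 1) / real k) - s)) \<partial>lborel)"
  proof (rule test_functional_ge[OF k int])
    fix t assume "t \<in> {0..real k + 1}"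
    then show "0 \<le> p t" using u[of t] by (simp add: p_def)
  next
    fix t assume t: "t \<in> {0<..real k + 1}"
    have "1 + (1 + real k * (t / (real k + 1)) powr q - t) \<le> exp (1 + real k * (t / (real k + 1)) powr q - t)"
      by (rule exp_ge_add_one_self)
    then have "p t \<le> exp (-1) * exp (1 + real k * (t / (real k + 1)) powr q - t)"
      unfolding p_def by (intro mult_left_mono) auto
    also have "\<dots> = exp (real k * (t / (real k + 1)) powr q - t)" unfolding exp_add[symmetric] by simp
    finally show "p t \<le> exp (real k * (t / (real k + 1)) powr ((real k + 1) / real k) - t)" by (simp add: q_def)
  qed
  moreover have "1 + exp (harm k) < c + exp (-1) * (test_end k - (real k + 1)) + exp (-1)"
    unfolding c_def by (rule test_constant_ge2[OF k2])
  moreover have "0 < 1 + exp (harm k :: real)" by (simp add: add_pos_pos)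
  ultimately show ?thesis by (meson ennreal_lessI less_trans order.strict_trans2)
qed

section \<open>Existence of maximisers of the reduced functional\<close>

lemma prim_cmult: "prim (\<lambda>s. c * g s) t = c * prim g t"
  by (simp add: prim_def)

lemma decr_cmult: "decr g \<Longrightarrow> 0 \<le> c \<Longrightarrow> decr (\<lambda>s. c * g s)"
  by (auto simp: decr_def intro: mult_left_mono)

text \<open>On the support of the test density the weight s powr (b k) is at most its value at
  \<open>test_end k\<close>. The factor compensates for this and for the budget (1 - b)^k, and it
  tends to 1 as b tends to 0.\<close>

lemma (in mt_class) scaled_test:
  defines "scl \<equiv> ((1 - b) * test_end k powr - b) powr (real k / (real k + 1))"
  shows "cls (\<lambda>s. scl * test_deriv k s)"
proof -
  have A: "test_end k > 0" using test_end_ge[OF k] by simp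
  have "test_end k \<ge> 1" using test_end_ge[OF k] by simp
  have l0: "scl \<ge> 0" by (simp add: scl_def)
  have lk: "scl ^ Suc k * test_end k powr (b * real k) = (1 - b) ^ k"
  proof -
    have "(1 - b) * test_end k powr - b > 0" using b1 A by simp
    then have "scl ^ Suc k = ((1 - b) * test_end k powr - b) powr real k"
      unfolding scl_def by (subst powr_power) (auto simp: add_nonneg_eq_0_iff add.commute)
    also have "\<dots> = (1 - b) ^ k * test_end k powr (- (b * real k))"
      using b1 k A by (simp add: powr_mult powr_realpow powr_powr)
    finally show ?thesis using A by (simp add: powr_minus field_simps)
  qed
  note d = decr_test_deriv[OF k]
  have [measurable]: "test_deriv k \<in> borel_measurable borel" by (rule decr_borel_measurable[OF d])
  have "energy {0<..} (\<lambda>s. scl * test_deriv k s) \<le>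
    (\<integral>\<^sup>+s. ennreal (scl ^ Suc k * test_end k powr (b * real k)) * (ennreal (test_deriv k s ^ Suc k) * indicator {0<..} s) \<partial>lborel)"
    unfolding energy_def
  proof (rule nn_integral_mono)
    fix s
    show "ennreal ((scl * test_deriv k s) ^ Suc k * s powr (b * real k)) * indicator {0<..} s
      \<le> ennreal (scl ^ Suc k * test_end k powr (b * real k)) * (ennreal (test_deriv k s ^ Suc k) * indicator {0<..} s)"
    proof (cases "0 < s \<and> s \<le> test_end k")
      case True
      have "(scl * test_deriv k s) ^ Suc k * s powr (b * real k) \<le> (scl * test_deriv k s) ^ Suc k * test_end k powr (b * real k)"
        using True l0 decrD(2)[OF d] b0 by (intro mult_left_mono powr_mono2) auto
      also have "\<dots> = (scl ^ Suc k * test_end k powr (b * real k)) * test_deriv k s ^ Suc k"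
        by (simp add: power_mult_distrib)
      finally show ?thesis using True l0 decrD(2)[OF d]
        by (simp add: ennreal_mult[symmetric] ennreal_leI del: power_Suc)
    next
      case False
      then show ?thesis using test_end_ge[OF k] by (auto simp: test_deriv_def indicator_def)
    qed
  qed
  also have "\<dots> = ennreal ((1 - b) ^ k) * (\<integral>\<^sup>+s. ennreal (test_deriv k s ^ Suc k) * indicator {0<..} s \<partial>lborel)"
    unfolding lk by (rule nn_integral_cmult) simp
  also have "\<dots> \<le> ennreal ((1 - b) ^ k) * 1"
    by (intro mult_left_mono test_energy[OF k]) simp
  finally show ?thesis
    unfolding cls_def using decr_cmult[OF d l0] by simp
qed

text \<open>Otherwise the level is not exceeded for some parameters b j tending to 0. The scaled
  test functions and their exponents converge, so Fatou's lemma would bound the functional at b = 0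
  by the same level, against \<open>test_functional_gt\<close>. It matters that the level is the
  same for all b.\<close>

lemma exceeds_concentration_level:
  assumes k: "1 \<le> k"
  shows "\<exists>\<beta>\<^sub>0>0. \<beta>\<^sub>0 < 1 \<and> (\<forall>b. 0 \<le> b \<and> b < \<beta>\<^sub>0 \<longrightarrow> (\<exists>g. mt_class.cls k b g \<and> ennreal (1 + exp (harm k)) < mt_class.J k b g))"
proof (rule ccontr)
  assume contra: "\<not> ?thesis"
  have "\<exists>b. 0 \<le> b \<and> b < 1 / (real j + 2) \<and> (\<forall>g. mt_class.cls k b g \<longrightarrow> mt_class.J k b g \<le> ennreal (1 + exp (harm k)))" for j :: nat
  proof -
    have "0 < 1 / (real j + 2)" "1 / (real j + 2) < 1" by auto
    then show ?thesis using contra by (meson not_le)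
  qed
  then obtain b where b: "\<And>j. 0 \<le> b j" "\<And>j. b j < 1 / (real j + 2)"
    "\<And>j g. mt_class.cls k (b j) g \<Longrightarrow> mt_class.J k (b j) g \<le> ennreal (1 + exp (harm k))"
    by metis
  have b1: "b j < 1" for j
  proof -
    have "1 / (real j + 2) < 1" by simp
    then show ?thesis using b(2)[of j] by linarith
  qed
  have mt: "mt_class k (b j)" for j using k b(1)[of j] b1[of j] by unfold_locales
  have blim: "b \<longlonglongrightarrow> 0"
  proof (rule tendsto_sandwich[of "\<lambda>_. 0" _ _ "\<lambda>j. 1 / (real j + 2)"])
    show "(\<lambda>j. 1 / (real j + 2)) \<longlonglongrightarrow> 0" by real_asymp
  qed (use b in \<open>auto intro!: always_eventually less_imp_le\<close>)
  define l where "l j = ((1 - b j) * test_end k powr - b j) powr (real k / (real k + 1))" for j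
  define G where "G j = (real k + 1) / (real k * (1 - b j))" for j
  define y where "y = prim (test_deriv k)"
  have A: "test_end k > 0" using test_end_ge[OF k] by simp
  have d: "decr_int (test_deriv k)"
  proof -
    interpret mt_class k 0 using k by unfold_locales auto
    have "energy {0<..} (test_deriv k) \<le> 1"
      using test_energy[OF k] unfolding energy_def
      by (rule order_trans[rotated]) (auto intro!: nn_integral_mono simp: indicator_def)
    then show ?thesis using decr_test_deriv[OF k] by (intro decr_int_energy) (auto intro: le_less_trans)
  qed
  have llim: "l \<longlonglongrightarrow> 1"
  proof -
    have "l \<longlonglongrightarrow> ((1 - 0) * test_end k powr - 0) powr (real k / (real k + 1))"
      unfolding l_def using A by (intro tendsto_intros blim) auto
    then show ?thesis using A by simp
  qed
  have Glim: "G \<longlonglongrightarrow> (real k + 1) / real k"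
  proof -
    have "G \<longlonglongrightarrow> (real k + 1) / (real k * (1 - 0))"
      unfolding G_def using k by (intro tendsto_intros blim) auto
    then show ?thesis by simp
  qed
  have J: "(\<integral>\<^sup>+s\<in>{0<..}. ennreal (exp ((l j * y s) powr G j - s)) \<partial>lborel) \<le> ennreal (1 + exp (harm k))" for j
  proof -
    interpret mt_class k "b j" by (rule mt)
    have "J (\<lambda>s. l j * test_deriv k s) \<le> ennreal (1 + exp (harm k))"
      using scaled_test unfolding l_def by (rule b(3))
    then show ?thesis by (simp add: J_def y_def prim_cmult G_def gam_def kap_def)
  qed
  have ym: "(\<lambda>s. y s * indicator {0<..} s) \<in> borel_measurable borel"
  proof -
    have "continuous_on {0<..} y" unfolding y_def by (rule continuous_on_subset[OF prim_continuous_on[OF d]]) auto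
    then have "(\<lambda>s. indicator {0<..} s *\<^sub>R y s) \<in> borel_measurable borel"
      by (intro borel_measurable_continuous_on_indicator) auto
    then show ?thesis by (simp add: mult.commute)
  qed
  have "(\<integral>\<^sup>+s\<in>{0<..}. ennreal (exp (y s powr ((real k + 1) / real k) - s)) \<partial>lborel) =
      (\<integral>\<^sup>+s. liminf (\<lambda>j. ennreal (exp ((l j * y s) powr G j - s)) * indicator {0<..} s) \<partial>lborel)"
  proof (rule nn_integral_cong)
    fix s
    have "(\<lambda>j. ennreal (exp ((l j * y s) powr G j - s)) * indicator {0<..} s) \<longlonglongrightarrow>
        ennreal (exp (y s powr ((real k + 1) / real k) - s)) * indicator {0<..} s"
    proof (cases "s > 0")
      case True
      have "0 \<le> y s" using prim_nonneg[OF d, of s] True by (simp add: y_def)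
      then have "(\<lambda>j. (l j * y s) powr G j) \<longlonglongrightarrow> (1 * y s) powr ((real k + 1) / real k)"
        using k by (intro tendsto_powr2 tendsto_mult llim Glim tendsto_const) (auto simp: l_def intro!: always_eventually)
      then show ?thesis using True by (auto intro!: tendsto_intros)
    qed simp
    then show "ennreal (exp (y s powr ((real k + 1) / real k) - s)) * indicator {0<..} s =
        liminf (\<lambda>j. ennreal (exp ((l j * y s) powr G j - s)) * indicator {0<..} s)"
      by (simp add: lim_imp_Liminf)
  qed
  also have "\<dots> \<le> liminf (\<lambda>j. \<integral>\<^sup>+s\<in>{0<..}. ennreal (exp ((l j * y s) powr G j - s)) \<partial>lborel)"
  proof (rule nn_integral_liminf)
    fix j
    have "(\<lambda>s. ennreal (exp ((l j * (y s * indicator {0<..} s)) powr G j - s)) * indicator {0<..} s) \<in> borel_measurable lborel"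
      using ym by measurable
    also have "(\<lambda>s. ennreal (exp ((l j * (y s * indicator {0<..} s)) powr G j - s)) * indicator {0<..} s) =
        (\<lambda>s. ennreal (exp ((l j * y s) powr G j - s)) * indicator {0<..} s)"
      by (auto simp: indicator_def fun_eq_iff)
    finally show "(\<lambda>s. ennreal (exp ((l j * y s) powr G j - s)) * indicator {0<..} s) \<in> borel_measurable lborel" .
  qed
  also have "\<dots> \<le> ennreal (1 + exp (harm k))"
    using J by (intro Liminf_le) (auto intro!: always_eventually)
  finally show False using test_functional_gt[OF k] by (simp add: y_def not_less[symmetric])
qed

lemma (in mt_class) maximizer_exists:
  assumes g0: "cls g0" "ennreal (1 + exp (harm k)) < J g0"
  shows "\<exists>g. cls g \<and> (\<forall>h. cls h \<longrightarrow> J h \<le> J g)"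
proof -
  define S where "S = (SUP g\<in>{g. cls g}. J g)"
  have S: "ennreal (1 + exp (harm k)) < S"
    using g0(2) SUP_upper[of g0 "{g. cls g}" J] g0(1) unfolding S_def by (auto intro: less_le_trans)
  obtain f :: "nat \<Rightarrow> ennreal" where f: "incseq f" "range f \<subseteq> J ` {g. cls g}" "Sup (J ` {g. cls g}) = (SUP i. f i)"
    using ennreal_Sup_countable_SUP[of "J ` {g. cls g}"] g0(1) by auto
  have "\<exists>g. cls g \<and> J g = f i" for i
  proof -
    have "f i \<in> J ` {g. cls g}" using f(2) by auto
    then show ?thesis by force
  qed
  then obtain g where g: "\<And>i. cls (g i)" "\<And>i. J (g i) = f i" by metis
  have fS: "f \<longlonglongrightarrow> S" unfolding S_def f(3) using f(1) by (rule LIMSEQ_SUP)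
  obtain r g' where r: "strict_mono r" "decr_int g'" "energy {0<..} g' \<le> ennreal ((1 - b) ^ k)"
    "\<And>s. 0 \<le> s \<Longrightarrow> (\<lambda>m. prim (g (r m)) s) \<longlonglongrightarrow> prim g' s"
    using helly[of g "(1 - b) ^ k"] clsD[OF g(1)] b1 by auto
  have g': "cls g'" using r(3) decr_intD(1)[OF r(2)] by (simp add: cls_def)
  have JS: "(\<lambda>m. J (g (r m))) \<longlonglongrightarrow> S"
    using LIMSEQ_subseq_LIMSEQ[OF fS r(1)] by (simp add: g(2) o_def)
  have "\<exists>s1>0. 0 < prim g' s1"
  proof (rule ccontr)
    assume "\<not> (\<exists>s1>0. 0 < prim g' s1)"
    then have z: "prim g' s = 0" if "0 \<le> s" for s
    proof (cases "s = 0")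
      case False
      then have "\<not> 0 < prim g' s" using \<open>\<not> (\<exists>s1>0. 0 < prim g' s1)\<close> that by simp
      then show ?thesis using prim_nonneg[OF r(2) that] by simp
    qed simp
    have "S \<le> ennreal (1 + exp (harm k)) + ennreal e" if e: "0 < e" for e
    proof -
      have "\<forall>\<^sub>F m in sequentially. J (g (r m)) \<le> ennreal (1 + exp (harm k) + e)"
        using r(4) z e by (intro J_concentration g(1)) auto
      then have "S \<le> ennreal (1 + exp (harm k) + e)"
        by (intro tendsto_upperbound[OF JS]) auto
      then show ?thesis using e by (simp add: ennreal_plus[symmetric] del: ennreal_plus)
    qed
    then have "S \<le> ennreal (1 + exp (harm k))" by (rule ennreal_le_epsilon)
    then show False using S by simp
  qed
  then obtain s1 where s1: "0 < s1" "0 < prim g' s1" by blast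
  have "(\<lambda>m. J (g (r m))) \<longlonglongrightarrow> J g'"
    by (rule J_convergent[OF g(1) g' r(4) s1])
  then have "S = J g'" by (rule LIMSEQ_unique[OF JS])
  moreover have "J h \<le> S" if "cls h" for h unfolding S_def using that by (auto intro: SUP_upper)
  ultimately show ?thesis using g' by auto
qed

theorem maximizer_exists_small:
  assumes k: "1 \<le> k"
  shows "\<exists>\<beta>\<^sub>0>0. \<beta>\<^sub>0 < 1 \<and> (\<forall>b. 0 \<le> b \<and> b < \<beta>\<^sub>0 \<longrightarrow>
    (\<exists>g. mt_class.cls k b g \<and> (\<forall>h. mt_class.cls k b h \<longrightarrow> mt_class.J k b h \<le> mt_class.J k b g)))"
proof -
  obtain \<beta>0 where \<beta>0: "\<beta>0 > 0" "\<beta>0 < 1"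
    "\<And>b. 0 \<le> b \<and> b < \<beta>0 \<Longrightarrow> \<exists>g. mt_class.cls k b g \<and> ennreal (1 + exp (harm k)) < mt_class.J k b g"
    using exceeds_concentration_level[OF k] by metis
  have "\<exists>g. mt_class.cls k b g \<and> (\<forall>h. mt_class.cls k b h \<longrightarrow> mt_class.J k b h \<le> mt_class.J k b g)"
    if b: "0 \<le> b \<and> b < \<beta>0" for b
  proof -
    interpret mt_class k b using k b \<beta>0 by unfold_locales auto
    show ?thesis using \<beta>0(3)[OF b] maximizer_exists by blast
  qed
  then show ?thesis using \<beta>0 by blast
qed

section \<open>Change of variables\<close>

text \<open>The image of the measure under h is determined by its values on the half-lines, which
  are closed under intersection and generate the Borel sets. One computation of tails thus takes the
  place of polar coordinates, for the ball as well as for the interval (0, 1).\<close>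

lemma nn_integral_exponential_tail:
  fixes h :: "'a \<Rightarrow> real" and f :: "real \<Rightarrow> ennreal"
  assumes A: "A \<in> sets M" and h: "h \<in> borel_measurable M" and h0: "\<And>x. x \<in> A \<Longrightarrow> 0 < h x"
    and lam: "0 < lam" and V: "0 \<le> V"
    and tail: "\<And>\<sigma>. 0 \<le> \<sigma> \<Longrightarrow> emeasure M {x \<in> A. \<sigma> < h x} = ennreal (V * exp (- lam * \<sigma>))"
    and f: "f \<in> borel_measurable borel"
  shows "(\<integral>\<^sup>+x\<in>A. f (h x) \<partial>M) = (\<integral>\<^sup>+s\<in>{0<..}. f s * ennreal (V * lam * exp (- lam * s)) \<partial>lborel)"
proof -
  note [measurable] = A h f
  define \<nu> where "\<nu> = density lborel (\<lambda>s. ennreal (V * lam * exp (- lam * s)) * indicator {0<..} s)"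
  define \<mu> where "\<mu> = distr (density M (indicator A)) borel h"
  have AM: "A \<subseteq> space M" using A by (rule sets.sets_into_space)
  have tail': "emeasure M {x \<in> A. \<sigma> < h x} = ennreal (V * exp (- lam * max 0 \<sigma>))" for \<sigma>
  proof (cases "\<sigma> \<ge> 0")
    case False
    then have "{x \<in> A. \<sigma> < h x} = {x \<in> A. 0 < h x}" using h0 by force
    then show ?thesis using tail[of 0] False by (simp add: max_def)
  qed (simp add: tail max_def)
  have em: "emeasure \<mu> {\<sigma><..} = ennreal (V * exp (- lam * max 0 \<sigma>))" for \<sigma>
  proof -
    have "emeasure \<mu> {\<sigma><..} = emeasure M ({x \<in> space M. x \<in> A} \<inter> (h -` {\<sigma><..} \<inter> space M))"
      unfolding \<mu>_def using AM
      by (subst emeasure_distr, simp, simp, subst emeasure_density, simp, simp)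
         (auto simp: indicator_inter_arith[symmetric] Int_absorb1 Int_def[symmetric] nn_integral_indicator intro!: arg_cong[where f = "emeasure M"])
    also have "{x \<in> space M. x \<in> A} \<inter> (h -` {\<sigma><..} \<inter> space M) = {x \<in> A. \<sigma> < h x}" using AM by auto
    finally show ?thesis by (simp add: tail')
  qed
  have en: "emeasure \<nu> {\<sigma><..} = ennreal (V * exp (- lam * max 0 \<sigma>))" for \<sigma>
  proof -
    have "emeasure \<nu> {\<sigma><..} = (\<integral>\<^sup>+s. ennreal (V * lam * exp (- lam * s)) * indicator {0<..} s * indicator {\<sigma><..} s \<partial>lborel)"
      unfolding \<nu>_def by (rule emeasure_density) auto
    also have "\<dots> = (\<integral>\<^sup>+s. ennreal (V * lam * exp (- lam * s)) * indicator {max 0 \<sigma>..} s \<partial>lborel)"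
      using AE_lborel_singleton[of "max 0 \<sigma>"]
      by (intro nn_integral_cong_AE) (auto simp: indicator_def elim!: eventually_mono)
    also have "\<dots> = (\<integral>\<^sup>+s. ennreal (V * lam) * (ennreal (exp (- lam * s)) * indicator {max 0 \<sigma>..} s) \<partial>lborel)"
      using V lam by (intro nn_integral_cong) (simp add: ennreal_mult mult.assoc)
    also have "\<dots> = ennreal (V * lam) * ennreal (exp (- lam * max 0 \<sigma>) / lam)"
      using nn_integral_exp_atLeast[OF lam, of "max 0 \<sigma>"] by (subst nn_integral_cmult) auto
    also have "\<dots> = ennreal (V * exp (- lam * max 0 \<sigma>))"
      using V lam by (subst ennreal_mult[symmetric]) auto
    finally show ?thesis .
  qed
  have "\<mu> = \<nu>"
  proof (rule measure_eqI_generator_eq[where E = "range greaterThan" and \<Omega> = UNIV and A = "\<lambda>i::nat. {- real i<..}"])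
    show "Int_stable (range greaterThan :: real set set)"
    proof (rule Int_stableI_image)
      fix i j :: real
      have "{i<..} \<inter> {j<..} = {max i j<..}" by auto
      then show "\<exists>k\<in>UNIV. {i<..} \<inter> {j<..} = {k<..}" by blast
    qed
    show "sets \<mu> = sigma_sets UNIV (range greaterThan)" "sets \<nu> = sigma_sets UNIV (range greaterThan)"
      by (simp_all add: \<mu>_def \<nu>_def borel_Ioi)
    show "(\<Union>i. {- real i<..}) = UNIV"
    proof -
      have "\<exists>i. - real i < x" for x using reals_Archimedean2[of "- x"] by (auto simp: minus_less_iff)
      then show ?thesis by auto
    qed
  qed (auto simp: em en)
  have "(\<integral>\<^sup>+x\<in>A. f (h x) \<partial>M) = (\<integral>\<^sup>+s. f s \<partial>\<mu>)"
    unfolding \<mu>_def by (subst nn_integral_distr, simp, simp, subst nn_integral_density) (auto simp: mult.commute)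
  also have "\<dots> = (\<integral>\<^sup>+s\<in>{0<..}. f s * ennreal (V * lam * exp (- lam * s)) \<partial>lborel)"
    unfolding \<open>\<mu> = \<nu>\<close> \<nu>_def by (subst nn_integral_density) (auto intro!: nn_integral_cong simp: mult_ac)
  finally show ?thesis .
qed

text \<open>The superlevel sets of - n ln (norm x) are balls of radius exp (- \<sigma> / n), whose
  volume is proportional to exp (- \<sigma>). This is the reason for the factor n in the
  substitution.\<close>

lemma nn_integral_radial_log:
  fixes f :: "real \<Rightarrow> ennreal"
  assumes "f \<in> borel_measurable borel"
  shows "(\<integral>\<^sup>+x\<in>ball (0::real^'n::finite) 1 - {0}. f (- real CARD('n) * ln (norm x)) \<partial>lborel) =
    (\<integral>\<^sup>+s\<in>{0<..}. f s * ennreal (unit_ball_vol (real CARD('n)) * exp (- s)) \<partial>lborel)"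
proof -
  let ?n = "real CARD('n)"
  have n: "?n > 0" by simp
  have "(\<integral>\<^sup>+x\<in>ball (0::real^'n) 1 - {0}. f (- ?n * ln (norm x)) \<partial>lborel) =
    (\<integral>\<^sup>+s\<in>{0<..}. f s * ennreal (unit_ball_vol ?n * 1 * exp (- 1 * s)) \<partial>lborel)"
  proof (rule nn_integral_exponential_tail)
    fix x :: "real^'n" assume "x \<in> ball 0 1 - {0}"
    then show "0 < - ?n * ln (norm x)" using n by (simp add: mult_pos_neg)
  next
    fix \<sigma> :: real assume \<sigma>: "0 \<le> \<sigma>"
    have "{x \<in> ball (0::real^'n) 1 - {0}. \<sigma> < - ?n * ln (norm x)} = ball 0 (exp (- \<sigma> / ?n)) - {0}"
    proof -
      have "x \<in> ball 0 1 \<and> \<sigma> < - ?n * ln (norm x) \<longleftrightarrow> norm x < exp (- \<sigma> / ?n)" if x: "x \<noteq> 0" for x :: "real^'n"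
      proof -
        have "\<sigma> < - ?n * ln (norm x) \<longleftrightarrow> ln (norm x) < - \<sigma> / ?n"
          using n by (auto simp: field_simps)
        also have "\<dots> \<longleftrightarrow> norm x < exp (- \<sigma> / ?n)" using x by (metis exp_less_cancel_iff exp_ln zero_less_norm_iff)
        finally have "\<sigma> < - ?n * ln (norm x) \<longleftrightarrow> norm x < exp (- \<sigma> / ?n)" .
        moreover have "exp (- \<sigma> / ?n) \<le> 1" using \<sigma> n by simp
        ultimately show ?thesis by (meson mem_ball_0 order_less_le_trans)
      qed
      then show ?thesis unfolding set_eq_iff mem_Collect_eq Diff_iff singleton_iff mem_ball_0 by blast
    qed
    moreover have "emeasure lborel (ball (0::real^'n) (exp (- \<sigma> / ?n)) - {0}) = emeasure lborel (ball (0::real^'n) (exp (- \<sigma> / ?n)))"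
      by (rule emeasure_Diff_null_set) (auto simp: null_sets_def)
    moreover have "emeasure lborel (ball (0::real^'n) (exp (- \<sigma> / ?n))) = ennreal (unit_ball_vol ?n * exp (- 1 * \<sigma>))"
      by (subst emeasure_ball) (auto simp flip: exp_of_nat_mult)
    ultimately show "emeasure lborel {x \<in> ball (0::real^'n) 1 - {0}. \<sigma> < - ?n * ln (norm x)} = ennreal (unit_ball_vol ?n * exp (- 1 * \<sigma>))"
      by simp
  qed (use assms in \<open>auto simp: unit_ball_vol_nonneg\<close>)
  then show ?thesis by simp
qed

lemma nn_integral_log_01:
  fixes f :: "real \<Rightarrow> ennreal"
  assumes f: "f \<in> borel_measurable borel" and N: "N > 0"
  shows "(\<integral>\<^sup>+r\<in>{0<..<1}. f (- N * ln r) \<partial>lborel) =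
    (\<integral>\<^sup>+s\<in>{0<..}. f s * ennreal (exp (- s / N) / N) \<partial>lborel)"
proof -
  have "(\<integral>\<^sup>+r\<in>{0<..<1}. f (- N * ln r) \<partial>lborel) =
    (\<integral>\<^sup>+s\<in>{0<..}. f s * ennreal (1 * (1 / N) * exp (- (1 / N) * s)) \<partial>lborel)"
  proof (rule nn_integral_exponential_tail)
    fix x :: real assume "x \<in> {0<..<1}"
    then show "0 < - N * ln x" using N by (simp add: mult_pos_neg)
  next
    fix \<sigma> :: real assume \<sigma>: "0 \<le> \<sigma>"
    have "{x \<in> {0<..<1}. \<sigma> < - N * ln x} = {0<..<exp (- \<sigma> / N)}"
    proof -
      have "x < 1 \<and> \<sigma> < - N * ln x \<longleftrightarrow> x < exp (- \<sigma> / N)" if x: "0 < x" for x :: real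
      proof -
        have "\<sigma> < - N * ln x \<longleftrightarrow> ln x < - \<sigma> / N" using N by (auto simp: field_simps)
        also have "\<dots> \<longleftrightarrow> x < exp (- \<sigma> / N)" using x by (metis exp_less_cancel_iff exp_ln)
        finally have "\<sigma> < - N * ln x \<longleftrightarrow> x < exp (- \<sigma> / N)" .
        moreover have "exp (- \<sigma> / N) \<le> 1" using \<sigma> N by simp
        ultimately show ?thesis by (meson order_less_le_trans)
      qed
      then show ?thesis unfolding set_eq_iff mem_Collect_eq greaterThanLessThan_iff by blast
    qed
    then show "emeasure lborel {x \<in> {0<..<1}. \<sigma> < - N * ln x} = ennreal (1 * exp (- (1 / N) * \<sigma>))" by simp
  qed (use f N in auto)
  then show ?thesis by simp
qed

section \<open>Constants and norms in the logarithmic variable\<close>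

context mt_class
begin

text \<open>Normalised so that the critical exponent alpha |u| powr gam of u = - scl * y is just y
  powr gam for y \<ge> 0.\<close>

definition scl :: real where "scl = alpha_crit (2 * k) b powr (- 1 / gam)"

definition cc :: real where "cc = c_const (2 * k) k"

definition radial_energy :: "(real \<Rightarrow> real) \<Rightarrow> ennreal" where
  "radial_energy f = (\<integral>\<^sup>+r\<in>{0<..<1}. ennreal (r ^ k * \<bar>f r\<bar> ^ Suc k * ln (1 / r) powr (b * real k)) \<partial>lborel)"

text \<open>The outer root in \<open>Phi_norm\<close>, isolated so that bounds, finiteness and
  convergence to 0 of the norm can be read off from its radicand.\<close>

definition ennroot :: "ennreal \<Rightarrow> ennreal" where
  "ennroot E = (if E = \<infinity> then \<infinity> else ennreal (enn2real E powr (1 / (real k + 1))))"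

lemma cc_pos: "cc > 0"
proof -
  have "unit_ball_vol (real (2 * k)) > 0" by (rule unit_ball_vol_pos) simp
  then have "sphere_area (2 * k) > 0" using k by (simp add: sphere_area_def)
  moreover have "(2 * k - 1) choose (k - 1) > 0" using k by (simp add: zero_less_binomial_iff)
  ultimately show ?thesis using k by (simp add: cc_def c_const_def)
qed

lemma gamma_exp_eq: "gamma_exp (2 * k) b = gam"
proof -
  have "real (2 * k) + 2 = 2 * (real k + 1)" "real (2 * k) * (1 - b) = 2 * (real k * (1 - b))" by simp_all
  then show ?thesis
    unfolding gamma_exp_def gam_def kap_def
    using nonzero_mult_divide_mult_cancel_left[of 2 "real k + 1" "real k * (1 - b)"] by (simp only:)
qed

lemma alpha_eq: "alpha_crit (2 * k) b = 2 * real k * (cc powr (1 / real k) * (1 - b)) powr (1 / (1 - b))"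
  using k by (simp add: alpha_crit_def cc_def)

lemma alpha_pos: "alpha_crit (2 * k) b > 0"
  unfolding alpha_eq using k b1 cc_pos by simp

lemma scl_pos: "scl > 0"
  using alpha_pos by (simp add: scl_def)

lemma alpha_scl: "alpha_crit (2 * k) b * scl powr gam = 1"
proof -
  have "scl powr gam = alpha_crit (2 * k) b powr (- 1)"
    unfolding scl_def powr_powr using gam_pos by simp
  then show ?thesis using alpha_pos by (simp add: powr_minus)
qed

text \<open>The form of \<open>alpha_crit\<close> is used here: together with it the constants of
  the substitution collapse to 1 / (1 - b)^k, so that norm at most 1 is the same as energy at most
  (1 - b)^k.\<close>

lemma scl_power: "cc * scl ^ Suc k * (2 * real k) powr kap = 1 / (1 - b) ^ k"
proof -
  have "gam * kap = real k + 1" using kap_pos by (simp add: gam_def)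
  then have "(- 1 / gam) * real (Suc k) = - kap" using gam_pos by (simp add: field_simps)
  then have s: "scl ^ Suc k = alpha_crit (2 * k) b powr (- kap)"
    unfolding scl_def using alpha_pos by (subst powr_power) auto
  have "alpha_crit (2 * k) b powr kap = (2 * real k) powr kap * (cc * (1 - b) ^ k)"
  proof -
    have "((cc powr (1 / real k) * (1 - b)) powr (1 / (1 - b))) powr kap = (cc powr (1 / real k) * (1 - b)) powr real k"
      using b1 by (simp add: powr_powr kap_def)
    also have "\<dots> = cc * (1 - b) ^ k"
      using cc_pos b1 k by (simp add: powr_mult powr_powr powr_realpow)
    finally show ?thesis unfolding alpha_eq using k b1 cc_pos by (simp add: powr_mult)
  qed
  then show ?thesis unfolding s using alpha_pos cc_pos b1 k by (simp add: powr_minus field_simps)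
qed

lemma MT_functional_eq:
  fixes u :: "real^'n::finite \<Rightarrow> real"
  assumes n: "CARD('n) = 2 * k" and g: "cls g"
    and u: "\<And>x. x \<in> ball 0 1 \<Longrightarrow> x \<noteq> 0 \<Longrightarrow> u x = - scl * prim g (- real CARD('n) * ln (norm x))"
  shows "MT_functional (alpha_crit CARD('n) b) b u = ennreal (unit_ball_vol (real CARD('n))) * J g"
proof -
  let ?n = "real CARD('n)"
  note gd = clsD[OF g]
  define f where "f s = ennreal (exp ((prim g s * indicator {0<..} s) powr gam))" for s
  have pm: "(\<lambda>s. prim g s * indicator {0<..} s) \<in> borel_measurable borel"
  proof -
    have "continuous_on {0<..} (prim g)" by (rule continuous_on_subset[OF prim_continuous_on[OF gd(3)]]) auto
    then have "(\<lambda>s. indicator {0<..} s *\<^sub>R prim g s) \<in> borel_measurable borel"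
      by (intro borel_measurable_continuous_on_indicator) auto
    then show ?thesis by (simp add: mult.commute)
  qed
  have fm: "f \<in> borel_measurable borel" unfolding f_def using pm by measurable
  have "MT_functional (alpha_crit CARD('n) b) b u =
      (\<integral>\<^sup>+x\<in>ball 0 1. ennreal (exp (alpha_crit CARD('n) b * \<bar>u x\<bar> powr gam)) \<partial>lborel)"
    unfolding MT_functional_def n gamma_exp_eq by (rule nn_integral_completion)
  also have "\<dots> = (\<integral>\<^sup>+x\<in>ball (0::real^'n) 1 - {0}. f (- ?n * ln (norm x)) \<partial>lborel)"
  proof (rule nn_integral_cong_AE)
    show "AE x in lborel. ennreal (exp (alpha_crit CARD('n) b * \<bar>u x\<bar> powr gam)) * indicator (ball 0 1) x =
        f (- ?n * ln (norm x)) * indicator (ball 0 1 - {0}) x"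
      using AE_lborel_singleton[of "0 :: real^'n"]
    proof eventually_elim
      case (elim x)
      show ?case
      proof (cases "x \<in> ball 0 1")
        case True
        define s where "s = - ?n * ln (norm x)"
        have s: "s > 0" using True elim by (simp add: s_def mult_pos_neg)
        have "u x = - scl * prim g s" using u[OF True elim] by (simp add: s_def)
        then have "\<bar>u x\<bar> = scl * prim g s"
          using scl_pos prim_nonneg[OF gd(3), of s] s by (simp add: abs_mult)
        then have "alpha_crit CARD('n) b * \<bar>u x\<bar> powr gam = (alpha_crit (2 * k) b * scl powr gam) * prim g s powr gam"
          using scl_pos prim_nonneg[OF gd(3), of s] s by (simp add: powr_mult n)
        moreover have "f (- ?n * ln (norm x)) = ennreal (exp (prim g s powr gam))"
          unfolding s_def[symmetric] f_def using s by simp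
        ultimately show ?thesis using True elim by (simp add: alpha_scl)
      qed simp
    qed
  qed
  also have "\<dots> = (\<integral>\<^sup>+s\<in>{0<..}. f s * ennreal (unit_ball_vol ?n * exp (- s)) \<partial>lborel)"
    by (rule nn_integral_radial_log[OF fm])
  also have "\<dots> = (\<integral>\<^sup>+s. ennreal (unit_ball_vol ?n) * (ennreal (exp (prim g s powr gam - s)) * indicator {0<..} s) \<partial>lborel)"
    by (intro nn_integral_cong) (auto simp: f_def indicator_def ennreal_mult[symmetric] exp_diff exp_minus field_simps)
  also have "\<dots> = ennreal (unit_ball_vol ?n) * J g"
    unfolding J_def
  proof (rule nn_integral_cmult)
    have "(\<lambda>s. ennreal (exp ((prim g s * indicator {0<..} s) powr gam - s)) * indicator {0<..} s) \<in> borel_measurable lborel"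
      using pm by measurable
    also have "(\<lambda>s. ennreal (exp ((prim g s * indicator {0<..} s) powr gam - s)) * indicator {0<..} s) =
        (\<lambda>s. ennreal (exp (prim g s powr gam - s)) * indicator {0<..} s)" by (auto simp: indicator_def fun_eq_iff)
    finally show "(\<lambda>s. ennreal (exp (prim g s powr gam - s)) * indicator {0<..} s) \<in> borel_measurable lborel" .
  qed
  finally show ?thesis .
qed

lemma Phi_norm_eq:
  fixes u :: "real^'n::finite \<Rightarrow> real"
  assumes n: "CARD('n) = 2 * k"
  shows "Phi_norm (CARD('n) div 2) (w0 CARD('n) b) u = ennroot (ennreal cc * radial_energy (deriv (radial_profile u)))"
proof -
  have "(\<integral>\<^sup>+r\<in>{0<..<1}. ennreal (r ^ (CARD('n) - CARD('n) div 2) *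
        \<bar>deriv (radial_profile u) r\<bar> ^ (CARD('n) div 2 + 1) * w0 CARD('n) b r) \<partial>lebesgue) = radial_energy (deriv (radial_profile u))"
    unfolding radial_energy_def nn_integral_completion using n by (simp add: w0_def)
  then show ?thesis
    unfolding Phi_norm_def Let_def ennroot_def using n by (simp add: cc_def)
qed

lemma radial_energy_cong_AE:
  assumes "AE r in lborel. r \<in> {0<..<1} \<longrightarrow> f r = g r"
  shows "radial_energy f = radial_energy g"
  unfolding radial_energy_def using assms
  by (intro nn_integral_cong_AE) (auto simp: indicator_def elim!: eventually_mono)

text \<open>With s = - 2 k ln r the powers of r combine to dr / r, a multiple of ds; the weight
  contributes (1 / (2 k)) powr (b k), and all constants meet in \<open>scl_power\<close>. The
  absolute value on the right admits differences of densities, needed for convergence in the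
  norm.\<close>

lemma radial_energy_eq:
  assumes f: "f \<in> borel_measurable borel"
    and v: "AE r in lborel. r \<in> {0<..<1} \<longrightarrow> v r = scl * (2 * real k) * f (- (2 * real k) * ln r) / r"
  shows "ennreal cc * radial_energy v = ennreal (1 / (1 - b) ^ k) * energy {0<..} (\<lambda>s. \<bar>f s\<bar>)"
proof -
  let ?N = "2 * real k"
  have N: "?N > 0" using k by simp
  note [measurable] = f
  define C where "C = scl ^ Suc k * ?N ^ Suc k * (1 / ?N) powr (b * real k)"
  have C: "C \<ge> 0" using scl_pos by (simp add: C_def)
  define F where "F s = ennreal (C * \<bar>f s\<bar> ^ Suc k * s powr (b * real k) * exp (s / ?N))" for s
  have "radial_energy v = (\<integral>\<^sup>+r\<in>{0<..<1}. F (- ?N * ln r) \<partial>lborel)"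
    unfolding radial_energy_def
  proof (rule nn_integral_cong_AE)
    show "AE r in lborel. ennreal (r ^ k * \<bar>v r\<bar> ^ Suc k * ln (1 / r) powr (b * real k)) * indicator {0<..<1} r =
        F (- ?N * ln r) * indicator {0<..<1} r"
      using v
    proof eventually_elim
      case (elim r)
      show ?case
      proof (cases "r \<in> {0<..<1}")
        case True
        define s where "s = - ?N * ln r"
        have s: "s > 0" using True N by (simp add: s_def mult_pos_neg)
        have v: "\<bar>v r\<bar> = scl * ?N * \<bar>f s\<bar> / r"
          using elim True scl_pos N by (simp add: s_def abs_mult)
        have lr: "ln (1 / r) = s * (1 / ?N)" using True N by (simp add: s_def ln_div)
        have er: "exp (s / ?N) = 1 / r" using True N by (simp add: s_def exp_minus inverse_eq_divide)
        have rk: "r ^ k * (1 / r) ^ Suc k = 1 / r" using True by (simp add: power_divide)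
        have "\<bar>v r\<bar> ^ Suc k = scl ^ Suc k * ?N ^ Suc k * \<bar>f s\<bar> ^ Suc k * (1 / r) ^ Suc k"
          unfolding v by (simp only: power_mult_distrib[symmetric] times_divide_eq_right mult_1_right)
        moreover have "ln (1 / r) powr (b * real k) = s powr (b * real k) * (1 / ?N) powr (b * real k)"
          unfolding lr by (subst powr_mult) (use s N in auto)
        ultimately have "r ^ k * \<bar>v r\<bar> ^ Suc k * ln (1 / r) powr (b * real k) =
            (scl ^ Suc k * ?N ^ Suc k * (1 / ?N) powr (b * real k)) * \<bar>f s\<bar> ^ Suc k * s powr (b * real k) * (r ^ k * (1 / r) ^ Suc k)"
          by (simp only: mult_ac)
        then show ?thesis unfolding F_def s_def[symmetric] rk er C_def by (simp only:)
      qed simp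
    qed
  qed
  also have "\<dots> = (\<integral>\<^sup>+s\<in>{0<..}. F s * ennreal (exp (- s / ?N) / ?N) \<partial>lborel)"
    by (rule nn_integral_log_01) (use N in \<open>auto simp: F_def\<close>)
  also have "\<dots> = (\<integral>\<^sup>+s. ennreal (C / ?N) * (ennreal (\<bar>f s\<bar> ^ Suc k * s powr (b * real k)) * indicator {0<..} s) \<partial>lborel)"
  proof (rule nn_integral_cong)
    fix s
    have "C * \<bar>f s\<bar> ^ Suc k * s powr (b * real k) * exp (s / ?N) * (exp (- s / ?N) / ?N) = C / ?N * (\<bar>f s\<bar> ^ Suc k * s powr (b * real k))"
      by (simp add: exp_minus)
    then have "F s * ennreal (exp (- s / ?N) / ?N) = ennreal (C / ?N) * ennreal (\<bar>f s\<bar> ^ Suc k * s powr (b * real k))"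
      unfolding F_def using C N by (simp add: ennreal_mult[symmetric] del: power_Suc)
    then show "F s * ennreal (exp (- s / ?N) / ?N) * indicator {0<..} s = ennreal (C / ?N) * (ennreal (\<bar>f s\<bar> ^ Suc k * s powr (b * real k)) * indicator {0<..} s)"
      by (simp only: mult.assoc)
  qed
  also have "\<dots> = ennreal (C / ?N) * energy {0<..} (\<lambda>s. \<bar>f s\<bar>)"
    unfolding energy_def by (rule nn_integral_cmult) simp
  finally have "ennreal cc * radial_energy v = ennreal cc * (ennreal (C / ?N) * energy {0<..} (\<lambda>s. \<bar>f s\<bar>))" by simp
  also have "\<dots> = ennreal (cc * (C / ?N)) * energy {0<..} (\<lambda>s. \<bar>f s\<bar>)"
  proof -
    have "ennreal cc * ennreal (C / ?N) = ennreal (cc * (C / ?N))"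
      using C N cc_pos by (intro ennreal_mult[symmetric]) auto
    then show ?thesis by (simp only: mult.assoc[symmetric])
  qed
  also have "cc * (C / ?N) = 1 / (1 - b) ^ k"
  proof -
    have "?N ^ Suc k / ?N * (1 / ?N) powr (b * real k) = ?N powr kap"
    proof -
      have "?N ^ Suc k / ?N = ?N powr real k" using N by (simp add: powr_realpow)
      moreover have "(1 / ?N) powr (b * real k) = ?N powr (- (b * real k))" using N by (simp add: powr_divide powr_minus_divide)
      moreover have "kap = real k + - (b * real k)" by (simp add: kap_def algebra_simps)
      ultimately show ?thesis by (simp only: powr_add)
    qed
    then have "cc * scl ^ Suc k * (?N ^ Suc k / ?N * (1 / ?N) powr (b * real k)) = 1 / (1 - b) ^ k"
      using scl_power by simp
    moreover have "cc * (S * X * P / n) = cc * S * (X / n * P)" for S X P n :: real by simp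
    ultimately show ?thesis by (simp only: C_def)
  qed
  finally show ?thesis .
qed

lemma ennroot_le_1: "ennroot E \<le> 1 \<longleftrightarrow> E \<le> 1"
proof (cases E rule: ennreal_cases)
  case (real r)
  have "r powr (1 / (real k + 1)) \<le> 1 \<longleftrightarrow> r \<le> 1"
    using real powr_mono2[of "1 / (real k + 1)" r 1] powr_less_mono2[of "1 / (real k + 1)" 1 r]
    by (auto simp: not_le[symmetric])
  then show ?thesis using real by (simp add: ennroot_def ennreal_le_1)
qed (simp add: ennroot_def)

lemma ennroot_less_top: "ennroot E < \<infinity> \<longleftrightarrow> E < \<infinity>"
  by (auto simp: ennroot_def less_top)

lemma ennroot_tendsto_0: "((\<lambda>m. ennroot (E m)) \<longlonglongrightarrow> 0) \<longleftrightarrow> (E \<longlonglongrightarrow> 0)"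
proof
  have lt: "ennroot x < ennreal e \<longleftrightarrow> x < ennreal (e ^ Suc k)" if e: "e > 0" for x e
  proof (cases x rule: ennreal_cases)
    case (real r)
    have "r powr (1 / (real k + 1)) < e \<longleftrightarrow> r < e ^ Suc k"
    proof -
      have re: "(e ^ Suc k) powr (1 / (real k + 1)) = e"
        using e powr_realpow[of e "Suc k"] by (simp add: powr_powr add.commute add_nonneg_eq_0_iff flip: powr_realpow del: power_Suc)
      have "r powr (1 / (real k + 1)) < (e ^ Suc k) powr (1 / (real k + 1)) \<longleftrightarrow> r < e ^ Suc k"
        using powr_less_mono2[of "1 / (real k + 1)" r "e ^ Suc k"] powr_mono2[of "1 / (real k + 1)" "e ^ Suc k" r] real e
        by (smt (verit) divide_pos_pos of_nat_0_le_iff zero_le_power)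
      then show ?thesis unfolding re .
    qed
    then show ?thesis using real e by (simp add: ennroot_def ennreal_less_iff del: power_Suc)
  qed (simp add: ennroot_def)
  have ev: "(f \<longlonglongrightarrow> 0) \<longleftrightarrow> (\<forall>e>0. \<forall>\<^sub>F m in sequentially. f m < ennreal e)" for f :: "nat \<Rightarrow> ennreal"
  proof
    assume "f \<longlonglongrightarrow> 0"
    then show "\<forall>e>0. \<forall>\<^sub>F m in sequentially. f m < ennreal e" by (auto intro: order_tendstoD)
  next
    assume *: "\<forall>e>0. \<forall>\<^sub>F m in sequentially. f m < ennreal e"
    show "f \<longlonglongrightarrow> 0"
    proof (rule order_tendstoI)
      fix a :: ennreal assume "0 < a"
      then obtain e where e: "0 < e" "ennreal e < a"
        by (metis ennreal_less_zero_iff ennreal_rat_dense dense ennreal_cases less_top order.strict_trans ennreal_less_iff top.not_eq_extremum)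
      show "\<forall>\<^sub>F m in sequentially. f m < a"
        using *[rule_format, OF e(1)] by eventually_elim (use e in \<open>auto intro: less_trans\<close>)
    qed simp
  qed
  {
    assume *: "(\<lambda>m. ennroot (E m)) \<longlonglongrightarrow> 0"
    show "E \<longlonglongrightarrow> 0"
      unfolding ev
    proof (intro allI impI)
      fix e :: real assume e: "e > 0"
      have "(root (Suc k) e) ^ Suc k = e" using e by (intro real_root_pow_pos) auto
      moreover have "root (Suc k) e > 0" using e by simp
      ultimately show "\<forall>\<^sub>F m in sequentially. E m < ennreal e"
        using *[unfolded ev, rule_format, of "root (Suc k) e"] lt[of "root (Suc k) e"] by (simp del: power_Suc)
    qed
  next
    assume *: "E \<longlonglongrightarrow> 0"
    show "(\<lambda>m. ennroot (E m)) \<longlonglongrightarrow> 0"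
      unfolding ev
    proof (intro allI impI)
      fix e :: real assume e: "e > 0"
      then have "e ^ Suc k > 0" by simp
      then show "\<forall>\<^sub>F m in sequentially. ennroot (E m) < ennreal e"
        using *[unfolded ev, rule_format, of "e ^ Suc k"] lt[OF e] by (simp del: power_Suc)
    qed
  }
qed

end

section \<open>Minors of rank-one perturbations of scalar matrices\<close>

text \<open>Composition with a transposition of two points of T maps the permutations of T onto
  themselves and reverses every sign.\<close>

lemma sum_sign_permutes:
  fixes T :: "'a::finite set"
  shows "(\<Sum>p | p permutes T. of_int (sign p) :: real) = (if card T \<le> 1 then 1 else 0)"
proof (cases "card T \<le> 1")
  case True
  then have "T = {} \<or> (\<exists>a. T = {a})" by (metis One_nat_def card_0_eq card_1_singletonE finite le_SucE le_zero_eq)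
  then have "{p. p permutes T} = {id}" by auto
  then show ?thesis using True by (simp add: sign_id)
next
  case False
  then have "card T > 1" by simp
  then obtain a c where ac: "a \<in> T" "c \<in> T" "a \<noteq> c" by (metis One_nat_def card_le_Suc0_iff_eq finite not_le)
  let ?t = "Transposition.transpose a c"
  let ?S = "\<Sum>p | p permutes T. of_int (sign p) :: real"
  have t: "?t permutes T" using ac by (simp add: permutes_swap_id)
  have "?S = (\<Sum>p | p permutes T. of_int (sign (?t \<circ> p)))"
    by (rule sum.reindex_bij_witness[of _ "\<lambda>p. ?t \<circ> p" "\<lambda>p. ?t \<circ> p"])
       (auto simp: permutes_compose[OF _ t] o_assoc)
  also have "\<dots> = (\<Sum>p | p permutes T. - of_int (sign p))"
  proof (rule sum.cong)
    fix p assume "p \<in> {p. p permutes T}"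
    then have "permutation p" "permutation ?t"
      using permutation_permutes[of p] permutation_swap_id by auto
    then show "(of_int (sign (?t \<circ> p)) :: real) = - of_int (sign p)"
      using ac by (simp add: sign_compose sign_swap_id)
  qed simp
  also have "\<dots> = - ?S" by (rule sum_negf)
  finally show ?thesis using False by simp
qed

text \<open>Expand each product over the set T of rows in which the rank-one entry is taken. Off T
  the permutation must fix the row, so it permutes T, and then the rank-one factors no longer depend
  on it. The sum of signs removes every T with more than one element.\<close>

lemma principal_minor_rank_one:
  fixes A :: "real^'n^'n::finite" and x :: "real^'n"
  assumes A: "\<And>i j. A $ i $ j = (if i = j then a else 0) + b * x $ i * x $ j"
  shows "principal_minor I A = a ^ card I + a ^ (card I - 1) * b * (\<Sum>i\<in>I. (x $ i)\<^sup>2)"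
proof -
  have prod: "(\<Prod>i\<in>I. A $ i $ p i) = (\<Sum>T\<in>Pow I. if p permutes T then a ^ card (I - T) * (\<Prod>i\<in>T. b * (x $ i)\<^sup>2) else 0)"
    if p: "p permutes I" for p
  proof -
    have "(\<Prod>i\<in>I. A $ i $ p i) = (\<Prod>i\<in>I. b * x $ i * x $ p i + (if i = p i then a else 0))"
      by (simp add: A add.commute)
    also have "\<dots> = (\<Sum>T\<in>Pow I. (\<Prod>i\<in>T. b * x $ i * x $ p i) * (\<Prod>i\<in>I - T. if i = p i then a else 0))"
      by (rule prod_add) simp
    also have "\<dots> = (\<Sum>T\<in>Pow I. if p permutes T then a ^ card (I - T) * (\<Prod>i\<in>T. b * (x $ i)\<^sup>2) else 0)"
    proof (rule sum.cong)
      fix T assume T: "T \<in> Pow I"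
      show "(\<Prod>i\<in>T. b * x $ i * x $ p i) * (\<Prod>i\<in>I - T. if i = p i then a else 0) =
        (if p permutes T then a ^ card (I - T) * (\<Prod>i\<in>T. b * (x $ i)\<^sup>2) else 0)"
      proof (cases "p permutes T")
        case True
        have "(\<Prod>i\<in>I - T. if i = p i then a else 0) = (\<Prod>i\<in>I - T. a)"
          using permutes_not_in[OF True] by (intro prod.cong) auto
        moreover have "(\<Prod>i\<in>T. b * x $ i * x $ p i) = (\<Prod>i\<in>T. b * x $ i) * (\<Prod>i\<in>T. x $ i)"
          using prod.permute[OF True, of "\<lambda>i. x $ i"] by (simp add: prod.distrib o_def)
        moreover have "(\<Prod>i\<in>T. b * x $ i) * (\<Prod>i\<in>T. x $ i) = (\<Prod>i\<in>T. b * (x $ i)\<^sup>2)"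
          by (simp add: prod.distrib[symmetric] power2_eq_square mult.assoc)
        ultimately show ?thesis using True by simp
      next
        case False
        have "\<exists>i\<in>I - T. p i \<noteq> i"
        proof (rule ccontr)
          assume "\<not> (\<exists>i\<in>I - T. p i \<noteq> i)"
          then have "\<forall>i. i \<notin> T \<longrightarrow> p i = i" using permutes_not_in[OF p] by blast
          moreover have "bij p" using p by (rule permutes_bij)
          ultimately have "p permutes T" unfolding permutes_def bij_iff by blast
          then show False using False by simp
        qed
        then obtain i where "i \<in> I - T" "p i \<noteq> i" by blast
        then have "(\<Prod>i\<in>I - T. if i = p i then a else 0) = 0" by (intro prod_zero) force+
        then show ?thesis using False by simp
      qed
    qed simp
    finally show ?thesis .
  qed
  let ?w = "\<lambda>T. a ^ card (I - T) * (\<Prod>i\<in>T. b * (x $ i)\<^sup>2)"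
  have "principal_minor I A = (\<Sum>p | p permutes I. of_int (sign p) * (\<Sum>T\<in>Pow I. if p permutes T then ?w T else 0))"
    unfolding principal_minor_def by (intro sum.cong) (simp_all add: prod)
  also have "\<dots> = (\<Sum>p | p permutes I. \<Sum>T\<in>Pow I. if p permutes T then of_int (sign p) * ?w T else 0)"
    by (intro sum.cong refl) (auto simp: sum_distrib_left intro!: sum.cong)
  also have "\<dots> = (\<Sum>T\<in>Pow I. \<Sum>p | p permutes I. if p permutes T then of_int (sign p) * ?w T else 0)"
    by (rule sum.swap)
  also have "\<dots> = (\<Sum>T\<in>Pow I. if card T \<le> 1 then ?w T else 0)"
  proof (rule sum.cong)
    fix T assume T: "T \<in> Pow I"
    have "(\<Sum>p | p permutes I. if p permutes T then of_int (sign p) * ?w T else 0) =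
        (\<Sum>p | p permutes T. of_int (sign p) * ?w T)"
      using T permutes_subset by (intro sum.mono_neutral_cong_right) (auto simp: finite_permutations)
    also have "\<dots> = (\<Sum>p | p permutes T. of_int (sign p)) * ?w T" by (rule sum_distrib_right[symmetric])
    finally show "(\<Sum>p | p permutes I. if p permutes T then of_int (sign p) * ?w T else 0) = (if card T \<le> 1 then ?w T else 0)"
      unfolding sum_sign_permutes by simp
  qed simp
  also have "\<dots> = (\<Sum>T\<in>insert {} ((\<lambda>i. {i}) ` I). ?w T)"
  proof (rule sum.mono_neutral_cong_right)
    show "\<forall>T\<in>Pow I - insert {} ((\<lambda>i. {i}) ` I). (if card T \<le> 1 then ?w T else 0) = 0"
    proof
      fix T assume T: "T \<in> Pow I - insert {} ((\<lambda>i. {i}) ` I)"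
      have "\<not> card T \<le> 1"
      proof
        assume "card T \<le> 1"
        then have "T = {} \<or> (\<exists>a. T = {a})" by (metis One_nat_def card_0_eq card_1_singletonE finite le_SucE le_zero_eq)
        then show False using T by auto
      qed
      then show "(if card T \<le> 1 then ?w T else 0) = 0" by simp
    qed
  qed auto
  also have "\<dots> = ?w {} + (\<Sum>T\<in>(\<lambda>i. {i}) ` I. ?w T)"
    by (rule sum.insert) auto
  also have "(\<Sum>T\<in>(\<lambda>i. {i}) ` I. ?w T) = (\<Sum>i\<in>I. ?w {i})"
    by (subst sum.reindex) (auto simp: inj_on_def)
  also have "\<dots> = (\<Sum>i\<in>I. a ^ (card I - 1) * b * (x $ i)\<^sup>2)"
    by (intro sum.cong) auto
  also have "\<dots> = a ^ (card I - 1) * b * (\<Sum>i\<in>I. (x $ i)\<^sup>2)" by (rule sum_distrib_left[symmetric])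
  finally show ?thesis by simp
qed

lemma card_subsets_containing:
  fixes i :: "'n::finite"
  assumes "1 \<le> j"
  shows "card {I. card I = j \<and> i \<in> I} = (CARD('n) - 1) choose (j - 1)"
proof -
  have "card {I. card I = j \<and> i \<in> I} = card {J. J \<subseteq> UNIV - {i} \<and> card J = j - 1}"
  proof (rule bij_betw_same_card[of "\<lambda>I. I - {i}"])
    show "bij_betw (\<lambda>I. I - {i}) {I. card I = j \<and> i \<in> I} {J. J \<subseteq> UNIV - {i} \<and> card J = j - 1}"
      by (rule bij_betw_byWitness[where f' = "insert i"])
         (use assms in \<open>auto simp: card_Diff_singleton card_insert_if insert_absorb\<close>)
  qed
  also have "\<dots> = card (UNIV - {i}) choose (j - 1)" by (rule n_subsets) simp
  finally show ?thesis by (simp add: card_Diff_singleton)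
qed

text \<open>Double counting: every index lies in (n - 1 choose j - 1) sets of size j, so the partial
  sums of squares add up to that multiple of the squared norm.\<close>

lemma S_minors_rank_one:
  fixes A :: "real^'n^'n::finite" and x :: "real^'n"
  assumes A: "\<And>i j. A $ i $ j = (if i = j then a else 0) + b * x $ i * x $ j" and j: "1 \<le> j"
  shows "S_minors j A = real (CARD('n) choose j) * a ^ j + real ((CARD('n) - 1) choose (j - 1)) * a ^ (j - 1) * b * (norm x)\<^sup>2"
proof -
  have "S_minors j A = (\<Sum>I | card I = j. a ^ j + a ^ (j - 1) * b * (\<Sum>i\<in>I. (x $ i)\<^sup>2))"
    unfolding S_minors_def by (intro sum.cong) (auto simp: principal_minor_rank_one[OF A])
  also have "\<dots> = real (card {I :: 'n set. card I = j}) * a ^ j + a ^ (j - 1) * b * (\<Sum>I | card I = j. \<Sum>i\<in>I. (x $ i)\<^sup>2)"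
    by (simp add: sum.distrib sum_distrib_left)
  also have "card {I :: 'n set. card I = j} = CARD('n) choose j"
    using n_subsets[of "UNIV :: 'n set" j] by simp
  also have "(\<Sum>I | card I = j. \<Sum>i\<in>I. (x $ i)\<^sup>2) = (\<Sum>I | card I = j. \<Sum>i\<in>UNIV. if i \<in> I then (x $ i)\<^sup>2 else 0)"
  proof (rule sum.cong)
    fix I :: "'n set"
    show "(\<Sum>i\<in>I. (x $ i)\<^sup>2) = (\<Sum>i\<in>UNIV. if i \<in> I then (x $ i)\<^sup>2 else 0)"
      by (rule sum.mono_neutral_cong_left) auto
  qed simp
  also have "\<dots> = (\<Sum>i\<in>UNIV. \<Sum>I | card I = j. if i \<in> I then (x $ i)\<^sup>2 else 0)"
    by (rule sum.swap)
  also have "\<dots> = (\<Sum>i\<in>UNIV. real ((CARD('n) - 1) choose (j - 1)) * (x $ i)\<^sup>2)"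
  proof (rule sum.cong)
    fix i :: 'n
    have "(\<Sum>I | card I = j. if i \<in> I then (x $ i)\<^sup>2 else 0) = (\<Sum>I | card I = j \<and> i \<in> I. (x $ i)\<^sup>2)"
      by (subst sum.inter_filter[symmetric]) (auto intro!: sum.cong)
    then show "(\<Sum>I | card I = j. if i \<in> I then (x $ i)\<^sup>2 else 0) = real ((CARD('n) - 1) choose (j - 1)) * (x $ i)\<^sup>2"
      using card_subsets_containing[OF j, of i] by simp
  qed simp
  also have "\<dots> = real ((CARD('n) - 1) choose (j - 1)) * (norm x)\<^sup>2"
    unfolding power2_norm_eq_inner inner_vec_def by (simp add: sum_distrib_left power2_eq_square)
  finally show ?thesis by (simp add: algebra_simps)
qed

section \<open>Profiles of radial admissible functions\<close>

lemma differentiable_line_derivative: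
  fixes F :: "real^'n::finite \<Rightarrow> real"
  assumes "F differentiable (at x)"
  shows "((\<lambda>t. F (x + t *\<^sub>R v)) has_real_derivative frechet_derivative F (at x) v) (at 0)"
proof -
  let ?D = "frechet_derivative F (at x)"
  have D: "(F has_derivative ?D) (at x)" using assms by (simp add: frechet_derivative_works)
  have "((\<lambda>t. x + t *\<^sub>R v) has_derivative (\<lambda>t. t *\<^sub>R v)) (at 0)"
    by (auto intro!: derivative_eq_intros)
  then have "((\<lambda>t. F (x + t *\<^sub>R v)) has_derivative (\<lambda>t. ?D (t *\<^sub>R v))) (at 0)"
    using has_derivative_compose[of "\<lambda>t. x + t *\<^sub>R v" "\<lambda>t. t *\<^sub>R v" 0 UNIV F ?D] D by simp
  moreover have "(\<lambda>t. ?D (t *\<^sub>R v)) = (*) (?D v)"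
    using linear_cmul[OF has_derivative_linear[OF D]] by (auto simp: fun_eq_iff mult.commute)
  ultimately show ?thesis
    unfolding has_field_derivative_def by (simp only:)
qed

lemma partial_deriv_frechet:
  fixes F :: "real^'n::finite \<Rightarrow> real"
  assumes "F differentiable (at x)"
  shows "partial_deriv i F x = frechet_derivative F (at x) (axis i 1)"
  unfolding partial_deriv_def by (rule DERIV_imp_deriv[OF differentiable_line_derivative[OF assms]])

lemma has_real_derivative_line:
  fixes F :: "real^'n::finite \<Rightarrow> real"
  assumes "F differentiable (at (r *\<^sub>R axis i 1))"
  shows "((\<lambda>t. F (t *\<^sub>R axis i 1)) has_real_derivative partial_deriv i F (r *\<^sub>R axis i 1)) (at r)"
proof -
  have "((\<lambda>t. F (r *\<^sub>R axis i 1 + t *\<^sub>R axis i 1)) has_real_derivative partial_deriv i F (r *\<^sub>R axis i 1)) (at 0)"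
    unfolding partial_deriv_frechet[OF assms] by (rule differentiable_line_derivative[OF assms])
  then have "((\<lambda>t. F ((t + r) *\<^sub>R axis i 1)) has_real_derivative partial_deriv i F (r *\<^sub>R axis i 1)) (at 0)"
    by (simp add: scaleR_add_left add.commute)
  then show ?thesis
    using DERIV_shift[of "\<lambda>t. F (t *\<^sub>R axis i 1)" "partial_deriv i F (r *\<^sub>R axis i 1)" 0 r] by simp
qed

lemma has_real_derivative_cong_eventually:
  fixes f g :: "real \<Rightarrow> real"
  assumes "(g has_real_derivative D) (at x)" "\<forall>\<^sub>F t in nhds x. f t = g t"
  shows "(f has_real_derivative D) (at x)"
  using assms DERIV_cong_ev[of x x f g D D] by simp

lemma norm_line_derivative:
  fixes x :: "real^'n::finite"
  assumes "x \<noteq> 0"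
  shows "((\<lambda>t. norm (x + t *\<^sub>R axis i 1)) has_real_derivative x $ i / norm x) (at 0)"
proof -
  have "((\<lambda>t. x + t *\<^sub>R axis i 1) has_derivative (\<lambda>t. t *\<^sub>R axis i 1)) (at 0)"
    by (auto intro!: derivative_eq_intros)
  moreover have "(norm has_derivative (\<lambda>h. inner (sgn x) h)) (at (x + 0 *\<^sub>R axis i 1))"
    using has_derivative_norm[OF assms] by (simp add: inner_commute)
  ultimately have "((\<lambda>t. norm (x + t *\<^sub>R axis i 1)) has_derivative (\<lambda>t. inner (sgn x) (t *\<^sub>R axis i 1))) (at 0)"
    using has_derivative_compose by blast
  moreover have "(\<lambda>t. inner (sgn x) (t *\<^sub>R axis i 1)) = (*) (x $ i / norm x)"
    by (auto simp: fun_eq_iff sgn_vec_def inner_axis divide_inverse)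
  ultimately show ?thesis unfolding has_field_derivative_def by (simp only:)
qed

text \<open>Differentiate the gradient p(r) x / r once more. The result is a scalar matrix plus a
  rank-one matrix, with eigenvalue p / r on tangential directions and p' on the radial one.\<close>

lemma radial_hessian:
  fixes U :: "real^'n::finite \<Rightarrow> real"
  assumes U: "\<And>y. y \<in> ball 0 1 \<Longrightarrow> U y = V (norm y)"
    and V: "\<And>r. 0 < r \<Longrightarrow> r < 1 \<Longrightarrow> (V has_real_derivative p r) (at r)"
    and p: "\<And>r. 0 < r \<Longrightarrow> r < 1 \<Longrightarrow> (p has_real_derivative p' r) (at r)"
    and x: "x \<in> ball 0 1" "x \<noteq> 0"
  shows "hessian U x $ i $ j = (if i = j then p (norm x) / norm x else 0) +
    ((p' (norm x) - p (norm x) / norm x) / (norm x)\<^sup>2) * x $ i * x $ j"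
proof -
  have line: "\<forall>\<^sub>F t in nhds 0. z + t *\<^sub>R axis l 1 \<in> ball 0 1 - {0}" if "z \<in> ball 0 1" "z \<noteq> 0" for z :: "real^'n" and l
  proof -
    have "((\<lambda>t. z + t *\<^sub>R axis l 1) \<longlongrightarrow> z + 0 *\<^sub>R axis l 1) (nhds (0::real))"
      by (intro tendsto_intros filterlim_ident)
    moreover have "open (ball 0 1 - {0 :: real^'n})" by (intro open_Diff) auto
    ultimately show ?thesis using that by (intro topological_tendstoD[where f = "\<lambda>t. z + t *\<^sub>R axis l 1"]) auto
  qed
  have pd: "partial_deriv l U z = p (norm z) / norm z * z $ l" if z: "z \<in> ball 0 1" "z \<noteq> 0" for z l
  proof -
    have "((\<lambda>t. V (norm (z + t *\<^sub>R axis l 1))) has_real_derivative p (norm z) * (z $ l / norm z)) (at 0)"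
      using DERIV_chain2[of V "p (norm z)" "\<lambda>t. norm (z + t *\<^sub>R axis l 1)" 0 "z $ l / norm z" UNIV] V[of "norm z"]
        norm_line_derivative[OF z(2), of l] z by simp
    moreover have "\<forall>\<^sub>F t in nhds 0. U (z + t *\<^sub>R axis l 1) = V (norm (z + t *\<^sub>R axis l 1))"
      using line[OF z, of l] by eventually_elim (use U in auto)
    ultimately have "((\<lambda>t. U (z + t *\<^sub>R axis l 1)) has_real_derivative p (norm z) * (z $ l / norm z)) (at 0)"
      by (rule has_real_derivative_cong_eventually)
    then show ?thesis unfolding partial_deriv_def by (simp add: DERIV_imp_deriv)
  qed
  let ?r = "norm x"
  have r: "0 < ?r" "?r < 1" using x by auto
  let ?\<phi> = "\<lambda>r. p r / r"
  let ?d = "(p' ?r - p ?r / ?r) / ?r"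
  have d\<phi>: "(?\<phi> has_real_derivative ?d) (at ?r)"
    using r by (auto intro!: derivative_eq_intros p simp: field_simps)
  have "((\<lambda>t. ?\<phi> (norm (x + t *\<^sub>R axis i 1))) has_real_derivative ?d * (x $ i / ?r)) (at 0)"
    using DERIV_chain2[of ?\<phi> ?d "\<lambda>t. norm (x + t *\<^sub>R axis i 1)" 0 "x $ i / ?r" UNIV] d\<phi> norm_line_derivative[OF x(2), of i] by simp
  moreover have "((\<lambda>t. (x + t *\<^sub>R axis i 1) $ j) has_real_derivative (if i = j then 1 else 0)) (at 0)"
    by (auto intro!: derivative_eq_intros simp: axis_def)
  ultimately have "((\<lambda>t. ?\<phi> (norm (x + t *\<^sub>R axis i 1)) * (x + t *\<^sub>R axis i 1) $ j) has_real_derivative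
      ?d * (x $ i / ?r) * (x + 0 *\<^sub>R axis i 1) $ j + (if i = j then 1 else 0) * ?\<phi> (norm (x + 0 *\<^sub>R axis i 1))) (at 0)"
    by (rule DERIV_mult)
  moreover have "\<forall>\<^sub>F t in nhds 0. partial_deriv j U (x + t *\<^sub>R axis i 1) = ?\<phi> (norm (x + t *\<^sub>R axis i 1)) * (x + t *\<^sub>R axis i 1) $ j"
    using line[OF x, of i] by eventually_elim (use pd in auto)
  ultimately have "((\<lambda>t. partial_deriv j U (x + t *\<^sub>R axis i 1)) has_real_derivative
      ?d * (x $ i / ?r) * (x + 0 *\<^sub>R axis i 1) $ j + (if i = j then 1 else 0) * ?\<phi> (norm (x + 0 *\<^sub>R axis i 1))) (at 0)"
    by (rule has_real_derivative_cong_eventually)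
  then have "partial_deriv i (partial_deriv j U) x = ?d * (x $ i / ?r) * x $ j + (if i = j then 1 else 0) * ?\<phi> ?r"
    unfolding partial_deriv_def[of i] by (simp add: DERIV_imp_deriv)
  then show ?thesis by (simp add: hessian_def power2_eq_square)
qed

text \<open>The case j = 1 says that r^(n-1) p is nondecreasing; it vanishes at 0, so p \<ge> 0. For
  n = 2 k one has (n choose k) = 2 (n - 1 choose k - 1), and the case j = k becomes (p / r)^(k-1) (p
  / r + p') \<ge> 0, which is (r p)' \<ge> 0 wherever p > 0.\<close>

lemma Phi_0_rad_profile:
  fixes U :: "real^'n::finite \<Rightarrow> real"
  assumes U: "U \<in> Phi_0_rad k" and n: "CARD('n) = 2 * k" and k: "1 \<le> k"
  obtains p where
    "\<And>r. 0 < r \<Longrightarrow> r < 1 \<Longrightarrow> (radial_profile U has_real_derivative p r) (at r)"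
    "continuous_on {0<..<1} p" "\<And>r. 0 < r \<Longrightarrow> r < 1 \<Longrightarrow> 0 \<le> p r"
    "\<And>r s. 0 < r \<Longrightarrow> r \<le> s \<Longrightarrow> s < 1 \<Longrightarrow> r * p r \<le> s * p s"
    "continuous_on {0..1} (radial_profile U)" "radial_profile U 1 = 0"
proof -
  define ax :: "real^'n" where "ax = axis undefined 1"
  have ax: "norm ax = 1" by (simp add: ax_def)
  have adm: "C2_on (ball 0 1) U" "continuous_on (cball 0 1) U"
    "\<And>j x. 1 \<le> j \<Longrightarrow> j \<le> k \<Longrightarrow> x \<in> ball 0 1 \<Longrightarrow> 0 \<le> S_minors j (hessian U x)"
    and rad: "radial_on (cball 0 1) U" and bd: "\<And>x. x \<in> sphere 0 1 \<Longrightarrow> U x = 0"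
    using U by (auto simp: Phi_0_rad_def k_admissible_def)
  define e :: "real^'n" where "e = (SOME e. norm e = 1)"
  have e: "norm e = 1" unfolding e_def by (rule someI[of _ ax]) (rule ax)
  have prof: "radial_profile U r = U (r *\<^sub>R ax)" if "0 \<le> r" "r \<le> 1" for r
  proof -
    have "U (r *\<^sub>R e) = U (r *\<^sub>R ax)"
      using rad that e ax unfolding radial_on_def by (metis mem_cball_0 mult.right_neutral norm_scaleR real_norm_def abs_of_nonneg)
    then show ?thesis by (simp add: radial_profile_def e_def)
  qed
  have Unorm: "U y = radial_profile U (norm y)" if "y \<in> ball 0 1" for y
  proof (rule radial_profile_norm)
    show "radial_on (ball 0 1) U" using rad ball_subset_cball[of "0 :: real^'n" 1] unfolding radial_on_def by blast
  qed (rule that)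
  have diff: "U differentiable (at x)" "partial_deriv i U differentiable (at x)" if "x \<in> ball 0 1" for x i
    using adm(1) that differentiable_on_eq_differentiable_at[OF open_ball] unfolding C2_on_def C1_on_def by blast+
  define i0 :: 'n where "i0 = undefined"
  have ax0: "ax = axis i0 1" by (simp add: ax_def i0_def)
  define p where "p r = partial_deriv i0 U (r *\<^sub>R ax)" for r
  define p' where "p' r = partial_deriv i0 (partial_deriv i0 U) (r *\<^sub>R ax)" for r
  have inb: "r *\<^sub>R ax \<in> ball 0 1" if "\<bar>r\<bar> < 1" for r using that ax by simp
  have dV: "(radial_profile U has_real_derivative p r) (at r)" if r: "0 < r" "r < 1" for r
  proof -
    have "((\<lambda>t. U (t *\<^sub>R ax)) has_real_derivative p r) (at r)"
      unfolding p_def ax0 by (rule has_real_derivative_line, rule diff) (use inb[of r] r ax0 in auto)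
    then show ?thesis
      by (rule has_field_derivative_transform_within_open[of _ _ _ "{0<..<1}"]) (use r prof in auto)
  qed
  have dp: "(p has_real_derivative p' r) (at r)" if r: "\<bar>r\<bar> < 1" for r
    unfolding p_def[abs_def] p'_def ax0 by (rule has_real_derivative_line, rule diff) (use inb[OF r] ax0 in auto)
  have pcont: "continuous_on {-1<..<1} p"
  proof (rule DERIV_continuous_on)
    fix r :: real assume "r \<in> {-1<..<1}"
    then show "(p has_real_derivative p' r) (at r within {-1<..<1})"
      by (intro has_field_derivative_at_within[OF dp]) auto
  qed
  have S: "0 \<le> real (CARD('n) choose j) * (p r / r) ^ j + real ((CARD('n) - 1) choose (j - 1)) * (p r / r) ^ (j - 1) * (p' r - p r / r)"
    if j: "1 \<le> j" "j \<le> k" and r: "0 < r" "r < 1" for j r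
  proof -
    have "0 \<le> S_minors j (hessian U (r *\<^sub>R ax))" using j inb[of r] r by (intro adm(3)) auto
    also have "\<dots> = real (CARD('n) choose j) * (p r / r) ^ j +
        real ((CARD('n) - 1) choose (j - 1)) * (p r / r) ^ (j - 1) * ((p' r - p r / r) / r\<^sup>2) * (norm (r *\<^sub>R ax))\<^sup>2"
    proof (rule S_minors_rank_one[OF _ j(1)])
      fix i l
      have nr: "norm (r *\<^sub>R ax) = r" using r ax by simp
      have "r *\<^sub>R ax \<noteq> 0" using r ax by auto
      have "hessian U (r *\<^sub>R ax) $ i $ l = (if i = l then p (norm (r *\<^sub>R ax)) / norm (r *\<^sub>R ax) else 0) +
          (p' (norm (r *\<^sub>R ax)) - p (norm (r *\<^sub>R ax)) / norm (r *\<^sub>R ax)) / (norm (r *\<^sub>R ax))\<^sup>2 * (r *\<^sub>R ax) $ i * (r *\<^sub>R ax) $ l"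
      proof (rule radial_hessian)
        show "r *\<^sub>R ax \<in> ball 0 1" using inb[of r] r by simp
      qed (use Unorm dV dp \<open>r *\<^sub>R ax \<noteq> 0\<close> in auto)
      then show "hessian U (r *\<^sub>R ax) $ i $ l = (if i = l then p r / r else 0) + (p' r - p r / r) / r\<^sup>2 * (r *\<^sub>R ax) $ i * (r *\<^sub>R ax) $ l"
        unfolding nr .
    qed
    also have "(norm (r *\<^sub>R ax))\<^sup>2 = r\<^sup>2" using r ax by simp
    finally show ?thesis using r by simp
  qed
  have p0: "0 \<le> p r" if r: "0 < r" "r < 1" for r
  proof -
    let ?m = "\<lambda>r. r ^ (CARD('n) - 1) * p r"
    have "?m 0 \<le> ?m r"
    proof (rule DERIV_nonneg_imp_increasing_open[where f = ?m and a = 0 and b = r])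
      fix s assume s: "0 < s" "s < r"
      then have s1: "s < 1" using r by simp
      define q where "q = CARD('n) - 2"
      have q: "CARD('n) - 1 = Suc q" "real CARD('n) = real q + 2" using n k by (auto simp: q_def)
      have "(?m has_real_derivative (real (Suc q) * s ^ q) * p s + p' s * s ^ Suc q) (at s)"
      proof -
        have "((\<lambda>r. r ^ Suc q) has_real_derivative real (Suc q) * s ^ q) (at s)"
          using DERIV_pow[of "Suc q" s] by simp
        moreover have "(p has_real_derivative p' s) (at s)" using s s1 by (intro dp) auto
        ultimately show ?thesis unfolding q(1) by (rule DERIV_mult)
      qed
      moreover have "0 \<le> (real (Suc q) * s ^ q) * p s + p' s * s ^ Suc q"
      proof -
        have "0 \<le> real CARD('n) * (p s / s) + (p' s - p s / s)" using S[of 1 s] k s s1 by simp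
        then have "0 \<le> s ^ Suc q * ((real q + 1) * (p s / s) + p' s)" 
        proof -
          assume "0 \<le> real CARD('n) * (p s / s) + (p' s - p s / s)"
          then have "0 \<le> (real q + 1) * (p s / s) + p' s" unfolding q(2) distrib_right by linarith
          then show ?thesis using s by (intro mult_nonneg_nonneg) auto
        qed
        also have "\<dots> = (real (Suc q) * s ^ q) * p s + p' s * s ^ Suc q" using s by (simp add: field_simps)
        finally show ?thesis .
      qed
      ultimately show "\<exists>y. (?m has_real_derivative y) (at s) \<and> 0 \<le> y" by blast
    next
      show "continuous_on {0..r} ?m"
        by (intro continuous_intros continuous_on_subset[OF pcont]) (use r in auto)
    qed (use r in auto)
    moreover have "(0::real) ^ (CARD('n) - 1) = 0" using n k by (intro power_0_left[THEN trans]) simp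
    ultimately have "0 \<le> r ^ (CARD('n) - 1) * p r" by (simp only: mult_zero_left)
    moreover have "0 < r ^ (CARD('n) - 1)" using r by simp
    ultimately show ?thesis by (simp only: zero_le_mult_iff) linarith
  qed
  have mono: "r * p r \<le> s * p s" if rs: "0 < r" "r \<le> s" "s < 1" for r s
  proof (rule DERIV_nonneg_imp_nondecreasing[OF rs(2)])
    fix t assume t: "r \<le> t" "t \<le> s"
    then have t1: "0 < t" "t < 1" using rs by auto
    have "((\<lambda>t. t * p t) has_real_derivative p t + t * p' t) (at t)"
      using t1 by (auto intro!: derivative_eq_intros dp)
    moreover have "0 \<le> p t + t * p' t"
    proof (cases "p t = 0")
      case True
      \<comment> \<open>Here the factor p^(k-1) may make the minor condition empty, but a zero of
        the nonnegative p is an interior minimum.\<close>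
      have "p' t = 0"
      proof (rule DERIV_local_min[OF dp])
        show "0 < min t (1 - t)" using t1 by simp
        show "\<forall>y. \<bar>t - y\<bar> < min t (1 - t) \<longrightarrow> p t \<le> p y"
          using p0 True by (auto simp: abs_if split: if_splits)
      qed (use t1 in auto)
      then show ?thesis using True by simp
    next
      case False
      then have pt: "p t > 0" using p0[OF t1] by simp
      define c where "c = real ((CARD('n) - 1) choose (k - 1))"
      have c: "c > 0" unfolding c_def using n k by (simp add: zero_less_binomial_iff)
      have "k * (CARD('n) choose k) = CARD('n) * ((CARD('n) - 1) choose (k - 1))"
        using k by (intro times_binomial_minus1_eq) simp
      then have "real k * real (CARD('n) choose k) = real k * (2 * c)"
        unfolding c_def n by (metis (no_types, opaque_lifting) mult.assoc mult.commute of_nat_mult of_nat_numeral)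
      then have bin: "real (CARD('n) choose k) = 2 * c" using k by simp
      have "0 \<le> 2 * c * (p t / t) ^ k + c * (p t / t) ^ (k - 1) * (p' t - p t / t)"
        using S[of k t] k t1 unfolding bin c_def by simp
      also have "(p t / t) ^ k = (p t / t) ^ (k - 1) * (p t / t)" using k by (cases k) auto
      also have "2 * c * ((p t / t) ^ (k - 1) * (p t / t)) + c * (p t / t) ^ (k - 1) * (p' t - p t / t) =
          (c * (p t / t) ^ (k - 1)) * (p t / t + p' t)" by (simp add: algebra_simps)
      finally have "0 \<le> (c * (p t / t) ^ (k - 1)) * (p t / t + p' t)" .
      moreover have "0 < c * (p t / t) ^ (k - 1)" using c pt t1 by simp
      ultimately have "0 \<le> p t / t + p' t" by (simp add: zero_le_mult_iff)
      then have "0 \<le> t * (p t / t + p' t)" using t1 by simp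
      then show ?thesis using t1 by (simp add: algebra_simps)
    qed
    ultimately show "\<exists>y. ((\<lambda>t. t * p t) has_real_derivative y) (at t) \<and> 0 \<le> y" by blast
  qed
  have "continuous_on {0..1} (\<lambda>r. U (r *\<^sub>R ax))"
    by (rule continuous_on_compose2[OF adm(2)]) (use ax in \<open>auto intro!: continuous_intros\<close>)
  then have Vcont: "continuous_on {0..1} (radial_profile U)"
    by (rule continuous_on_eq) (use prof in auto)
  have "radial_profile U 1 = 0" using prof[of 1] bd[of ax] ax by simp
  then show ?thesis
    using that[of p] dV p0 mono Vcont continuous_on_subset[OF pcont, of "{0<..<1}"] by fastforce
qed

section \<open>Profiles of the weighted space\<close>

text \<open>The densities on the exhausting intervals from a i to 1 - a i all agree almost
  everywhere with the derivative. Off one null set they are therefore eventually constant in i, and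
  their limit is a single Borel function serving all compact subintervals.\<close>

lemma locally_abs_continuous_derivative:
  assumes v: "locally_abs_continuous_01 v"
  obtains F where "F \<in> borel_measurable borel"
    "AE r in lborel. r \<in> {0<..<1} \<longrightarrow> (v has_real_derivative F r) (at r)"
    "\<And>x y. 0 < x \<Longrightarrow> x \<le> y \<Longrightarrow> y < 1 \<Longrightarrow> set_integrable lborel {x..y} F \<and> v y - v x = (LINT t:{x..y}|lborel. F t)"
proof -
  define a where "a i = 1 / (real i + 3)" for i
  have a: "0 < a i" "a i < 1 - a i" for i
  proof -
    show "0 < a i" by (simp add: a_def)
    have "a i \<le> 1 / 3" unfolding a_def by (intro divide_left_mono) auto
    then show "a i < 1 - a i" by linarith
  qed
  define P where "P i f \<longleftrightarrow> integrable lborel f \<and> (\<forall>x y. a i \<le> x \<longrightarrow> x \<le> y \<longrightarrow> y \<le> 1 - a i \<longrightarrow> v y - v x = integral {x..y} f) \<and>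
      (AE x in lborel. x \<in> {a i<..<1 - a i} \<longrightarrow> (v has_real_derivative f x) (at x))" for i f
  have "\<exists>f. P i f" for i
  proof -
    have "abs_continuous_on_interval (a i) (1 - a i) v"
      using v a[of i] unfolding locally_abs_continuous_01_def by simp
    then show ?thesis
      by (rule abs_continuous_on_interval_integral[OF _ a(2)]) (auto simp: P_def)
  qed
  then obtain f where Pf: "\<And>i. P i (f i)" by metis
  have f: "\<And>i. integrable lborel (f i)"
    "\<And>i x y. a i \<le> x \<Longrightarrow> x \<le> y \<Longrightarrow> y \<le> 1 - a i \<Longrightarrow> v y - v x = integral {x..y} (f i)"
    "\<And>i. AE x in lborel. x \<in> {a i<..<1 - a i} \<longrightarrow> (v has_real_derivative f i x) (at x)"
    using Pf by (auto simp: P_def)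
  have [measurable]: "f i \<in> borel_measurable borel" for i using f(1)[of i] by auto
  define F where "F r = lim (\<lambda>i. f i r)" for r
  have Fm: "F \<in> borel_measurable borel" unfolding F_def by measurable
  have ev: "\<forall>\<^sub>F i in sequentially. a i < x" if "x > 0" for x
  proof -
    have "a \<longlonglongrightarrow> 0" unfolding a_def by real_asymp
    then show ?thesis using that by (rule order_tendstoD)
  qed
  have all: "AE r in lborel. \<forall>i. r \<in> {a i<..<1 - a i} \<longrightarrow> (v has_real_derivative f i r) (at r)"
    using f(3) by (simp add: AE_all_countable)
  have Fr: "(v has_real_derivative F r) (at r) \<and> F r = f i r"
    if h: "\<forall>i. r \<in> {a i<..<1 - a i} \<longrightarrow> (v has_real_derivative f i r) (at r)" and i: "r \<in> {a i<..<1 - a i}" for r i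
  proof -
    have r01: "0 < r" "0 < 1 - r" using i a(1)[of i] by auto
    have d: "(v has_real_derivative f i r) (at r)" using h i by blast
    have "\<forall>\<^sub>F j in sequentially. f j r = f i r"
      using ev[OF r01(1)] ev[OF r01(2)]
    proof eventually_elim
      case (elim j)
      then have "(v has_real_derivative f j r) (at r)" using h by auto
      then show ?case using d by (rule DERIV_unique)
    qed
    then have "(\<lambda>j. f j r) \<longlonglongrightarrow> f i r" by (rule tendsto_eventually)
    then have "F r = f i r" unfolding F_def by (rule limI)
    then show ?thesis using d by simp
  qed
  have "AE r in lborel. r \<in> {0<..<1} \<longrightarrow> (v has_real_derivative F r) (at r)"
    using all
  proof eventually_elim
    case (elim r)
    show ?case
    proof
      assume r: "r \<in> {0<..<1}"
      have "\<forall>\<^sub>F i in sequentially. a i < r \<and> a i < 1 - r" using ev[of r] ev[of "1 - r"] r by (auto intro: eventually_conj)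
      then obtain i where "a i < r" "a i < 1 - r" by (auto simp: eventually_sequentially)
      then show "(v has_real_derivative F r) (at r)" using Fr[OF elim, of i] by auto
    qed
  qed
  moreover have "set_integrable lborel {x..y} F \<and> v y - v x = (LINT t:{x..y}|lborel. F t)"
    if xy: "0 < x" "x \<le> y" "y < 1" for x y
  proof -
    have "\<forall>\<^sub>F i in sequentially. a i < x \<and> a i < 1 - y" using ev[of x] ev[of "1 - y"] xy by (auto intro: eventually_conj)
    then obtain i where i: "a i < x" "a i < 1 - y" by (auto simp: eventually_sequentially)
    have fi: "set_integrable lborel {x..y} (f i)"
      unfolding set_integrable_def using f(1) by (intro integrable_mult_indicator) auto
    have eq: "AE t in lborel. indicator {x..y} t *\<^sub>R F t = indicator {x..y} t *\<^sub>R f i t"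
      using all
    proof eventually_elim
      case (elim t)
      show ?case
      proof (cases "t \<in> {x..y}")
        case True
        then have "t \<in> {a i<..<1 - a i}" using i by auto
        then show ?thesis using Fr[OF elim, of i] by simp
      qed simp
    qed
    have "set_integrable lborel {x..y} F"
      using fi eq Fm unfolding set_integrable_def by (subst integrable_cong_AE[where g = "\<lambda>t. indicator {x..y} t *\<^sub>R f i t"]) auto
    moreover have "(LINT t:{x..y}|lborel. F t) = (LINT t:{x..y}|lborel. f i t)"
      unfolding set_lebesgue_integral_def using eq Fm by (intro integral_cong_AE) auto
    moreover have "(LINT t:{x..y}|lborel. f i t) = v y - v x"
      using f(2)[of i x y] i xy set_borel_integral_eq_integral(2)[OF fi] by simp
    ultimately show ?thesis by simp
  qed
  ultimately show ?thesis using that[OF Fm] by blast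
qed

section \<open>From norm limits back to nonincreasing densities\<close>

context mt_class
begin

lemma nn_integral_weight_le:
  assumes x: "0 < x" "x < 1"
  shows "(\<integral>\<^sup>+r\<in>{x..<1}. ennreal (1 / r * ln (1 / r) powr - b) \<partial>lborel) \<le> ennreal ((- ln x) powr (1 - b) / (1 - b))"
proof -
  define L where "L = - ln x"
  have L: "L > 0" using x by (simp add: L_def)
  have "(\<integral>\<^sup>+r\<in>{x..<1}. ennreal (1 / r * ln (1 / r) powr - b) \<partial>lborel) \<le>
      (\<integral>\<^sup>+r\<in>{0<..<1}. ennreal (exp (- 1 * ln r) * (- 1 * ln r) powr - b) * indicator {0<..L} (- 1 * ln r) \<partial>lborel)"
  proof (rule nn_integral_mono)
    fix r
    show "ennreal (1 / r * ln (1 / r) powr - b) * indicator {x..<1} r \<le>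
      ennreal (exp (- 1 * ln r) * (- 1 * ln r) powr - b) * indicator {0<..L} (- 1 * ln r) * indicator {0<..<1} r"
      using x by (auto simp: indicator_def exp_minus ln_div inverse_eq_divide L_def)
  qed
  also have "\<dots> = (\<integral>\<^sup>+s\<in>{0<..}. ennreal (exp s * s powr - b) * indicator {0<..L} s * ennreal (exp (- s / 1) / 1) \<partial>lborel)"
    by (rule nn_integral_log_01[where f = "\<lambda>s. ennreal (exp s * s powr - b) * indicator {0<..L} s"]) auto
  also have "\<dots> = (\<integral>\<^sup>+s\<in>{0<..L}. ennreal (s powr - b) \<partial>lborel)"
    by (intro nn_integral_cong) (auto simp: indicator_def ennreal_mult[symmetric] exp_minus)
  also have "\<dots> = ennreal (L powr (1 - b) / (1 - b))"
    using L b0 b1 by (subst nn_integral_powr_Ioc) auto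
  finally show ?thesis by (simp add: L_def)
qed

text \<open>Because V - v tends to 0 at r = 1, its value at x is, up to sign, the integral of p - F
  over (x, 1). Hoelder with \<omega> = (1 / r) ln (1 / r) powr (- b) bounds this by the energy, so
  convergence in the norm implies pointwise convergence of profiles.\<close>

lemma profile_diff_le:
  assumes V: "\<And>r. 0 < r \<Longrightarrow> r < 1 \<Longrightarrow> (V has_real_derivative p r) (at r)"
    and p: "continuous_on {0<..<1} p"
    and lim: "((\<lambda>r. V r - v r) \<longlongrightarrow> 0) (at_left 1)"
    and F: "F \<in> borel_measurable borel"
      "\<And>x y. 0 < x \<Longrightarrow> x \<le> y \<Longrightarrow> y < 1 \<Longrightarrow> set_integrable lborel {x..y} F \<and> v y - v x = (LINT t:{x..y}|lborel. F t)"
    and E: "radial_energy (\<lambda>r. p r - F r) \<le> ennreal E" "0 \<le> E" and x: "0 < x" "x < 1"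
  shows "\<bar>V x - v x\<bar> \<le> root (Suc k) (E * ((- ln x) powr (1 - b) / (1 - b)) ^ k)"
proof -
  define q where "q r = indicator {0<..<1} r *\<^sub>R p r - F r" for r
  have "(\<lambda>r. indicator {0<..<1} r *\<^sub>R p r) \<in> borel_measurable borel"
    using p by (intro borel_measurable_continuous_on_indicator) auto
  then have qm [measurable]: "q \<in> borel_measurable borel" unfolding q_def using F(1) by measurable
  let ?B = "root (Suc k) (E * ((- ln x) powr (1 - b) / (1 - b)) ^ k)"
  have X: "0 < (- ln x) powr (1 - b) / (1 - b)" using x b1 by simp
  have B0: "0 \<le> ?B" using E X by (simp add: zero_le_mult_iff)
  have step: "\<bar>(V y - v y) - (V x - v x)\<bar> \<le> ?B" if y: "x \<le> y" "y < 1" for y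
  proof -
    have pc: "continuous_on {x..y} p" by (rule continuous_on_subset[OF p]) (use x y in auto)
    have pi: "set_integrable lborel {x..y} p" using pc by (rule borel_integrable_atLeastAtMost')
    have "(p has_integral (V y - V x)) {x..y}"
    proof (rule fundamental_theorem_of_calculus[OF y(1)])
      fix t assume "t \<in> {x..y}"
      then have "(V has_real_derivative p t) (at t within {x..y})" using x y by (intro has_field_derivative_at_within[OF V]) auto
      then show "(V has_vector_derivative p t) (at t within {x..y})" by (simp add: has_real_derivative_iff_has_vector_derivative)
    qed
    then have Vp: "V y - V x = (LINT t:{x..y}|lborel. p t)"
      using set_borel_integral_eq_integral(2)[OF pi] by (simp add: integral_unique)
    have qi: "set_integrable lborel {x..y} (\<lambda>t. p t - F t)" using pi F(2)[OF x(1) y] by auto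
    have "(V y - v y) - (V x - v x) = (LINT t:{x..y}|lborel. p t - F t)"
      using Vp F(2)[OF x(1) y] pi by (subst set_integral_diff) auto
    also have "\<bar>\<dots>\<bar> \<le> (LINT t:{x..y}|lborel. \<bar>p t - F t\<bar>)"
      using set_integral_norm_bound[OF qi] by simp
    finally have "ennreal \<bar>(V y - v y) - (V x - v x)\<bar> \<le> ennreal (LINT t:{x..y}|lborel. \<bar>p t - F t\<bar>)" by (rule ennreal_leI)
    also have "\<dots> = (\<integral>\<^sup>+t\<in>{x..y}. ennreal \<bar>p t - F t\<bar> \<partial>lborel)"
    proof -
      have "set_integrable lborel {x..y} (\<lambda>t. \<bar>p t - F t\<bar>)" using qi by (rule set_integrable_abs)
      then have "ennreal (LINT t:{x..y}|lborel. \<bar>p t - F t\<bar>) = (\<integral>\<^sup>+t. ennreal (indicator {x..y} t *\<^sub>R \<bar>p t - F t\<bar>) \<partial>lborel)"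
        unfolding set_lebesgue_integral_def set_integrable_def by (intro nn_integral_eq_integral[symmetric]) auto
      also have "\<dots> = (\<integral>\<^sup>+t\<in>{x..y}. ennreal \<bar>p t - F t\<bar> \<partial>lborel)"
        by (intro nn_integral_cong) (auto simp: indicator_def)
      finally show ?thesis .
    qed
    also have "\<dots> = (\<integral>\<^sup>+t\<in>{x..y}. ennreal \<bar>q t\<bar> \<partial>lborel)"
      using x y by (intro nn_integral_cong) (auto simp: indicator_def q_def)
    also have "\<dots> \<le> ennreal ?B"
    proof (rule nn_integral_power_mean[where \<omega> = "\<lambda>r. 1 / r * ln (1 / r) powr - b"])
      show "(\<integral>\<^sup>+r\<in>{x..y}. ennreal (1 / r * ln (1 / r) powr - b) \<partial>lborel) \<le> ennreal ((- ln x) powr (1 - b) / (1 - b))"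
        by (rule order_trans[OF nn_integral_mono nn_integral_weight_le[OF x]]) (use y in \<open>auto simp: indicator_def\<close>)
      have "(\<integral>\<^sup>+r\<in>{x..y}. ennreal (\<bar>q r\<bar> ^ Suc k / (1 / r * ln (1 / r) powr - b) ^ k) \<partial>lborel) \<le> radial_energy (\<lambda>r. p r - F r)"
        unfolding radial_energy_def
      proof (rule nn_integral_mono)
        fix r
        show "ennreal (\<bar>q r\<bar> ^ Suc k / (1 / r * ln (1 / r) powr - b) ^ k) * indicator {x..y} r \<le>
          ennreal (r ^ k * \<bar>p r - F r\<bar> ^ Suc k * ln (1 / r) powr (b * real k)) * indicator {0<..<1} r"
        proof (cases "r \<in> {x..y}")
          case True
          then have r: "0 < r" "r < 1" using x y by auto
          have l: "ln (1 / r) > 0" using r by (simp add: ln_div)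
          have "(ln (1 / r) powr - b) ^ k = ln (1 / r) powr - (b * real k)" using l by (simp add: powr_power mult.commute)
          then have "\<bar>q r\<bar> ^ Suc k / (1 / r * ln (1 / r) powr - b) ^ k = r ^ k * \<bar>q r\<bar> ^ Suc k * ln (1 / r) powr (b * real k)"
            unfolding power_mult_distrib using r l by (simp add: powr_minus power_divide field_simps)
          then show ?thesis using True r by (simp add: q_def)
        qed simp
      qed
      then show "(\<integral>\<^sup>+r\<in>{x..y}. ennreal (\<bar>q r\<bar> ^ Suc k / (1 / r * ln (1 / r) powr - b) ^ k) \<partial>lborel) \<le> ennreal E"
        using E(1) by (rule order_trans)
      fix r assume "r \<in> {x..y}"
      then have "0 < r" "0 < ln (1 / r)" using x y by (auto simp: ln_div)
      then show "0 < 1 / r * ln (1 / r) powr - b" by simp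
    qed (use E X in auto)
    finally show ?thesis using B0 by (subst (asm) ennreal_le_iff) auto
  qed
  have "((\<lambda>y. \<bar>(V y - v y) - (V x - v x)\<bar>) \<longlongrightarrow> \<bar>0 - (V x - v x)\<bar>) (at_left 1)"
    by (intro tendsto_intros lim)
  moreover have "\<forall>\<^sub>F y in at_left 1. \<bar>(V y - v y) - (V x - v x)\<bar> \<le> ?B"
  proof -
    have "\<forall>\<^sub>F y in at_left 1. y \<in> {x<..<1}" by (rule eventually_at_left_real[OF x(2)])
    then show ?thesis by eventually_elim (use step in auto)
  qed
  ultimately have "\<bar>0 - (V x - v x)\<bar> \<le> ?B" by (rule tendsto_upperbound) simp
  then show ?thesis by simp
qed

text \<open>Only radii that correspond to discontinuities of g can fail, and there are countably
  many of them.\<close>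

lemma AE_prim_log_derivative:
  assumes g: "decr_int g"
  shows "AE r in lborel. r \<in> {0<..<1} \<longrightarrow>
    ((\<lambda>r. - scl * prim g (- (2 * real k) * ln r)) has_real_derivative scl * (2 * real k) * g (- (2 * real k) * ln r) / r) (at r)"
proof -
  let ?N = "2 * real k"
  have N: "?N > 0" using k by simp
  define S where "S = {s. 0 < s \<and> \<not> isCont g s}"
  have "countable S" unfolding S_def by (rule decr_countable_discont[OF decr_intD(1)[OF g]])
  then have "countable ((\<lambda>s. exp (- s / ?N)) ` S)" by simp
  then have "(\<lambda>s. exp (- s / ?N)) ` S \<in> null_sets lborel" by (rule countable_imp_null_set_lborel)
  then have "AE r in lborel. r \<notin> (\<lambda>s. exp (- s / ?N)) ` S" by (rule AE_not_in)
  then show ?thesis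
  proof eventually_elim
    case (elim r)
    show ?case
    proof
      assume r: "r \<in> {0<..<1}"
      define s where "s = - ?N * ln r"
      have s: "s > 0" using r N by (simp add: s_def mult_pos_neg)
      have "exp (- s / ?N) = r" using r N by (simp add: s_def)
      then have "isCont g s" using elim s unfolding S_def by (metis (mono_tags, lifting) image_eqI mem_Collect_eq)
      then have d: "(prim g has_real_derivative g s) (at s)" by (rule prim_has_derivative[OF g s])
      have "((\<lambda>r. - ?N * ln r) has_real_derivative - ?N * (1 / r)) (at r)"
        using r by (auto intro!: derivative_eq_intros)
      from DERIV_chain2[OF d[unfolded s_def] this]
      have "((\<lambda>r. prim g (- ?N * ln r)) has_real_derivative g (- ?N * ln r) * (- ?N * (1 / r))) (at r)" .
      from DERIV_cmult[OF this, of "- scl"]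
      show "((\<lambda>r. - scl * prim g (- ?N * ln r)) has_real_derivative scl * ?N * g (- ?N * ln r) / r) (at r)"
        by (simp add: mult_ac)
    qed
  qed
qed

text \<open>The density is r p(r) / (2 k scl) at r = exp (- s / (2 k)); it is nonincreasing in s
  because r p(r) is nondecreasing in r. The condition V 1 = 0 fixes the constant of
  integration.\<close>

lemma profile_prim:
  fixes V p :: "real \<Rightarrow> real"
  assumes V: "\<And>r. 0 < r \<Longrightarrow> r < 1 \<Longrightarrow> (V has_real_derivative p r) (at r)"
    and p: "\<And>r. 0 < r \<Longrightarrow> r < 1 \<Longrightarrow> 0 \<le> p r" "\<And>r s. 0 < r \<Longrightarrow> r \<le> s \<Longrightarrow> s < 1 \<Longrightarrow> r * p r \<le> s * p s"
    and V1: "continuous_on {0..1} V" "V 1 = 0" and fin: "radial_energy p < \<infinity>"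
  obtains g where "decr_int g" "ennreal cc * radial_energy p = ennreal (1 / (1 - b) ^ k) * energy {0<..} g"
    "\<And>r. 0 < r \<Longrightarrow> r < 1 \<Longrightarrow> V r = - scl * prim g (- (2 * real k) * ln r)"
proof -
  let ?N = "2 * real k"
  have N: "?N > 0" using k by simp
  define g where "g s = (if s \<le> 0 then 0 else exp (- s / ?N) * p (exp (- s / ?N)) / (scl * ?N))" for s
  have e01: "0 < exp (- s / ?N)" "exp (- s / ?N) < 1" if "s > 0" for s using that N by auto
  have g: "decr g"
    unfolding decr_def
  proof (intro conjI allI impI)
    fix s t :: real assume st: "0 < s" "s \<le> t"
    have "exp (- t / ?N) \<le> exp (- s / ?N)" using st N by (simp add: divide_right_mono)
    then have "exp (- t / ?N) * p (exp (- t / ?N)) \<le> exp (- s / ?N) * p (exp (- s / ?N))"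
      using st e01 by (intro p(2)) auto
    then show "g t \<le> g s" using st scl_pos N by (simp add: g_def divide_right_mono)
  next
    fix s show "0 \<le> g s" using e01[of s] p(1)[of "exp (- s / ?N)"] scl_pos N by (simp add: g_def)
  qed (simp add: g_def)
  have pg: "p r = scl * ?N * g (- ?N * ln r) / r" if "0 < r" "r < 1" for r
  proof -
    have "- ?N * ln r > 0" using that N by (simp add: mult_pos_neg)
    moreover have "exp (- (- ?N * ln r) / ?N) = r" using that N by simp
    ultimately show ?thesis using that scl_pos N by (simp add: g_def)
  qed
  have en: "ennreal cc * radial_energy p = ennreal (1 / (1 - b) ^ k) * energy {0<..} g"
  proof -
    have "(\<lambda>s. \<bar>g s\<bar>) = g" using decrD(2)[OF g] by auto
    moreover have "ennreal cc * radial_energy p = ennreal (1 / (1 - b) ^ k) * energy {0<..} (\<lambda>s. \<bar>g s\<bar>)"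
      by (rule radial_energy_eq[OF decr_borel_measurable[OF g]]) (use pg in auto)
    ultimately show ?thesis by simp
  qed
  have "energy {0<..} g < \<infinity>"
  proof (rule ccontr)
    assume "\<not> energy {0<..} g < \<infinity>"
    then have "energy {0<..} g = top" by (simp add: less_top[symmetric])
    then have "ennreal (1 / (1 - b) ^ k) * energy {0<..} g = \<infinity>" using b1 by (simp add: ennreal_mult_top)
    then show False using en fin by (simp add: ennreal_mult_eq_top_iff)
  qed
  then have gi: "decr_int g" by (rule decr_int_energy[OF g])
  have "V r = - scl * prim g (- ?N * ln r)" if r: "0 < r" "r < 1" for r
  proof -
    define s where "s = - ?N * ln r"
    have s: "s > 0" using r N by (simp add: s_def mult_pos_neg)
    have rs: "exp (- s / ?N) = r" using r N by (simp add: s_def)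
    have "(g has_integral (- V (exp (- s / ?N)) / scl - - V (exp (- 0 / ?N)) / scl)) {0..s}"
    proof (rule fundamental_theorem_of_calculus_interior)
      show "continuous_on {0..s} (\<lambda>s. - V (exp (- s / ?N)) / scl)"
        by (intro continuous_intros continuous_on_compose2[OF V1(1)]) (use scl_pos N in auto)
      fix t assume t: "t \<in> {0<..<s}"
      then have e: "0 < exp (- t / ?N)" "exp (- t / ?N) < 1" using e01[of t] by auto
      have "((\<lambda>t. exp (- t / ?N)) has_real_derivative exp (- t / ?N) * (- 1 / ?N)) (at t)"
        using N by (auto intro!: derivative_eq_intros)
      from DERIV_cdivide[OF DERIV_minus[OF DERIV_chain2[OF V[OF e] this]], of scl]
      have "((\<lambda>t. - V (exp (- t / ?N)) / scl) has_real_derivative g t) (at t)"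
        using t by (simp add: g_def mult_ac)
      then show "((\<lambda>t. - V (exp (- t / ?N)) / scl) has_vector_derivative g t) (at t)"
        by (simp add: has_real_derivative_iff_has_vector_derivative)
    qed (use s in auto)
    then have "prim g s = - V r / scl" unfolding rs prim_def using V1(2) by (simp add: integral_unique)
    then have "V r = - scl * prim g s" using scl_pos by simp
    then show ?thesis by (simp only: s_def)
  qed
  then show ?thesis using that[OF gi en] by blast
qed

text \<open>The factor 2^(k+1) is crude but sufficient: the estimate serves to bound the energies of
  an approximating sequence uniformly, as \<open>helly\<close> requires.\<close>

lemma radial_energy_triangle:
  assumes p: "continuous_on {0<..<1} p" and F: "F \<in> borel_measurable borel"
  shows "radial_energy p \<le> ennreal (2 ^ Suc k) * (radial_energy (\<lambda>r. p r - F r) + radial_energy F)"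
proof -
  define q where "q r = indicator {0<..<1} r *\<^sub>R p r" for r
  have qm: "q \<in> borel_measurable borel"
    unfolding q_def using p by (intro borel_measurable_continuous_on_indicator) auto
  have qp: "radial_energy p = radial_energy q" "radial_energy (\<lambda>r. p r - F r) = radial_energy (\<lambda>r. q r - F r)"
    by (auto intro!: radial_energy_cong_AE simp: q_def)
  note [measurable] = qm F
  have "radial_energy q \<le> (\<integral>\<^sup>+r. ennreal (2 ^ Suc k) * (ennreal (r ^ k * \<bar>q r - F r\<bar> ^ Suc k * ln (1 / r) powr (b * real k)) * indicator {0<..<1} r +
      ennreal (r ^ k * \<bar>F r\<bar> ^ Suc k * ln (1 / r) powr (b * real k)) * indicator {0<..<1} r) \<partial>lborel)"
    unfolding radial_energy_def
  proof (rule nn_integral_mono)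
    fix r
    show "ennreal (r ^ k * \<bar>q r\<bar> ^ Suc k * ln (1 / r) powr (b * real k)) * indicator {0<..<1} r \<le>
      ennreal (2 ^ Suc k) * (ennreal (r ^ k * \<bar>q r - F r\<bar> ^ Suc k * ln (1 / r) powr (b * real k)) * indicator {0<..<1} r +
      ennreal (r ^ k * \<bar>F r\<bar> ^ Suc k * ln (1 / r) powr (b * real k)) * indicator {0<..<1} r)"
    proof (cases "r \<in> {0<..<1}")
      case True
      define A B where "A = \<bar>q r - F r\<bar>" and "B = \<bar>F r\<bar>"
      have AB: "0 \<le> A" "0 \<le> B" "\<bar>q r\<bar> \<le> A + B" by (auto simp: A_def B_def)
      have "A + B \<le> 2 * max A B" by simp
      then have "(A + B) ^ Suc k \<le> (2 * max A B) ^ Suc k" using AB by (intro power_mono) auto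
      also have "\<dots> = 2 ^ Suc k * (max A B) ^ Suc k" by (rule power_mult_distrib)
      also have "\<dots> \<le> 2 ^ Suc k * (A ^ Suc k + B ^ Suc k)"
        using AB by (intro mult_left_mono) (auto simp: max_def)
      finally have "\<bar>q r\<bar> ^ Suc k \<le> 2 ^ Suc k * (A ^ Suc k + B ^ Suc k)"
        using AB power_mono[of "\<bar>q r\<bar>" "A + B" "Suc k"] by linarith
      moreover define W where "W = r ^ k * ln (1 / r) powr (b * real k)"
      moreover have W: "0 \<le> W" using True by (simp add: W_def)
      ultimately have "W * \<bar>q r\<bar> ^ Suc k \<le> W * (2 ^ Suc k * (A ^ Suc k + B ^ Suc k))" by (intro mult_left_mono)
      also have "\<dots> = 2 ^ Suc k * (W * A ^ Suc k + W * B ^ Suc k)" by (simp add: algebra_simps)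
      finally have "ennreal (W * \<bar>q r\<bar> ^ Suc k) \<le> ennreal (2 ^ Suc k) * (ennreal (W * A ^ Suc k) + ennreal (W * B ^ Suc k))"
        using W AB by (subst ennreal_plus[symmetric]; (subst ennreal_mult[symmetric])?) (auto simp del: power_Suc ennreal_plus intro!: ennreal_leI)
      then show ?thesis using True by (simp add: W_def A_def B_def mult_ac del: power_Suc)
    qed simp
  qed
  also have "\<dots> = ennreal (2 ^ Suc k) * (radial_energy (\<lambda>r. q r - F r) + radial_energy F)"
    unfolding radial_energy_def by (subst nn_integral_cmult, simp, subst nn_integral_add) auto
  finally show ?thesis unfolding qp .
qed

text \<open>Helly's principle gives a limit density g' of the approximants, and pointwise
  convergence of the profiles identifies u with it. The sharp budget does not come from the
  approximants, whose bound \<open>M\<close> is crude: it is read off from the norm of u itself,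
  once the derivative of the profile is expressed by g'.\<close>

lemma weighted_class_profile:
  fixes u :: "real^'n::finite \<Rightarrow> real"
  assumes n: "CARD('n) = 2 * k"
    and u: "u \<in> Phi_0_rad_weighted (CARD('n) div 2) (w0 CARD('n) b)"
    and norm: "Phi_norm (CARD('n) div 2) (w0 CARD('n) b) u \<le> 1"
  shows "\<exists>g. cls g \<and> (\<forall>x\<in>ball 0 1. x \<noteq> 0 \<longrightarrow> u x = - scl * prim g (- real CARD('n) * ln (norm x)))"
proof -
  let ?N = "2 * real k"
  have N: "?N > 0" "real CARD('n) = ?N" using k n by auto
  define v where "v = radial_profile u"
  obtain U where rad: "radial_on (ball 0 1) u" and ac: "locally_abs_continuous_01 v"
    and v1: "(v \<longlongrightarrow> 0) (at_left 1)"
    and U: "\<And>m. U m \<in> Phi_0_rad k" "\<And>m. Phi_norm (CARD('n) div 2) (w0 CARD('n) b) (U m) < \<infinity>"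
    and conv: "(\<lambda>m. Phi_norm (CARD('n) div 2) (w0 CARD('n) b) (\<lambda>x. U m x - u x)) \<longlonglongrightarrow> 0"
    using u n unfolding Phi_0_rad_weighted_def v_def by auto
  obtain F where F: "F \<in> borel_measurable borel"
    "AE r in lborel. r \<in> {0<..<1} \<longrightarrow> (v has_real_derivative F r) (at r)"
    "\<And>x y. 0 < x \<Longrightarrow> x \<le> y \<Longrightarrow> y < 1 \<Longrightarrow> set_integrable lborel {x..y} F \<and> v y - v x = (LINT t:{x..y}|lborel. F t)"
    by (rule locally_abs_continuous_derivative[OF ac]) (rule that)
  define V where "V m = radial_profile (U m)" for m
  define P where "P m p \<longleftrightarrow> (\<forall>r. 0 < r \<longrightarrow> r < 1 \<longrightarrow> (V m has_real_derivative p r) (at r)) \<and>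
    continuous_on {0<..<1} p \<and> (\<forall>r. 0 < r \<longrightarrow> r < 1 \<longrightarrow> 0 \<le> p r) \<and>
    (\<forall>r s. 0 < r \<longrightarrow> r \<le> s \<longrightarrow> s < 1 \<longrightarrow> r * p r \<le> s * p s) \<and>
    continuous_on {0..1} (V m) \<and> V m 1 = 0" for m p
  have "\<exists>p. P m p" for m
    by (rule Phi_0_rad_profile[OF U(1) n k, of m]) (rule exI, auto simp: P_def V_def)
  then obtain p where Pp: "\<And>m. P m (p m)" by metis
  have p: "\<And>m r. 0 < r \<Longrightarrow> r < 1 \<Longrightarrow> (V m has_real_derivative p m r) (at r)"
    "\<And>m. continuous_on {0<..<1} (p m)" "\<And>m r. 0 < r \<Longrightarrow> r < 1 \<Longrightarrow> 0 \<le> p m r"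
    "\<And>m r s. 0 < r \<Longrightarrow> r \<le> s \<Longrightarrow> s < 1 \<Longrightarrow> r * p m r \<le> s * p m s"
    "\<And>m. continuous_on {0..1} (V m)" "\<And>m. V m 1 = 0"
    using Pp by (auto simp: P_def)
  define E where "E m = radial_energy (\<lambda>r. p m r - F r)" for m
  have dv: "radial_energy (deriv v) = radial_energy F"
    using F(2) by (intro radial_energy_cong_AE) (auto elim!: eventually_mono intro: DERIV_imp_deriv)
  have dV: "radial_energy (deriv (V m)) = radial_energy (p m)" for m
    using p(1) by (intro radial_energy_cong_AE AE_I2) (auto intro: DERIV_imp_deriv)
  have dW: "radial_energy (deriv (radial_profile (\<lambda>x. U m x - u x))) = E m" for m
    unfolding E_def
  proof (rule radial_energy_cong_AE)
    have W: "radial_profile (\<lambda>x. U m x - u x) = (\<lambda>r. V m r - v r)"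
      by (simp add: radial_profile_def V_def v_def fun_eq_iff)
    show "AE r in lborel. r \<in> {0<..<1} \<longrightarrow> deriv (radial_profile (\<lambda>x. U m x - u x)) r = p m r - F r"
      using F(2)
    proof eventually_elim
      case (elim r)
      show ?case
      proof
        assume r: "r \<in> {0<..<1}"
        have "((\<lambda>r. V m r - v r) has_real_derivative p m r - F r) (at r)"
          using elim r p(1)[of r m] by (intro DERIV_diff) auto
        then show "deriv (radial_profile (\<lambda>x. U m x - u x)) r = p m r - F r"
          unfolding W by (rule DERIV_imp_deriv)
      qed
    qed
  qed
  have cc0: "ennreal cc > 0" using cc_pos by simp
  have mult0: "x = ennreal (1 / cc) * (ennreal cc * x)" for x
    using cc_pos by (simp add: mult.assoc[symmetric] ennreal_mult[symmetric])
  have "(\<lambda>m. ennreal cc * E m) \<longlonglongrightarrow> 0"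
    using conv unfolding Phi_norm_eq[OF n] dW ennroot_tendsto_0 .
  then have "(\<lambda>m. ennreal (1 / cc) * (ennreal cc * E m)) \<longlonglongrightarrow> ennreal (1 / cc) * 0"
    by (intro ennreal_tendsto_cmult) auto
  then have E0: "E \<longlonglongrightarrow> 0" unfolding mult0[symmetric] by simp
  have normF: "ennreal cc * radial_energy F \<le> 1"
    using norm unfolding Phi_norm_eq[OF n] ennroot_le_1 v_def[symmetric] dv .
  obtain M0 where M0: "\<And>m. m \<ge> M0 \<Longrightarrow> E m < 1"
    using order_tendstoD(2)[OF E0, of 1] by (auto simp: eventually_sequentially)
  have finU: "radial_energy (p m) < \<infinity>" for m
  proof (rule ccontr)
    assume "\<not> radial_energy (p m) < \<infinity>"
    then have "radial_energy (p m) = top" by (simp add: less_top[symmetric])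
    then have "ennreal cc * radial_energy (p m) = \<infinity>" using cc0 by (simp add: ennreal_mult_top)
    moreover have "ennreal cc * radial_energy (p m) < \<infinity>"
      using U(2)[of m] unfolding Phi_norm_eq[OF n] ennroot_less_top V_def[symmetric] dV .
    ultimately show False by simp
  qed
  define G where "G m g \<longleftrightarrow> decr_int g \<and> ennreal cc * radial_energy (p m) = ennreal (1 / (1 - b) ^ k) * energy {0<..} g \<and>
    (\<forall>r. 0 < r \<longrightarrow> r < 1 \<longrightarrow> V m r = - scl * prim g (- ?N * ln r))" for m g
  have "\<exists>g. G m g" for m
  proof (rule profile_prim[of "V m" "p m"])
    fix g
    assume "decr_int g" "ennreal cc * radial_energy (p m) = ennreal (1 / (1 - b) ^ k) * energy {0<..} g"
      "\<And>r. 0 < r \<Longrightarrow> r < 1 \<Longrightarrow> V m r = - scl * prim g (- ?N * ln r)"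
    then show ?thesis unfolding G_def by blast
  qed (use p finU in auto)
  then obtain g where Gg: "\<And>m. G m (g m)" by metis
  have g: "\<And>m. decr_int (g m)"
    "\<And>m. ennreal cc * radial_energy (p m) = ennreal (1 / (1 - b) ^ k) * energy {0<..} (g m)"
    "\<And>m r. 0 < r \<Longrightarrow> r < 1 \<Longrightarrow> V m r = - scl * prim (g m) (- ?N * ln r)"
    using Gg by (auto simp: G_def)
  have inv: "ennreal ((1 - b) ^ k) * (ennreal (1 / (1 - b) ^ k) * x) = x" for x
    using b1 by (simp add: mult.assoc[symmetric] ennreal_mult[symmetric])
  define M where "M = (1 - b) ^ k * (2 ^ Suc k * (cc + 1))"
  have M0': "M \<ge> 0" using b1 cc_pos by (simp add: M_def)
  have bound: "energy {0<..} (g m) \<le> ennreal M" if m: "m \<ge> M0" for m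
  proof -
    have "ennreal cc * radial_energy (p m) \<le> ennreal cc * (ennreal (2 ^ Suc k) * (E m + radial_energy F))"
      unfolding E_def by (intro mult_left_mono radial_energy_triangle p(2) F(1)) simp
    also have "\<dots> = ennreal (2 ^ Suc k) * (ennreal cc * E m + ennreal cc * radial_energy F)"
      by (simp only: distrib_left mult_ac)
    also have "\<dots> \<le> ennreal (2 ^ Suc k) * (ennreal cc * 1 + 1)"
      using M0[OF m] normF by (intro mult_left_mono add_mono) auto
    also have "\<dots> = ennreal (2 ^ Suc k * (cc + 1))"
    proof -
      have "ennreal cc * 1 + 1 = ennreal (cc + 1)" using cc_pos by simp
      then show ?thesis using cc_pos by (simp only:) (rule ennreal_mult[symmetric], auto)
    qed
    finally have le: "ennreal (1 / (1 - b) ^ k) * energy {0<..} (g m) \<le> ennreal (2 ^ Suc k * (cc + 1))" unfolding g(2) .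
    have "energy {0<..} (g m) = ennreal ((1 - b) ^ k) * (ennreal (1 / (1 - b) ^ k) * energy {0<..} (g m))" by (simp only: inv)
    also have "\<dots> \<le> ennreal ((1 - b) ^ k) * ennreal (2 ^ Suc k * (cc + 1))" using le by (rule mult_left_mono) simp
    also have "\<dots> = ennreal M" unfolding M_def using b1 cc_pos by (intro ennreal_mult[symmetric]) auto
    finally show ?thesis .
  qed
  obtain r g' where r: "strict_mono r" and g': "decr_int g'" and
    pc: "\<And>s. 0 \<le> s \<Longrightarrow> (\<lambda>m. prim (g (r m + M0)) s) \<longlonglongrightarrow> prim g' s"
    by (rule helly[of "\<lambda>m. g (m + M0)" M]) (use decr_intD(1)[OF g(1)] bound M0' in auto)
  have rlim: "filterlim (\<lambda>m. r m + M0) at_top sequentially"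
    using filterlim_subseq[OF r] by (rule filterlim_at_top_mono) auto
  have vg: "v x = - scl * prim g' (- ?N * ln x)" if x: "0 < x" "x < 1" for x
  proof -
    have s: "- ?N * ln x \<ge> 0" using x N by (simp add: mult_nonneg_nonpos)
    have "(\<lambda>m. V (r m + M0) x) \<longlonglongrightarrow> - scl * prim g' (- ?N * ln x)"
      unfolding g(3)[OF x] by (intro tendsto_intros pc s)
    moreover have "(\<lambda>m. V (r m + M0) x) \<longlonglongrightarrow> v x"
    proof -
      define X where "X = (- ln x) powr (1 - b) / (1 - b)"
      have dle: "\<bar>V m x - v x\<bar> \<le> root (Suc k) (enn2real (E m) * X ^ k)" if m: "m \<ge> M0" for m
        unfolding X_def
      proof (rule profile_diff_le[where p = "p m" and F = F])
        have "(V m \<longlongrightarrow> V m 1) (at_left 1)"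
        proof -
          have "(V m \<longlongrightarrow> V m 1) (at 1 within {0..1})" using p(5)[of m] unfolding continuous_on_def by simp
          then show ?thesis by (simp add: at_within_Icc_at_left)
        qed
        then show "((\<lambda>r. V m r - v r) \<longlongrightarrow> 0) (at_left 1)" using tendsto_diff[OF _ v1, of "V m" 0] p(6) by simp
        show "radial_energy (\<lambda>r. p m r - F r) \<le> ennreal (enn2real (E m))"
        proof -
          have "E m < top" using M0[OF m] by (rule less_trans) simp
          then show ?thesis by (simp add: E_def[symmetric])
        qed
      qed (use p F x in auto)
      have "(\<lambda>m. enn2real (E (r m + M0))) \<longlonglongrightarrow> enn2real 0"
        using filterlim_compose[OF E0 rlim] by (intro tendsto_enn2real) (auto simp: o_def)
      then have "(\<lambda>m. root (Suc k) (enn2real (E (r m + M0)) * X ^ k)) \<longlonglongrightarrow> root (Suc k) (enn2real 0 * X ^ k)"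
        by (intro tendsto_real_root tendsto_mult tendsto_const)
      then have z: "(\<lambda>m. root (Suc k) (enn2real (E (r m + M0)) * X ^ k)) \<longlonglongrightarrow> 0" by simp
      have "(\<lambda>m. V (r m + M0) x - v x) \<longlonglongrightarrow> 0"
        by (rule Lim_null_comparison[OF _ z]) (use dle in \<open>auto intro!: always_eventually\<close>)
      then show ?thesis by (simp add: LIM_zero_iff)
    qed
    ultimately show ?thesis by (rule LIMSEQ_unique[symmetric])
  qed
  have "AE r in lborel. r \<in> {0<..<1} \<longrightarrow> F r = scl * ?N * g' (- ?N * ln r) / r"
    using F(2) AE_prim_log_derivative[OF g']
  proof eventually_elim
    case (elim r)
    show ?case
    proof
      assume r: "r \<in> {0<..<1}"
      have "(v has_real_derivative scl * ?N * g' (- ?N * ln r) / r) (at r)"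
        by (rule has_field_derivative_transform_within_open[of "\<lambda>r. - scl * prim g' (- ?N * ln r)" _ _ "{0<..<1}"])
           (use elim r vg in auto)
      then show "F r = scl * ?N * g' (- ?N * ln r) / r" using elim r DERIV_unique by blast
    qed
  qed
  then have "ennreal cc * radial_energy F = ennreal (1 / (1 - b) ^ k) * energy {0<..} (\<lambda>s. \<bar>g' s\<bar>)"
    by (intro radial_energy_eq decr_borel_measurable decr_intD(1)[OF g'])
  also have "(\<lambda>s. \<bar>g' s\<bar>) = g'" using decrD(2)[OF decr_intD(1)[OF g']] by auto
  finally have le: "ennreal (1 / (1 - b) ^ k) * energy {0<..} g' \<le> 1" using normF by simp
  have "energy {0<..} g' = ennreal ((1 - b) ^ k) * (ennreal (1 / (1 - b) ^ k) * energy {0<..} g')" by (simp only: inv)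
  also have "\<dots> \<le> ennreal ((1 - b) ^ k) * 1" using le by (rule mult_left_mono) simp
  finally have "cls g'" using decr_intD(1)[OF g'] by (simp add: cls_def)
  moreover have "u x = - scl * prim g' (- real CARD('n) * ln (norm x))" if x: "x \<in> ball 0 1" "x \<noteq> 0" for x
    using radial_profile_norm[OF rad x(1)] vg[of "norm x"] x N by (simp add: v_def)
  ultimately show ?thesis by blast
qed

end

section \<open>Smooth approximation of profiles\<close>

lemma prim_diff_bounds:
  assumes g: "decr_int g" and ab: "0 < a" "a \<le> b"
  shows "(b - a) * g b \<le> prim g b - prim g a" "prim g b - prim g a \<le> (b - a) * g a"
proof -
  have d: "prim g b - prim g a = integral {a..b} g" using g ab by (intro prim_diff) auto
  have i: "g integrable_on {a..b}" using g ab by (intro decr_int_integrable_on) auto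
  have c: "integral {a..b} (\<lambda>t. y) = (b - a) * y" for y :: real using ab by simp
  have "integral {a..b} (\<lambda>t. g b) \<le> integral {a..b} g"
    using i ab decrD(1)[OF decr_intD(1)[OF g]] by (intro integral_le) auto
  then show "(b - a) * g b \<le> prim g b - prim g a" unfolding c d .
  have "integral {a..b} g \<le> integral {a..b} (\<lambda>t. g a)"
    using i ab decrD(1)[OF decr_intD(1)[OF g]] by (intro integral_le) auto
  then show "prim g b - prim g a \<le> (b - a) * g a" unfolding c d .
qed

lemma decr_int_le:
  assumes g: "decr_int g" and f: "decr f" and le: "\<And>s. 0 < s \<Longrightarrow> f s \<le> g s"
  shows "decr_int f"
proof (rule decr_intI[OF f])
  fix s :: real assume s: "s > 0"
  have "(\<integral>\<^sup>+t\<in>{0<..s}. ennreal (f t) \<partial>lborel) \<le> (\<integral>\<^sup>+t\<in>{0<..s}. ennreal (g t) \<partial>lborel)"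
    using le by (intro nn_integral_mono) (auto simp: indicator_def intro!: ennreal_leI)
  also have "\<dots> = ennreal (prim g s - prim g 0)" using g s by (intro prim_diff_nn_Ioc[symmetric]) auto
  also have "\<dots> < \<infinity>" by simp
  finally show "(\<integral>\<^sup>+t\<in>{0<..s}. ennreal (f t) \<partial>lborel) < \<infinity>" .
qed

text \<open>The forward Steklov mean. For nonincreasing g it lies between g (s + h) and g s, so
  smoothing never exceeds g.\<close>

definition avg :: "real \<Rightarrow> (real \<Rightarrow> real) \<Rightarrow> real \<Rightarrow> real" where
  "avg h g s = (if s \<le> 0 then 0 else (prim g (s + h) - prim g s) / h)"

lemma avg_bounds:
  assumes g: "decr_int g" and h: "0 < h" and s: "0 < s"
  shows "g (s + h) \<le> avg h g s" "avg h g s \<le> g s"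
  using prim_diff_bounds[OF g s, of "s + h"] h s by (auto simp: avg_def field_simps)

lemma decr_int_avg:
  assumes g: "decr_int g" and h: "0 < h"
  shows "decr_int (avg h g)"
proof (rule decr_int_le[OF g])
  note dg = decr_intD(1)[OF g]
  show "decr (avg h g)"
    unfolding decr_def
  proof (intro conjI allI impI)
    fix s t :: real assume st: "0 < s" "s \<le> t"
    show "avg h g t \<le> avg h g s"
    \<comment> \<open>If the two windows overlap, their common part cancels and the pieces of length
      t - s at either end are compared; if they are disjoint, g (s + h) separates the two
      means.\<close>
    proof (cases "t \<le> s + h")
      case True
      have "prim g (t + h) - prim g (s + h) \<le> (t - s) * g (s + h)"
        using prim_diff_bounds(2)[OF g, of "s + h" "t + h"] st h by simp
      also have "\<dots> \<le> (t - s) * g t" using decrD(1)[OF dg, of t "s + h"] st True by (intro mult_left_mono) auto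
      also have "\<dots> \<le> prim g t - prim g s" using prim_diff_bounds(1)[OF g, of s t] st by simp
      finally have "prim g (t + h) - prim g t \<le> prim g (s + h) - prim g s" by simp
      then show ?thesis using st h by (simp add: avg_def divide_right_mono)
    next
      case False
      have "avg h g t \<le> g t" using avg_bounds(2)[OF g h] st by simp
      also have "\<dots> \<le> g (s + h)" using decrD(1)[OF dg, of "s + h" t] st h False by simp
      also have "\<dots> \<le> avg h g s" using avg_bounds(1)[OF g h] st by simp
      finally show ?thesis .
    qed
  next
    fix s show "0 \<le> avg h g s"
    proof (cases "0 < s")
      case True
      then show ?thesis using avg_bounds(1)[OF g h True] decrD(2)[OF dg, of "s + h"] by linarith
    qed (simp add: avg_def)
  qed (simp add: avg_def)
qed (use avg_bounds[OF g h] in auto)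

lemma isCont_prim:
  assumes "decr_int g" "0 < s" shows "isCont (prim g) s"
proof -
  have "continuous_on {0<..} (prim g)" by (rule continuous_on_subset[OF prim_continuous_on[OF assms(1)]]) auto
  then show ?thesis using assms(2) by (simp add: continuous_on_eq_continuous_at)
qed

lemma isCont_avg:
  assumes g: "decr_int g" and h: "0 < h" and s: "0 < s"
  shows "isCont (avg h g) s"
proof -
  have "((\<lambda>t. (prim g (t + h) - prim g t) / h) \<longlongrightarrow> (prim g (s + h) - prim g s) / h) (at s)"
    using h s by (intro tendsto_intros isCont_tendsto_compose[OF isCont_prim[OF g]] isContD[OF isCont_prim[OF g]]) auto
  moreover have "\<forall>\<^sub>F t in at s. (prim g (t + h) - prim g t) / h = avg h g t"
  proof -
    have "\<forall>\<^sub>F t in at s. t \<in> {0<..}" using s by (intro eventually_at_in_open') auto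
    then show ?thesis by eventually_elim (simp add: avg_def)
  qed
  ultimately have "(avg h g \<longlongrightarrow> (prim g (s + h) - prim g s) / h) (at s)" by (rule Lim_transform_eventually)
  then show ?thesis using s by (simp add: isCont_def avg_def)
qed

lemma avg_has_derivative:
  assumes g: "decr_int g" and h: "0 < h" and c: "\<And>t. 0 < t \<Longrightarrow> isCont g t" and s: "0 < s"
  shows "(avg h g has_real_derivative (g (s + h) - g s) / h) (at s)"
proof -
  have "((\<lambda>t. prim g (t + h)) has_real_derivative g (s + h)) (at s)"
    using DERIV_shift[of "prim g" "g (s + h)" s h] prim_has_derivative[OF g _ c, of "s + h"] h s by simp
  then have "((\<lambda>t. (prim g (t + h) - prim g t) / h) has_real_derivative (g (s + h) - g s) / h) (at s)"
    by (intro DERIV_cdivide DERIV_diff prim_has_derivative[OF g s c[OF s]])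
  then show ?thesis
    by (rule has_field_derivative_transform_within_open[where S = "{0<..}"]) (use s in \<open>auto simp: avg_def\<close>)
qed

text \<open>The first mean is continuous, the second continuously differentiable, for s > 0. The
  squared cutoff is itself of class C^1 and makes the result vanish for s \<ge> i + 1, which
  corresponds to a neighbourhood of the centre of the ball.\<close>

definition smoothing :: "nat \<Rightarrow> (real \<Rightarrow> real) \<Rightarrow> real \<Rightarrow> real" where
  "smoothing i g s = avg (1 / real (Suc i)) (avg (1 / real (Suc i)) g) s * (max 0 (1 - s / real (Suc i)))\<^sup>2"

definition smoothing_deriv :: "nat \<Rightarrow> (real \<Rightarrow> real) \<Rightarrow> real \<Rightarrow> real" where
  "smoothing_deriv i g s =
    real (Suc i) * (avg (1 / real (Suc i)) g (s + 1 / real (Suc i)) - avg (1 / real (Suc i)) g s) * (max 0 (1 - s / real (Suc i)))\<^sup>2 -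
    avg (1 / real (Suc i)) (avg (1 / real (Suc i)) g) s * (2 * max 0 (1 - s / real (Suc i)) / real (Suc i))"

lemma DERIV_max_0_square: "((\<lambda>x::real. (max 0 x)\<^sup>2) has_real_derivative 2 * max 0 x) (at x)"
proof -
  consider "x > 0" | "x < 0" | "x = 0" by linarith
  then show ?thesis
  proof cases
    case 1
    have "((\<lambda>x::real. x\<^sup>2) has_real_derivative 2 * x) (at x)" by (auto intro!: derivative_eq_intros)
    then have "((\<lambda>x::real. (max 0 x)\<^sup>2) has_real_derivative 2 * x) (at x)"
      by (rule has_field_derivative_transform_within_open[where S = "{0<..}"]) (use 1 in auto)
    then show ?thesis using 1 by simp
  next
    case 2
    have "((\<lambda>x::real. 0) has_real_derivative 0) (at x)" by (auto intro!: derivative_eq_intros)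
    then have "((\<lambda>x::real. (max 0 x)\<^sup>2) has_real_derivative 0) (at x)"
      by (rule has_field_derivative_transform_within_open[where S = "{..<0}"]) (use 2 in auto)
    then show ?thesis using 2 by simp
  next
    case 3
    have "((\<lambda>h::real. (max 0 h)\<^sup>2 / h) \<longlongrightarrow> 0) (at 0)"
    proof (rule Lim_null_comparison)
      show "((\<lambda>h::real. \<bar>h\<bar>) \<longlongrightarrow> 0) (at 0)" by (rule tendsto_rabs_zero) simp
      show "\<forall>\<^sub>F h::real in at 0. norm ((max 0 h)\<^sup>2 / h) \<le> \<bar>h\<bar>"
        by (rule always_eventually) (auto simp: max_def power2_eq_square)
    qed
    then show ?thesis using 3 by (simp add: has_field_derivative_iff)
  qed
qed

text \<open>The bound by g gives domination, the lower bound gives convergence at continuity points,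
  and the sign of the derivative is what admissibility will require.\<close>

lemma smoothing:
  assumes g: "decr_int g"
  shows "decr_int (smoothing i g)"
    and "\<And>s. 0 < s \<Longrightarrow> smoothing i g s \<le> g s"
    and "\<And>s. 0 < s \<Longrightarrow> g (s + 2 / real (Suc i)) * (max 0 (1 - s / real (Suc i)))\<^sup>2 \<le> smoothing i g s"
    and "\<And>s. 0 < s \<Longrightarrow> (smoothing i g has_real_derivative smoothing_deriv i g s) (at s)"
    and "continuous_on {0<..} (smoothing_deriv i g)"
    and "\<And>s. 0 < s \<Longrightarrow> smoothing_deriv i g s \<le> 0"
    and "\<And>s. real (Suc i) \<le> s \<Longrightarrow> smoothing i g s = 0 \<and> smoothing_deriv i g s = 0"
proof -
  define h where "h = 1 / real (Suc i)"
  define m where "m = real (Suc i)"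
  have h: "h > 0" and m: "m > 0" by (auto simp: h_def m_def)
  define f where "f = avg h g"
  define e where "e = avg h f"
  have f: "decr_int f" unfolding f_def by (rule decr_int_avg[OF g h])
  have e: "decr_int e" unfolding e_def by (rule decr_int_avg[OF f h])
  define q where "q s = (max 0 (1 - s / m))\<^sup>2" for s
  have sm: "smoothing i g = (\<lambda>s. e s * q s)"
    by (simp add: fun_eq_iff smoothing_def e_def f_def h_def q_def m_def)
  have sd: "smoothing_deriv i g = (\<lambda>s. (f (s + h) - f s) / h * q s + e s * (2 * max 0 (1 - s / m) * (- 1 / m)))"
    by (simp add: fun_eq_iff smoothing_deriv_def e_def f_def h_def q_def m_def)
  have q01: "0 \<le> q s" "s \<ge> 0 \<Longrightarrow> q s \<le> 1" for s
    using m by (auto simp: q_def power2_eq_square max_def intro!: mult_le_one)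
  have qm: "q t \<le> q s" if "s \<le> t" for s t
    unfolding q_def using that m by (intro power_mono max.mono) (auto simp: divide_right_mono)
  have e0: "0 \<le> e s" for s using decrD(2)[OF decr_intD(1)[OF e]] .
  have le: "e s \<le> g s" if "0 < s" for s
    using avg_bounds(2)[OF f h that] avg_bounds(2)[OF g h that] by (simp add: e_def f_def)
  have ge: "g (s + 2 * h) \<le> e s" if s: "0 < s" for s
  proof -
    have "g (s + h + h) \<le> f (s + h)" unfolding f_def using h s by (intro avg_bounds(1)[OF g h]) simp
    also have "\<dots> \<le> e s" unfolding e_def by (rule avg_bounds(1)[OF f h s])
    finally show ?thesis by (simp add: algebra_simps)
  qed
  have eq: "e s * q s \<le> e s" if "0 \<le> s" for s using mult_left_mono[OF q01(2)[OF that] e0[of s]] by simp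
  show di: "decr_int (smoothing i g)"
  proof (rule decr_int_le[OF e])
    show "decr (smoothing i g)"
      unfolding decr_def sm
    proof (intro conjI allI impI)
      fix s t :: real assume st: "0 < s" "s \<le> t"
      show "e t * q t \<le> e s * q s"
        using decrD(1)[OF decr_intD(1)[OF e] st] qm[OF st(2)] e0 q01 by (intro mult_mono) auto
    qed (use e0 q01 decrD(3)[OF decr_intD(1)[OF e]] in auto)
  qed (use eq in \<open>auto simp: sm\<close>)
  show "smoothing i g s \<le> g s" if "0 < s" for s using eq[of s] le[OF that] that by (simp add: sm)
  show "g (s + 2 / real (Suc i)) * (max 0 (1 - s / real (Suc i)))\<^sup>2 \<le> smoothing i g s" if s: "0 < s" for s
    using mult_right_mono[OF ge[OF s] q01(1)[of s]] by (simp add: sm q_def m_def h_def)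
  have fc: "isCont f s" if "0 < s" for s unfolding f_def by (rule isCont_avg[OF g h that])
  have ec: "isCont e s" if "0 < s" for s unfolding e_def by (rule isCont_avg[OF f h that])
  show "(smoothing i g has_real_derivative smoothing_deriv i g s) (at s)" if s: "0 < s" for s
  proof -
    have de: "(e has_real_derivative (f (s + h) - f s) / h) (at s)"
      unfolding e_def by (rule avg_has_derivative[OF f h fc s])
    have "((\<lambda>s. 1 - s / m) has_real_derivative - 1 / m) (at s)" using m by (auto intro!: derivative_eq_intros)
    from DERIV_chain2[OF DERIV_max_0_square this]
    have dq: "(q has_real_derivative 2 * max 0 (1 - s / m) * (- 1 / m)) (at s)" unfolding q_def .
    have "((\<lambda>s. e s * q s) has_real_derivative (f (s + h) - f s) / h * q s + 2 * max 0 (1 - s / m) * (- 1 / m) * e s) (at s)"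
      by (rule DERIV_mult[OF de dq])
    moreover have "(f (s + h) - f s) / h * q s + 2 * max 0 (1 - s / m) * (- 1 / m) * e s = smoothing_deriv i g s"
      by (simp add: sd mult_ac)
    ultimately show ?thesis unfolding sm by simp
  qed
  have "continuous_on {0<..} f" "continuous_on {0<..} e" using fc ec by (auto simp: continuous_on_eq_continuous_at)
  then show "continuous_on {0<..} (smoothing_deriv i g)"
    unfolding sd q_def using h m by (intro continuous_intros) (auto intro!: continuous_on_compose2[of "{0<..}" f] continuous_intros)
  show "smoothing_deriv i g s \<le> 0" if s: "0 < s" for s
  proof -
    have "f (s + h) \<le> f s" using decrD(1)[OF decr_intD(1)[OF f] s] h by simp
    then have "(f (s + h) - f s) / h * q s \<le> 0" using h q01(1)[of s] by (simp add: mult_nonpos_nonneg divide_nonpos_pos)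
    moreover have "e s * (2 * max 0 (1 - s / m) * (- 1 / m)) \<le> 0"
      using e0[of s] m by (intro mult_nonneg_nonpos) (auto simp: divide_nonneg_pos)
    ultimately show ?thesis by (simp add: sd)
  qed
  show "smoothing i g s = 0 \<and> smoothing_deriv i g s = 0" if s: "real (Suc i) \<le> s" for s
  proof -
    have "1 - s / m \<le> 0" using s m by (simp add: m_def)
    then have "max 0 (1 - s / m) = 0" by simp
    then show ?thesis by (simp add: sm sd q_def)
  qed
qed

lemma smoothing_tendsto:
  assumes g: "decr_int g" and s: "0 < s" and c: "isCont g s"
  shows "(\<lambda>i. smoothing i g s) \<longlonglongrightarrow> g s"
proof (rule tendsto_sandwich)
  have "(\<lambda>i. s + 2 / real (Suc i)) \<longlonglongrightarrow> s" by real_asymp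
  then have "(\<lambda>i. g (s + 2 / real (Suc i))) \<longlonglongrightarrow> g s" by (rule isCont_tendsto_compose[OF c])
  moreover have "(\<lambda>i. 1 - s / real (Suc i)) \<longlonglongrightarrow> 1" by real_asymp
  ultimately have "(\<lambda>i. g (s + 2 / real (Suc i)) * (max 0 (1 - s / real (Suc i)))\<^sup>2) \<longlonglongrightarrow> g s * (max 0 1)\<^sup>2"
    by (intro tendsto_intros)
  then show "(\<lambda>i. g (s + 2 / real (Suc i)) * (max 0 (1 - s / real (Suc i)))\<^sup>2) \<longlonglongrightarrow> g s" by simp
qed (use smoothing(2,3)[OF g] s in auto)

section \<open>Admissibility of smooth functions of the squared norm\<close>

lemma has_derivative_imp_partial_deriv:
  fixes F :: "real^'n::finite \<Rightarrow> real"
  assumes "(F has_derivative L) (at x)"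
  shows "partial_deriv i F x = L (axis i 1)"
  using partial_deriv_frechet[of F x i] frechet_derivative_at[OF assms] assms
  by (auto simp: differentiable_def)

lemma C1_onI:
  fixes F :: "real^'n::finite \<Rightarrow> real"
  assumes F: "\<And>x. x \<in> ball 0 1 \<Longrightarrow> (F has_derivative L x) (at x)"
    and L: "\<And>i. continuous_on (ball 0 1) (\<lambda>x. L x (axis i 1))"
  shows "C1_on (ball 0 1) F"
  unfolding C1_on_def
proof (intro conjI allI)
  show "F differentiable_on ball 0 1"
    unfolding differentiable_on_def differentiable_def using F by (blast intro: has_derivative_at_withinI)
  show "continuous_on (ball 0 1) (partial_deriv i F)" for i
    using L[of i] by (rule continuous_on_eq) (simp add: has_derivative_imp_partial_deriv[OF F])
qed

lemma has_derivative_radial: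
  fixes x :: "real^'n::finite"
  assumes "(\<psi> has_real_derivative d) (at (x \<bullet> x))"
  shows "((\<lambda>x. \<psi> (x \<bullet> x)) has_derivative (\<lambda>h. d * (2 * (x \<bullet> h)))) (at x)"
proof -
  have "((\<lambda>x. x \<bullet> x) has_derivative (\<lambda>h. x \<bullet> h + h \<bullet> x)) (at x)"
    by (intro has_derivative_inner has_derivative_ident)
  from has_derivative_compose[OF this, of \<psi> "(*) d"] assms
  show ?thesis by (simp add: has_field_derivative_def inner_commute)
qed

text \<open>Written through x \<bullet> x, the function needs no special treatment at the origin:
  its Hessian is 2 \<psi>1 times the identity plus 4 \<psi>2 times the matrix of products of
  coordinates. Since n = 2 k \<ge> 2 j, (n choose j) is at least 2 (n - 1 choose j - 1), and the two
  sign conditions settle all j \<le> k at once.\<close>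

lemma radial_k_admissible:
  fixes U :: "real^'n::finite \<Rightarrow> real"
  assumes n: "CARD('n) = 2 * k"
    and U: "\<And>x. U x = \<psi> (x \<bullet> x)"
    and d1: "\<And>z. z < 1 \<Longrightarrow> (\<psi> has_real_derivative \<psi>1 z) (at z)"
    and d2: "\<And>z. z < 1 \<Longrightarrow> (\<psi>1 has_real_derivative \<psi>2 z) (at z)"
    and c2: "continuous_on {..<1} \<psi>2" and c: "continuous_on {..1} \<psi>"
    and pos: "\<And>z. 0 \<le> z \<Longrightarrow> z < 1 \<Longrightarrow> 0 \<le> \<psi>1 z" "\<And>z. 0 \<le> z \<Longrightarrow> z < 1 \<Longrightarrow> 0 \<le> \<psi>1 z + z * \<psi>2 z"
  shows "k_admissible k U"
proof -
  have z: "x \<bullet> x < 1" if "x \<in> ball 0 1" for x :: "real^'n"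
    using that by (simp add: dot_square_norm power_less_one_iff)
  have UE: "U = (\<lambda>x. \<psi> (x \<bullet> x))" using U by auto
  have D1: "(U has_derivative (\<lambda>h. \<psi>1 (x \<bullet> x) * (2 * (x \<bullet> h)))) (at x)" if "x \<in> ball 0 1" for x
    unfolding UE by (rule has_derivative_radial[OF d1[OF z[OF that]]])
  have p1: "partial_deriv i U x = 2 * x $ i * \<psi>1 (x \<bullet> x)" if "x \<in> ball 0 1" for i x
    using has_derivative_imp_partial_deriv[OF D1[OF that], of i] by (simp add: inner_axis)
  have D2: "(partial_deriv i U has_derivative (\<lambda>h. 2 * x $ i * (\<psi>2 (x \<bullet> x) * (2 * (x \<bullet> h))) + 2 * h $ i * \<psi>1 (x \<bullet> x))) (at x)"
    if x: "x \<in> ball 0 1" for i x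
  proof (rule has_derivative_transform_within_open[where s = "ball 0 1"])
    have "((\<lambda>x. 2 * x $ i) has_derivative (\<lambda>h. 2 * h $ i)) (at x)"
      by (intro has_derivative_mult_right bounded_linear_imp_has_derivative bounded_linear_vec_nth)
    then show "((\<lambda>x. 2 * x $ i * \<psi>1 (x \<bullet> x)) has_derivative
        (\<lambda>h. 2 * x $ i * (\<psi>2 (x \<bullet> x) * (2 * (x \<bullet> h))) + 2 * h $ i * \<psi>1 (x \<bullet> x))) (at x)"
      by (rule has_derivative_mult[OF _ has_derivative_radial[OF d2[OF z[OF x]]]])
  qed (use x p1 in auto)
  have p2: "partial_deriv j (partial_deriv i U) x = 4 * \<psi>2 (x \<bullet> x) * x $ i * x $ j + (if j = i then 2 * \<psi>1 (x \<bullet> x) else 0)"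
    if "x \<in> ball 0 1" for i j x
  proof -
    have "axis j (1::real) $ i = (if j = i then 1 else 0)" by (simp add: axis_def)
    then show ?thesis using has_derivative_imp_partial_deriv[OF D2[OF that], of j i] by (simp add: inner_axis)
  qed
  have zi: "(\<lambda>x::real^'n. x \<bullet> x) ` ball 0 1 \<subseteq> {..<1}" using z by auto
  have c1: "continuous_on {..<1} \<psi>1"
    using d2 by (intro continuous_at_imp_continuous_on) (auto intro: DERIV_isCont)
  have cc1: "continuous_on (ball 0 1) (\<lambda>x::real^'n. \<psi>1 (x \<bullet> x))"
    by (rule continuous_on_compose2[OF c1 _ zi]) (intro continuous_intros)
  have cc2: "continuous_on (ball 0 1) (\<lambda>x::real^'n. \<psi>2 (x \<bullet> x))"
    by (rule continuous_on_compose2[OF c2 _ zi]) (intro continuous_intros)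
  have "C2_on (ball 0 1) U"
    unfolding C2_on_def
  proof (intro conjI allI)
    show "C1_on (ball 0 1) U" by (rule C1_onI[OF D1]) (simp, intro continuous_intros cc1)
    show "C1_on (ball 0 1) (partial_deriv i U)" for i by (rule C1_onI[OF D2]) (simp, intro continuous_intros cc1 cc2)
  qed
  moreover have "continuous_on (cball 0 1) U"
    unfolding UE by (rule continuous_on_compose2[OF c]) (intro continuous_intros, auto simp: dot_square_norm power_le_one_iff)
  moreover have "S_minors j (hessian U x) \<ge> 0" if j: "1 \<le> j" "j \<le> k" and x: "x \<in> ball 0 1" for j x
  proof -
    let ?a = "2 * \<psi>1 (x \<bullet> x)" and ?b = "4 * \<psi>2 (x \<bullet> x)"
    let ?C = "real ((CARD('n) - 1) choose (j - 1))"
    have "hessian U x $ i $ l = (if i = l then ?a else 0) + ?b * x $ i * x $ l" for i l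
      by (simp add: hessian_def p2[OF x])
    from S_minors_rank_one[of "hessian U x" ?a ?b x, OF this j(1)]
    have S: "S_minors j (hessian U x) = real (CARD('n) choose j) * ?a ^ j + ?C * ?a ^ (j - 1) * ?b * (x \<bullet> x)"
      by (simp only: dot_square_norm)
    have a: "0 \<le> ?a" using pos(1)[of "x \<bullet> x"] z[OF x] by simp
    have "real j * real (CARD('n) choose j) = real CARD('n) * ?C"
      using times_binomial_minus1_eq[of j "CARD('n)"] j unfolding of_nat_mult[symmetric] by simp
    moreover have "real CARD('n) * ?C \<ge> real j * (2 * ?C)"
      using mult_right_mono[of "real j * 2" "real CARD('n)" ?C] n j by simp
    ultimately have "real j * (2 * ?C) \<le> real j * real (CARD('n) choose j)" by linarith
    then have "2 * ?C \<le> real (CARD('n) choose j)" using j by (subst (asm) mult_le_cancel_left_pos) auto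
    then have "2 * ?C * ?a ^ j \<le> real (CARD('n) choose j) * ?a ^ j" using a by (intro mult_right_mono) auto
    moreover have e: "?a ^ (j - 1) * ?a = ?a ^ j" using j by (simp add: power_eq_if)
    ultimately have "S_minors j (hessian U x) \<ge> 2 * ?C * (?a ^ (j - 1) * ?a) + ?C * ?a ^ (j - 1) * ?b * (x \<bullet> x)"
      unfolding S e by (intro add_right_mono)
    also have "2 * ?C * (?a ^ (j - 1) * ?a) + ?C * ?a ^ (j - 1) * ?b * (x \<bullet> x) =
        ?C * ?a ^ (j - 1) * (4 * (\<psi>1 (x \<bullet> x) + (x \<bullet> x) * \<psi>2 (x \<bullet> x)))"
      by (simp add: algebra_simps)
    finally have "?C * ?a ^ (j - 1) * (4 * (\<psi>1 (x \<bullet> x) + (x \<bullet> x) * \<psi>2 (x \<bullet> x))) \<le> S_minors j (hessian U x)" .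
    moreover have "0 \<le> ?C * ?a ^ (j - 1) * (4 * (\<psi>1 (x \<bullet> x) + (x \<bullet> x) * \<psi>2 (x \<bullet> x)))"
      using pos(2)[of "x \<bullet> x"] z[OF x] a by (intro mult_nonneg_nonneg zero_le_power) auto
    ultimately show ?thesis by linarith
  qed
  ultimately show ?thesis by (auto simp: k_admissible_def)
qed

lemma radial_profile_radial:
  assumes "\<And>x::real^'n::finite. u x = f (norm x)"
  shows "radial_profile u r = f \<bar>r\<bar>"
proof -
  have "norm (axis undefined 1 :: real^'n) = 1" by simp
  then have "norm (SOME e :: real^'n. norm e = 1) = 1" by (rule someI)
  then show ?thesis by (simp add: radial_profile_def assms)
qed

context mt_class
begin

text \<open>The maximum only replaces arguments at which G already vanishes; it makes the function
  constant near the origin, where the logarithm is singular. Outside that region \<psi>1 + z \<psi>2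
  = - scl k^2 G' / z, so monotonicity of the density is exactly the second sign condition. The
  factor k instead of 2 k reflects ln (x \<bullet> x) = 2 ln (norm x).\<close>

lemma smooth_profile_in_Phi_0_rad:
  fixes U :: "real^'n::finite \<Rightarrow> real"
  assumes n: "CARD('n) = 2 * k" and G: "decr_int G" and T: "0 < T"
    and dG: "\<And>s. 0 < s \<Longrightarrow> (G has_real_derivative G' s) (at s)"
    and cG: "continuous_on {0<..} G'" and G': "\<And>s. 0 < s \<Longrightarrow> G' s \<le> 0"
    and zero: "\<And>s. T \<le> s \<Longrightarrow> G s = 0 \<and> G' s = 0"
    and U: "\<And>x. U x = - scl * prim G (- real k * ln (max (x \<bullet> x) (exp (- T / real k))))"
  shows "U \<in> Phi_0_rad k"
proof -
  define z0 where "z0 = exp (- T / real k)"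
  have kp: "real k > 0" using k by simp
  have z0: "0 < z0" "z0 < 1" using kp T by (auto simp: z0_def)
  have lz0: "- real k * ln z0 = T" using kp by (simp add: z0_def)
  define \<psi> where "\<psi> z = - scl * prim G (- real k * ln (max z z0))" for z
  define \<psi>1 where "\<psi>1 z = (if z < z0 then 0 else scl * real k * G (- real k * ln z) / z)" for z
  define \<psi>2 where "\<psi>2 z = (if z < z0 then 0 else - scl * real k * (real k * G' (- real k * ln z) + G (- real k * ln z)) / z\<^sup>2)" for z
  have big: "T \<le> - real k * ln z" if "0 < z" "z \<le> z0" for z
  proof -
    have "ln z \<le> ln z0" using that by simp
    then have "real k * ln z \<le> real k * ln z0" using kp by (intro mult_left_mono) auto
    then show ?thesis using lz0 by simp
  qed
  have spos: "0 < - real k * ln z" if "0 < z" "z < 1" for z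
    using that kp by (simp add: mult_pos_neg)
  have primT: "prim G s = prim G T" if "T \<le> s" for s
  proof -
    have "0 \<le> prim G s - prim G T" "prim G s - prim G T \<le> 0"
      using prim_diff_bounds[OF G T that] decrD(2)[OF decr_intD(1)[OF G]] zero[of T] zero[of s] that by auto
    then show ?thesis by simp
  qed
  have \<psi>_eq: "\<psi> z = - scl * prim G (- real k * ln z)" if "0 < z" for z
    using primT[OF big[of z]] primT[of T] lz0 that by (auto simp: \<psi>_def max_def)
  have \<psi>1_eq: "\<psi>1 z = scl * real k * G (- real k * ln z) / z" if "0 < z" for z
    using zero[OF big[of z]] that by (auto simp: \<psi>1_def)
  have \<psi>2_eq: "\<psi>2 z = - scl * real k * (real k * G' (- real k * ln z) + G (- real k * ln z)) / z\<^sup>2" if "0 < z" for z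
    using zero[OF big[of z]] that by (auto simp: \<psi>2_def)
  have dl: "((\<lambda>z. - real k * ln z) has_real_derivative - real k / z) (at z)" if "0 < z" for z
    using that by (auto intro!: derivative_eq_intros)
  show ?thesis
    unfolding Phi_0_rad_def
  proof (intro CollectI conjI ballI)
    have UE: "U x = \<psi> (x \<bullet> x)" for x by (simp add: U \<psi>_def z0_def)
    show "k_admissible k U"
    proof (rule radial_k_admissible[of k U \<psi> \<psi>1 \<psi>2, OF n])
      show "U x = \<psi> (x \<bullet> x)" for x by (rule UE)
      show "(\<psi> has_real_derivative \<psi>1 z) (at z)" if z: "z < 1" for z
      proof (cases "z < z0")
        case True
        have "((\<lambda>z. - scl * prim G T) has_real_derivative 0) (at z)" by (rule DERIV_const)
        then have "(\<psi> has_real_derivative 0) (at z)"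
          by (rule has_field_derivative_transform_within_open[where S = "{..<z0}"]) (use True lz0 in \<open>auto simp: \<psi>_def max_def\<close>)
        then show ?thesis using True by (simp add: \<psi>1_def)
      next
        case False
        then have z': "0 < z" using z0 by simp
        have "(prim G has_real_derivative G (- real k * ln z)) (at (- real k * ln z))"
          using spos[OF z' z] by (intro prim_has_derivative[OF G] DERIV_isCont[OF dG])
        from DERIV_cmult[OF DERIV_chain2[OF this dl[OF z']], of "- scl"]
        have "((\<lambda>z. - scl * prim G (- real k * ln z)) has_real_derivative \<psi>1 z) (at z)"
          by (simp add: \<psi>1_eq[OF z'] mult_ac)
        then show ?thesis
          by (rule has_field_derivative_transform_within_open[where S = "{0<..}"]) (use z' \<psi>_eq in auto)
      qed
      show "(\<psi>1 has_real_derivative \<psi>2 z) (at z)" if z: "z < 1" for z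
      proof (cases "z < z0")
        case True
        have "((\<lambda>z. 0) has_real_derivative 0) (at z)" by (rule DERIV_const)
        then have "(\<psi>1 has_real_derivative 0) (at z)"
          by (rule has_field_derivative_transform_within_open[where S = "{..<z0}"]) (use True in \<open>auto simp: \<psi>1_def\<close>)
        then show ?thesis using True by (simp add: \<psi>2_def)
      next
        case False
        then have z': "0 < z" using z0 by simp
        have "((\<lambda>z. G (- real k * ln z)) has_real_derivative G' (- real k * ln z) * (- real k / z)) (at z)"
          by (rule DERIV_chain2[OF dG[OF spos[OF z' z]] dl[OF z']])
        from DERIV_divide[OF DERIV_cmult[OF this, of "scl * real k"] DERIV_ident]
        have "((\<lambda>z. scl * real k * G (- real k * ln z) / z) has_real_derivative \<psi>2 z) (at z)"
        proof (rule DERIV_cong)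
          have "(c * (x * (- y / z)) * z - c * w * 1) / (z * z) = - c * (y * x + w) / z\<^sup>2" for c x y w :: real
            using z' by (simp add: field_simps power2_eq_square)
          from this[of "scl * real k" "G' (- real k * ln z)" "real k" "G (- real k * ln z)"]
          show "(scl * real k * (G' (- real k * ln z) * (- real k / z)) * z - scl * real k * G (- real k * ln z) * 1) / (z * z) = \<psi>2 z"
            unfolding \<psi>2_eq[OF z'] by (simp only: minus_mult_left)
        qed (use z' in simp)
        then show ?thesis
          by (rule has_field_derivative_transform_within_open[where S = "{0<..}"]) (use z' \<psi>1_eq in auto)
      qed
      have cGG: "continuous_on {0<..} G" using DERIV_isCont[OF dG] by (auto simp: continuous_on_eq_continuous_at)
      have "continuous_on {0<..<1} (\<lambda>z. - scl * real k * (real k * G' (- real k * ln z) + G (- real k * ln z)) / z\<^sup>2)"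
        by (intro continuous_intros continuous_on_compose2[OF cG] continuous_on_compose2[OF cGG]) (use spos in auto)
      then have "continuous_on {0<..<1} \<psi>2" by (rule continuous_on_eq) (simp add: \<psi>2_eq)
      moreover have "continuous_on {..<z0} \<psi>2"
        by (rule continuous_on_eq[OF continuous_on_const[of _ 0]]) (simp add: \<psi>2_def)
      ultimately have "continuous_on ({0<..<1} \<union> {..<z0}) \<psi>2" by (intro continuous_on_open_Un) auto
      moreover have "{0<..<1} \<union> {..<z0} = {..<1}" using z0 by auto
      ultimately show "continuous_on {..<1} \<psi>2" by simp
      have "- real k * ln (max z z0) \<ge> 0" if "z \<le> 1" for z
      proof -
        have "ln (max z z0) \<le> 0" using that z0 by (auto simp: max_def)
        then show ?thesis using kp by (simp add: mult_nonneg_nonpos)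
      qed
      then show "continuous_on {..1} \<psi>"
        unfolding \<psi>_def using z0
        by (intro continuous_intros continuous_on_compose2[OF prim_continuous_on[OF G]]) (auto simp: max_def)
      have G0: "0 \<le> G s" for s using decrD(2)[OF decr_intD(1)[OF G]] .
      show "0 \<le> \<psi>1 z" for z
        using z0 scl_pos G0 by (auto simp: \<psi>1_def)
      show "0 \<le> \<psi>1 z + z * \<psi>2 z" if "0 \<le> z" "z < 1" for z
      proof (cases "z < z0")
        case False
        then have z': "0 < z" using z0 by simp
        have "\<psi>1 z + z * \<psi>2 z = scl * (real k)\<^sup>2 * (- G' (- real k * ln z)) / z"
          using z' by (simp add: \<psi>1_eq \<psi>2_eq field_simps power2_eq_square)
        also have "\<dots> \<ge> 0" using G'[OF spos[OF z' that(2)]] scl_pos z'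
          by (intro divide_nonneg_pos mult_nonneg_nonneg) auto
        finally show ?thesis .
      qed (simp add: \<psi>1_def \<psi>2_def)
    qed
    show "radial_on (cball 0 1) U" by (auto simp: radial_on_def U dot_square_norm)
    show "U x = 0" if "x \<in> sphere 0 1" for x
      using that z0 by (simp add: UE \<psi>_def dot_square_norm max_def)
  qed
qed

end

lemma lipschitz_imp_abs_continuous_on_interval:
  assumes L: "\<And>x y. a \<le> x \<Longrightarrow> x \<le> y \<Longrightarrow> y \<le> c \<Longrightarrow> \<bar>v y - v x\<bar> \<le> L * (y - x)" and L0: "0 \<le> L"
  shows "abs_continuous_on_interval a c v"
  unfolding abs_continuous_on_interval_def
proof (intro allI impI)
  fix e :: real assume e: "0 < e"
  show "\<exists>\<delta>>0. \<forall>D. finite D \<and> (\<forall>(x, y)\<in>D. a \<le> x \<and> x \<le> y \<and> y \<le> c) \<and>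
      disjoint_family_on (\<lambda>(x, y). {x<..<y}) D \<and> (\<Sum>(x, y)\<in>D. y - x) < \<delta> \<longrightarrow> (\<Sum>(x, y)\<in>D. \<bar>v y - v x\<bar>) < e"
  proof (intro exI[of _ "e / (L + 1)"] conjI allI impI)
    show "0 < e / (L + 1)" using e L0 by simp
    fix D :: "(real \<times> real) set"
    assume D: "finite D \<and> (\<forall>(x, y)\<in>D. a \<le> x \<and> x \<le> y \<and> y \<le> c) \<and>
      disjoint_family_on (\<lambda>(x, y). {x<..<y}) D \<and> (\<Sum>(x, y)\<in>D. y - x) < e / (L + 1)"
    have "(\<Sum>(x, y)\<in>D. \<bar>v y - v x\<bar>) \<le> (\<Sum>(x, y)\<in>D. L * (y - x))"
      using D L by (intro sum_mono) auto
    also have "\<dots> = L * (\<Sum>(x, y)\<in>D. y - x)" by (simp add: sum_distrib_left case_prod_unfold)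
    also have "\<dots> \<le> L * (e / (L + 1))" using D L0 by (intro mult_left_mono) auto
    also have "\<dots> < e" using e L0 by (simp add: field_simps)
    finally show "(\<Sum>(x, y)\<in>D. \<bar>v y - v x\<bar>) < e" .
  qed
qed

section \<open>Membership of the reduced functions in the weighted space\<close>

context mt_class
begin

text \<open>On [a, c] the largest radius gives the smallest s, where the density is largest; the
  density is thus bounded by g s0, the logarithm is Lipschitz there, and so is the profile.\<close>

lemma locally_abs_continuous_prim_log:
  assumes g: "decr_int g"
  shows "locally_abs_continuous_01 (\<lambda>r. - scl * prim g (- (2 * real k) * ln \<bar>r\<bar>))"
  unfolding locally_abs_continuous_01_def
proof (intro allI impI)
  fix a c :: real assume ac: "0 < a \<and> a < c \<and> c < 1"
  let ?N = "2 * real k"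
  have N: "?N > 0" using k by simp
  define s0 where "s0 = - ?N * ln c"
  have s0: "s0 > 0" using ac N by (simp add: s0_def mult_pos_neg)
  have g0: "0 \<le> g s0" using decrD(2)[OF decr_intD(1)[OF g]] .
  show "abs_continuous_on_interval a c (\<lambda>r. - scl * prim g (- ?N * ln \<bar>r\<bar>))"
  proof (rule lipschitz_imp_abs_continuous_on_interval)
    fix x y assume xy: "a \<le> x" "x \<le> y" "y \<le> c"
    define s t where "s = - ?N * ln y" and "t = - ?N * ln x"
    have pos: "0 < x" "0 < y" using ac xy by auto
    have "s0 \<le> s" unfolding s0_def s_def using xy pos N by simp
    moreover have st: "s \<le> t" unfolding s_def t_def using xy pos N by simp
    ultimately have gs: "g s \<le> g s0" and s: "0 < s" using decrD(1)[OF decr_intD(1)[OF g] s0] s0 by auto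
    have "prim g t - prim g s \<le> (t - s) * g s" by (rule prim_diff_bounds(2)[OF g s st])
    also have "\<dots> \<le> (t - s) * g s0" using gs st by (intro mult_left_mono) auto
    also have "t - s = ?N * ln (y / x)" using pos by (simp add: s_def t_def ln_div algebra_simps)
    also have "\<dots> \<le> ?N * ((y - x) / a)"
    proof -
      have "ln (y / x) \<le> y / x - 1" using pos by (intro ln_le_minus_one) simp
      also have "\<dots> = (y - x) / x" using pos by (simp add: field_simps)
      also have "\<dots> \<le> (y - x) / a" using ac xy by (intro divide_left_mono) auto
      finally show ?thesis using N by (intro mult_left_mono) auto
    qed
    finally have le: "prim g t - prim g s \<le> ?N * ((y - x) / a) * g s0" using g0 by (auto intro: mult_right_mono)
    have "0 \<le> prim g t - prim g s" using prim_mono[OF g, of s t] s st by simp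
    then have "\<bar>- scl * prim g (- ?N * ln \<bar>y\<bar>) - - scl * prim g (- ?N * ln \<bar>x\<bar>)\<bar> = scl * (prim g t - prim g s)"
      using pos scl_pos by (simp add: s_def t_def abs_mult right_diff_distrib[symmetric])
    also have "\<dots> \<le> scl * (?N * ((y - x) / a) * g s0)" using le scl_pos by (intro mult_left_mono) auto
    finally show "\<bar>- scl * prim g (- ?N * ln \<bar>y\<bar>) - - scl * prim g (- ?N * ln \<bar>x\<bar>)\<bar> \<le> (scl * ?N * g s0 / a) * (y - x)"
      by (simp add: field_simps)
  qed (use scl_pos N g0 ac in auto)
qed

lemma prim_log_tendsto_0:
  assumes g: "decr_int g"
  shows "((\<lambda>r. - scl * prim g (- (2 * real k) * ln \<bar>r\<bar>)) \<longlongrightarrow> 0) (at_left 1)"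
proof -
  have "continuous_on {1/2..1} (\<lambda>r. - scl * prim g (- (2 * real k) * ln \<bar>r\<bar>))"
    by (intro continuous_intros continuous_on_compose2[OF prim_continuous_on[OF g]]) (auto simp: mult_nonneg_nonpos)
  then have "((\<lambda>r. - scl * prim g (- (2 * real k) * ln \<bar>r\<bar>)) \<longlongrightarrow> - scl * prim g (- (2 * real k) * ln \<bar>1\<bar>)) (at 1 within {1/2..1})"
    unfolding continuous_on_def by (rule bspec) simp
  then show ?thesis by (simp add: at_within_Icc_at_left)
qed

text \<open>Since 0 \<le> smoothing \<le> g, the difference is dominated by g, whose energy is
  finite; it tends to 0 at every continuity point of g.\<close>

lemma energy_smoothing_tendsto_0:
  assumes g: "decr_int g" and E: "energy {0<..} g < \<infinity>"
  shows "(\<lambda>i. energy {0<..} (\<lambda>s. \<bar>smoothing i g s - g s\<bar>)) \<longlonglongrightarrow> 0"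
proof -
  note [measurable] = decr_borel_measurable[OF decr_intD(1)[OF g]] decr_borel_measurable[OF decr_intD(1)[OF smoothing(1)[OF g]]]
  have "(\<lambda>i. \<integral>\<^sup>+s\<in>{0<..}. ennreal (\<bar>smoothing i g s - g s\<bar> ^ Suc k * s powr (b * real k)) \<partial>lborel) \<longlonglongrightarrow> (\<integral>\<^sup>+s. 0 \<partial>(lborel :: real measure))"
  proof (rule nn_integral_dominated_convergence[where w = "\<lambda>s. ennreal (g s ^ Suc k * s powr (b * real k)) * indicator {0<..} s"])
    show "AE s in lborel. ennreal (\<bar>smoothing j g s - g s\<bar> ^ Suc k * s powr (b * real k)) * indicator {0<..} s \<le>
      ennreal (g s ^ Suc k * s powr (b * real k)) * indicator {0<..} s" for j
    proof (rule AE_I2)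
      fix s :: real
      have "\<bar>smoothing j g s - g s\<bar> \<le> g s" if "0 < s"
        using smoothing(2)[OF g that, of j] decrD(2)[OF decr_intD(1)[OF smoothing(1)[OF g]], of j s] by auto
      then show "ennreal (\<bar>smoothing j g s - g s\<bar> ^ Suc k * s powr (b * real k)) * indicator {0<..} s \<le>
        ennreal (g s ^ Suc k * s powr (b * real k)) * indicator {0<..} s"
        by (auto simp: indicator_def simp del: power_Suc intro!: ennreal_leI mult_right_mono power_mono)
    qed
    show "(\<integral>\<^sup>+s\<in>{0<..}. ennreal (g s ^ Suc k * s powr (b * real k)) \<partial>lborel) < \<infinity>" using E by (simp only: energy_def)
    show "AE s in lborel. (\<lambda>i. ennreal (\<bar>smoothing i g s - g s\<bar> ^ Suc k * s powr (b * real k)) * indicator {0<..} s) \<longlonglongrightarrow> 0"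
      using decr_AE_isCont[OF decr_intD(1)[OF g]]
    proof eventually_elim
      case (elim s)
      show ?case
      proof (cases "0 < s")
        case True
        then have "(\<lambda>i. smoothing i g s - g s) \<longlonglongrightarrow> 0" using smoothing_tendsto[OF g True] elim by (simp add: LIM_zero)
        then have "(\<lambda>i. \<bar>smoothing i g s - g s\<bar> ^ Suc k * s powr (b * real k)) \<longlonglongrightarrow> \<bar>0\<bar> ^ Suc k * s powr (b * real k)"
          by (intro tendsto_mult tendsto_power tendsto_rabs tendsto_const)
        then have "(\<lambda>i. ennreal (\<bar>smoothing i g s - g s\<bar> ^ Suc k * s powr (b * real k))) \<longlonglongrightarrow> ennreal 0"
          by (intro tendsto_ennrealI) simp
        then show ?thesis using True by simp
      qed simp
    qed
  qed measurable
  then show ?thesis by (simp only: energy_def) simp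
qed

text \<open>The approximants are built from the smoothings of g, so the norm of the difference is
  the energy of smoothing minus g. At the origin the default ln 0 = 0 gives u the value 0; the norm
  and the conditions on the profile see only radii in (0, 1).\<close>

lemma class_profile_in_weighted:
  fixes u :: "real^'n::finite \<Rightarrow> real"
  assumes n: "CARD('n) = 2 * k" and g: "cls g" and u: "\<And>x. u x = - scl * prim g (- real CARD('n) * ln (norm x))"
  shows "u \<in> Phi_0_rad_weighted (CARD('n) div 2) (w0 CARD('n) b)"
    and "Phi_norm (CARD('n) div 2) (w0 CARD('n) b) u \<le> 1"
proof -
  let ?N = "2 * real k"
  have N: "?N > 0" "real CARD('n) = ?N" using k n by auto
  note gi = clsD(3)[OF g]
  have prof: "radial_profile u = (\<lambda>r. - scl * prim g (- ?N * ln \<bar>r\<bar>))"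
    by (rule ext, rule radial_profile_radial) (simp add: u N)
  have energy_g: "ennreal (1 / (1 - b) ^ k) * energy {0<..} g \<le> 1"
  proof -
    have "ennreal (1 / (1 - b) ^ k) * energy {0<..} g \<le> ennreal (1 / (1 - b) ^ k) * ennreal ((1 - b) ^ k)"
      by (rule mult_left_mono[OF clsD(2)[OF g]]) simp
    also have "\<dots> = 1" using b1 by (simp add: ennreal_mult[symmetric])
    finally show ?thesis .
  qed
  have fin_g: "energy {0<..} g < \<infinity>" using clsD(2)[OF g] by (rule order.strict_trans1) simp
  have du: "AE r in lborel. r \<in> {0<..<1} \<longrightarrow> (radial_profile u has_real_derivative scl * ?N * g (- ?N * ln r) / r) (at r)"
    using AE_prim_log_derivative[OF gi]
  proof eventually_elim
    case (elim r)
    show ?case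
    proof
      assume r: "r \<in> {0<..<1}"
      show "(radial_profile u has_real_derivative scl * ?N * g (- ?N * ln r) / r) (at r)"
        by (rule has_field_derivative_transform_within_open[OF elim[rule_format, OF r], of "{0<..<1}"]) (use r prof in auto)
    qed
  qed
  have abs_g: "(\<lambda>s. \<bar>f s\<bar>) = f" if "decr_int f" for f using decrD(2)[OF decr_intD(1)[OF that]] by auto
  have "ennreal cc * radial_energy (deriv (radial_profile u)) = ennreal (1 / (1 - b) ^ k) * energy {0<..} (\<lambda>s. \<bar>g s\<bar>)"
    by (rule radial_energy_eq[OF decr_borel_measurable[OF decr_intD(1)[OF gi]]])
       (use du in \<open>auto elim!: eventually_mono intro: DERIV_imp_deriv\<close>)
  then show "Phi_norm (CARD('n) div 2) (w0 CARD('n) b) u \<le> 1"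
    unfolding Phi_norm_eq[OF n] ennroot_le_1 using energy_g abs_g[OF gi] by simp
  define G where "G i = smoothing i g" for i
  note sm = smoothing[OF gi, folded G_def]
  define T where "T i = real (Suc i)" for i
  define U :: "nat \<Rightarrow> real^'n \<Rightarrow> real" where
    "U i x = - scl * prim (G i) (- real k * ln (max (x \<bullet> x) (exp (- T i / real k))))" for i x
  have U_Phi: "U i \<in> Phi_0_rad k" for i
    by (rule smooth_profile_in_Phi_0_rad[OF n sm(1) _ sm(4) sm(5) sm(6) _ U_def]) (use sm(7) in \<open>auto simp: T_def\<close>)
  have profU: "radial_profile (U i) r = - scl * prim (G i) (- ?N * ln r)" if r: "0 < r" for i r
  proof -
    have primT: "prim (G i) s = prim (G i) (T i)" if s: "T i \<le> s" for s
    proof -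
      have "0 \<le> prim (G i) s - prim (G i) (T i)" "prim (G i) s - prim (G i) (T i) \<le> 0"
        using prim_diff_bounds[OF sm(1), of "T i" s i] sm(7)[of i "T i"] sm(7)[of i s] s by (auto simp: T_def)
      then show ?thesis by simp
    qed
    have "radial_profile (U i) r = - scl * prim (G i) (- real k * ln (max (\<bar>r\<bar>\<^sup>2) (exp (- T i / real k))))"
      by (rule radial_profile_radial) (simp add: U_def dot_square_norm)
    also have "prim (G i) (- real k * ln (max (\<bar>r\<bar>\<^sup>2) (exp (- T i / real k)))) = prim (G i) (- real k * ln (r\<^sup>2))"
    proof (cases "r\<^sup>2 \<le> exp (- T i / real k)")
      case True
      then have "ln (r\<^sup>2) \<le> ln (exp (- T i / real k))" using r by (subst ln_le_cancel_iff) auto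
      then have "real k * ln (r\<^sup>2) \<le> real k * (- T i / real k)" using k by (intro mult_left_mono) auto
      then have "T i \<le> - real k * ln (r\<^sup>2)" using k by simp
      from primT[OF this] show ?thesis using True k by (simp add: max_def)
    next
      case False
      then show ?thesis by (simp add: max_def)
    qed
    also have "- real k * ln (r\<^sup>2) = - ?N * ln r" using r by (simp add: ln_realpow)
    finally show ?thesis .
  qed
  have dU: "AE r in lborel. r \<in> {0<..<1} \<longrightarrow> (radial_profile (U i) has_real_derivative scl * ?N * G i (- ?N * ln r) / r) (at r)" for i
    using AE_prim_log_derivative[OF sm(1)[of i]]
  proof eventually_elim
    case (elim r)
    show ?case
    proof
      assume r: "r \<in> {0<..<1}"
      show "(radial_profile (U i) has_real_derivative scl * ?N * G i (- ?N * ln r) / r) (at r)"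
        by (rule has_field_derivative_transform_within_open[OF elim[rule_format, OF r], of "{0<..<1}"]) (use r profU in auto)
    qed
  qed
  have "Phi_norm (CARD('n) div 2) (w0 CARD('n) b) (U i) < \<infinity>" for i
  proof -
    have "ennreal cc * radial_energy (deriv (radial_profile (U i))) = ennreal (1 / (1 - b) ^ k) * energy {0<..} (\<lambda>s. \<bar>G i s\<bar>)"
      by (rule radial_energy_eq[OF decr_borel_measurable[OF decr_intD(1)[OF sm(1)]]])
         (use dU[of i] in \<open>auto elim!: eventually_mono intro: DERIV_imp_deriv\<close>)
    also have "\<dots> \<le> ennreal (1 / (1 - b) ^ k) * energy {0<..} g"
      unfolding abs_g[OF sm(1)] energy_def using sm(2) decrD(2)[OF decr_intD(1)[OF sm(1)]]
      by (intro mult_left_mono nn_integral_mono)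
         (auto simp: indicator_def simp del: power_Suc intro!: ennreal_leI mult_right_mono power_mono)
    also have "\<dots> < \<infinity>" using energy_g by (rule order.strict_trans1) simp
    finally show ?thesis unfolding Phi_norm_eq[OF n] ennroot_less_top .
  qed
  moreover have "(\<lambda>i. Phi_norm (CARD('n) div 2) (w0 CARD('n) b) (\<lambda>x. U i x - u x)) \<longlonglongrightarrow> 0"
    unfolding Phi_norm_eq[OF n] ennroot_tendsto_0
  proof -
    have "ennreal cc * radial_energy (deriv (radial_profile (\<lambda>x. U i x - u x))) =
        ennreal (1 / (1 - b) ^ k) * energy {0<..} (\<lambda>s. \<bar>G i s - g s\<bar>)" for i
    proof (rule radial_energy_eq)
      show "(\<lambda>s. G i s - g s) \<in> borel_measurable borel"
        by (intro borel_measurable_diff decr_borel_measurable decr_intD(1) sm(1) gi)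
      have W: "radial_profile (\<lambda>x. U i x - u x) = (\<lambda>r. radial_profile (U i) r - radial_profile u r)"
        by (simp add: radial_profile_def fun_eq_iff)
      show "AE r in lborel. r \<in> {0<..<1} \<longrightarrow> deriv (radial_profile (\<lambda>x. U i x - u x)) r =
          scl * ?N * (G i (- ?N * ln r) - g (- ?N * ln r)) / r"
        using dU[of i] du
      proof eventually_elim
        case (elim r)
        show ?case
        proof
          assume r: "r \<in> {0<..<1}"
          have "((\<lambda>r. radial_profile (U i) r - radial_profile u r) has_real_derivative
              scl * ?N * G i (- ?N * ln r) / r - scl * ?N * g (- ?N * ln r) / r) (at r)"
            using elim r by (intro DERIV_diff) auto
          then show "deriv (radial_profile (\<lambda>x. U i x - u x)) r = scl * ?N * (G i (- ?N * ln r) - g (- ?N * ln r)) / r"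
            unfolding W by (subst DERIV_imp_deriv) (auto simp: diff_divide_distrib right_diff_distrib)
        qed
      qed
    qed
    moreover have "(\<lambda>i. ennreal (1 / (1 - b) ^ k) * energy {0<..} (\<lambda>s. \<bar>G i s - g s\<bar>)) \<longlonglongrightarrow> ennreal (1 / (1 - b) ^ k) * 0"
      unfolding G_def by (intro ennreal_tendsto_cmult energy_smoothing_tendsto_0[OF gi fin_g]) simp
    ultimately show "(\<lambda>i. ennreal cc * radial_energy (deriv (radial_profile (\<lambda>x. U i x - u x)))) \<longlonglongrightarrow> 0" by simp
  qed
  ultimately show "u \<in> Phi_0_rad_weighted (CARD('n) div 2) (w0 CARD('n) b)"
    using locally_abs_continuous_prim_log[OF gi, folded prof] prim_log_tendsto_0[OF gi, folded prof] U_Phi n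
    unfolding Phi_0_rad_weighted_def by (intro CollectI conjI exI[of _ U]) (auto simp: radial_on_def u)
qed

end

text \<open>Every competitor has a density in the class and the maximising density is realised by a
  competitor, so the two suprema differ only by the factor \<open>unit_ball_vol\<close>.\<close>

lemma (in mt_class) MT_attained:
  assumes n: "CARD('n::finite) = 2 * k" and g: "cls g" and max: "\<And>h. cls h \<Longrightarrow> J h \<le> J g"
  shows "\<exists>u :: real^'n \<Rightarrow> real.
       u \<in> Phi_0_rad_weighted (CARD('n) div 2) (w0 CARD('n) b) \<and>
       Phi_norm (CARD('n) div 2) (w0 CARD('n) b) u \<le> 1 \<and>
       MT_functional (alpha_crit CARD('n) b) b u = MT TYPE('n) (alpha_crit CARD('n) b) b"
proof -
  define u :: "real^'n \<Rightarrow> real" where "u x = - scl * prim g (- real CARD('n) * ln (norm x))" for x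
  note u = class_profile_in_weighted[OF n g u_def]
  have Mu: "MT_functional (alpha_crit CARD('n) b) b u = ennreal (unit_ball_vol (real CARD('n))) * J g"
    by (rule MT_functional_eq[OF n g]) (rule u_def)
  have "MT_functional (alpha_crit CARD('n) b) b u = MT TYPE('n) (alpha_crit CARD('n) b) b"
  proof (rule antisym)
    show "MT_functional (alpha_crit CARD('n) b) b u \<le> MT TYPE('n) (alpha_crit CARD('n) b) b"
      unfolding MT_def by (rule SUP_upper) (use u in \<open>simp add: MT_admissible_def\<close>)
    show "MT TYPE('n) (alpha_crit CARD('n) b) b \<le> MT_functional (alpha_crit CARD('n) b) b u"
      unfolding MT_def
    proof (rule SUP_least)
      fix w :: "real^'n \<Rightarrow> real" assume "w \<in> MT_admissible b"
      then obtain h where h: "cls h"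
        and w: "\<And>x. x \<in> ball 0 1 \<Longrightarrow> x \<noteq> 0 \<Longrightarrow> w x = - scl * prim h (- real CARD('n) * ln (norm x))"
        using weighted_class_profile[OF n, of w] by (auto simp: MT_admissible_def)
      show "MT_functional (alpha_crit CARD('n) b) b w \<le> MT_functional (alpha_crit CARD('n) b) b u"
        unfolding Mu using MT_functional_eq[OF n h w] max[OF h] by (simp add: mult_left_mono)
    qed
  qed
  with u show ?thesis by blast
qed

theorem theorem1p4:
  assumes "even CARD('n::finite)" and "CARD('n) \<ge> 2"
  shows "\<exists>\<beta>\<^sub>0::real. 0 < \<beta>\<^sub>0 \<and> \<beta>\<^sub>0 < 1 \<and>
    (\<forall>\<beta>\<in>{0..<\<beta>\<^sub>0}. \<exists>u :: real^'n \<Rightarrow> real.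
       u \<in> Phi_0_rad_weighted (CARD('n) div 2) (w0 CARD('n) \<beta>) \<and>
       Phi_norm (CARD('n) div 2) (w0 CARD('n) \<beta>) u \<le> 1 \<and>
       MT_functional (alpha_crit CARD('n) \<beta>) \<beta> u = MT TYPE('n) (alpha_crit CARD('n) \<beta>) \<beta>)"
proof -
  define k where "k = CARD('n) div 2"
  have k: "1 \<le> k" and n: "CARD('n) = 2 * k" using assms by (auto simp: k_def)
  obtain \<beta>0 where \<beta>0: "0 < \<beta>0" "\<beta>0 < 1" and ex: "\<And>b. 0 \<le> b \<Longrightarrow> b < \<beta>0 \<Longrightarrow>
      \<exists>g. mt_class.cls k b g \<and> (\<forall>h. mt_class.cls k b h \<longrightarrow> mt_class.J k b h \<le> mt_class.J k b g)"
    using maximizer_exists_small[OF k] by blast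
  show ?thesis
  proof (intro exI[of _ \<beta>0] conjI ballI \<beta>0)
    fix \<beta> assume \<beta>: "\<beta> \<in> {0..<\<beta>0}"
    then interpret mt_class k \<beta> using k \<beta>0 by unfold_locales auto
    obtain g where "cls g" "\<And>h. cls h \<Longrightarrow> J h \<le> J g" using ex[of \<beta>] \<beta> by auto
    then show "\<exists>u :: real^'n \<Rightarrow> real.
       u \<in> Phi_0_rad_weighted (CARD('n) div 2) (w0 CARD('n) \<beta>) \<and>
       Phi_norm (CARD('n) div 2) (w0 CARD('n) \<beta>) u \<le> 1 \<and>
       MT_functional (alpha_crit CARD('n) \<beta>) \<beta> u = MT TYPE('n) (alpha_crit CARD('n) \<beta>) \<beta>"
      by (rule MT_attained[OF n])
  qed
qed

end
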